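(* Let $F$ be a field of characteristic $2$, and let $\varphi$ and $\psi$ be anisotropic quasilinear quadratic forms of dimension $\geq 2$ over $F$. If $\varphi$ and $\psi$ are stably birationally equivalent, then $\Delta(\varphi)=\Delta(\psi)$.
   Context: A quasilinear quadratic form over a field $F$ of characteristic $2$ is a map $\varphi\colon V_\varphi\to F$ on a finite-dimensional $F$-vector space with $\varphi(av+w)=a^2\varphi(v)+\varphi(w)$ for all $a\in F$, $v,w\in V_\varphi$; $\dim\varphi:=\dim V_\varphi$. The zero set $V_\varphi^0=\{v:\varphi(v)=0\}$ is a subspace; $\varphi$ is anisotropic if it is $0$. The anisotropic part $\varphi_{\mathrm{an}}$ is the form induced on $V_\varphi/V_\varphi^0$. $D(\varphi)=\varphi(V_\varphi)$. $\varphi_L$ denotes scalar extension to a field $L\supseteq F$. $\langle a_1,\dots,a_n\rangle$ is the form $\sum a_ix_i^2$ on $F^n$; $\langle a_i\rangle_i\otimes\langle b_j\rangle_j=\langle a_ib_j\rangle_{i,j}$. If $\varphi$ is anisotropic of dimension $\geq 2$, $X_\varphi=\{\varphi=0\}\subset\mathbb{A}(V_\varphi)$ is an integral affine quadric, $F(\varphi)$ is its function field, and $\varphi_1:=(\varphi_{F(\varphi)})_{\mathrm{an}}$, a form over $F(\varphi)$. Two such forms $\varphi,\psi$ are stably birationally equivalent if $X_\varphi$ and $X_\psi$ are stably birational as varieties over $F$. An $m$-fold quasi-Pfister form is a form isomorphic to $\langle 1\rangle$ ($m=0$) or $\langle 1,a_1\rangle\otimes\cdots\otimes\langle 1,a_m\rangle$.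 For nonzero $\varphi$, $N(\varphi)$ is the smallest subfield of $F$ containing all products $ab$ with $a,b\in D(\varphi)$ (a finite extension of $F^2$), and $\mathrm{lndeg}(\varphi):=\log_2[N(\varphi):F^2]$. For an anisotropic form $\varphi$ over a field of characteristic $2$ and $r\geq 0$, $P_r(\varphi)$ is the set of isomorphism classes of anisotropic $r$-fold quasi-Pfister forms $\pi$ over that field with $\dim(\pi\otimes\varphi)_{\mathrm{an}}<\dim\varphi+2^r$. For $\varphi$ anisotropic of dimension $\geq 2$, $\Delta(\varphi):=\{r\in\mathbb{Z}_{\ge 0}: r<\mathrm{lndeg}(\varphi)\text{ and }P_r(\varphi_1)\neq\emptyset\}$. *)

theory Defs
  imports
    "HOL-Algebra.Indexed_Polynomials"
    "HOL-Algebra.Generated_Fields"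
    "Jordan_Normal_Form.Missing_VectorSpace"
begin

section \<open>Quasilinear quadratic forms\<close>

text \<open>A form is its underlying vector space together with the quadratic map, so that
  \<^term>\<open>vectorspace F \<phi>\<close> and \<^term>\<open>vectorspace.dim F \<phi>\<close> refer to the space of the form
  itself. The fields \<open>mult\<close> and \<open>one\<close> inherited from \<open>module\<close> carry no information.\<close>

record ('a, 'v) qform = "('a, 'v) module" +
  qval :: "'v \<Rightarrow> 'a"

locale quasilinear_form = vectorspace F \<phi>
  for F :: "('a, 'm) ring_scheme" (structure) and \<phi> :: "('a, 'v) qform" +
  assumes char2: "\<one> \<oplus> \<one> = \<zero>"
    and finite_dimensional: "fin_dim"
    and qval_closed: "v \<in> carrier \<phi> \<Longrightarrow> qval \<phi> v \<in> carrier F"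
    and qval_semilinear:
      "\<lbrakk>a \<in> carrier F; v \<in> carrier \<phi>; w \<in> carrier \<phi>\<rbrakk> \<Longrightarrow>
        qval \<phi> ((a \<odot>\<^bsub>\<phi>\<^esub> v) \<oplus>\<^bsub>\<phi>\<^esub> w) = (a [^] (2::nat)) \<otimes> qval \<phi> v \<oplus> qval \<phi> w"

definition zero_set :: "('a, 'm) ring_scheme \<Rightarrow> ('a, 'v) qform \<Rightarrow> 'v set"
  where "zero_set F \<phi> = {v \<in> carrier \<phi>. qval \<phi> v = \<zero>\<^bsub>F\<^esub>}"

definition anisotropic :: "('a, 'm) ring_scheme \<Rightarrow> ('a, 'v) qform \<Rightarrow> bool"
  where "anisotropic F \<phi> \<longleftrightarrow> zero_set F \<phi> = {\<zero>\<^bsub>\<phi>\<^esub>}"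

definition value_set :: "('a, 'v) qform \<Rightarrow> 'a set"
  where "value_set \<phi> = qval \<phi> ` carrier \<phi>"

text \<open>The quadratic map is constant on the cosets of the zero set, so the representative
  chosen in \<open>qval\<close> is irrelevant.\<close>

definition aniso_part :: "('a, 'm) ring_scheme \<Rightarrow> ('a, 'v) qform \<Rightarrow> ('a, 'v set) qform"
  where "aniso_part F \<phi> =
    \<lparr>carrier = a_rcosets\<^bsub>\<phi>\<^esub> (zero_set F \<phi>),
     monoid.mult = (\<lambda>A B. zero_set F \<phi>),
     one = zero_set F \<phi>,
     ring.zero = zero_set F \<phi>,
     add = set_add \<phi>,
     smult = (\<lambda>a A. \<Union>v\<in>A. zero_set F \<phi> +>\<^bsub>\<phi>\<^esub> (a \<odot>\<^bsub>\<phi>\<^esub> v)),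
     qval = (\<lambda>A. qval \<phi> (SOME v. v \<in> A))\<rparr>"

definition isometric ::
    "('a, 'm) ring_scheme \<Rightarrow> ('a, 'v) qform \<Rightarrow> ('a, 'w) qform \<Rightarrow> bool"
  where "isometric F \<phi> \<psi> \<longleftrightarrow>
    (\<exists>h \<in> module_hom F \<phi> \<psi>. bij_betw h (carrier \<phi>) (carrier \<psi>) \<and>
      (\<forall>v \<in> carrier \<phi>. qval \<psi> (h v) = qval \<phi> v))"

definition diag_form :: "('a, 'm) ring_scheme \<Rightarrow> 'a list \<Rightarrow> ('a, nat \<Rightarrow> 'a) qform"
  where "diag_form F as =
    module.extend (ring.func_space F {..<length as})
      (qform.fields
        (\<lambda>x. \<Oplus>\<^bsub>F\<^esub>i\<in>{..<length as}. as ! i \<otimes>\<^bsub>F\<^esub> (x i [^]\<^bsub>F\<^esub> (2::nat))))"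

text \<open>In characteristic 2 every basis of a quasilinear form diagonalizes it: if
  \<open>b\<^sub>1, \<dots>, b\<^sub>n\<close> is a basis, then the form is \<open>\<langle>\<phi>(b\<^sub>1), \<dots>, \<phi>(b\<^sub>n)\<rangle>\<close> in the corresponding
  coordinates. We fix one basis per form and use it as the coordinate system for scalar
  extension, tensor products and the quadric; another choice changes these objects only by
  an isomorphism.\<close>

definition coord_basis :: "('a, 'm) ring_scheme \<Rightarrow> ('a, 'v) qform \<Rightarrow> 'v list"
  where "coord_basis F \<phi> = (SOME bs. distinct bs \<and> vectorspace.basis F \<phi> (set bs))"

definition diag_coeffs :: "('a, 'm) ring_scheme \<Rightarrow> ('a, 'v) qform \<Rightarrow> 'a list"
  where "diag_coeffs F \<phi> = map (qval \<phi>) (coord_basis F \<phi>)"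

definition scalar_extension ::
    "('a, 'm) ring_scheme \<Rightarrow> ('b, 'n) ring_scheme \<Rightarrow> ('a \<Rightarrow> 'b) \<Rightarrow> ('a, 'v) qform
      \<Rightarrow> ('b, nat \<Rightarrow> 'b) qform"
  where "scalar_extension F L \<iota> \<phi> = diag_form L (map \<iota> (diag_coeffs F \<phi>))"

definition tensor_coeffs :: "('a, 'm) ring_scheme \<Rightarrow> 'a list \<Rightarrow> 'a list \<Rightarrow> 'a list"
  where "tensor_coeffs F as bs = concat (map (\<lambda>a. map (\<lambda>b. a \<otimes>\<^bsub>F\<^esub> b) bs) as)"

definition tensor_form ::
    "('a, 'm) ring_scheme \<Rightarrow> ('a, 'v) qform \<Rightarrow> ('a, 'w) qform \<Rightarrow> ('a, nat \<Rightarrow> 'a) qform"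
  where "tensor_form F \<pi> \<phi> =
    diag_form F (tensor_coeffs F (diag_coeffs F \<pi>) (diag_coeffs F \<phi>))"


section \<open>Quasi-Pfister forms\<close>

text \<open>Coefficients of \<open>\<langle>1, a\<^sub>1\<rangle> \<otimes> \<dots> \<otimes> \<langle>1, a\<^sub>m\<rangle>\<close>.\<close>

fun pfister_coeffs :: "('a, 'm) ring_scheme \<Rightarrow> 'a list \<Rightarrow> 'a list"
  where
    "pfister_coeffs F [] = [\<one>\<^bsub>F\<^esub>]"
  | "pfister_coeffs F (a # as) = tensor_coeffs F [\<one>\<^bsub>F\<^esub>, a] (pfister_coeffs F as)"

definition quasi_pfister :: "('a, 'm) ring_scheme \<Rightarrow> nat \<Rightarrow> ('a, 'v) qform \<Rightarrow> bool"
  where "quasi_pfister F m \<pi> \<longleftrightarrow>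
    (\<exists>as. length as = m \<and> set as \<subseteq> carrier F \<and> isometric F \<pi> (diag_form F (pfister_coeffs F as)))"

text \<open>Isomorphism classes are taken inside the fixed type of forms whose vectors are functions
  \<open>nat \<Rightarrow> 'a\<close>. It contains \<open>F\<^sup>n\<close> for every \<open>n\<close>, hence a form from each isomorphism class.\<close>

definition iso_class ::
    "('a, 'm) ring_scheme \<Rightarrow> ('a, nat \<Rightarrow> 'a) qform \<Rightarrow> ('a, nat \<Rightarrow> 'a) qform set"
  where "iso_class F \<pi> = {\<pi>'. quasilinear_form F \<pi>' \<and> isometric F \<pi> \<pi>'}"

definition P_set ::
    "('a, 'm) ring_scheme \<Rightarrow> nat \<Rightarrow> ('a, 'v) qform \<Rightarrow> ('a, nat \<Rightarrow> 'a) qform set set"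
  where "P_set F r \<phi> =
    {iso_class F \<pi> | \<pi>. quasilinear_form F \<pi> \<and> anisotropic F \<pi> \<and> quasi_pfister F r \<pi> \<and>
      vectorspace.dim F (aniso_part F (tensor_form F \<pi> \<phi>)) < vectorspace.dim F \<phi> + 2 ^ r}"


section \<open>Norm field\<close>

definition squares :: "('a, 'm) ring_scheme \<Rightarrow> 'a set"
  where "squares F = {a [^]\<^bsub>F\<^esub> (2::nat) | a. a \<in> carrier F}"

definition norm_field :: "('a, 'm) ring_scheme \<Rightarrow> ('a, 'v) qform \<Rightarrow> 'a set"
  where "norm_field F \<phi> =
    generate_field F {a \<otimes>\<^bsub>F\<^esub> b | a b. a \<in> value_set \<phi> \<and> b \<in> value_set \<phi>}"

definition lndeg :: "('a, 'm) ring_scheme \<Rightarrow> ('a, 'v) qform \<Rightarrow> real"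
  where "lndeg F \<phi> = log 2 (real (ring.dim F (squares F) (norm_field F \<phi>)))"


section \<open>Polynomial rings and localization\<close>

definition mpoly_ring :: "('a, 'm) ring_scheme \<Rightarrow> 'c set \<Rightarrow> ('c multiset \<Rightarrow> 'a) ring"
  where "mpoly_ring F I =
    \<lparr>carrier = ring.indexed_pset F I (carrier F),
     monoid.mult = (\<lambda>P Q m. \<Oplus>\<^bsub>F\<^esub>k\<in>{k. k \<subseteq># m}. P k \<otimes>\<^bsub>F\<^esub> Q (m - k)),
     one = ring.indexed_const F \<one>\<^bsub>F\<^esub>,
     ring.zero = ring.indexed_const F \<zero>\<^bsub>F\<^esub>,
     add = ring.indexed_padd F\<rparr>"

definition loc_rel :: "('a, 'm) ring_scheme \<Rightarrow> 'a set \<Rightarrow> (('a \<times> 'a) \<times> ('a \<times> 'a)) set"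
  where "loc_rel R S =
    {((a, s), (b, t)) | a s b t. a \<in> carrier R \<and> s \<in> S \<and> b \<in> carrier R \<and> t \<in> S \<and>
      (\<exists>u\<in>S. u \<otimes>\<^bsub>R\<^esub> (a \<otimes>\<^bsub>R\<^esub> t) = u \<otimes>\<^bsub>R\<^esub> (b \<otimes>\<^bsub>R\<^esub> s))}"

definition loc_frac :: "('a, 'm) ring_scheme \<Rightarrow> 'a set \<Rightarrow> 'a \<Rightarrow> 'a \<Rightarrow> ('a \<times> 'a) set"
  where "loc_frac R S a s = loc_rel R S `` {(a, s)}"

definition localization :: "('a, 'm) ring_scheme \<Rightarrow> 'a set \<Rightarrow> ('a \<times> 'a) set ring"
  where "localization R S =
    \<lparr>carrier = {loc_frac R S a s | a s. a \<in> carrier R \<and> s \<in> S},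
     monoid.mult = (\<lambda>A B. \<Union>(a, s)\<in>A. \<Union>(b, t)\<in>B. loc_frac R S (a \<otimes>\<^bsub>R\<^esub> b) (s \<otimes>\<^bsub>R\<^esub> t)),
     one = loc_frac R S \<one>\<^bsub>R\<^esub> \<one>\<^bsub>R\<^esub>,
     ring.zero = loc_frac R S \<zero>\<^bsub>R\<^esub> \<one>\<^bsub>R\<^esub>,
     add = (\<lambda>A B. \<Union>(a, s)\<in>A. \<Union>(b, t)\<in>B.
       loc_frac R S (a \<otimes>\<^bsub>R\<^esub> t \<oplus>\<^bsub>R\<^esub> b \<otimes>\<^bsub>R\<^esub> s) (s \<otimes>\<^bsub>R\<^esub> t))\<rparr>"


section \<open>The affine quadric of a form, and its function field\<close>

text \<open>For \<open>\<phi> \<cong> \<langle>a\<^sub>1, \<dots>, a\<^sub>n\<rangle>\<close> the following is the coordinate ring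
  \<open>F[X\<^sub>0, \<dots>, X\<^bsub>n+m-1\<^esub>] / (a\<^sub>1 X\<^sub>0\<^sup>2 + \<dots> + a\<^sub>n X\<^bsub>n-1\<^esub>\<^sup>2)\<close> of \<open>X\<^sub>\<phi> \<times> \<bbbA>\<^sup>m\<close>;
  the quadric itself is the case \<open>m = 0\<close>.\<close>

definition quadric_poly :: "('a, 'm) ring_scheme \<Rightarrow> 'a list \<Rightarrow> nat \<Rightarrow> nat multiset \<Rightarrow> 'a"
  where "quadric_poly F as m =
    (let R = mpoly_ring F {..<length as + m} in
      \<Oplus>\<^bsub>R\<^esub>i\<in>{..<length as}.
        ring.indexed_const F (as ! i) \<otimes>\<^bsub>R\<^esub> (ring.indexed_var F i [^]\<^bsub>R\<^esub> (2::nat)))"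

definition quadric_ideal ::
    "('a, 'm) ring_scheme \<Rightarrow> ('a, 'v) qform \<Rightarrow> nat \<Rightarrow> (nat multiset \<Rightarrow> 'a) set"
  where "quadric_ideal F \<phi> m =
    PIdl\<^bsub>mpoly_ring F {..<length (diag_coeffs F \<phi>) + m}\<^esub> (quadric_poly F (diag_coeffs F \<phi>) m)"

definition quadric_ring ::
    "('a, 'm) ring_scheme \<Rightarrow> ('a, 'v) qform \<Rightarrow> nat \<Rightarrow> (nat multiset \<Rightarrow> 'a) set ring"
  where "quadric_ring F \<phi> m =
    mpoly_ring F {..<length (diag_coeffs F \<phi>) + m} Quot quadric_ideal F \<phi> m"

definition quadric_const ::
    "('a, 'm) ring_scheme \<Rightarrow> ('a, 'v) qform \<Rightarrow> nat \<Rightarrow> 'a \<Rightarrow> (nat multiset \<Rightarrow> 'a) set"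
  where "quadric_const F \<phi> m c =
    quadric_ideal F \<phi> m
      +>\<^bsub>mpoly_ring F {..<length (diag_coeffs F \<phi>) + m}\<^esub> ring.indexed_const F c"

type_synonym 'a quadric_frac =
  "((nat multiset \<Rightarrow> 'a) set \<times> (nat multiset \<Rightarrow> 'a) set) set"

definition function_field ::
    "('a, 'm) ring_scheme \<Rightarrow> ('a, 'v) qform \<Rightarrow> 'a quadric_frac ring"
  where "function_field F \<phi> =
    localization (quadric_ring F \<phi> 0)
      (carrier (quadric_ring F \<phi> 0) - {\<zero>\<^bsub>quadric_ring F \<phi> 0\<^esub>})"

definition function_field_const ::
    "('a, 'm) ring_scheme \<Rightarrow> ('a, 'v) qform \<Rightarrow> 'a \<Rightarrow> 'a quadric_frac"
  where "function_field_const F \<phi> c =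
    loc_frac (quadric_ring F \<phi> 0)
      (carrier (quadric_ring F \<phi> 0) - {\<zero>\<^bsub>quadric_ring F \<phi> 0\<^esub>})
      (quadric_const F \<phi> 0 c) \<one>\<^bsub>quadric_ring F \<phi> 0\<^esub>"

definition first_form ::
    "('a, 'm) ring_scheme \<Rightarrow> ('a, 'v) qform
      \<Rightarrow> ('a quadric_frac, (nat \<Rightarrow> 'a quadric_frac) set) qform"
  where "first_form F \<phi> =
    aniso_part (function_field F \<phi>)
      (scalar_extension F (function_field F \<phi>) (function_field_const F \<phi>) \<phi>)"


section \<open>Stable birational equivalence\<close>

definition powers :: "('a, 'm) ring_scheme \<Rightarrow> 'a \<Rightarrow> 'a set"
  where "powers R f = {f [^]\<^bsub>R\<^esub> k | k :: nat. True}"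

text \<open>Two integral affine \<open>F\<close>-varieties with coordinate rings \<open>A\<close> and \<open>B\<close> (structure maps
  \<open>\<alpha>\<close>, \<open>\<beta>\<close>) are birational if some nonempty open subvarieties are isomorphic over \<open>F\<close>. As the
  basic open sets \<open>D(f)\<close> with \<open>f \<noteq> 0\<close> form a basis of the nonempty open sets, these may be
  taken to be \<open>D(f) = Spec A\<^sub>f\<close> and \<open>D(g) = Spec B\<^sub>g\<close>.\<close>

definition birational ::
    "('a, 'm) ring_scheme \<Rightarrow> ('b, 'n) ring_scheme \<Rightarrow> ('a \<Rightarrow> 'b)
      \<Rightarrow> ('c, 'k) ring_scheme \<Rightarrow> ('a \<Rightarrow> 'c) \<Rightarrow> bool"
  where "birational F A \<alpha> B \<beta> \<longleftrightarrow>
    (\<exists>f \<in> carrier A - {\<zero>\<^bsub>A\<^esub>}. \<exists>g \<in> carrier B - {\<zero>\<^bsub>B\<^esub>}.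
      \<exists>h \<in> ring_iso (localization A (powers A f)) (localization B (powers B g)).
        \<forall>c \<in> carrier F.
          h (loc_frac A (powers A f) (\<alpha> c) \<one>\<^bsub>A\<^esub>) = loc_frac B (powers B g) (\<beta> c) \<one>\<^bsub>B\<^esub>)"

definition stably_birational ::
    "('a, 'm) ring_scheme \<Rightarrow> ('a, 'v) qform \<Rightarrow> ('a, 'w) qform \<Rightarrow> bool"
  where "stably_birational F \<phi> \<psi> \<longleftrightarrow>
    (\<exists>m n. birational F (quadric_ring F \<phi> m) (quadric_const F \<phi> m)
                        (quadric_ring F \<psi> n) (quadric_const F \<psi> n))"


section \<open>The invariant \<open>\<Delta>\<close>\<close>

definition Delta :: "('a, 'm) ring_scheme \<Rightarrow> ('a, 'v) qform \<Rightarrow> nat set"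
  where "Delta F \<phi> =
    {r. real r < lndeg F \<phi> \<and> P_set (function_field F \<phi>) r (first_form F \<phi>) \<noteq> {}}"

end

theory Submission
  imports Defs
begin

text \<open>Let \<open>\<phi> = \<langle>a\<^sub>1, \<dots>, a\<^sub>n\<rangle>\<close> and \<open>\<psi> = \<langle>b\<^sub>1, \<dots>, b\<^sub>k\<rangle>\<close>. The quadric of \<open>\<phi>\<close> has, at every point, the
  whole affine space as tangent space, and the equation is \<open>q(P + t v) = t\<^sup>2 q(v)\<close> at a point \<open>P\<close>.
  Comparing second order terms, an isomorphism between open subsets of the (stabilized) quadrics
  shows that \<open>\<phi>\<^sub>N\<close> and \<open>\<psi>\<^sub>N\<close> have similar value sets over every field \<open>N\<close> with a pair of corresponding
  points. Over the function fields \<open>L = F(\<phi>)\<close> and \<open>L' = F(\<psi>)\<close> this gives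
  \<open>D(\<phi>\<^sub>L) = u D(\<psi>\<^sub>L)\<close>; over \<open>N = N(\<psi>)\<close>, an \<open>F\<close>-algebra through squaring, it gives
  \<open>N(\<phi>) \<subseteq> N(\<psi>)\<close>, hence equality of the norm degrees.

  Whether \<open>P\<^sub>r(\<phi>\<^sub>1)\<close> is nonempty depends only on \<open>D(\<phi>\<^sub>L)\<close>: there must be \<open>c\<^sub>1, \<dots>, c\<^sub>r\<close>, independent in
  the sense that \<open>M = L\<^sup>2(c\<^sub>1, \<dots>, c\<^sub>r)\<close> has degree \<open>2\<^sup>r\<close> over \<open>L\<^sup>2\<close>, such that \<open>D(\<phi>\<^sub>L)\<close> spans an
  \<open>M\<close>-space of small dimension. After replacing \<open>D(\<phi>\<^sub>L)\<close> by \<open>D(\<psi>\<^sub>L)\<close> the data are finitely many equations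
  expressing the \<open>b\<^sub>j \<in> F\<close>, which can be specialized along the rational map from \<open>L\<close> to \<open>L'\<close>. The
  specialized \<open>c\<^sub>i\<close> may become dependent, but they can be completed to an independent family of the same
  length: the derivations \<open>\<partial>/\<partial>X\<^sub>j\<close> show that \<open>[L' : L'\<^sup>2] \<ge> 2\<^sup>k\<close>, and \<open>r\<close> is less than the norm degree,
  which is at most \<open>k\<close>.\<close>

section \<open>Polynomial rings\<close>

text \<open>In characteristic 2 the square of \<open>Q + w t\<close> is
  \<open>Q^2 + w^2 t^2\<close>. First order data therefore never see the form, and
  \<open>t^3 = 0\<close> is the smallest truncation in which \<open>q(w)\<close> appears. For the
  norm fields let \<open>N = N(\<psi>)\<close>, with \<open>F\<close> acting by squaring. The
  coefficients become \<open>a_i^2\<close>, so the value sets over \<open>N\<close> are the squares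
  of the \<open>N\<close>-spans of the \<open>a_i\<close> and of the \<open>b_j\<close>. As every
  \<open>b_j b_l\<close> lies in \<open>N\<close>, similarity puts every \<open>a_i a_l\<close> into
  \<open>N\<close>. The required points exist because over \<open>F^(1/2)\<close> the equation is
  the square of a linear form, which gives a dense supply of points; the same points show that the
  coordinate rings are domains. A rational map from \<open>L\<close> to \<open>L'\<close> is used
  only on a finitely generated subalgebra that depends on the elements at hand. So only finitely
  many equations can be specialized, and their constant sides have to come from \<open>F\<close>.
  Passing from \<open>D(\<phi>_L)\<close> to \<open>D(\<psi>_L)\<close> beforehand makes these sides
  the \<open>b_j\<close>, as \<open>\<psi>_1\<close> requires. The equality
  \<open>dim \<phi>_1 = dim \<psi>_1\<close>, on which the bound in \<open>P_r\<close> depends, is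
  the same transfer with no \<open>c_i\<close>.\<close>

lemma finite_submultisets: "finite {k. k \<subseteq># (m :: 'c multiset)}"
proof (induction m)
  case empty
  show ?case by simp
next
  case (add i m)
  have "{k. k \<subseteq># add_mset i m} \<subseteq> {k. k \<subseteq># m} \<union> add_mset i ` {k. k \<subseteq># m}"
  proof
    fix k assume k: "k \<in> {k. k \<subseteq># add_mset i m}"
    show "k \<in> {k. k \<subseteq># m} \<union> add_mset i ` {k. k \<subseteq># m}"
    proof (cases "i \<in># k")
      case True
      then have "k = add_mset i (k - {#i#})" by simp
      moreover have "k - {#i#} \<subseteq># m" using k True
        by (simp add: subset_eq_diff_conv)
      ultimately show ?thesis by blast
    next
      case False
      have "count k j \<le> count m j" for j
        using k False mset_subset_eq_count[of k "add_mset i m" j]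
        by (cases "j = i") (auto simp: not_in_iff)
      then have "k \<subseteq># m" by (simp add: mset_subset_eqI)
      then show ?thesis by blast
    qed
  qed
  then show ?case using add by (meson finite_UnI finite_imageI finite_subset)
qed

context cring
begin

text \<open>Multisets are exponent vectors, so the submultisets \<open>k\<close> of \<open>m\<close>
  are the ways to split a monomial into two factors.\<close>

definition pmul :: "('c multiset \<Rightarrow> 'a) \<Rightarrow> ('c multiset \<Rightarrow> 'a) \<Rightarrow> 'c multiset \<Rightarrow> 'a"
  where "pmul P Q = (\<lambda>m. \<Oplus>k\<in>{k. k \<subseteq># m}. P k \<otimes> Q (m - k))"

lemma mpoly_ring_simps [simp]:
  "carrier (mpoly_ring R I) = indexed_pset I (carrier R)"
  "\<one>\<^bsub>mpoly_ring R I\<^esub> = indexed_const \<one>"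
  "\<zero>\<^bsub>mpoly_ring R I\<^esub> = indexed_const \<zero>"
  "P \<otimes>\<^bsub>mpoly_ring R I\<^esub> Q = pmul P Q"
  "P \<oplus>\<^bsub>mpoly_ring R I\<^esub> Q = indexed_padd P Q"
  by (simp_all add: mpoly_ring_def pmul_def)

lemma coeff_closed [simp]: "P \<in> indexed_pset I (carrier R) \<Longrightarrow> P m \<in> carrier R"
  using indexed_pset_in_carrier carrier_coeffE by blast

lemma pset_carrier_coeff: "P \<in> indexed_pset I (carrier R) \<Longrightarrow> carrier_coeff P"
  using indexed_pset_in_carrier by blast

lemma finite_support:
  fixes P :: "'c multiset \<Rightarrow> 'a"
  shows "P \<in> indexed_pset I (carrier R) \<Longrightarrow> finite {m. P m \<noteq> \<zero>}"
proof (induction rule: indexed_pset.induct)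
  case (indexed_const k)
  have "{m :: 'c multiset. indexed_const k m \<noteq> \<zero>} \<subseteq> {{#}}" by (auto simp: indexed_const_def)
  then show ?case by (simp add: finite_subset)
next
  case (indexed_padd P Q)
  have "{m. indexed_padd P Q m \<noteq> \<zero>} \<subseteq> {m. P m \<noteq> \<zero>} \<union> {m. Q m \<noteq> \<zero>}"
    by (auto simp: indexed_padd_def)
  then show ?case using indexed_padd by (meson finite_UnI finite_subset)
next
  case (indexed_pmult P i)
  have "{m. indexed_pmult P i m \<noteq> \<zero>} \<subseteq> add_mset i ` {m. P m \<noteq> \<zero>}"
    by (auto simp: indexed_pmult_def image_iff split: if_splits) (metis insert_DiffM)
  then show ?case using indexed_pmult by (meson finite_imageI finite_subset)
qed

lemma support_indices: "P \<in> indexed_pset I (carrier R) \<Longrightarrow> P m \<noteq> \<zero> \<Longrightarrow> set_mset m \<subseteq> I"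
proof (induction arbitrary: m rule: indexed_pset.induct)
  case (indexed_const k)
  then show ?case by (auto simp: indexed_const_def split: if_splits)
next
  case (indexed_padd P Q)
  then have "P m \<noteq> \<zero> \<or> Q m \<noteq> \<zero>" by (auto simp: indexed_padd_def)
  then show ?case using indexed_padd by blast
next
  case (indexed_pmult P i)
  then have i: "i \<in># m" and "P (m - {#i#}) \<noteq> \<zero>" by (auto simp: indexed_pmult_def split: if_splits)
  then have "set_mset (m - {#i#}) \<subseteq> I" using indexed_pmult.IH by blast
  moreover have "set_mset m = insert i (set_mset (m - {#i#}))" using i
    by (metis insert_DiffM set_mset_add_mset_insert)
  ultimately show ?case using indexed_pmult.hyps by simp
qed

lemma pmul_closed_coeff: "carrier_coeff P \<Longrightarrow> carrier_coeff Q \<Longrightarrow> carrier_coeff (pmul P Q)"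
  unfolding carrier_coeff_def pmul_def by (auto intro!: finsum_closed)

lemma pmul_const: 
  assumes "c \<in> carrier R" "carrier_coeff Q"
  shows "pmul (indexed_const c) Q = (\<lambda>m. c \<otimes> Q m)"
proof
  fix m
  have "pmul (indexed_const c) Q m = (\<Oplus>k\<in>{k. k \<subseteq># m}. if {#} = k then c \<otimes> Q (m - k) else \<zero>)"
    unfolding pmul_def indexed_const_def using assms
    by (intro finsum_cong') (auto simp: carrier_coeff_def)
  also have "\<dots> = c \<otimes> Q m"
    using add.finprod_singleton[of "{#}" "{k. k \<subseteq># m}" "\<lambda>k. c \<otimes> Q (m - k)"] finite_submultisets assms
    by (auto simp: carrier_coeff_def)
  finally show "pmul (indexed_const c) Q m = c \<otimes> Q m" .
qed

lemma pmul_padd: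
  assumes "carrier_coeff P" "carrier_coeff P'" "carrier_coeff Q"
  shows "pmul (indexed_padd P P') Q = indexed_padd (pmul P Q) (pmul P' Q)"
proof
  fix m
  show "pmul (indexed_padd P P') Q m = indexed_padd (pmul P Q) (pmul P' Q) m"
    unfolding pmul_def indexed_padd_def
    using assms by (subst add.finprod_multf[symmetric])
       (auto simp: carrier_coeff_def l_distr intro!: add.finprod_cong')
qed

lemma pmul_pmult:
  assumes "carrier_coeff P" "carrier_coeff Q"
  shows "pmul (indexed_pmult P i) Q = indexed_pmult (pmul P Q) i"
proof
  fix m
  show "pmul (indexed_pmult P i) Q m = indexed_pmult (pmul P Q) i m"
  proof (cases "i \<in># m")
    case False
    then have "pmul (indexed_pmult P i) Q m = (\<Oplus>k\<in>{k. k \<subseteq># m}. \<zero>)"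
      unfolding pmul_def indexed_pmult_def using assms
      by (intro finsum_cong') (auto simp: carrier_coeff_def dest: mset_subset_eqD)
    then show ?thesis using False by (simp add: indexed_pmult_def)
  next
    case True
    let ?A = "{k. k \<subseteq># m}" and ?B = "add_mset i ` {k. k \<subseteq># m - {#i#}}"
    have BA: "?B \<subseteq> ?A" using True by (auto simp: insert_subset_eq_iff)
    have "pmul (indexed_pmult P i) Q m = (\<Oplus>k\<in>?A. indexed_pmult P i k \<otimes> Q (m - k))"
      by (simp add: pmul_def)
    also have "\<dots> = (\<Oplus>k\<in>?B. indexed_pmult P i k \<otimes> Q (m - k))"
    proof (rule add.finprod_mono_neutral_cong[symmetric])
      show "finite ?A" by (rule finite_submultisets)
      then show "finite ?B" using BA finite_subset by blast
      show "indexed_pmult P i k \<otimes> Q (m - k) = \<zero>" if "k \<in> ?A - ?B" for k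
      proof -
        have "i \<notin># k"
        proof
          assume i: "i \<in># k"
          then obtain k' where k': "k = add_mset i k'" by (metis insert_DiffM)
          then have "k' \<subseteq># m - {#i#}" using that True by (simp add: insert_subset_eq_iff)
          then show False using that k' by blast
        qed
        then show ?thesis using assms by (simp add: indexed_pmult_def carrier_coeff_def)
      qed
    qed (use BA assms in \<open>auto simp: indexed_pmult_def carrier_coeff_def\<close>)
    also have "\<dots> = (\<Oplus>k\<in>{k. k \<subseteq># m - {#i#}}. indexed_pmult P i (add_mset i k) \<otimes> Q (m - add_mset i k))"
      by (rule finsum_reindex) (use assms in \<open>auto simp: indexed_pmult_def carrier_coeff_def inj_on_def\<close>)
    also have "\<dots> = pmul P Q (m - {#i#})"
      unfolding pmul_def by (simp add: indexed_pmult_def)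
    finally show ?thesis using True by (simp add: indexed_pmult_def)
  qed
qed

text \<open>The complement \<open>k \<mapsto> m - k\<close> permutes the submultisets of
  \<open>m\<close> and exchanges the two factors.\<close>

lemma pmul_comm:
  assumes "carrier_coeff P" "carrier_coeff Q"
  shows "pmul P Q = pmul Q P"
proof
  fix m :: "'c multiset"
  let ?A = "{k. k \<subseteq># m}"
  have double_diff_mset: "m - (m - k) = k" if "k \<subseteq># m" for k
    using mset_subset_eq_count[OF that] by (simp add: multiset_eq_iff)
  have im: "(\<lambda>k. m - k) ` ?A = ?A"
  proof
    show "?A \<subseteq> (\<lambda>k. m - k) ` ?A"
    proof
      fix k assume "k \<in> ?A"
      then have "k = m - (m - k)" using double_diff_mset by simp
      then show "k \<in> (\<lambda>k. m - k) ` ?A" by (metis diff_subset_eq_self imageI mem_Collect_eq)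
    qed
  qed auto
  have "inj_on (\<lambda>k. m - k) ?A"
    using double_diff_mset by (intro inj_on_inverseI[of _ "\<lambda>k. m - k"]) simp
  then have "pmul P Q m = (\<Oplus>k\<in>?A. P (m - k) \<otimes> Q (m - (m - k)))"
    unfolding pmul_def using finsum_reindex[of "\<lambda>k. P k \<otimes> Q (m - k)" "\<lambda>k. m - k" ?A] assms
    by (auto simp: im carrier_coeff_def)
  also have "\<dots> = pmul Q P m" unfolding pmul_def
  proof (rule finsum_cong')
    fix k assume "k \<in> ?A"
    then show "P (m - k) \<otimes> Q (m - (m - k)) = Q k \<otimes> P (m - k)"
      using assms m_comm[of "P (m - k)" "Q k"] by (simp add: double_diff_mset carrier_coeff_def)
  qed (use assms in \<open>auto simp: carrier_coeff_def\<close>)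
  finally show "pmul P Q m = pmul Q P m" .
qed

lemma smult_pset:
  fixes Q :: "'c multiset \<Rightarrow> 'a"
  assumes "Q \<in> indexed_pset I (carrier R)" "c \<in> carrier R"
  shows "(\<lambda>m. c \<otimes> Q m) \<in> indexed_pset I (carrier R)"
  using assms(1)
proof induction
  case (indexed_const k)
  have "(\<lambda>m :: 'c multiset. c \<otimes> indexed_const k m) = indexed_const (c \<otimes> k)"
    using assms by (auto simp: indexed_const_def)
  moreover have "(indexed_const (c \<otimes> k) :: 'c multiset \<Rightarrow> 'a) \<in> indexed_pset I (carrier R)"
    by (rule indexed_pset.indexed_const) (use assms indexed_const in simp)
  ultimately show ?case by simp
next
  case (indexed_padd P Q)
  have "(\<lambda>m. c \<otimes> indexed_padd P Q m) = indexed_padd (\<lambda>m. c \<otimes> P m) (\<lambda>m. c \<otimes> Q m)"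
    using assms indexed_padd by (auto simp: indexed_padd_def r_distr)
  then show ?case using indexed_padd by (simp add: indexed_pset.indexed_padd)
next
  case (indexed_pmult P i)
  have "(\<lambda>m. c \<otimes> indexed_pmult P i m) = indexed_pmult (\<lambda>m. c \<otimes> P m) i"
    using assms by (auto simp: indexed_pmult_def)
  then show ?case using indexed_pmult by (simp add: indexed_pset.indexed_pmult)
qed

lemma pmul_closed:
  assumes "P \<in> indexed_pset I (carrier R)" "Q \<in> indexed_pset I (carrier R)"
  shows "pmul P Q \<in> indexed_pset I (carrier R)"
  using assms(1)
proof induction
  case (indexed_const k)
  then show ?case using assms(2) by (simp add: pmul_const smult_pset pset_carrier_coeff)
next
  case (indexed_padd P Q')
  then show ?case using assms(2) 
    by (simp add: pmul_padd pset_carrier_coeff[of _ I] indexed_pset.indexed_padd)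
next
  case (indexed_pmult P i)
  then show ?case using assms(2) 
    by (simp add: pmul_pmult pset_carrier_coeff[of _ I] indexed_pset.indexed_pmult)
qed

text \<open>Induction on the first factor reduces associativity to constants, since
  \<open>pmul_padd\<close> and \<open>pmul_pmult\<close> move sums and variables out of a product.
  Triple sums over splittings are avoided.\<close>

lemma pmul_assoc:
  assumes "P \<in> indexed_pset I (carrier R)" "carrier_coeff Q" "carrier_coeff S"
  shows "pmul (pmul P Q) S = pmul P (pmul Q S)"
  using assms(1)
proof induction
  case (indexed_const c)
  have "pmul (\<lambda>m. c \<otimes> Q m) S = (\<lambda>m. c \<otimes> pmul Q S m)"
  proof
    fix m
    show "pmul (\<lambda>m. c \<otimes> Q m) S m = c \<otimes> pmul Q S m"
      unfolding pmul_def using indexed_const assms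
      by (subst finsum_rdistr) (auto simp: finite_submultisets carrier_coeff_def m_assoc intro!: finsum_cong')
  qed
  then show ?case using indexed_const assms by (simp add: pmul_const pmul_closed_coeff)
next
  case (indexed_padd P Q')
  then show ?case using assms
    by (simp add: pmul_padd pmul_closed_coeff pset_carrier_coeff[of _ I])
next
  case (indexed_pmult P i)
  then show ?case using assms
    by (simp add: pmul_pmult pmul_closed_coeff pset_carrier_coeff[of _ I])
qed

lemma mpoly_cring: "cring (mpoly_ring R I)"
proof -
  note cc = pset_carrier_coeff[of _ I]
  have const_in: "indexed_const c \<in> indexed_pset I (carrier R)" if "c \<in> carrier R" for c
    using that by (rule indexed_pset.indexed_const)
  have one: "pmul (indexed_const \<one>) P = P" if "P \<in> indexed_pset I (carrier R)" for P
    using that by (simp add: pmul_const cc)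
  have padd_closed: "indexed_padd P Q \<in> indexed_pset I (carrier R)"
    if "P \<in> indexed_pset I (carrier R)" "Q \<in> indexed_pset I (carrier R)" for P Q
    using that by (rule indexed_pset.indexed_padd)
  have comm: "pmul P Q = pmul Q P"
    if "P \<in> indexed_pset I (carrier R)" "Q \<in> indexed_pset I (carrier R)" for P Q
    using that by (intro pmul_comm cc)
  have "abelian_group (mpoly_ring R I)"
  proof (rule abelian_groupI)
    fix P assume P: "P \<in> carrier (mpoly_ring R I)"
    have "indexed_padd (\<lambda>m. (\<ominus> \<one>) \<otimes> P m) P = indexed_const \<zero>"
      using P by (auto simp: indexed_padd_def indexed_zero_def l_minus l_neg)
    then show "\<exists>y\<in>carrier (mpoly_ring R I). y \<oplus>\<^bsub>mpoly_ring R I\<^esub> P = \<zero>\<^bsub>mpoly_ring R I\<^esub>"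
      using P smult_pset[of P I "\<ominus> \<one>"] by auto
    show "\<zero>\<^bsub>mpoly_ring R I\<^esub> \<oplus>\<^bsub>mpoly_ring R I\<^esub> P = P"
      using P by (simp add: indexed_padd_zero cc)
  next
    show "\<zero>\<^bsub>mpoly_ring R I\<^esub> \<in> carrier (mpoly_ring R I)" using const_in by simp
  qed (use padd_closed in \<open>auto simp: indexed_padd_def a_assoc intro!: ext a_comm\<close>)
  moreover have "comm_monoid (mpoly_ring R I)"
  proof (rule comm_monoidI)
    show "\<one>\<^bsub>mpoly_ring R I\<^esub> \<in> carrier (mpoly_ring R I)" using const_in by simp
    fix P Q assume PQ: "P \<in> carrier (mpoly_ring R I)" "Q \<in> carrier (mpoly_ring R I)"
    show "P \<otimes>\<^bsub>mpoly_ring R I\<^esub> Q = Q \<otimes>\<^bsub>mpoly_ring R I\<^esub> P" using PQ comm by simp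
    fix S assume "S \<in> carrier (mpoly_ring R I)"
    then show "P \<otimes>\<^bsub>mpoly_ring R I\<^esub> Q \<otimes>\<^bsub>mpoly_ring R I\<^esub> S =
        P \<otimes>\<^bsub>mpoly_ring R I\<^esub> (Q \<otimes>\<^bsub>mpoly_ring R I\<^esub> S)"
      using PQ by (simp add: pmul_assoc cc)
  qed (simp_all add: pmul_closed one)
  moreover have "(P \<oplus>\<^bsub>mpoly_ring R I\<^esub> Q) \<otimes>\<^bsub>mpoly_ring R I\<^esub> S =
      P \<otimes>\<^bsub>mpoly_ring R I\<^esub> S \<oplus>\<^bsub>mpoly_ring R I\<^esub> Q \<otimes>\<^bsub>mpoly_ring R I\<^esub> S"
    if "P \<in> carrier (mpoly_ring R I)" "Q \<in> carrier (mpoly_ring R I)"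
      "S \<in> carrier (mpoly_ring R I)" for P Q S
    using that by (simp add: pmul_padd cc)
  ultimately show ?thesis by (rule cringI)
qed

end

section \<open>Evaluation of polynomials along a ring homomorphism\<close>

context ring_hom_cring
begin

text \<open>Indices outside \<open>I\<close> are ignored, that is, evaluated at 1. The elimination
  of one variable in \<open>exists_common_nonzero_aux\<close> relies on this.\<close>

definition mono_eval :: "'e set \<Rightarrow> ('e \<Rightarrow> 'c) \<Rightarrow> 'e multiset \<Rightarrow> 'c"
  where "mono_eval I x m = (\<Otimes>\<^bsub>S\<^esub>i\<in>I. x i [^]\<^bsub>S\<^esub> count m i)"

definition mpoly_eval :: "'e set \<Rightarrow> ('e \<Rightarrow> 'c) \<Rightarrow> ('e multiset \<Rightarrow> 'a) \<Rightarrow> 'c"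
  where "mpoly_eval I x P = (\<Oplus>\<^bsub>S\<^esub>m\<in>{m. P m \<noteq> \<zero>\<^bsub>R\<^esub>}. h (P m) \<otimes>\<^bsub>S\<^esub> mono_eval I x m)"

lemma mono_eval_closed [simp]: "x \<in> I \<rightarrow> carrier S \<Longrightarrow> mono_eval I x m \<in> carrier S"
  unfolding mono_eval_def by (intro S.finprod_closed) auto

lemma mpoly_eval_closed:
  "R.carrier_coeff P \<Longrightarrow> x \<in> I \<rightarrow> carrier S \<Longrightarrow> mpoly_eval I x P \<in> carrier S"
  unfolding mpoly_eval_def by (intro S.finsum_closed) (auto simp: R.carrier_coeff_def)

text \<open>Coefficients may cancel, so the support of a sum is known only up to inclusion; any
  finite set containing the support gives the same value.\<close>

lemma mpoly_eval_superset:
  assumes "finite A" "{m. P m \<noteq> \<zero>\<^bsub>R\<^esub>} \<subseteq> A" "R.carrier_coeff P" "x \<in> I \<rightarrow> carrier S"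
  shows "mpoly_eval I x P = (\<Oplus>\<^bsub>S\<^esub>m\<in>A. h (P m) \<otimes>\<^bsub>S\<^esub> mono_eval I x m)"
  unfolding mpoly_eval_def
proof (rule S.add.finprod_mono_neutral_cong_left)
  show "h (P m) \<otimes>\<^bsub>S\<^esub> mono_eval I x m = \<zero>\<^bsub>S\<^esub>" if "m \<in> A - {m. P m \<noteq> \<zero>\<^bsub>R\<^esub>}" for m
    using that assms by auto
qed (use assms in \<open>auto simp: R.carrier_coeff_def\<close>)

lemma mpoly_eval_const:
  assumes "c \<in> carrier R" "x \<in> I \<rightarrow> carrier S"
  shows "mpoly_eval I x (R.indexed_const c) = h c"
proof -
  have "mpoly_eval I x (R.indexed_const c) =
      (\<Oplus>\<^bsub>S\<^esub>m\<in>{{#}}. h (R.indexed_const c m) \<otimes>\<^bsub>S\<^esub> mono_eval I x m)"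
    using assms by (intro mpoly_eval_superset) (auto simp: R.indexed_const_def R.carrier_coeff_def)
  also have "\<dots> = h c"
    using assms by (simp add: R.indexed_const_def mono_eval_def)
  finally show ?thesis .
qed

lemma mpoly_eval_padd:
  assumes "P \<in> R.indexed_pset J (carrier R)" "Q \<in> R.indexed_pset J (carrier R)" "x \<in> I \<rightarrow> carrier S"
  shows "mpoly_eval I x (R.indexed_padd P Q) = mpoly_eval I x P \<oplus>\<^bsub>S\<^esub> mpoly_eval I x Q"
proof -
  let ?A = "{m. P m \<noteq> \<zero>\<^bsub>R\<^esub>} \<union> {m. Q m \<noteq> \<zero>\<^bsub>R\<^esub>}"
  have A: "finite ?A" using assms R.finite_support by blast
  note cc = R.pset_carrier_coeff[OF assms(1)] R.pset_carrier_coeff[OF assms(2)]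
  have "mpoly_eval I x (R.indexed_padd P Q) =
      (\<Oplus>\<^bsub>S\<^esub>m\<in>?A. h (R.indexed_padd P Q m) \<otimes>\<^bsub>S\<^esub> mono_eval I x m)"
    using A cc assms by (intro mpoly_eval_superset R.indexed_padd_in_carrier) (auto simp: R.indexed_padd_def)
  also have "\<dots> = (\<Oplus>\<^bsub>S\<^esub>m\<in>?A. h (P m) \<otimes>\<^bsub>S\<^esub> mono_eval I x m \<oplus>\<^bsub>S\<^esub> h (Q m) \<otimes>\<^bsub>S\<^esub> mono_eval I x m)"
    using cc assms
    by (intro S.finsum_cong') (auto simp: R.indexed_padd_def R.carrier_coeff_def S.l_distr)
  also have "\<dots> = (\<Oplus>\<^bsub>S\<^esub>m\<in>?A. h (P m) \<otimes>\<^bsub>S\<^esub> mono_eval I x m) \<oplus>\<^bsub>S\<^esub>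
      (\<Oplus>\<^bsub>S\<^esub>m\<in>?A. h (Q m) \<otimes>\<^bsub>S\<^esub> mono_eval I x m)"
    using cc assms by (intro S.finsum_addf) (auto simp: R.carrier_coeff_def)
  also have "\<dots> = mpoly_eval I x P \<oplus>\<^bsub>S\<^esub> mpoly_eval I x Q"
    using A cc assms mpoly_eval_superset[of ?A P x I] mpoly_eval_superset[of ?A Q x I] by auto
  finally show ?thesis .
qed

lemma mono_eval_add_mset:
  assumes "finite I" "i \<in> I" "x \<in> I \<rightarrow> carrier S"
  shows "mono_eval I x (add_mset i m) = mono_eval I x m \<otimes>\<^bsub>S\<^esub> x i"
proof -
  have I: "I = insert i (I - {i})" using assms by auto
  have "mono_eval I x (add_mset i m) = x i [^]\<^bsub>S\<^esub> Suc (count m i) \<otimes>\<^bsub>S\<^esub>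
      (\<Otimes>\<^bsub>S\<^esub>j\<in>I - {i}. x j [^]\<^bsub>S\<^esub> count (add_mset i m) j)"
    unfolding mono_eval_def using assms
    by (subst I, subst S.finprod_insert) auto
  also have "(\<Otimes>\<^bsub>S\<^esub>j\<in>I - {i}. x j [^]\<^bsub>S\<^esub> count (add_mset i m) j) = (\<Otimes>\<^bsub>S\<^esub>j\<in>I - {i}. x j [^]\<^bsub>S\<^esub> count m j)"
    using assms by (intro S.finprod_cong') auto
  also have "x i [^]\<^bsub>S\<^esub> Suc (count m i) \<otimes>\<^bsub>S\<^esub> \<dots> = (x i [^]\<^bsub>S\<^esub> count m i \<otimes>\<^bsub>S\<^esub> \<dots>) \<otimes>\<^bsub>S\<^esub> x i"
  proof -
    have "(\<Otimes>\<^bsub>S\<^esub>j\<in>I - {i}. x j [^]\<^bsub>S\<^esub> count m j) \<in> carrier S" "x i \<in> carrier S"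
      using assms by (auto intro!: S.finprod_closed)
    then show ?thesis by (simp add: S.m_ac)
  qed
  also have "x i [^]\<^bsub>S\<^esub> count m i \<otimes>\<^bsub>S\<^esub> (\<Otimes>\<^bsub>S\<^esub>j\<in>I - {i}. x j [^]\<^bsub>S\<^esub> count m j) = mono_eval I x m"
    unfolding mono_eval_def using assms
    by (subst (2) I, subst S.finprod_insert) auto
  finally show ?thesis .
qed

lemma mpoly_eval_pmult:
  assumes "P \<in> R.indexed_pset J (carrier R)" "finite I" "i \<in> I" "x \<in> I \<rightarrow> carrier S"
  shows "mpoly_eval I x (R.indexed_pmult P i) = mpoly_eval I x P \<otimes>\<^bsub>S\<^esub> x i"
proof -
  let ?A = "{m. P m \<noteq> \<zero>\<^bsub>R\<^esub>}"
  have A: "finite ?A" using assms R.finite_support by blast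
  note cc = R.pset_carrier_coeff[OF assms(1)]
  have xi: "x i \<in> carrier S" using assms by auto
  have "mpoly_eval I x (R.indexed_pmult P i) =
      (\<Oplus>\<^bsub>S\<^esub>m\<in>add_mset i ` ?A. h (R.indexed_pmult P i m) \<otimes>\<^bsub>S\<^esub> mono_eval I x m)"
  proof (rule mpoly_eval_superset)
    show "{m. R.indexed_pmult P i m \<noteq> \<zero>\<^bsub>R\<^esub>} \<subseteq> add_mset i ` ?A"
      by (auto simp: R.indexed_pmult_def image_iff split: if_splits) (metis insert_DiffM)
  qed (use A cc assms R.indexed_pmult_in_carrier in auto)
  also have "\<dots> = (\<Oplus>\<^bsub>S\<^esub>m\<in>?A. h (R.indexed_pmult P i (add_mset i m)) \<otimes>\<^bsub>S\<^esub> mono_eval I x (add_mset i m))"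
    using cc assms
    by (intro S.finsum_reindex) (auto simp: R.indexed_pmult_def R.carrier_coeff_def inj_on_def)
  also have "\<dots> = (\<Oplus>\<^bsub>S\<^esub>m\<in>?A. (h (P m) \<otimes>\<^bsub>S\<^esub> mono_eval I x m) \<otimes>\<^bsub>S\<^esub> x i)"
    using cc assms xi
    by (intro S.finsum_cong')
       (auto simp: R.indexed_pmult_def R.carrier_coeff_def mono_eval_add_mset S.m_assoc)
  also have "\<dots> = mpoly_eval I x P \<otimes>\<^bsub>S\<^esub> x i"
    unfolding mpoly_eval_def using cc assms A xi
    by (intro S.finsum_ldistr[symmetric]) (auto simp: R.carrier_coeff_def)
  finally show ?thesis .
qed

lemma mpoly_eval_smult:
  assumes "P \<in> R.indexed_pset J (carrier R)" "c \<in> carrier R" "x \<in> I \<rightarrow> carrier S"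
  shows "mpoly_eval I x (\<lambda>m. c \<otimes> P m) = h c \<otimes>\<^bsub>S\<^esub> mpoly_eval I x P"
proof -
  let ?A = "{m. P m \<noteq> \<zero>\<^bsub>R\<^esub>}"
  have A: "finite ?A" using assms R.finite_support by blast
  note cc = R.pset_carrier_coeff[OF assms(1)]
  have "mpoly_eval I x (\<lambda>m. c \<otimes> P m) = (\<Oplus>\<^bsub>S\<^esub>m\<in>?A. h (c \<otimes> P m) \<otimes>\<^bsub>S\<^esub> mono_eval I x m)"
    using A cc assms by (intro mpoly_eval_superset) (auto simp: R.carrier_coeff_def)
  also have "\<dots> = (\<Oplus>\<^bsub>S\<^esub>m\<in>?A. h c \<otimes>\<^bsub>S\<^esub> (h (P m) \<otimes>\<^bsub>S\<^esub> mono_eval I x m))"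
    using cc assms by (intro S.finsum_cong') (auto simp: R.carrier_coeff_def S.m_assoc)
  also have "\<dots> = h c \<otimes>\<^bsub>S\<^esub> mpoly_eval I x P"
    unfolding mpoly_eval_def using cc assms A
    by (intro S.finsum_rdistr[symmetric]) (auto simp: R.carrier_coeff_def)
  finally show ?thesis .
qed

lemma mpoly_eval_pmul:
  assumes "P \<in> R.indexed_pset I (carrier R)" "Q \<in> R.indexed_pset I (carrier R)"
    and "finite I" "x \<in> I \<rightarrow> carrier S"
  shows "mpoly_eval I x (R.pmul P Q) = mpoly_eval I x P \<otimes>\<^bsub>S\<^esub> mpoly_eval I x Q"
  using assms(1)
proof induction
  note cc = R.pset_carrier_coeff[of _ I]
  {
    case (indexed_const k)
    then show ?case using assms cc by (simp add: R.pmul_const mpoly_eval_const mpoly_eval_smult)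
  next
    case (indexed_padd P P')
    then show ?case using assms cc
      by (simp add: R.pmul_padd mpoly_eval_padd[of _ I] R.pmul_closed[of _ I] S.l_distr mpoly_eval_closed)
  next
    case (indexed_pmult P i)
    moreover have "x i \<in> carrier S" using assms indexed_pmult by auto
    ultimately show ?case using assms cc
      by (simp add: R.pmul_pmult mpoly_eval_pmult[of _ I] R.pmul_closed[of _ I] S.m_ac mpoly_eval_closed)
  }
qed

lemma mpoly_eval_hom:
  assumes "finite I" "x \<in> I \<rightarrow> carrier S"
  shows "mpoly_eval I x \<in> ring_hom (mpoly_ring R I) S"
  using assms by (intro ring_hom_memI)
   (auto simp: mpoly_eval_closed R.pset_carrier_coeff mpoly_eval_pmul mpoly_eval_padd[of _ I] mpoly_eval_const)

lemma mpoly_eval_var: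
  assumes "finite I" "x \<in> I \<rightarrow> carrier S" "i \<in> I"
  shows "mpoly_eval I x (R.indexed_var i) = x i"
proof -
  have "mpoly_eval I x (R.indexed_pmult (R.indexed_const \<one>) i) = x i"
    by (subst mpoly_eval_pmult[of _ I])
       (use assms funcset_mem[of x I "carrier S" i] in
         \<open>auto simp: mpoly_eval_const R.indexed_pset.indexed_const\<close>)
  then show ?thesis by (simp add: R.indexed_var_def)
qed

end

context cring
begin

lemma var_closed [simp]: "i \<in> I \<Longrightarrow> indexed_var i \<in> indexed_pset I (carrier R)"
  unfolding indexed_var_def by (intro indexed_pset.intros) auto

lemma const_closed [simp]: "c \<in> carrier R \<Longrightarrow> indexed_const c \<in> indexed_pset I (carrier R)"
  by (rule indexed_pset.indexed_const)

lemma pmult_eq_var: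
  fixes P :: "'c multiset \<Rightarrow> 'a"
  assumes "P \<in> indexed_pset I (carrier R)"
  shows "indexed_pmult P i = pmul (indexed_var i) P"
proof -
  have cc: "carrier_coeff P" using assms by (rule pset_carrier_coeff)
  then have "pmul (indexed_const \<one>) P = P"
    by (simp add: pmul_const) (simp add: carrier_coeff_def)
  moreover have "carrier_coeff (indexed_const \<one> :: 'c multiset \<Rightarrow> 'a)" by (simp add: carrier_coeff_def indexed_const_def)
  ultimately show ?thesis unfolding indexed_var_def using cc by (simp add: pmul_pmult)
qed

lemma mpoly_induct [consumes 1, case_names const add mult]:
  fixes I :: "'c set"
  assumes "P \<in> carrier (mpoly_ring R I)"
    and "\<And>c. c \<in> carrier R \<Longrightarrow> \<Phi> (indexed_const c)"
    and "\<And>P Q. P \<in> carrier (mpoly_ring R I) \<Longrightarrow> Q \<in> carrier (mpoly_ring R I) \<Longrightarrow> \<Phi> P \<Longrightarrow> \<Phi> Q \<Longrightarrow>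
           \<Phi> (P \<oplus>\<^bsub>mpoly_ring R I\<^esub> Q)"
    and "\<And>P i. P \<in> carrier (mpoly_ring R I) \<Longrightarrow> i \<in> I \<Longrightarrow> \<Phi> P \<Longrightarrow>
           \<Phi> (indexed_var i \<otimes>\<^bsub>mpoly_ring R I\<^esub> P)"
  shows "\<Phi> P"
proof -
  from assms(1) have "P \<in> indexed_pset I (carrier R)" by simp
  then show ?thesis
  proof induction
    case (indexed_pmult P i)
    then show ?case using assms(4)[of P i] pmult_eq_var[of P I i] by simp
  qed (use assms in auto)
qed

lemma const_hom: "indexed_const \<in> ring_hom R (mpoly_ring R I)"
proof (rule ring_hom_memI)
  fix a b assume "a \<in> carrier R" "b \<in> carrier R"
  then show "indexed_const (a \<otimes> b) = indexed_const a \<otimes>\<^bsub>mpoly_ring R I\<^esub> indexed_const b"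
    by (subst mpoly_ring_simps, subst pmul_const) (auto simp: carrier_coeff_def indexed_const_def)
qed (auto simp: indexed_padd_const)

text \<open>The standard way below to compare two evaluations: agreement is checked on generators
  and no sums are expanded.\<close>

lemma mpoly_hom_eqI:
  assumes "f \<in> ring_hom (mpoly_ring R I) S" "g \<in> ring_hom (mpoly_ring R I) S"
    and "\<And>c. c \<in> carrier R \<Longrightarrow> f (indexed_const c) = g (indexed_const c)"
    and "\<And>i. i \<in> I \<Longrightarrow> f (indexed_var i) = g (indexed_var i)"
    and "P \<in> carrier (mpoly_ring R I)"
  shows "f P = g P"
  using assms(5)
proof (induction rule: mpoly_induct)
  case (add P Q)
  then show ?case using ring_hom_add[OF assms(1), of P Q] ring_hom_add[OF assms(2), of P Q] by simp
next
  case (mult P i)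
  then have "indexed_var i \<in> carrier (mpoly_ring R I)" by simp
  then show ?case using mult assms(4)
    ring_hom_mult[OF assms(1), of "indexed_var i" P] ring_hom_mult[OF assms(2), of "indexed_var i" P]
    by (simp del: mpoly_ring_simps)
qed (use assms in auto)

end

section \<open>Points at which finitely many polynomials do not vanish\<close>

context domain
begin

text \<open>The polynomials of \<open>eval\<close> are coefficient lists with the leading
  coefficient first, hence \<open>rev\<close>.\<close>

lemma eval_rev_map:
  assumes "c \<in> {..<N} \<rightarrow> carrier R" "t \<in> carrier R"
  shows "eval (rev (map c [0..<N])) t = (\<Oplus>k\<in>{..<N}. c k \<otimes> t [^] k)"
  using assms(1)
proof (induction N)
  case (Suc N)
  then have c: "c \<in> {..<N} \<rightarrow> carrier R" "c N \<in> carrier R" by auto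
  have "(\<Oplus>k\<in>{..<Suc N}. c k \<otimes> t [^] k) = c N \<otimes> t [^] N \<oplus> (\<Oplus>k\<in>{..<N}. c k \<otimes> t [^] k)"
    unfolding lessThan_Suc using c assms(2) by (subst finsum_insert) (auto intro!: Pi_I m_closed)
  then show ?case using Suc.IH[OF c(1)] by simp
qed simp

text \<open>The nonzero coefficient \<open>c k\<close> need not be the top one. It only guarantees
  that \<open>normalize\<close>, which strips leading zeros, does not return the empty list, and
  then the bound on the number of roots applies.\<close>

lemma finite_zeros_finsum:
  assumes "c \<in> {..<N :: nat} \<rightarrow> carrier R" "k < N" "c k \<noteq> \<zero>"
  shows "finite {t \<in> carrier R. (\<Oplus>k\<in>{..<N}. c k \<otimes> t [^] k) = \<zero>}"
proof -
  let ?l = "rev (map c [0..<N])"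
  have l: "set ?l \<subseteq> carrier R" using assms(1) by auto
  have nz: "set l \<subseteq> {\<zero>}" if "normalize l = []" for l
    using that by (induction l) (auto split: if_splits)
  have "normalize ?l \<noteq> []" using nz[of ?l] assms by force
  moreover have "normalize ?l \<in> carrier (poly_ring R)"
    using normalize_gives_polynomial[OF l] univ_poly_carrier by blast
  moreover have "finite {t. t \<in> carrier R \<and> eval p t = \<zero>}" if "p \<noteq> []" "p \<in> carrier (poly_ring R)" for p
    using finite_number_of_roots[OF that(2)] that(1) by (simp only: is_root_def simp_thms)
  ultimately have "finite {t. t \<in> carrier R \<and> eval (normalize ?l) t = \<zero>}" by blast
  also have "{t. t \<in> carrier R \<and> eval (normalize ?l) t = \<zero>} =
      {t \<in> carrier R. (\<Oplus>k\<in>{..<N}. c k \<otimes> t [^] k) = \<zero>}"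
    using eval_normalize[OF l] eval_rev_map[OF assms(1)] by (intro Collect_cong conj_cong refl) (simp only:)
  finally show ?thesis .
qed

lemma id_hom_cring: "ring_hom_cring R R id"
  by (intro ring_hom_cring.intro ring_hom_cring_axioms.intro is_cring ring_hom_memI) auto

definition peval :: "'e set \<Rightarrow> ('e \<Rightarrow> 'a) \<Rightarrow> ('e multiset \<Rightarrow> 'a) \<Rightarrow> 'a"
  where "peval = ring_hom_cring.mpoly_eval R R id"

text \<open>Induction on the set of variables over an infinite domain. The hypotheses speak of
  coefficients and supports instead of membership in \<open>mpoly_ring\<close>, so that they pass to
  coefficient polynomials without rebuilding these from generators.\<close>

lemma exists_common_nonzero_aux:
  assumes "infinite (carrier R)" "finite I" "finite \<P>"
    and "\<And>P. P \<in> \<P> \<Longrightarrow> carrier_coeff P \<and> finite {m. P m \<noteq> \<zero>} \<and> (\<forall>m. P m \<noteq> \<zero> \<longrightarrow> set_mset m \<subseteq> I) \<and>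
      (\<exists>m. P m \<noteq> \<zero>)"
  shows "\<exists>x \<in> I \<rightarrow> carrier R. \<forall>P \<in> \<P>. peval I x P \<noteq> \<zero>"
proof -
  interpret E: ring_hom_cring R R id by (rule id_hom_cring)
  show ?thesis
    using assms(2-)
  proof (induction I arbitrary: \<P> rule: finite_induct)
    case empty
    have "peval {} x P \<noteq> \<zero>" if "P \<in> \<P>" for P x
    proof -
      have P: "carrier_coeff P" "\<And>m. P m \<noteq> \<zero> \<Longrightarrow> m = {#}" "\<exists>m. P m \<noteq> \<zero>"
        using empty(2)[OF that] by auto
      then have ne: "P {#} \<noteq> \<zero>" by metis
      have "peval {} x P = (\<Oplus>m\<in>{{#}}. id (P m) \<otimes> E.mono_eval {} x m)"
        unfolding peval_def using P by (intro E.mpoly_eval_superset) auto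
      then show ?thesis using P(1) ne by (simp add: E.mono_eval_def carrier_coeff_def)
    qed
    then show ?case by auto
  next
    case (insert i I)
    have peval_closed: "peval I x Q \<in> carrier R" if "x \<in> I \<rightarrow> carrier R" "carrier_coeff Q" for x Q
      unfolding peval_def using that by (intro E.mpoly_eval_closed)
    \<comment> \<open>\<open>slice P k\<close> is the coefficient of the \<open>k\<close>-th power
      of variable \<open>i\<close>, a polynomial in the remaining variables. The guard makes each
      monomial of \<open>P\<close> appear in exactly one slice.\<close>
    define slice where "slice P k = (\<lambda>m. if i \<in># m then \<zero> else P (m + replicate_mset k i))" for P k
    define mon where "mon P = (SOME m. P m \<noteq> \<zero>)" for P :: "'c multiset \<Rightarrow> 'a"
    \<comment> \<open>Not the degree, but the exponent of \<open>i\<close> in some monomial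
      occurring in \<open>P\<close>; this suffices for \<open>slice P (deg P)\<close> to be
      nonzero.\<close>
    define deg where "deg P = count (mon P) i" for P :: "'c multiset \<Rightarrow> 'a"
    have fin: "finite {m. P m \<noteq> \<zero>}" and cc: "carrier_coeff P"
      and supp: "\<And>m. P m \<noteq> \<zero> \<Longrightarrow> set_mset m \<subseteq> insert i I" and mon: "P (mon P) \<noteq> \<zero>" if "P \<in> \<P>" for P
      using insert.prems(2)[OF that] someI_ex[of "\<lambda>m. P m \<noteq> \<zero>"] by (auto simp: mon_def)
    have inj: "inj_on (\<lambda>m. m + replicate_mset k i) A" for k A by (auto simp: inj_on_def)
    have slice_cc: "carrier_coeff (slice P k)" if "P \<in> \<P>" for P k
      using cc[OF that] by (auto simp: slice_def carrier_coeff_def)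
    have slice_fin: "finite {m. slice P k m \<noteq> \<zero>}" if "P \<in> \<P>" for P k
    proof -
      have "(\<lambda>m. m + replicate_mset k i) ` {m. slice P k m \<noteq> \<zero>} \<subseteq> {m. P m \<noteq> \<zero>}"
        by (auto simp: slice_def split: if_splits)
      then have "finite ((\<lambda>m. m + replicate_mset k i) ` {m. slice P k m \<noteq> \<zero>})"
        using fin[OF that] by (rule finite_subset)
      then show ?thesis using inj by (rule finite_imageD)
    qed
    have slice_supp: "set_mset m \<subseteq> I" if "P \<in> \<P>" "slice P k m \<noteq> \<zero>" for P k m
      using supp[of P "m + replicate_mset k i"] that by (auto simp: slice_def split: if_splits)
    have slice_nz: "\<exists>m. slice P (deg P) m \<noteq> \<zero>" if "P \<in> \<P>" for P
    proof
      have "filter_mset (\<lambda>j. j \<noteq> i) (mon P) + replicate_mset (deg P) i = mon P"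
        by (auto simp: multiset_eq_iff deg_def)
      then show "slice P (deg P) (filter_mset (\<lambda>j. j \<noteq> i) (mon P)) \<noteq> \<zero>"
        using mon[OF that] by (simp add: slice_def)
    qed
    have "\<exists>x \<in> I \<rightarrow> carrier R. \<forall>Q \<in> (\<lambda>P. slice P (deg P)) ` \<P>. peval I x Q \<noteq> \<zero>"
    proof (rule insert.IH)
      show "finite ((\<lambda>P. slice P (deg P)) ` \<P>)" using insert.prems(1) by simp
      fix Q assume "Q \<in> (\<lambda>P. slice P (deg P)) ` \<P>"
      then obtain P where P: "P \<in> \<P>" "Q = slice P (deg P)" by blast
      show "carrier_coeff Q \<and> finite {m. Q m \<noteq> \<zero>} \<and> (\<forall>m. Q m \<noteq> \<zero> \<longrightarrow> set_mset m \<subseteq> I) \<and> (\<exists>m. Q m \<noteq> \<zero>)"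
        unfolding P(2) using slice_cc[OF P(1)] slice_fin[OF P(1)] slice_supp[OF P(1)] slice_nz[OF P(1)]
        by blast
    qed
    then obtain x where x: "x \<in> I \<rightarrow> carrier R" "\<And>P. P \<in> \<P> \<Longrightarrow> peval I x (slice P (deg P)) \<noteq> \<zero>"
      by blast
    \<comment> \<open>One more than every exponent of \<open>i\<close> in \<open>P\<close>.
      Inserting \<open>deg P\<close> makes the maximum range over a nonempty set and gives
      \<open>deg P < N P\<close> at once.\<close>
    define N where "N P = Suc (Max (insert (deg P) ((\<lambda>m. count m i) ` {m. P m \<noteq> \<zero>})))"
      for P :: "'c multiset \<Rightarrow> 'a"
    have expand: "peval (insert i I) (x(i := t)) P = (\<Oplus>k\<in>{..<N P}. peval I x (slice P k) \<otimes> t [^] k)"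
      if P: "P \<in> \<P>" and t: "t \<in> carrier R" for P t
    proof -
      let ?A = "{m. P m \<noteq> \<zero>}"
      let ?B = "\<lambda>k. {m. P m \<noteq> \<zero> \<and> count m i = k}"
      have xt: "x(i := t) \<in> insert i I \<rightarrow> carrier R" using x(1) t by auto
      have xc: "x j \<in> carrier R" if "j \<in> I" for j using that x(1) by auto
      have mono: "E.mono_eval (insert i I) (x(i := t)) m = E.mono_eval I x m \<otimes> t [^] count m i" for m
      proof -
        have "(\<Otimes>j\<in>I. (x(i := t)) j [^] count m j) = (\<Otimes>j\<in>I. x j [^] count m j)"
          using insert.hyps x(1) by (intro finprod_cong') auto
        then show ?thesis
          unfolding E.mono_eval_def using insert.hyps xt t x(1)
          by (subst finprod_insert) (auto intro!: m_comm finprod_closed nat_pow_closed xc)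
      qed
      have less: "count m i < N P" if "P m \<noteq> \<zero>" for m
        unfolding N_def using fin[OF P] that by (auto simp: less_Suc_eq_le)
      have un: "?A = (\<Union>k\<in>{..<N P}. ?B k)" using less by auto
      have finB: "finite (?B k)" for k using fin[OF P] by (rule finite_subset[rotated]) auto
      have "peval (insert i I) (x(i := t)) P = (\<Oplus>m\<in>?A. P m \<otimes> (E.mono_eval I x m \<otimes> t [^] count m i))"
        unfolding peval_def E.mpoly_eval_def mono id_apply ..
      also have "\<dots> = (\<Oplus>k\<in>{..<N P}. \<Oplus>m\<in>?B k. P m \<otimes> (E.mono_eval I x m \<otimes> t [^] count m i))"
        unfolding un using finB x(1) t cc[OF P]
        by (intro add.finprod_UN_disjoint) (auto simp: pairwise_def disjnt_def carrier_coeff_def)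
      also have "\<dots> = (\<Oplus>k\<in>{..<N P}. peval I x (slice P k) \<otimes> t [^] k)"
      proof (rule finsum_cong')
        fix k assume "k \<in> {..<N P}"
        let ?C = "{m. slice P k m \<noteq> \<zero>}"
        have im: "(\<lambda>m. m + replicate_mset k i) ` ?C = ?B k"
        proof
          show "?B k \<subseteq> (\<lambda>m. m + replicate_mset k i) ` ?C"
          proof
            fix m assume m: "m \<in> ?B k"
            let ?m = "filter_mset (\<lambda>j. j \<noteq> i) m"
            have "?m + replicate_mset k i = m" using m by (auto simp: multiset_eq_iff)
            moreover from this have "?m \<in> ?C" using m by (auto simp: slice_def)
            ultimately show "m \<in> (\<lambda>m. m + replicate_mset k i) ` ?C" by (metis imageI)
          qed
        qed (auto simp: slice_def not_in_iff split: if_splits)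
        have monor: "E.mono_eval I x (m + replicate_mset k i) = E.mono_eval I x m" for m
          unfolding E.mono_eval_def using insert.hyps x(1) by (intro finprod_cong') auto
        have "(\<Oplus>m\<in>?B k. P m \<otimes> (E.mono_eval I x m \<otimes> t [^] count m i)) =
            (\<Oplus>m\<in>?B k. (P m \<otimes> E.mono_eval I x m) \<otimes> t [^] k)"
          using x(1) t cc[OF P] by (intro finsum_cong') (auto simp: carrier_coeff_def m_assoc)
        also have "\<dots> = (\<Oplus>m\<in>?B k. P m \<otimes> E.mono_eval I x m) \<otimes> t [^] k"
          using x(1) t cc[OF P] finB by (intro finsum_ldistr[symmetric]) (auto simp: carrier_coeff_def)
        also have "(\<Oplus>m\<in>?B k. P m \<otimes> E.mono_eval I x m) =
            (\<Oplus>m\<in>?C. P (m + replicate_mset k i) \<otimes> E.mono_eval I x (m + replicate_mset k i))"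
          unfolding im[symmetric] using x(1) cc[OF P] inj
          by (intro finsum_reindex) (auto simp: carrier_coeff_def)
        also have "\<dots> = (\<Oplus>m\<in>?C. slice P k m \<otimes> E.mono_eval I x m)"
          using x(1) cc[OF P] monor
          by (intro finsum_cong') (auto simp: slice_def carrier_coeff_def split: if_splits)
        also have "\<dots> = peval I x (slice P k)" unfolding peval_def E.mpoly_eval_def id_apply ..
        finally show "(\<Oplus>m\<in>?B k. P m \<otimes> (E.mono_eval I x m \<otimes> t [^] count m i)) =
            peval I x (slice P k) \<otimes> t [^] k" .
      qed (use x(1) t slice_cc[OF P] peval_closed in \<open>auto intro!: m_closed\<close>)
      finally show ?thesis .
    qed
    \<comment> \<open>With \<open>x\<close> fixed, each \<open>P\<close> is a nonzero polynomial in
      the last coordinate \<open>t\<close>, so only finitely many \<open>t\<close> are bad.\<close>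
    define Z where "Z = (\<Union>P\<in>\<P>. {t \<in> carrier R. (\<Oplus>k\<in>{..<N P}. peval I x (slice P k) \<otimes> t [^] k) = \<zero>})"
    have "finite Z"
      unfolding Z_def
    proof (intro finite_UN_I insert.prems(1))
      fix P assume P: "P \<in> \<P>"
      show "finite {t \<in> carrier R. (\<Oplus>k\<in>{..<N P}. peval I x (slice P k) \<otimes> t [^] k) = \<zero>}"
      proof (rule finite_zeros_finsum)
        show "deg P < N P" unfolding N_def using fin[OF P] by (auto simp: less_Suc_eq_le)
        show "peval I x (slice P (deg P)) \<noteq> \<zero>" using x(2) P by blast
      qed (use slice_cc[OF P] x(1) peval_closed in auto)
    qed
    then obtain t where t: "t \<in> carrier R" "t \<notin> Z"
      using assms(1) by (meson finite_subset subsetI)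
    then have "\<forall>P\<in>\<P>. peval (insert i I) (x(i := t)) P \<noteq> \<zero>" using expand by (auto simp: Z_def)
    moreover have "x(i := t) \<in> insert i I \<rightarrow> carrier R" using x(1) t by auto
    ultimately show ?case by blast
  qed
qed

lemma exists_common_nonzero:
  assumes "infinite (carrier R)" "finite I" "finite \<P>"
    and "\<And>P. P \<in> \<P> \<Longrightarrow> P \<in> carrier (mpoly_ring R I) \<and> P \<noteq> \<zero>\<^bsub>mpoly_ring R I\<^esub>"
  obtains x where "x \<in> I \<rightarrow> carrier R" "\<And>P. P \<in> \<P> \<Longrightarrow> peval I x P \<noteq> \<zero>"
proof -
  have "\<exists>x \<in> I \<rightarrow> carrier R. \<forall>P \<in> \<P>. peval I x P \<noteq> \<zero>"
  proof (rule exists_common_nonzero_aux[OF assms(1-3)])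
    fix P assume "P \<in> \<P>"
    then have P: "P \<in> indexed_pset I (carrier R)" "P \<noteq> (\<lambda>_. \<zero>)"
      using assms(4) by (auto simp: indexed_zero_def)
    then show "carrier_coeff P \<and> finite {m. P m \<noteq> \<zero>} \<and> (\<forall>m. P m \<noteq> \<zero> \<longrightarrow> set_mset m \<subseteq> I) \<and>
      (\<exists>m. P m \<noteq> \<zero>)"
      using pset_carrier_coeff finite_support support_indices by blast
  qed
  then show ?thesis using that by blast
qed

end

section \<open>Localizations\<close>

text \<open>Operations on fractions are unions over all pairs of representatives. Once the result
  does not depend on the choice, the union is that one class.\<close>

lemma UN_pairs_const:
  assumes "(a, s) \<in> A" "(b, t) \<in> B" "\<And>a s b t. (a, s) \<in> A \<Longrightarrow> (b, t) \<in> B \<Longrightarrow> f a s b t = c"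
  shows "(\<Union>(a, s)\<in>A. \<Union>(b, t)\<in>B. f a s b t) = c"
proof
  show "(\<Union>(a, s)\<in>A. \<Union>(b, t)\<in>B. f a s b t) \<subseteq> c" using assms(3) by blast
  show "c \<subseteq> (\<Union>(a, s)\<in>A. \<Union>(b, t)\<in>B. f a s b t)"
    unfolding assms(3)[OF assms(1,2), symmetric] using assms(1,2) by blast
qed

locale mult_subset = cring R for R (structure) +
  fixes S
  assumes S_subset: "S \<subseteq> carrier R" and S_one: "\<one> \<in> S"
    and S_mult: "s \<in> S \<Longrightarrow> t \<in> S \<Longrightarrow> s \<otimes> t \<in> S"
begin

abbreviation "L \<equiv> localization R S"

lemma S_carrier [simp]: "s \<in> S \<Longrightarrow> s \<in> carrier R"
  using S_subset by blast

lemma loc_rel_iff: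
  "((a, s), (b, t)) \<in> loc_rel R S \<longleftrightarrow> a \<in> carrier R \<and> s \<in> S \<and> b \<in> carrier R \<and> t \<in> S \<and>
    (\<exists>u\<in>S. u \<otimes> (a \<otimes> t) = u \<otimes> (b \<otimes> s))"
  by (simp add: loc_rel_def)

lemma equiv_loc_rel: "equiv (carrier R \<times> S) (loc_rel R S)"
proof (rule equivI)
  show "loc_rel R S \<subseteq> (carrier R \<times> S) \<times> (carrier R \<times> S)"
    unfolding loc_rel_def by auto
  show "refl_on (carrier R \<times> S) (loc_rel R S)"
    unfolding refl_on_def using S_one by (auto simp: loc_rel_iff)
  show "sym (loc_rel R S)"
  proof (rule symI)
    fix x y assume "(x, y) \<in> loc_rel R S"
    then show "(y, x) \<in> loc_rel R S"
      by (cases x; cases y) (auto simp: loc_rel_iff intro: sym)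
  qed
  show "trans (loc_rel R S)"
  proof (rule transI)
    fix x y z assume "(x, y) \<in> loc_rel R S" "(y, z) \<in> loc_rel R S"
    then obtain a s b t c r u v where *: "x = (a, s)" "y = (b, t)" "z = (c, r)"
      "a \<in> carrier R" "b \<in> carrier R" "c \<in> carrier R" "s \<in> S" "t \<in> S" "r \<in> S" "u \<in> S" "v \<in> S"
      "u \<otimes> (a \<otimes> t) = u \<otimes> (b \<otimes> s)" "v \<otimes> (b \<otimes> r) = v \<otimes> (c \<otimes> t)"
      by (cases x; cases y; cases z) (auto simp: loc_rel_iff)
    \<comment> \<open>Comparing \<open>a / s\<close> with \<open>c / r\<close> passes through
      \<open>b / t\<close>, so the middle denominator \<open>t\<close> joins the two witnesses
      \<open>u\<close> and \<open>v\<close>.\<close>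
    have "(u \<otimes> v \<otimes> t) \<otimes> (a \<otimes> r) = v \<otimes> r \<otimes> (u \<otimes> (a \<otimes> t))" using *(4-11) S_carrier by (simp add: m_ac)
    also have "\<dots> = u \<otimes> s \<otimes> (v \<otimes> (b \<otimes> r))" unfolding *(12) using *(4-11) S_carrier by (simp add: m_ac)
    also have "\<dots> = (u \<otimes> v \<otimes> t) \<otimes> (c \<otimes> s)" unfolding *(13) using *(4-11) S_carrier by (simp add: m_ac)
    finally have "\<exists>w\<in>S. w \<otimes> (a \<otimes> r) = w \<otimes> (c \<otimes> s)"
      using *(7-11) S_mult by (intro bexI[of _ "u \<otimes> v \<otimes> t"]) simp_all
    then show "(x, z) \<in> loc_rel R S" using *(1-9) by (simp add: loc_rel_iff)
  qed
qed

lemma frac_eq_iff: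
  assumes "a \<in> carrier R" "s \<in> S" "b \<in> carrier R" "t \<in> S"
  shows "loc_frac R S a s = loc_frac R S b t \<longleftrightarrow> (\<exists>u\<in>S. u \<otimes> (a \<otimes> t) = u \<otimes> (b \<otimes> s))"
proof -
  have "loc_frac R S a s = loc_frac R S b t \<longleftrightarrow> ((a, s), (b, t)) \<in> loc_rel R S"
    unfolding loc_frac_def using assms by (intro eq_equiv_class_iff[OF equiv_loc_rel]) auto
  then show ?thesis using assms by (simp add: loc_rel_iff)
qed

lemma mem_frac:
  assumes "a \<in> carrier R" "s \<in> S" "(b, t) \<in> loc_frac R S a s"
  shows "b \<in> carrier R" "t \<in> S" "loc_frac R S b t = loc_frac R S a s"
proof -
  have *: "((a, s), (b, t)) \<in> loc_rel R S" using assms(3) by (simp add: loc_frac_def)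
  then show "b \<in> carrier R" "t \<in> S" by (auto simp: loc_rel_iff)
  show "loc_frac R S b t = loc_frac R S a s"
    unfolding loc_frac_def using equiv_class_eq[OF equiv_loc_rel *] by simp
qed

lemma frac_self: "a \<in> carrier R \<Longrightarrow> s \<in> S \<Longrightarrow> (a, s) \<in> loc_frac R S a s"
  unfolding loc_frac_def using equiv_class_self[OF equiv_loc_rel] by auto

lemma frac_closed [simp]: "a \<in> carrier R \<Longrightarrow> s \<in> S \<Longrightarrow> loc_frac R S a s \<in> carrier L"
  unfolding localization_def by auto

lemma fracE:
  assumes "x \<in> carrier L"
  obtains a s where "a \<in> carrier R" "s \<in> S" "x = loc_frac R S a s"
  using assms unfolding localization_def by auto

lemma frac_mult_eq:
  assumes "a \<in> carrier R" "s \<in> S" "a' \<in> carrier R" "s' \<in> S"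
    and "b \<in> carrier R" "t \<in> S" "b' \<in> carrier R" "t' \<in> S"
    and "loc_frac R S a s = loc_frac R S a' s'" "loc_frac R S b t = loc_frac R S b' t'"
  shows "loc_frac R S (a \<otimes> b) (s \<otimes> t) = loc_frac R S (a' \<otimes> b') (s' \<otimes> t')"
proof -
  obtain u v where uv: "u \<in> S" "v \<in> S" "u \<otimes> (a \<otimes> s') = u \<otimes> (a' \<otimes> s)" "v \<otimes> (b \<otimes> t') = v \<otimes> (b' \<otimes> t)"
    using assms frac_eq_iff by auto
  have "(u \<otimes> v) \<otimes> ((a \<otimes> b) \<otimes> (s' \<otimes> t')) = (u \<otimes> (a \<otimes> s')) \<otimes> (v \<otimes> (b \<otimes> t'))"
    using assms(1-8) uv(1,2) S_carrier by (simp add: m_ac)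
  also have "\<dots> = (u \<otimes> v) \<otimes> ((a' \<otimes> b') \<otimes> (s \<otimes> t))"
    unfolding uv(3,4) using assms(1-8) uv(1,2) S_carrier by (simp add: m_ac)
  finally show ?thesis using assms uv S_mult frac_eq_iff by auto
qed

lemma frac_add_eq:
  assumes "a \<in> carrier R" "s \<in> S" "a' \<in> carrier R" "s' \<in> S"
    and "b \<in> carrier R" "t \<in> S" "b' \<in> carrier R" "t' \<in> S"
    and "loc_frac R S a s = loc_frac R S a' s'" "loc_frac R S b t = loc_frac R S b' t'"
  shows "loc_frac R S (a \<otimes> t \<oplus> b \<otimes> s) (s \<otimes> t) = loc_frac R S (a' \<otimes> t' \<oplus> b' \<otimes> s') (s' \<otimes> t')"
proof -
  obtain u v where uv: "u \<in> S" "v \<in> S" "u \<otimes> (a \<otimes> s') = u \<otimes> (a' \<otimes> s)" "v \<otimes> (b \<otimes> t') = v \<otimes> (b' \<otimes> t)"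
    using assms frac_eq_iff by auto
  have "(u \<otimes> v) \<otimes> ((a \<otimes> t \<oplus> b \<otimes> s) \<otimes> (s' \<otimes> t')) =
      v \<otimes> t \<otimes> t' \<otimes> (u \<otimes> (a \<otimes> s')) \<oplus> u \<otimes> s \<otimes> s' \<otimes> (v \<otimes> (b \<otimes> t'))"
    using assms(1-8) uv(1,2) S_carrier by (simp add: m_ac l_distr r_distr)
  also have "\<dots> = (u \<otimes> v) \<otimes> ((a' \<otimes> t' \<oplus> b' \<otimes> s') \<otimes> (s \<otimes> t))"
    unfolding uv(3,4) using assms(1-8) uv(1,2) S_carrier by (simp add: m_ac l_distr r_distr)
  finally show ?thesis using assms uv S_mult frac_eq_iff by auto
qed

lemma loc_mult:
  assumes "a \<in> carrier R" "s \<in> S" "b \<in> carrier R" "t \<in> S"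
  shows "loc_frac R S a s \<otimes>\<^bsub>L\<^esub> loc_frac R S b t = loc_frac R S (a \<otimes> b) (s \<otimes> t)"
proof -
  have "loc_frac R S (a' \<otimes> b') (s' \<otimes> t') = loc_frac R S (a \<otimes> b) (s \<otimes> t)"
    if "(a', s') \<in> loc_frac R S a s" "(b', t') \<in> loc_frac R S b t" for a' s' b' t'
    using mem_frac[OF assms(1,2) that(1)] mem_frac[OF assms(3,4) that(2)] assms
    by (intro frac_mult_eq) auto
  then have "(\<Union>(a', s')\<in>loc_frac R S a s. \<Union>(b', t')\<in>loc_frac R S b t. loc_frac R S (a' \<otimes> b') (s' \<otimes> t'))
      = loc_frac R S (a \<otimes> b) (s \<otimes> t)"
    by (intro UN_pairs_const[OF frac_self[OF assms(1,2)] frac_self[OF assms(3,4)]])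
  then show ?thesis unfolding localization_def by simp
qed

lemma loc_add:
  assumes "a \<in> carrier R" "s \<in> S" "b \<in> carrier R" "t \<in> S"
  shows "loc_frac R S a s \<oplus>\<^bsub>L\<^esub> loc_frac R S b t = loc_frac R S (a \<otimes> t \<oplus> b \<otimes> s) (s \<otimes> t)"
proof -
  have "loc_frac R S (a' \<otimes> t' \<oplus> b' \<otimes> s') (s' \<otimes> t') = loc_frac R S (a \<otimes> t \<oplus> b \<otimes> s) (s \<otimes> t)"
    if "(a', s') \<in> loc_frac R S a s" "(b', t') \<in> loc_frac R S b t" for a' s' b' t'
    using mem_frac[OF assms(1,2) that(1)] mem_frac[OF assms(3,4) that(2)] assms
    by (intro frac_add_eq) auto
  then have "(\<Union>(a', s')\<in>loc_frac R S a s. \<Union>(b', t')\<in>loc_frac R S b t.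
        loc_frac R S (a' \<otimes> t' \<oplus> b' \<otimes> s') (s' \<otimes> t'))
      = loc_frac R S (a \<otimes> t \<oplus> b \<otimes> s) (s \<otimes> t)"
    by (intro UN_pairs_const[OF frac_self[OF assms(1,2)] frac_self[OF assms(3,4)]])
  then show ?thesis unfolding localization_def by simp
qed

lemma loc_one: "\<one>\<^bsub>L\<^esub> = loc_frac R S \<one> \<one>" and loc_zero: "\<zero>\<^bsub>L\<^esub> = loc_frac R S \<zero> \<one>"
  unfolding localization_def by simp_all

lemma frac_cancel:
  assumes "a \<in> carrier R" "s \<in> S" "t \<in> S"
  shows "loc_frac R S (a \<otimes> t) (s \<otimes> t) = loc_frac R S a s"
  using assms S_one S_mult by (subst frac_eq_iff) (auto simp: m_ac)

lemma localization_cring: "cring L"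
proof (rule cringI)
  show "abelian_group L"
  proof (rule abelian_groupI)
    fix x y assume "x \<in> carrier L" "y \<in> carrier L"
    then obtain a s b t where [simp]: "a \<in> carrier R" "s \<in> S" "x = loc_frac R S a s"
      "b \<in> carrier R" "t \<in> S" "y = loc_frac R S b t" using fracE by metis
    show "x \<oplus>\<^bsub>L\<^esub> y \<in> carrier L" by (simp add: loc_add S_mult)
    show "x \<oplus>\<^bsub>L\<^esub> y = y \<oplus>\<^bsub>L\<^esub> x" by (simp add: loc_add a_comm m_comm)
    show "\<zero>\<^bsub>L\<^esub> \<oplus>\<^bsub>L\<^esub> x = x" by (simp add: loc_zero loc_add S_one)
    have "loc_frac R S (\<ominus> a) s \<oplus>\<^bsub>L\<^esub> x = \<zero>\<^bsub>L\<^esub>"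
      using S_one S_mult by (simp add: loc_add loc_zero frac_eq_iff l_minus l_neg) (metis S_carrier S_one l_null m_comm r_null zero_closed)
    then show "\<exists>z\<in>carrier L. z \<oplus>\<^bsub>L\<^esub> x = \<zero>\<^bsub>L\<^esub>" by (metis \<open>a \<in> carrier R\<close> \<open>s \<in> S\<close> a_inv_closed frac_closed)
    fix z assume "z \<in> carrier L"
    then obtain c r where [simp]: "c \<in> carrier R" "r \<in> S" "z = loc_frac R S c r" using fracE by metis
    have "(a \<otimes> t \<oplus> b \<otimes> s) \<otimes> r \<oplus> c \<otimes> (s \<otimes> t) = a \<otimes> (t \<otimes> r) \<oplus> (b \<otimes> r \<oplus> c \<otimes> t) \<otimes> s"
      by (simp add: l_distr r_distr m_ac a_ac)
    then show "x \<oplus>\<^bsub>L\<^esub> y \<oplus>\<^bsub>L\<^esub> z = x \<oplus>\<^bsub>L\<^esub> (y \<oplus>\<^bsub>L\<^esub> z)"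
      by (simp add: loc_add S_mult m_assoc)
  qed (simp add: loc_zero S_one)
next
  show "comm_monoid L"
  proof (rule comm_monoidI)
    fix x y assume "x \<in> carrier L" "y \<in> carrier L"
    then obtain a s b t where [simp]: "a \<in> carrier R" "s \<in> S" "x = loc_frac R S a s"
      "b \<in> carrier R" "t \<in> S" "y = loc_frac R S b t" using fracE by metis
    show "x \<otimes>\<^bsub>L\<^esub> y \<in> carrier L" by (simp add: loc_mult S_mult)
    show "x \<otimes>\<^bsub>L\<^esub> y = y \<otimes>\<^bsub>L\<^esub> x" by (simp add: loc_mult m_comm)
    show "\<one>\<^bsub>L\<^esub> \<otimes>\<^bsub>L\<^esub> x = x" by (simp add: loc_one loc_mult S_one)
    fix z assume "z \<in> carrier L"
    then obtain c r where [simp]: "c \<in> carrier R" "r \<in> S" "z = loc_frac R S c r" using fracE by metis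
    show "x \<otimes>\<^bsub>L\<^esub> y \<otimes>\<^bsub>L\<^esub> z = x \<otimes>\<^bsub>L\<^esub> (y \<otimes>\<^bsub>L\<^esub> z)"
      by (simp add: loc_mult S_mult m_assoc)
  qed (simp add: loc_one S_one)
next
  fix x y z assume "x \<in> carrier L" "y \<in> carrier L" "z \<in> carrier L"
  then obtain a s b t c r where [simp]: "a \<in> carrier R" "s \<in> S" "x = loc_frac R S a s"
    "b \<in> carrier R" "t \<in> S" "y = loc_frac R S b t" 
    "c \<in> carrier R" "r \<in> S" "z = loc_frac R S c r" using fracE by metis
  have "x \<otimes>\<^bsub>L\<^esub> z \<oplus>\<^bsub>L\<^esub> y \<otimes>\<^bsub>L\<^esub> z = loc_frac R S ((a \<otimes> t \<oplus> b \<otimes> s) \<otimes> c \<otimes> r) (s \<otimes> t \<otimes> r \<otimes> r)"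
    by (simp add: loc_mult loc_add S_mult m_ac l_distr r_distr)
  also have "\<dots> = loc_frac R S ((a \<otimes> t \<oplus> b \<otimes> s) \<otimes> c) (s \<otimes> t \<otimes> r)"
    by (rule frac_cancel) (simp_all add: S_mult)
  finally show "(x \<oplus>\<^bsub>L\<^esub> y) \<otimes>\<^bsub>L\<^esub> z = x \<otimes>\<^bsub>L\<^esub> z \<oplus>\<^bsub>L\<^esub> y \<otimes>\<^bsub>L\<^esub> z"
    by (simp add: loc_mult loc_add S_mult)
qed

lemma loc_map_hom: "(\<lambda>a. loc_frac R S a \<one>) \<in> ring_hom R L"
  by (rule ring_hom_memI) (simp_all add: loc_mult loc_add S_one loc_one)

lemma frac_mult_denom:
  assumes "a \<in> carrier R" "s \<in> S"
  shows "loc_frac R S a s \<otimes>\<^bsub>L\<^esub> loc_frac R S s \<one> = loc_frac R S a \<one>"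
  using assms S_one S_mult by (simp add: loc_mult) (subst frac_eq_iff, auto simp: m_ac)

text \<open>An arbitrary representative is evaluated; \<open>loc_ext_frac\<close> shows that the
  choice does not matter when denominators go to units.\<close>

definition loc_ext :: "('c, 'd) ring_scheme \<Rightarrow> ('a \<Rightarrow> 'c) \<Rightarrow> ('a \<times> 'a) set \<Rightarrow> 'c"
  where "loc_ext T \<chi> x = (let (a, s) = (SOME p. p \<in> x) in \<chi> a \<otimes>\<^bsub>T\<^esub> inv\<^bsub>T\<^esub> \<chi> s)"

lemma loc_ext_frac:
  assumes T: "cring T" and \<chi>: "\<chi> \<in> ring_hom R T" and U: "\<And>s. s \<in> S \<Longrightarrow> \<chi> s \<in> Units T"
    and a: "a \<in> carrier R" and s: "s \<in> S"
  shows "loc_ext T \<chi> (loc_frac R S a s) = \<chi> a \<otimes>\<^bsub>T\<^esub> inv\<^bsub>T\<^esub> \<chi> s"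
proof -
  interpret T: cring T by (rule T)
  obtain b t where bt: "(SOME p. p \<in> loc_frac R S a s) = (b, t)" by force
  then have "(b, t) \<in> loc_frac R S a s" using frac_self[OF a s] by (metis someI_ex)
  note m = mem_frac[OF a s this]
  then obtain u where u: "u \<in> S" "u \<otimes> (b \<otimes> s) = u \<otimes> (a \<otimes> t)" using frac_eq_iff a s by blast
  note [simp] = ring_hom_closed[OF \<chi>] ring_hom_mult[OF \<chi>] T.Units_closed
  have c: "\<chi> u \<in> Units T" "\<chi> s \<in> Units T" "\<chi> t \<in> Units T" "\<chi> a \<in> carrier T" "\<chi> b \<in> carrier T"
    using U u a s m by auto
  have "\<chi> u \<otimes>\<^bsub>T\<^esub> (\<chi> b \<otimes>\<^bsub>T\<^esub> \<chi> s) = \<chi> u \<otimes>\<^bsub>T\<^esub> (\<chi> a \<otimes>\<^bsub>T\<^esub> \<chi> t)"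
    using arg_cong[OF u(2), of \<chi>] a s m u(1) by simp
  then have e: "\<chi> b \<otimes>\<^bsub>T\<^esub> \<chi> s = \<chi> a \<otimes>\<^bsub>T\<^esub> \<chi> t" using c T.Units_l_cancel by simp
  have "\<chi> b \<otimes>\<^bsub>T\<^esub> inv\<^bsub>T\<^esub> \<chi> t = (\<chi> b \<otimes>\<^bsub>T\<^esub> \<chi> s) \<otimes>\<^bsub>T\<^esub> (inv\<^bsub>T\<^esub> \<chi> t \<otimes>\<^bsub>T\<^esub> inv\<^bsub>T\<^esub> \<chi> s)"
  proof -
    have "(\<chi> b \<otimes>\<^bsub>T\<^esub> \<chi> s) \<otimes>\<^bsub>T\<^esub> (inv\<^bsub>T\<^esub> \<chi> t \<otimes>\<^bsub>T\<^esub> inv\<^bsub>T\<^esub> \<chi> s) =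
      \<chi> b \<otimes>\<^bsub>T\<^esub> inv\<^bsub>T\<^esub> \<chi> t \<otimes>\<^bsub>T\<^esub> (\<chi> s \<otimes>\<^bsub>T\<^esub> inv\<^bsub>T\<^esub> \<chi> s)"
      using c by (simp add: T.m_ac del: T.Units_r_inv T.Units_l_inv)
    then show ?thesis using c by simp
  qed
  also have "\<dots> = \<chi> a \<otimes>\<^bsub>T\<^esub> inv\<^bsub>T\<^esub> \<chi> s \<otimes>\<^bsub>T\<^esub> (\<chi> t \<otimes>\<^bsub>T\<^esub> inv\<^bsub>T\<^esub> \<chi> t)"
    unfolding e using c by (simp add: T.m_ac del: T.Units_r_inv T.Units_l_inv)
  also have "\<dots> = \<chi> a \<otimes>\<^bsub>T\<^esub> inv\<^bsub>T\<^esub> \<chi> s" using c by simp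
  finally show ?thesis unfolding loc_ext_def bt by simp
qed

lemma loc_ext_hom:
  assumes T: "cring T" and \<chi>: "\<chi> \<in> ring_hom R T" and U: "\<And>s. s \<in> S \<Longrightarrow> \<chi> s \<in> Units T"
  shows "loc_ext T \<chi> \<in> ring_hom L T"
proof -
  interpret T: cring T by (rule T)
  note ext = loc_ext_frac[OF T \<chi> U]
  note [simp] = ring_hom_closed[OF \<chi>] ring_hom_mult[OF \<chi>] ring_hom_add[OF \<chi>] ring_hom_one[OF \<chi>] T.Units_closed U
  have inv2: "inv\<^bsub>T\<^esub> (u \<otimes>\<^bsub>T\<^esub> v) = inv\<^bsub>T\<^esub> u \<otimes>\<^bsub>T\<^esub> inv\<^bsub>T\<^esub> v" if "u \<in> Units T" "v \<in> Units T" for u v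
  proof (rule T.comm_inv_char)
    have "u \<otimes>\<^bsub>T\<^esub> v \<otimes>\<^bsub>T\<^esub> (inv\<^bsub>T\<^esub> u \<otimes>\<^bsub>T\<^esub> inv\<^bsub>T\<^esub> v) =
        (u \<otimes>\<^bsub>T\<^esub> inv\<^bsub>T\<^esub> u) \<otimes>\<^bsub>T\<^esub> (v \<otimes>\<^bsub>T\<^esub> inv\<^bsub>T\<^esub> v)"
      using that by (simp add: T.m_ac del: T.Units_r_inv T.Units_l_inv)
    then show "u \<otimes>\<^bsub>T\<^esub> v \<otimes>\<^bsub>T\<^esub> (inv\<^bsub>T\<^esub> u \<otimes>\<^bsub>T\<^esub> inv\<^bsub>T\<^esub> v) = \<one>\<^bsub>T\<^esub>" using that by simp
  qed (use that in auto)
  show ?thesis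
  proof (rule ring_hom_memI)
    fix x assume "x \<in> carrier L"
    then obtain a s where [simp]: "a \<in> carrier R" "s \<in> S" "x = loc_frac R S a s" using fracE by metis
    show "loc_ext T \<chi> x \<in> carrier T" by (simp add: ext)
    fix y assume "y \<in> carrier L"
    then obtain b t where [simp]: "b \<in> carrier R" "t \<in> S" "y = loc_frac R S b t" using fracE by metis
    show "loc_ext T \<chi> (x \<otimes>\<^bsub>L\<^esub> y) = loc_ext T \<chi> x \<otimes>\<^bsub>T\<^esub> loc_ext T \<chi> y"
      by (simp add: ext loc_mult S_mult inv2 T.m_ac)
    have "\<chi> a \<otimes>\<^bsub>T\<^esub> \<chi> t \<otimes>\<^bsub>T\<^esub> (inv\<^bsub>T\<^esub> \<chi> s \<otimes>\<^bsub>T\<^esub> inv\<^bsub>T\<^esub> \<chi> t) = \<chi> a \<otimes>\<^bsub>T\<^esub> inv\<^bsub>T\<^esub> \<chi> s \<otimes>\<^bsub>T\<^esub> (\<chi> t \<otimes>\<^bsub>T\<^esub> inv\<^bsub>T\<^esub> \<chi> t)"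
      by (simp add: T.m_ac del: T.Units_r_inv T.Units_l_inv)
    moreover have "\<chi> b \<otimes>\<^bsub>T\<^esub> \<chi> s \<otimes>\<^bsub>T\<^esub> (inv\<^bsub>T\<^esub> \<chi> s \<otimes>\<^bsub>T\<^esub> inv\<^bsub>T\<^esub> \<chi> t) = \<chi> b \<otimes>\<^bsub>T\<^esub> inv\<^bsub>T\<^esub> \<chi> t \<otimes>\<^bsub>T\<^esub> (\<chi> s \<otimes>\<^bsub>T\<^esub> inv\<^bsub>T\<^esub> \<chi> s)"
      by (simp add: T.m_ac del: T.Units_r_inv T.Units_l_inv)
    ultimately show "loc_ext T \<chi> (x \<oplus>\<^bsub>L\<^esub> y) = loc_ext T \<chi> x \<oplus>\<^bsub>T\<^esub> loc_ext T \<chi> y"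
      by (simp add: ext loc_add S_mult inv2 T.l_distr)
  qed (simp add: loc_one ext S_one)
qed

lemma loc_ext_map:
  assumes "cring T" "\<chi> \<in> ring_hom R T" "\<And>s. s \<in> S \<Longrightarrow> \<chi> s \<in> Units T" "a \<in> carrier R"
  shows "loc_ext T \<chi> (loc_frac R S a \<one>) = \<chi> a"
proof -
  interpret T: cring T by (rule assms)
  show ?thesis
    using assms ring_hom_one[OF assms(2)] ring_hom_closed[OF assms(2,4)] S_one by (simp add: loc_ext_frac)
qed

end

lemma (in cring) mult_subset_powers:
  assumes "f \<in> carrier R"
  shows "mult_subset R (powers R f)"
proof (unfold_locales)
  show "powers R f \<subseteq> carrier R" using assms by (auto simp: powers_def)
  show "\<one> \<in> powers R f" unfolding powers_def using nat_pow_0[of f] by (metis (mono_tags) mem_Collect_eq)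
  show "s \<otimes> t \<in> powers R f" if "s \<in> powers R f" "t \<in> powers R f" for s t
    using that assms nat_pow_mult[of f] unfolding powers_def by (auto) 
qed

lemma (in domain) mult_subset_nonzero: "mult_subset R (carrier R - {\<zero>})"
  by unfold_locales (auto simp: integral_iff)

lemma (in domain) fraction_map_inj:
  assumes "a \<in> carrier R" "b \<in> carrier R"
  shows "loc_frac R (carrier R - {\<zero>}) a \<one> = loc_frac R (carrier R - {\<zero>}) b \<one> \<longleftrightarrow> a = b"
  using assms mult_subset.frac_eq_iff[OF mult_subset_nonzero, of a \<one> b \<one>]
  by (auto simp: m_lcancel)

lemma (in domain) fraction_field: "field (localization R (carrier R - {\<zero>}))"
proof -
  let ?S = "carrier R - {\<zero>}" and ?L = "localization R (carrier R - {\<zero>})"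
  note ms = mult_subset_nonzero
  note frac_eq_iff = mult_subset.frac_eq_iff[OF ms] and loc_zero = mult_subset.loc_zero[OF ms]
    and loc_one = mult_subset.loc_one[OF ms]
  have nz: "a \<noteq> \<zero>" if "loc_frac R ?S a s \<noteq> \<zero>\<^bsub>?L\<^esub>" "a \<in> carrier R" "s \<in> ?S" for a s
    using that by (auto simp: loc_zero frac_eq_iff)
  have ne: "\<one>\<^bsub>?L\<^esub> \<noteq> \<zero>\<^bsub>?L\<^esub>" using fraction_map_inj[of \<one> \<zero>] by (simp add: loc_one loc_zero)
  show ?thesis
  proof (rule cring.cring_fieldI2[OF mult_subset.localization_cring[OF ms] ne[symmetric]])
    fix x assume x: "x \<in> carrier ?L" "x \<noteq> \<zero>\<^bsub>?L\<^esub>"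
    obtain a s where as: "a \<in> carrier R" "s \<in> ?S" "x = loc_frac R ?S a s"
      using mult_subset.fracE[OF ms x(1)] by metis
    then have a: "a \<in> ?S" using nz x by auto
    have "x \<otimes>\<^bsub>?L\<^esub> loc_frac R ?S s a = loc_frac R ?S (a \<otimes> s) (s \<otimes> a)"
      unfolding as(3) using as a by (intro mult_subset.loc_mult[OF ms]) auto
    also have "\<dots> = \<one>\<^bsub>?L\<^esub>"
      unfolding loc_one using as a by (subst frac_eq_iff) (auto simp: m_comm integral_iff intro!: bexI[of _ \<one>])
    finally have "x \<otimes>\<^bsub>?L\<^esub> loc_frac R ?S s a = \<one>\<^bsub>?L\<^esub>" .
    moreover have "loc_frac R ?S s a \<in> carrier ?L" using as a by (intro mult_subset.frac_closed[OF ms]) auto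
    ultimately show "\<exists>y\<in>carrier ?L. x \<otimes>\<^bsub>?L\<^esub> y = \<one>\<^bsub>?L\<^esub>" by blast
  qed
qed

section \<open>Truncated polynomial rings\<close>

text \<open>A pair \<open>(a, b)\<close> stands for \<open>a + b t\<close> in \<open>N[t]/(t\<^sup>2)\<close>, a triple \<open>(a, b, c)\<close> for
  \<open>a + b t + c t\<^sup>2\<close> in \<open>N[t]/(t\<^sup>3)\<close>.\<close>

definition dual_ring :: "('a, 'm) ring_scheme \<Rightarrow> ('a \<times> 'a) ring"
  where "dual_ring N =
    \<lparr>carrier = carrier N \<times> carrier N,
     monoid.mult = (\<lambda>(a, b) (a', b'). (a \<otimes>\<^bsub>N\<^esub> a', a \<otimes>\<^bsub>N\<^esub> b' \<oplus>\<^bsub>N\<^esub> b \<otimes>\<^bsub>N\<^esub> a')),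
     one = (\<one>\<^bsub>N\<^esub>, \<zero>\<^bsub>N\<^esub>), ring.zero = (\<zero>\<^bsub>N\<^esub>, \<zero>\<^bsub>N\<^esub>),
     add = (\<lambda>(a, b) (a', b'). (a \<oplus>\<^bsub>N\<^esub> a', b \<oplus>\<^bsub>N\<^esub> b'))\<rparr>"

definition trunc3_ring :: "('a, 'm) ring_scheme \<Rightarrow> ('a \<times> 'a \<times> 'a) ring"
  where "trunc3_ring N =
    \<lparr>carrier = carrier N \<times> carrier N \<times> carrier N,
     monoid.mult = (\<lambda>(a, b, c) (a', b', c'). (a \<otimes>\<^bsub>N\<^esub> a', a \<otimes>\<^bsub>N\<^esub> b' \<oplus>\<^bsub>N\<^esub> b \<otimes>\<^bsub>N\<^esub> a',
       a \<otimes>\<^bsub>N\<^esub> c' \<oplus>\<^bsub>N\<^esub> b \<otimes>\<^bsub>N\<^esub> b' \<oplus>\<^bsub>N\<^esub> c \<otimes>\<^bsub>N\<^esub> a')),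
     one = (\<one>\<^bsub>N\<^esub>, \<zero>\<^bsub>N\<^esub>, \<zero>\<^bsub>N\<^esub>), ring.zero = (\<zero>\<^bsub>N\<^esub>, \<zero>\<^bsub>N\<^esub>, \<zero>\<^bsub>N\<^esub>),
     add = (\<lambda>(a, b, c) (a', b', c'). (a \<oplus>\<^bsub>N\<^esub> a', b \<oplus>\<^bsub>N\<^esub> b', c \<oplus>\<^bsub>N\<^esub> c'))\<rparr>"

context cring
begin

lemma dual_ring_simps [simp]:
  "p \<in> carrier (dual_ring R) \<longleftrightarrow> fst p \<in> carrier R \<and> snd p \<in> carrier R"
  "(a, b) \<otimes>\<^bsub>dual_ring R\<^esub> (a', b') = (a \<otimes> a', a \<otimes> b' \<oplus> b \<otimes> a')"
  "(a, b) \<oplus>\<^bsub>dual_ring R\<^esub> (a', b') = (a \<oplus> a', b \<oplus> b')"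
  "\<one>\<^bsub>dual_ring R\<^esub> = (\<one>, \<zero>)" "\<zero>\<^bsub>dual_ring R\<^esub> = (\<zero>, \<zero>)"
  by (simp_all add: dual_ring_def mem_Times_iff)

lemma trunc3_ring_simps [simp]:
  "p \<in> carrier (trunc3_ring R) \<longleftrightarrow> fst p \<in> carrier R \<and> fst (snd p) \<in> carrier R \<and> snd (snd p) \<in> carrier R"
  "(a, b, c) \<otimes>\<^bsub>trunc3_ring R\<^esub> (a', b', c') =
    (a \<otimes> a', a \<otimes> b' \<oplus> b \<otimes> a', a \<otimes> c' \<oplus> b \<otimes> b' \<oplus> c \<otimes> a')"
  "(a, b, c) \<oplus>\<^bsub>trunc3_ring R\<^esub> (a', b', c') = (a \<oplus> a', b \<oplus> b', c \<oplus> c')"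
  "\<one>\<^bsub>trunc3_ring R\<^esub> = (\<one>, \<zero>, \<zero>)" "\<zero>\<^bsub>trunc3_ring R\<^esub> = (\<zero>, \<zero>, \<zero>)"
  by (simp_all add: trunc3_ring_def mem_Times_iff)

lemma dual_ring_cring: "cring (dual_ring R)"
proof (intro cringI abelian_groupI comm_monoidI)
  fix p assume "p \<in> carrier (dual_ring R)"
  then show "\<exists>q\<in>carrier (dual_ring R). q \<oplus>\<^bsub>dual_ring R\<^esub> p = \<zero>\<^bsub>dual_ring R\<^esub>"
    by (cases p) (auto intro!: bexI[of _ "(\<ominus> fst p, \<ominus> snd p)"] simp: l_neg)
qed (simp_all add: split_paired_all l_distr r_distr m_ac a_ac)

lemma trunc3_ring_cring: "cring (trunc3_ring R)"
proof (intro cringI abelian_groupI comm_monoidI)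
  fix p assume "p \<in> carrier (trunc3_ring R)"
  then show "\<exists>q\<in>carrier (trunc3_ring R). q \<oplus>\<^bsub>trunc3_ring R\<^esub> p = \<zero>\<^bsub>trunc3_ring R\<^esub>"
    by (cases p) (auto intro!: bexI[of _ "(\<ominus> fst p, \<ominus> fst (snd p), \<ominus> snd (snd p))"] simp: l_neg)
qed (simp_all add: split_paired_all l_distr r_distr m_ac a_ac)

lemma dual_embed_hom: "(\<lambda>a. (a, \<zero>)) \<in> ring_hom R (dual_ring R)"
  by (rule ring_hom_memI) simp_all

lemma trunc3_embed_hom: "(\<lambda>a. (a, \<zero>, \<zero>)) \<in> ring_hom R (trunc3_ring R)"
  by (rule ring_hom_memI) simp_all

lemma dual_fst_hom: "fst \<in> ring_hom (dual_ring R) R"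
  by (rule ring_hom_memI) (auto simp: split_paired_all)

lemma trunc3_dual_hom: "(\<lambda>(a, b, c). (a, b)) \<in> ring_hom (trunc3_ring R) (dual_ring R)"
  by (rule ring_hom_memI) (auto simp: split_paired_all)

text \<open>As \<open>t\<close> is nilpotent, only the constant term matters: the inverse of
  \<open>a + b t\<close> is \<open>a^-1 - a^-1 b a^-1 t\<close>.\<close>

lemma dual_Units:
  assumes "p \<in> carrier (dual_ring R)" "fst p \<in> Units R"
  shows "p \<in> Units (dual_ring R)"
proof -
  obtain a b where p: "p = (a, b)" by (cases p)
  then have ab: "a \<in> Units R" "a \<in> carrier R" "b \<in> carrier R" "inv a \<in> carrier R" "a \<otimes> inv a = \<one>"
    using assms by auto
  let ?q = "(inv a, \<ominus> (inv a \<otimes> b \<otimes> inv a))"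
  have "a \<otimes> (\<ominus> (inv a \<otimes> b \<otimes> inv a)) \<oplus> b \<otimes> inv a = \<ominus> ((a \<otimes> inv a) \<otimes> b \<otimes> inv a) \<oplus> b \<otimes> inv a"
    using ab(2-4) by (simp add: r_minus m_assoc)
  also have "\<dots> = \<zero>" unfolding ab(5) using ab(2-4) by (simp add: l_neg)
  finally have 1: "p \<otimes>\<^bsub>dual_ring R\<^esub> ?q = \<one>\<^bsub>dual_ring R\<^esub>" unfolding p using ab by simp
  interpret D: cring "dual_ring R" by (rule dual_ring_cring)
  have "?q \<in> carrier (dual_ring R)" using ab by simp
  then show ?thesis using 1 assms(1) D.m_comm[of p ?q] unfolding Units_def by auto
qed

end

section \<open>Sums of squares in characteristic 2\<close>

text \<open>The diagonal form in coordinates. Only the \<open>x i\<close> with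
  \<open>i < length as\<close> count, so \<open>x\<close> need not be extensional as the vectors of
  \<open>diag_form\<close> are.\<close>

definition qsum :: "('a, 'm) ring_scheme \<Rightarrow> 'a list \<Rightarrow> (nat \<Rightarrow> 'a) \<Rightarrow> 'a"
  where "qsum F as x =
    (\<Oplus>\<^bsub>F\<^esub>i\<in>{..<length as}. as ! i \<otimes>\<^bsub>F\<^esub> (x i [^]\<^bsub>F\<^esub> (2::nat)))"

locale char2_cring = cring +
  assumes char2: "\<one> \<oplus> \<one> = \<zero>"

locale char2_field = char2_cring + field

context cring
begin

lemma sq_eq: "a \<in> carrier R \<Longrightarrow> a [^] (2::nat) = a \<otimes> a"
  by (simp add: numeral_2_eq_2)

lemma qsum_closed [simp]:
  assumes "set as \<subseteq> carrier R" "\<And>i. i < length as \<Longrightarrow> x i \<in> carrier R"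
  shows "qsum R as x \<in> carrier R"
  unfolding qsum_def using assms by (intro finsum_closed) (auto simp: subset_iff)

lemma qsum_cong:
  assumes "set as \<subseteq> carrier R" "\<And>i. i < length as \<Longrightarrow> x i \<in> carrier R"
    "\<And>i. i < length as \<Longrightarrow> x i = y i"
  shows "qsum R as x = qsum R as y"
  unfolding qsum_def using assms by (intro finsum_cong') (auto simp: subset_iff)

lemma qsum_smult:
  assumes "set as \<subseteq> carrier R" "\<And>i. i < length as \<Longrightarrow> x i \<in> carrier R" "c \<in> carrier R"
  shows "qsum R as (\<lambda>i. c \<otimes> x i) = c [^] (2::nat) \<otimes> qsum R as x"
proof -
  have as: "as ! i \<in> carrier R" if "i < length as" for i using assms(1) that by (auto simp: subset_iff)
  have "qsum R as (\<lambda>i. c \<otimes> x i) =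
      (\<Oplus>i\<in>{..<length as}. c [^] (2::nat) \<otimes> (as ! i \<otimes> x i [^] (2::nat)))"
    unfolding qsum_def using assms(2,3) as
    by (intro finsum_cong') (auto simp: nat_pow_distrib m_ac)
  also have "\<dots> = c [^] (2::nat) \<otimes> qsum R as x"
    unfolding qsum_def using assms(2,3) as by (intro finsum_rdistr[symmetric]) auto
  finally show ?thesis .
qed

lemma qsum_single:
  assumes "set as \<subseteq> carrier R" "j < length as"
  shows "qsum R as (\<lambda>i. if i = j then \<one> else \<zero>) = as ! j"
proof -
  have as: "as ! i \<in> carrier R" if "i < length as" for i using assms(1) that by (auto simp: subset_iff)
  have "qsum R as (\<lambda>i. if i = j then \<one> else \<zero>) = (\<Oplus>i\<in>{..<length as}. if j = i then as ! i else \<zero>)"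
    unfolding qsum_def using as by (intro finsum_cong') (auto simp: sq_eq)
  also have "\<dots> = as ! j" using assms as by (intro finsum_singleton) auto
  finally show ?thesis .
qed

end

lemma (in ring_hom_cring) hom_qsum:
  assumes "set as \<subseteq> carrier R" "\<And>i. i < length as \<Longrightarrow> x i \<in> carrier R"
  shows "h (qsum R as x) = qsum S (map h as) (\<lambda>i. h (x i))"
proof -
  have as: "as ! i \<in> carrier R" if "i < length as" for i using assms(1) that by (auto simp: subset_iff)
  have "h (qsum R as x) = (\<Oplus>\<^bsub>S\<^esub>i\<in>{..<length as}. h (as ! i \<otimes> (x i [^] (2::nat))))"
    unfolding qsum_def using assms as by (subst hom_finsum) (auto simp: comp_def)
  also have "\<dots> = qsum S (map h as) (\<lambda>i. h (x i))"
    unfolding qsum_def using assms as by (intro S.finsum_cong') (auto simp: hom_nat_pow R.sq_eq S.sq_eq)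
  finally show ?thesis .
qed

context char2_cring
begin

lemma add_self [simp]: "a \<in> carrier R \<Longrightarrow> a \<oplus> a = \<zero>"
  using l_distr[of \<one> \<one> a] char2 by simp

lemma minus_eq_self: "a \<in> carrier R \<Longrightarrow> \<ominus> a = a"
  using minus_equality[of a a] by simp

lemma add_eq_zero_iff: "a \<in> carrier R \<Longrightarrow> b \<in> carrier R \<Longrightarrow> a \<oplus> b = \<zero> \<longleftrightarrow> a = b"
  by (metis add_self minus_equality minus_eq_self)

lemma sq_add:
  assumes "a \<in> carrier R" "b \<in> carrier R"
  shows "(a \<oplus> b) [^] (2::nat) = a [^] (2::nat) \<oplus> b [^] (2::nat)"
proof -
  have "(a \<oplus> b) [^] (2::nat) = a \<otimes> a \<oplus> b \<otimes> b \<oplus> (a \<otimes> b \<oplus> a \<otimes> b)"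
    using assms by (simp add: sq_eq l_distr r_distr m_comm[of b a] a_ac del: add_self)
  then show ?thesis using assms by (simp add: sq_eq)
qed

lemma frobenius_hom: "(\<lambda>a. a [^] (2::nat)) \<in> ring_hom R R"
  by (rule ring_hom_memI) (auto simp: sq_add nat_pow_distrib)

lemma frobenius_hom_cring: "ring_hom_cring R R (\<lambda>a. a [^] (2::nat))"
  by (intro ring_hom_cring.intro ring_hom_cring_axioms.intro is_cring frobenius_hom)

lemma qsum_add:
  assumes "set as \<subseteq> carrier R" "\<And>i. i < length as \<Longrightarrow> x i \<in> carrier R"
    "\<And>i. i < length as \<Longrightarrow> y i \<in> carrier R"
  shows "qsum R as (\<lambda>i. x i \<oplus> y i) = qsum R as x \<oplus> qsum R as y"
proof -
  have as: "as ! i \<in> carrier R" if "i < length as" for i using assms(1) that by (auto simp: subset_iff)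
  have "qsum R as (\<lambda>i. x i \<oplus> y i) =
      (\<Oplus>i\<in>{..<length as}. as ! i \<otimes> x i [^] (2::nat) \<oplus> as ! i \<otimes> y i [^] (2::nat))"
    unfolding qsum_def using assms as by (intro finsum_cong') (auto simp: sq_add r_distr)
  also have "\<dots> = qsum R as x \<oplus> qsum R as y"
    unfolding qsum_def using assms as by (intro finsum_addf) auto
  finally show ?thesis .
qed

text \<open>In characteristic 2 the mixed terms of a square occur twice and cancel:
  \<open>(a + b t + c t^2)^2 = a^2 + b^2 t^2\<close> modulo \<open>t^3\<close>. So a form with
  constant coefficients has no term in \<open>t\<close>, and its \<open>t^2\<close> term is the form
  at the tangent vector.\<close>

lemma qsum_trunc3:
  assumes "set as \<subseteq> carrier R" "\<And>i. i < length as \<Longrightarrow> x i \<in> carrier (trunc3_ring R)"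
  shows "qsum (trunc3_ring R) (map (\<lambda>a. (a, \<zero>, \<zero>)) as) x =
    (qsum R as (\<lambda>i. fst (x i)), \<zero>, qsum R as (\<lambda>i. fst (snd (x i))))"
proof -
  interpret T: cring "trunc3_ring R" by (rule trunc3_ring_cring)
  have as: "as ! i \<in> carrier R" if "i < length as" for i using assms(1) that by (auto simp: subset_iff)
  have sq: "p [^]\<^bsub>trunc3_ring R\<^esub> (2::nat) = (fst p [^] (2::nat), \<zero>, fst (snd p) [^] (2::nat))"
    if "p \<in> carrier (trunc3_ring R)" for p
  proof -
    obtain a b c where p: "p = (a, b, c)" by (metis prod_cases3)
    then have abc: "a \<in> carrier R" "b \<in> carrier R" "c \<in> carrier R" using that by auto
    have "a \<otimes> c \<oplus> b \<otimes> b \<oplus> c \<otimes> a = (a \<otimes> c \<oplus> a \<otimes> c) \<oplus> b \<otimes> b"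
      using abc by (simp add: m_comm[of c a] a_ac del: add_self)
    then show ?thesis using that abc by (simp add: T.sq_eq sq_eq p m_comm[of b a])
  qed
  have "qsum (trunc3_ring R) (map (\<lambda>a. (a, \<zero>, \<zero>)) as) x = (\<Oplus>\<^bsub>trunc3_ring R\<^esub>i\<in>{..<length as}.
      (as ! i \<otimes> fst (x i) [^] (2::nat), \<zero>, as ! i \<otimes> fst (snd (x i)) [^] (2::nat)))"
    unfolding qsum_def using assms as by (intro T.finsum_cong') (auto simp: sq)
  also have "\<dots> = ((\<Oplus>i\<in>A. f i), \<zero>, (\<Oplus>i\<in>A. g i))" if "A = {..<length as}"
     "f = (\<lambda>i. as ! i \<otimes> fst (x i) [^] (2::nat))" "g = (\<lambda>i. as ! i \<otimes> fst (snd (x i)) [^] (2::nat))" for A f g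
  proof -
    have "(\<Oplus>\<^bsub>trunc3_ring R\<^esub>i\<in>A. (f i, \<zero>, g i)) = ((\<Oplus>i\<in>A. f i), \<zero>, (\<Oplus>i\<in>A. g i))"
      if "finite A" "f \<in> A \<rightarrow> carrier R" "g \<in> A \<rightarrow> carrier R" for A and f g :: "nat \<Rightarrow> 'a"
      using that
    proof (induction A rule: finite_induct)
      case (insert j A)
      then have "(\<Oplus>\<^bsub>trunc3_ring R\<^esub>i\<in>insert j A. (f i, \<zero>, g i)) =
          (f j, \<zero>, g j) \<oplus>\<^bsub>trunc3_ring R\<^esub> (\<Oplus>\<^bsub>trunc3_ring R\<^esub>i\<in>A. (f i, \<zero>, g i))"
        by (intro T.finsum_insert) auto
      then show ?case using insert by auto
    qed simp
    moreover have "f \<in> A \<rightarrow> carrier R" "g \<in> A \<rightarrow> carrier R" using that as assms(2) by auto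
    ultimately show ?thesis using that by simp
  qed
  finally show ?thesis by (simp add: qsum_def)
qed

end

lemma (in char2_cring) char2_cring_image:
  assumes "cring S" "h \<in> ring_hom R S"
  shows "char2_cring S"
proof -
  interpret S: cring S by (rule assms)
  have "\<one>\<^bsub>S\<^esub> \<oplus>\<^bsub>S\<^esub> \<one>\<^bsub>S\<^esub> = h (\<one> \<oplus> \<one>)"
    using ring_hom_add[OF assms(2) one_closed one_closed] ring_hom_one[OF assms(2)] by (simp only:)
  also have "\<dots> = \<zero>\<^bsub>S\<^esub>"
    using ring_hom_cring.hom_zero[OF ring_hom_cring.intro[OF is_cring assms(1) ring_hom_cring_axioms.intro[OF assms(2)]]]
    by (simp add: char2)
  finally show ?thesis using assms(1) by (intro char2_cring.intro char2_cring_axioms.intro)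
qed

section \<open>The coordinate ring of a quasilinear quadric\<close>

lemma (in ideal) quotient_hom_ext:
  assumes "ring T" "E \<in> ring_hom R T" "\<And>x. x \<in> I \<Longrightarrow> E x = \<zero>\<^bsub>T\<^esub>"
  obtains \<chi> where "\<chi> \<in> ring_hom (R Quot I) T" "\<And>p. p \<in> carrier R \<Longrightarrow> \<chi> (I +> p) = E p"
proof -
  interpret T: ring T by (rule assms)
  interpret Q: ring "R Quot I" by (rule quotient_is_ring)
  have I: "x \<in> I \<Longrightarrow> x \<in> carrier R" for x by (rule Icarr)
  have eq: "E x = E p" if p: "p \<in> carrier R" and x: "x \<in> I +> p" for p x
  proof -
    obtain i where i: "i \<in> I" "x = i \<oplus> p" using x by (auto simp: a_r_coset_def')
    then show ?thesis using p I assms ring_hom_add[OF assms(2), of i p] ring_hom_closed[OF assms(2)] by simp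
  qed
  have self: "p \<in> I +> p" if "p \<in> carrier R" for p using that a_rcos_self by blast
  define \<chi> where "\<chi> C = E (SOME p. p \<in> C)" for C
  have \<chi>: "\<chi> (I +> p) = E p" if "p \<in> carrier R" for p
    unfolding \<chi>_def using eq[OF that] self[OF that] by (metis someI_ex)
  have repr: "\<exists>p\<in>carrier R. C = I +> p" if "C \<in> carrier (R Quot I)" for C
    using that by (auto simp: FactRing_def A_RCOSETS_def')
  have "\<chi> \<in> ring_hom (R Quot I) T"
  proof (rule ring_hom_memI)
    fix C assume "C \<in> carrier (R Quot I)"
    then obtain p where p: "p \<in> carrier R" "C = I +> p" using repr by blast
    then show "\<chi> C \<in> carrier T" using \<chi> ring_hom_closed[OF assms(2)] by simp
    fix D assume "D \<in> carrier (R Quot I)"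
    then obtain r where r: "r \<in> carrier R" "D = I +> r" using repr by blast
    have "C \<otimes>\<^bsub>R Quot I\<^esub> D = I +> (p \<otimes> r)" using p r rcoset_mult_add by (simp add: FactRing_def)
    then show "\<chi> (C \<otimes>\<^bsub>R Quot I\<^esub> D) = \<chi> C \<otimes>\<^bsub>T\<^esub> \<chi> D"
      using p r \<chi> ring_hom_mult[OF assms(2)] by simp
    have "C \<oplus>\<^bsub>R Quot I\<^esub> D = I +> (p \<oplus> r)" using p r a_rcos_sum by (simp add: FactRing_def)
    then show "\<chi> (C \<oplus>\<^bsub>R Quot I\<^esub> D) = \<chi> C \<oplus>\<^bsub>T\<^esub> \<chi> D"
      using p r \<chi> ring_hom_add[OF assms(2)] by simp
  next
    show "\<chi> \<one>\<^bsub>R Quot I\<^esub> = \<one>\<^bsub>T\<^esub>" using \<chi>[of \<one>] ring_hom_one[OF assms(2)] by (simp add: FactRing_def)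
  qed
  then show ?thesis using that \<chi> by blast
qed

context cring
begin

lemma mpoly_ring_mono:
  assumes "J \<subseteq> I"
  shows "indexed_pset J (carrier R) \<subseteq> indexed_pset I (carrier R)"
proof
  fix P assume "P \<in> indexed_pset J (carrier R)"
  then show "P \<in> indexed_pset I (carrier R)"
    by induction (use assms in \<open>auto intro: indexed_pset.intros\<close>)
qed

lemma mpoly_hom_mono:
  assumes "E \<in> ring_hom (mpoly_ring R I) S" "J \<subseteq> I"
  shows "E \<in> ring_hom (mpoly_ring R J) S"
proof -
  have sub: "p \<in> carrier (mpoly_ring R I)" if "p \<in> carrier (mpoly_ring R J)" for p
    using that mpoly_ring_mono[OF assms(2)] by auto
  show ?thesis
    by (rule ring_hom_memI)
       (use sub ring_hom_closed[OF assms(1)] ring_hom_mult[OF assms(1)] ring_hom_add[OF assms(1)]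
          ring_hom_one[OF assms(1)] in auto)
qed

end

text \<open>On the smaller polynomial ring both evaluations are homomorphisms with the same values
  at the generators.\<close>

lemma (in ring_hom_cring) mpoly_eval_restrict:
  assumes "finite I" "J \<subseteq> I" "x \<in> I \<rightarrow> carrier S" "P \<in> carrier (mpoly_ring R J)"
  shows "mpoly_eval I x P = mpoly_eval J x P"
proof (rule R.mpoly_hom_eqI[OF R.mpoly_hom_mono[OF mpoly_eval_hom assms(2)] mpoly_eval_hom])
  show "finite J" using assms finite_subset by blast
  then show "mpoly_eval I x (R.indexed_const c) = mpoly_eval J x (R.indexed_const c)" if "c \<in> carrier R" for c
    using assms that by (subst (1 2) mpoly_eval_const) auto
  show "mpoly_eval I x (R.indexed_var i) = mpoly_eval J x (R.indexed_var i)" if "i \<in> J" for i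
    using assms that \<open>finite J\<close> by (subst (1 2) mpoly_eval_var) auto
qed (use assms in auto)

lemma ring_hom_cring_of:
  "cring R \<Longrightarrow> cring S \<Longrightarrow> h \<in> ring_hom R S \<Longrightarrow> ring_hom_cring R S h"
  by (intro ring_hom_cring.intro ring_hom_cring_axioms.intro)

text \<open>The diagonal coefficients of an anisotropic form of dimension at least 2;
  \<open>as_indep\<close> is anisotropy in coordinates.\<close>

locale quasilinear_coeffs = char2_field F for F (structure) +
  fixes as :: "'a list"
  assumes as_closed: "set as \<subseteq> carrier F"
    and as_length: "length as \<ge> 2"
    and as_indep: "\<lbrakk>\<And>i. i < length as \<Longrightarrow> x i \<in> carrier F; qsum F as x = \<zero>\<rbrakk> \<Longrightarrow> i < length as \<Longrightarrow> x i = \<zero>"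
begin

abbreviation "n \<equiv> length as"
abbreviation "P m \<equiv> mpoly_ring F {..<n + m}"
abbreviation "q m \<equiv> quadric_poly F as m"
abbreviation "A m \<equiv> P m Quot PIdl\<^bsub>P m\<^esub> q m"
abbreviation "cls m p \<equiv> PIdl\<^bsub>P m\<^esub> (q m) +>\<^bsub>P m\<^esub> p"

lemma as_nth [simp]: "i < n \<Longrightarrow> as ! i \<in> carrier F"
  using as_closed by (auto simp: subset_iff)

lemma P_cring: "cring (P m)" by (rule mpoly_cring)

lemma q_term_closed:
  assumes "i < n"
  shows "indexed_const (as ! i) \<otimes>\<^bsub>P m\<^esub> (indexed_var i [^]\<^bsub>P m\<^esub> (2::nat)) \<in> carrier (P m)"
proof -
  interpret P: cring "P m" by (rule P_cring)
  have "indexed_const (as ! i) \<in> carrier (P m)" "indexed_var i \<in> carrier (P m)"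
    using assms by auto
  then show ?thesis by (intro P.m_closed P.nat_pow_closed)
qed

lemma q_eq: "q m = qsum (P m) (map indexed_const as) indexed_var"
proof -
  interpret P: cring "P m" by (rule P_cring)
  show ?thesis unfolding quadric_poly_def Let_def qsum_def
    using q_term_closed by (intro P.finsum_cong') (auto simp del: mpoly_ring_simps)
qed

lemma q_closed: "q m \<in> carrier (P m)"
proof -
  interpret P: cring "P m" by (rule P_cring)
  show ?thesis unfolding q_eq by (rule P.qsum_closed) (use as_closed in auto)
qed

lemma mpoly_eval_q:
  assumes "cring T" "\<iota> \<in> ring_hom F T" "x \<in> {..<n + m} \<rightarrow> carrier T"
  shows "ring_hom_cring.mpoly_eval F T \<iota> {..<n + m} x (q m) = qsum T (map \<iota> as) x"
proof -
  interpret h: ring_hom_cring F T \<iota> using assms is_cring by (intro ring_hom_cring_of)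
  interpret P: cring "P m" by (rule P_cring)
  let ?E = "h.mpoly_eval {..<n + m} x"
  interpret E: ring_hom_cring "P m" T ?E
    using assms P_cring h.mpoly_eval_hom by (intro ring_hom_cring_of) auto
  have "?E (q m) = qsum T (map ?E (map indexed_const as)) (\<lambda>i. ?E (indexed_var i))"
    unfolding q_eq by (rule E.hom_qsum) (use as_closed in auto)
  also have "map ?E (map indexed_const as) = map \<iota> as"
    using assms as_closed by (auto simp: h.mpoly_eval_const subset_iff)
  also have "qsum T (map \<iota> as) (\<lambda>i. ?E (indexed_var i)) = qsum T (map \<iota> as) x"
    using assms as_closed
    by (intro h.S.qsum_cong) (auto simp: h.mpoly_eval_var subset_iff ring_hom_closed)
  finally show ?thesis .
qed

lemma as_nonzero:
  assumes "i < n"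
  shows "as ! i \<noteq> \<zero>"
proof
  assume "as ! i = \<zero>"
  then have "(if i = i then \<one> else \<zero>) = \<zero>"
    using qsum_single[OF as_closed assms] assms
    by (intro as_indep[of "\<lambda>j. if j = i then \<one> else \<zero>" i]) auto
  then show False by simp
qed

text \<open>Over a finite field of characteristic 2 squaring is bijective, so every element is a
  square and a form of dimension at least 2 is isotropic. Infinity of \<open>F\<close> is what
  allows polynomials to be separated by points.\<close>

lemma infinite_carrier: "infinite (carrier F)"
proof
  assume fin: "finite (carrier F)"
  let ?\<sigma> = "\<lambda>a. a [^] (2::nat)"
  have inj: "inj_on ?\<sigma> (carrier F)"
  proof (rule inj_onI)
    fix a b assume ab: "a \<in> carrier F" "b \<in> carrier F" "?\<sigma> a = ?\<sigma> b"
    then have "(a \<oplus> b) [^] (2::nat) = \<zero>" by (simp add: sq_add)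
    then have "a \<oplus> b = \<zero>" using ab by (simp add: sq_eq integral_iff)
    then show "a = b" using ab add_eq_zero_iff by blast
  qed
  then have surj: "?\<sigma> ` carrier F = carrier F"
    using fin by (intro endo_inj_surj) auto
  have n: "0 < n" "1 < n" using as_length by linarith+
  then have nz: "as ! 0 \<noteq> \<zero>" using as_nonzero by blast
  have "inv (as ! 0) \<otimes> as ! 1 \<in> carrier F" using n nz field_Units by simp
  then have "inv (as ! 0) \<otimes> as ! 1 \<in> ?\<sigma> ` carrier F" using surj by blast
  then obtain c where c': "inv (as ! 0) \<otimes> as ! 1 = c [^] (2::nat)" "c \<in> carrier F" by (rule imageE)
  note c = c'(2) c'(1)[symmetric]
  \<comment> \<open>As \<open>a_1 = a_0 c^2\<close>, this is a nontrivial zero of the form.\<close>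
  define x where "x i = (if i = 0 then c else if i = 1 then \<one> else \<zero>)" for i :: nat
  have "qsum F as x = (\<Oplus>i\<in>{0,1}. as ! i \<otimes> (x i [^] (2::nat)))"
    unfolding qsum_def using n c
    by (intro add.finprod_mono_neutral_cong_right) (auto simp: x_def sq_eq)
  also have "\<dots> = as ! 0 \<otimes> (inv (as ! 0) \<otimes> as ! 1) \<oplus> as ! 1"
  proof -
    have "(\<Oplus>i\<in>{0,1}. as ! i \<otimes> (x i [^] (2::nat))) =
        as ! 0 \<otimes> (x 0 [^] (2::nat)) \<oplus> (\<Oplus>i\<in>{1}. as ! i \<otimes> (x i [^] (2::nat)))"
      using n c(1) by (intro finsum_insert) (auto simp: x_def)
    also have "(\<Oplus>i\<in>{1}. as ! i \<otimes> (x i [^] (2::nat))) = as ! 1"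
      using n by (subst finsum_insert) (auto simp: x_def)
    finally show ?thesis using c by (simp add: x_def)
  qed
  also have "\<dots> = (as ! 0 \<otimes> inv (as ! 0)) \<otimes> as ! 1 \<oplus> as ! 1"
    using n nz field_Units by (simp add: m_assoc del: Units_r_inv Units_l_inv)
  also have "\<dots> = \<zero>" using n nz field_Units by simp
  finally have "x 1 = \<zero>" using n c by (intro as_indep[of x 1]) (auto simp: x_def)
  then show False by (simp add: x_def)
qed

text \<open>In the variable \<open>X_0\<close> the polynomial \<open>q\<close> is quadratic, with
  the unit \<open>a_0\<close> as leading coefficient and no linear term. Division by it leaves a
  remainder \<open>f0 + X_0 f1\<close> with \<open>f0\<close> and \<open>f1\<close> free of
  \<open>X_0\<close>.\<close>

lemma division_by_q:
  assumes "f \<in> carrier (P m)"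
  obtains f0 f1 g where "f0 \<in> carrier (mpoly_ring F {1..<n + m})" "f1 \<in> carrier (mpoly_ring F {1..<n + m})"
    "g \<in> carrier (P m)"
    "f = f0 \<oplus>\<^bsub>P m\<^esub> indexed_var 0 \<otimes>\<^bsub>P m\<^esub> f1 \<oplus>\<^bsub>P m\<^esub> g \<otimes>\<^bsub>P m\<^esub> q m"
proof -
  let ?Q = "mpoly_ring F {1..<n + m}"
  interpret P: cring "P m" by (rule P_cring)
  interpret Q: cring "?Q" by (rule mpoly_cring)
  have n: "0 < n" using as_length by linarith
  have sub: "carrier ?Q \<subseteq> carrier (P m)"
    unfolding mpoly_ring_simps(1) by (rule mpoly_ring_mono) auto
  have ops: "p \<oplus>\<^bsub>P m\<^esub> r = p \<oplus>\<^bsub>?Q\<^esub> r" "p \<otimes>\<^bsub>P m\<^esub> r = p \<otimes>\<^bsub>?Q\<^esub> r" "\<zero>\<^bsub>P m\<^esub> = \<zero>\<^bsub>?Q\<^esub>" for p r by simp_all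
  have X0: "indexed_var 0 \<in> carrier (P m)" using n by simp
  have a0: "inv (as ! 0) \<in> carrier F" "inv (as ! 0) \<otimes> as ! 0 = \<one>" using n as_nonzero field_Units by auto
  let ?c = "indexed_const (inv (as ! 0))"
  have c: "?c \<in> carrier ?Q" "?c \<in> carrier (P m)" using a0 by auto
  \<comment> \<open>\<open>X\<^sub>0\<^sup>2 = a\<^sub>0\<^sup>-\<^sup>1 q + \<rho>\<close> with \<open>\<rho>\<close> free of \<open>X\<^sub>0\<close>\<close>
  have "\<exists>\<rho>. \<rho> \<in> carrier ?Q \<and> indexed_var 0 \<otimes>\<^bsub>P m\<^esub> indexed_var 0 = ?c \<otimes>\<^bsub>P m\<^esub> q m \<oplus>\<^bsub>P m\<^esub> \<rho>"
  proof -
    let ?t = "\<lambda>i. indexed_const (as ! i) \<otimes>\<^bsub>P m\<^esub> (indexed_var i [^]\<^bsub>P m\<^esub> (2::nat))"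
    let ?t' = "\<lambda>i. indexed_const (as ! i) \<otimes>\<^bsub>?Q\<^esub> (indexed_var i \<otimes>\<^bsub>?Q\<^esub> indexed_var i)"
    let ?\<tau> = "\<Oplus>\<^bsub>?Q\<^esub>i\<in>{1..<n}. ?t' i"
    have t: "?t i \<in> carrier (P m)" if "i < n" for i
      using that by (rule q_term_closed)
    have t': "?t' i \<in> carrier ?Q" if "i \<in> {1..<n}" for i
      using that by (intro Q.m_closed) auto
    have tt': "?t i = ?t' i" if "i \<in> {1..<n}" for i
      using that P.sq_eq[of "indexed_var i"] by (simp add: ops)
    have \<tau>: "?\<tau> \<in> carrier ?Q" using t' by (intro Q.finsum_closed) auto
    have fs: "(\<Oplus>\<^bsub>P m\<^esub>i\<in>B. ?t i) = (\<Oplus>\<^bsub>?Q\<^esub>i\<in>B. ?t' i)" if "finite B" "B \<subseteq> {1..<n}" for B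
      using that
    proof (induction B rule: finite_induct)
      case (insert j B)
      then have "(\<Oplus>\<^bsub>P m\<^esub>i\<in>insert j B. ?t i) = ?t j \<oplus>\<^bsub>P m\<^esub> (\<Oplus>\<^bsub>P m\<^esub>i\<in>B. ?t i)"
        using t by (intro P.finsum_insert) auto
      also have "\<dots> = ?t' j \<oplus>\<^bsub>?Q\<^esub> (\<Oplus>\<^bsub>?Q\<^esub>i\<in>B. ?t' i)" using insert tt' by (simp add: ops)
      also have "\<dots> = (\<Oplus>\<^bsub>?Q\<^esub>i\<in>insert j B. ?t' i)"
        using insert t' by (intro Q.finsum_insert[symmetric]) auto
      finally show ?case .
    next
      case empty
      show ?case using ops(3) by (simp only: P.finsum_empty Q.finsum_empty)
    qed
    have "{..<n} = insert 0 {1..<n}" using n by auto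
    then have "q m = (\<Oplus>\<^bsub>P m\<^esub>i\<in>insert 0 {1..<n}. ?t i)" by (simp add: quadric_poly_def Let_def)
    also have "\<dots> = ?t 0 \<oplus>\<^bsub>P m\<^esub> (\<Oplus>\<^bsub>P m\<^esub>i\<in>{1..<n}. ?t i)"
      using t n by (intro P.finsum_insert) auto
    also have "(\<Oplus>\<^bsub>P m\<^esub>i\<in>{1..<n}. ?t i) = ?\<tau>" by (rule fs) auto
    finally have q: "q m = ?t 0 \<oplus>\<^bsub>P m\<^esub> ?\<tau>" .
    have \<tau>P: "?\<tau> \<in> carrier (P m)" using \<tau> sub by blast
    have c1: "?c \<otimes>\<^bsub>P m\<^esub> indexed_const (as ! 0) = \<one>\<^bsub>P m\<^esub>"
      using ring_hom_mult[OF const_hom, of "inv (as ! 0)" "as ! 0" "{..<n + m}"] a0 n by simp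
    have k0: "indexed_const (as ! 0) \<in> carrier (P m)" using n by simp
    have "?c \<otimes>\<^bsub>P m\<^esub> ?t 0 = (?c \<otimes>\<^bsub>P m\<^esub> indexed_const (as ! 0)) \<otimes>\<^bsub>P m\<^esub> (indexed_var 0 \<otimes>\<^bsub>P m\<^esub> indexed_var 0)"
      using c(2) k0 X0 P.sq_eq[OF X0] P.m_assoc[of ?c] P.m_closed[OF X0 X0] by (simp del: mpoly_ring_simps)
    also have "\<dots> = indexed_var 0 \<otimes>\<^bsub>P m\<^esub> indexed_var 0" unfolding c1 using X0 by (simp del: mpoly_ring_simps)
    finally have 1: "?c \<otimes>\<^bsub>P m\<^esub> q m = indexed_var 0 \<otimes>\<^bsub>P m\<^esub> indexed_var 0 \<oplus>\<^bsub>P m\<^esub> ?c \<otimes>\<^bsub>P m\<^esub> ?\<tau>"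
      unfolding q using c \<tau>P t n by (simp del: mpoly_ring_simps add: P.r_distr)
    have cc: "char2_cring (P m)" by (rule char2_cring_image[OF P_cring const_hom])
    have 2: "?c \<otimes>\<^bsub>P m\<^esub> ?\<tau> \<in> carrier (P m)" using c \<tau>P by (intro P.m_closed)
    have 3: "(a \<oplus>\<^bsub>P m\<^esub> b) \<oplus>\<^bsub>P m\<^esub> b = a" if "a \<in> carrier (P m)" "b \<in> carrier (P m)" for a b
      using that char2_cring.add_self[OF cc, of b] P.a_assoc[of a b b] by (simp del: mpoly_ring_simps)
    have "indexed_var 0 \<otimes>\<^bsub>P m\<^esub> indexed_var 0 = ?c \<otimes>\<^bsub>P m\<^esub> q m \<oplus>\<^bsub>P m\<^esub> ?c \<otimes>\<^bsub>P m\<^esub> ?\<tau>"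
      unfolding 1 using 2 X0 3[of "indexed_var 0 \<otimes>\<^bsub>P m\<^esub> indexed_var 0"] P.m_closed[OF X0 X0] by (simp only:)
    moreover have "?c \<otimes>\<^bsub>P m\<^esub> ?\<tau> \<in> carrier ?Q" unfolding ops using c \<tau> by (intro Q.m_closed)
    ultimately show ?thesis by blast
  qed
  then obtain \<rho> where \<rho>: "\<rho> \<in> carrier ?Q"
    and X0X0: "indexed_var 0 \<otimes>\<^bsub>P m\<^esub> indexed_var 0 = ?c \<otimes>\<^bsub>P m\<^esub> q m \<oplus>\<^bsub>P m\<^esub> \<rho>" by blast
  have "\<exists>f0 f1 g. f0 \<in> carrier ?Q \<and> f1 \<in> carrier ?Q \<and> g \<in> carrier (P m) \<and>
    f = f0 \<oplus>\<^bsub>P m\<^esub> indexed_var 0 \<otimes>\<^bsub>P m\<^esub> f1 \<oplus>\<^bsub>P m\<^esub> g \<otimes>\<^bsub>P m\<^esub> q m"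
    using assms
  proof (induction rule: mpoly_induct)
    case (const c)
    then have c: "indexed_const c \<in> carrier ?Q" "indexed_const c \<in> carrier (P m)" by auto
    then have "indexed_const c = indexed_const c \<oplus>\<^bsub>P m\<^esub> indexed_var 0 \<otimes>\<^bsub>P m\<^esub> \<zero>\<^bsub>P m\<^esub> \<oplus>\<^bsub>P m\<^esub> \<zero>\<^bsub>P m\<^esub> \<otimes>\<^bsub>P m\<^esub> q m"
      using X0 q_closed by (simp del: mpoly_ring_simps)
    then show ?case using c Q.zero_closed unfolding ops(3) by (metis P.zero_closed ops(3))
  next
    case (add f f')
    then obtain f0 f1 g f0' f1' g' where f: "f0 \<in> carrier ?Q" "f1 \<in> carrier ?Q" "g \<in> carrier (P m)"
        "f = f0 \<oplus>\<^bsub>P m\<^esub> indexed_var 0 \<otimes>\<^bsub>P m\<^esub> f1 \<oplus>\<^bsub>P m\<^esub> g \<otimes>\<^bsub>P m\<^esub> q m"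
      and f': "f0' \<in> carrier ?Q" "f1' \<in> carrier ?Q" "g' \<in> carrier (P m)"
        "f' = f0' \<oplus>\<^bsub>P m\<^esub> indexed_var 0 \<otimes>\<^bsub>P m\<^esub> f1' \<oplus>\<^bsub>P m\<^esub> g' \<otimes>\<^bsub>P m\<^esub> q m" by blast
    note mem = subsetD[OF sub f(1)] subsetD[OF sub f(2)] subsetD[OF sub f'(1)] subsetD[OF sub f'(2)]
      f(3) f'(3) X0 q_closed[of m]
    have "f \<oplus>\<^bsub>P m\<^esub> f' = (f0 \<oplus>\<^bsub>P m\<^esub> f0') \<oplus>\<^bsub>P m\<^esub> indexed_var 0 \<otimes>\<^bsub>P m\<^esub> (f1 \<oplus>\<^bsub>P m\<^esub> f1') \<oplus>\<^bsub>P m\<^esub>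
        (g \<oplus>\<^bsub>P m\<^esub> g') \<otimes>\<^bsub>P m\<^esub> q m"
      unfolding f(4) f'(4) using mem by (simp del: mpoly_ring_simps add: P.l_distr P.r_distr P.a_ac)
    moreover have "f0 \<oplus>\<^bsub>P m\<^esub> f0' \<in> carrier ?Q" "f1 \<oplus>\<^bsub>P m\<^esub> f1' \<in> carrier ?Q"
      unfolding ops by (rule Q.a_closed[OF f(1) f'(1)], rule Q.a_closed[OF f(2) f'(2)])
    ultimately show ?case using mem P.a_closed by metis
  next
    case (mult f i)
    then obtain f0 f1 g where f: "f0 \<in> carrier ?Q" "f1 \<in> carrier ?Q" "g \<in> carrier (P m)"
        "f = f0 \<oplus>\<^bsub>P m\<^esub> indexed_var 0 \<otimes>\<^bsub>P m\<^esub> f1 \<oplus>\<^bsub>P m\<^esub> g \<otimes>\<^bsub>P m\<^esub> q m" by blast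
    note mem = subsetD[OF sub f(1)] subsetD[OF sub f(2)] f(3) X0 q_closed[of m] subsetD[OF sub \<rho>] c(2)
    show ?case
    proof (cases "i = 0")
      case True
      have "indexed_var 0 \<otimes>\<^bsub>P m\<^esub> f = indexed_var 0 \<otimes>\<^bsub>P m\<^esub> f0 \<oplus>\<^bsub>P m\<^esub>
          (indexed_var 0 \<otimes>\<^bsub>P m\<^esub> indexed_var 0) \<otimes>\<^bsub>P m\<^esub> f1 \<oplus>\<^bsub>P m\<^esub> indexed_var 0 \<otimes>\<^bsub>P m\<^esub> g \<otimes>\<^bsub>P m\<^esub> q m"
        unfolding f(4) using mem by (simp del: mpoly_ring_simps add: P.l_distr P.r_distr P.m_assoc)
      also have "\<dots> = \<rho> \<otimes>\<^bsub>P m\<^esub> f1 \<oplus>\<^bsub>P m\<^esub> indexed_var 0 \<otimes>\<^bsub>P m\<^esub> f0 \<oplus>\<^bsub>P m\<^esub>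
          (?c \<otimes>\<^bsub>P m\<^esub> f1 \<oplus>\<^bsub>P m\<^esub> indexed_var 0 \<otimes>\<^bsub>P m\<^esub> g) \<otimes>\<^bsub>P m\<^esub> q m"
        unfolding X0X0 using mem by (simp del: mpoly_ring_simps add: P.l_distr P.r_distr P.m_ac P.a_ac)
      finally have "indexed_var i \<otimes>\<^bsub>P m\<^esub> f = \<dots>" using True by simp
      moreover have "\<rho> \<otimes>\<^bsub>P m\<^esub> f1 \<in> carrier ?Q" unfolding ops using f \<rho> by (intro Q.m_closed)
      moreover have "?c \<otimes>\<^bsub>P m\<^esub> f1 \<oplus>\<^bsub>P m\<^esub> indexed_var 0 \<otimes>\<^bsub>P m\<^esub> g \<in> carrier (P m)"
        using mem by (intro P.a_closed P.m_closed)
      ultimately show ?thesis using f(1) by blast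
    next
      case False
      then have i: "indexed_var i \<in> carrier ?Q" "indexed_var i \<in> carrier (P m)" using mult by auto
      have "indexed_var i \<otimes>\<^bsub>P m\<^esub> f = indexed_var i \<otimes>\<^bsub>P m\<^esub> f0 \<oplus>\<^bsub>P m\<^esub>
          indexed_var 0 \<otimes>\<^bsub>P m\<^esub> (indexed_var i \<otimes>\<^bsub>P m\<^esub> f1) \<oplus>\<^bsub>P m\<^esub> (indexed_var i \<otimes>\<^bsub>P m\<^esub> g) \<otimes>\<^bsub>P m\<^esub> q m"
        unfolding f(4) using mem i(2) by (simp del: mpoly_ring_simps add: P.l_distr P.r_distr P.m_ac P.a_ac)
      moreover have "indexed_var i \<otimes>\<^bsub>P m\<^esub> f0 \<in> carrier ?Q" "indexed_var i \<otimes>\<^bsub>P m\<^esub> f1 \<in> carrier ?Q"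
        unfolding ops by (rule Q.m_closed[OF i(1) f(1)], rule Q.m_closed[OF i(1) f(2)])
      moreover have "indexed_var i \<otimes>\<^bsub>P m\<^esub> g \<in> carrier (P m)" using mem i(2) by (intro P.m_closed)
      ultimately show ?thesis by blast
    qed
  qed
  then show ?thesis using that by blast
qed

end

context quasilinear_coeffs
begin

text \<open>The zero of the form over \<open>F\<^bsup>1/2\<^esup>\<close> with given coordinates \<open>z\<^sub>1, z\<^sub>2, \<dots>\<close>. The field \<open>F\<^bsup>1/2\<^esup>\<close> is
  modelled by \<open>F\<close> itself, with the Frobenius endomorphism as structure map \<open>F \<rightarrow> F\<^bsup>1/2\<^esup>\<close>.\<close>

definition tail_sum :: "(nat \<Rightarrow> 'a) \<Rightarrow> 'a"
  where "tail_sum z = (\<Oplus>j\<in>{1..<n}. as ! j \<otimes> z j [^] (2::nat))"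

definition special_pt :: "(nat \<Rightarrow> 'a) \<Rightarrow> nat \<Rightarrow> 'a"
  where "special_pt z i = (if i = 0 then inv (as ! 0) \<otimes> tail_sum z else z i [^] (2::nat))"

abbreviation "frob \<equiv> (\<lambda>a. a [^] (2::nat))"
abbreviation "frob_eval m z \<equiv> ring_hom_cring.mpoly_eval F F frob {..<n + m} (special_pt z)"

lemma n_pos: "0 < n" "Suc 0 < n"
  using as_length by linarith+

lemma a0_inv: "inv (as ! 0) \<in> carrier F" "as ! 0 \<otimes> inv (as ! 0) = \<one>"
  using as_nonzero[of 0] n_pos field_Units by auto

lemma qsum_split:
  assumes "\<And>i. i < n \<Longrightarrow> x i \<in> carrier F"
  shows "qsum F as x = as ! 0 \<otimes> x 0 [^] (2::nat) \<oplus> tail_sum x"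
proof -
  have "{..<n} = insert 0 {1..<n}" using n_pos by auto
  then have "qsum F as x = (\<Oplus>i\<in>insert 0 {1..<n}. as ! i \<otimes> x i [^] (2::nat))"
    by (simp only: qsum_def)
  also have "\<dots> = as ! 0 \<otimes> x 0 [^] (2::nat) \<oplus> tail_sum x"
    unfolding tail_sum_def using assms n_pos by (intro finsum_insert) auto
  finally show ?thesis .
qed

lemma pt_coord: "z \<in> {1..<n + m} \<rightarrow> carrier F \<Longrightarrow> 0 < i \<Longrightarrow> i < n + m \<Longrightarrow> z i \<in> carrier F"
  by (auto simp: Pi_iff)

lemma tail_sum_closed: "z \<in> {1..<n + m} \<rightarrow> carrier F \<Longrightarrow> tail_sum z \<in> carrier F"
  unfolding tail_sum_def using pt_coord[of z m] by (intro finsum_closed) auto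

lemma special_pt_closed:
  assumes "z \<in> {1..<n + m} \<rightarrow> carrier F"
  shows "special_pt z \<in> {..<n + m} \<rightarrow> carrier F"
  using pt_coord[OF assms] tail_sum_closed[OF assms] a0_inv by (auto simp: special_pt_def)

text \<open>A value \<open>x\<close> stands for its square root, so \<open>z_i\<close> is recorded
  as \<open>z_i^2\<close>. With the coefficients \<open>a_i^2\<close> the equation is the square of
  the linear form with coefficients \<open>a_i\<close>, and coordinate 0 is chosen to make this
  linear form vanish.\<close>

lemma special_pt_zero:
  assumes z: "z \<in> {1..<n + m} \<rightarrow> carrier F"
  shows "qsum F (map frob as) (special_pt z) = \<zero>"
proof -
  interpret fr: ring_hom_cring F F frob by (rule frobenius_hom_cring)
  note c = special_pt_closed[OF z]
  have ci: "special_pt z i \<in> carrier F" if "i < n" for i using c that by auto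
  have "qsum F (map frob as) (special_pt z) = (\<Oplus>i\<in>{..<n}. frob (as ! i \<otimes> special_pt z i))"
    unfolding qsum_def using ci by (intro finsum_cong') (auto simp: nat_pow_distrib)
  also have "\<dots> = frob (\<Oplus>i\<in>{..<n}. as ! i \<otimes> special_pt z i)"
    using ci by (subst fr.hom_finsum) (auto simp: comp_def)
  also have "(\<Oplus>i\<in>{..<n}. as ! i \<otimes> special_pt z i) =
      as ! 0 \<otimes> special_pt z 0 \<oplus> (\<Oplus>i\<in>{1..<n}. as ! i \<otimes> special_pt z i)"
  proof -
    have "{..<n} = insert 0 {1..<n}" using n_pos by auto
    then have "(\<Oplus>i\<in>{..<n}. as ! i \<otimes> special_pt z i) = (\<Oplus>i\<in>insert 0 {1..<n}. as ! i \<otimes> special_pt z i)"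
      by (simp only:)
    also have "\<dots> = as ! 0 \<otimes> special_pt z 0 \<oplus> (\<Oplus>i\<in>{1..<n}. as ! i \<otimes> special_pt z i)"
      using ci n_pos by (intro finsum_insert) auto
    finally show ?thesis .
  qed
  also have "(\<Oplus>i\<in>{1..<n}. as ! i \<otimes> special_pt z i) = tail_sum z"
    unfolding tail_sum_def using pt_coord[OF z] by (intro finsum_cong') (auto simp: special_pt_def)
  also have "as ! 0 \<otimes> special_pt z 0 = tail_sum z"
    using a0_inv tail_sum_closed[OF z] n_pos m_assoc[of "as ! 0" "inv (as ! 0)" "tail_sum z"]
    by (simp add: special_pt_def)
  finally show ?thesis using tail_sum_closed[OF z] by (simp add: sq_eq)
qed

lemma frob_eval_hom:
  assumes "z \<in> {1..<n + m} \<rightarrow> carrier F"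
  shows "frob_eval m z \<in> ring_hom (P m) F"
  using ring_hom_cring.mpoly_eval_hom[OF frobenius_hom_cring _ special_pt_closed[OF assms]] by simp

lemma frob_eval_ideal:
  assumes z: "z \<in> {1..<n + m} \<rightarrow> carrier F" and f: "f \<in> PIdl\<^bsub>P m\<^esub> (q m)"
  shows "frob_eval m z f = \<zero>"
proof -
  note E = frob_eval_hom[OF z]
  obtain g where g: "g \<in> carrier (P m)" "f = g \<otimes>\<^bsub>P m\<^esub> q m" using f by (auto simp: cgenideal_def)
  have "frob_eval m z (q m) = \<zero>"
    using mpoly_eval_q[OF is_cring frobenius_hom special_pt_closed[OF z]] special_pt_zero[OF z] by simp
  then show ?thesis
    unfolding g(2) ring_hom_mult[OF E g(1) q_closed] using ring_hom_closed[OF E g(1)] by simp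
qed

text \<open>Special points are dense in the quadric. Reduce \<open>f\<close> to
  \<open>f0 + X_0 f1\<close>. Its value at a special point, times \<open>a_0\<close>, is the value
  of the form itself at \<open>(f0(z), z_1 f1(z), z_2 f1(z), ...)\<close>. By anisotropy this is
  zero only if \<open>f0(z)\<close> and all \<open>z_j f1(z)\<close> are. A point \<open>z\<close>
  off the zeros of those \<open>f0\<close>, \<open>f1\<close> that are not zero polynomials excludes
  this unless \<open>f\<close> is a multiple of \<open>q\<close>.\<close>

lemma exists_special_pt:
  assumes "finite \<F>" "\<And>f. f \<in> \<F> \<Longrightarrow> f \<in> carrier (P m) \<and> f \<notin> PIdl\<^bsub>P m\<^esub> (q m)"
  obtains z where "z \<in> {1..<n + m} \<rightarrow> carrier F" "\<And>f. f \<in> \<F> \<Longrightarrow> frob_eval m z f \<noteq> \<zero>"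
proof -
  let ?J = "{1..<n + m}"
  let ?Q = "mpoly_ring F ?J"
  interpret P: cring "P m" by (rule P_cring)
  interpret Q: cring ?Q by (rule mpoly_cring)
  interpret fr: ring_hom_cring F F frob by (rule frobenius_hom_cring)
  interpret id: ring_hom_cring F F id by (rule id_hom_cring)
  have "\<forall>f\<in>\<F>. \<exists>f0 f1 g. f0 \<in> carrier ?Q \<and> f1 \<in> carrier ?Q \<and> g \<in> carrier (P m) \<and>
     f = f0 \<oplus>\<^bsub>P m\<^esub> indexed_var 0 \<otimes>\<^bsub>P m\<^esub> f1 \<oplus>\<^bsub>P m\<^esub> g \<otimes>\<^bsub>P m\<^esub> q m"
    using assms(2) division_by_q by metis
  then obtain f0 f1 g where dec: "\<And>f. f \<in> \<F> \<Longrightarrow> f0 f \<in> carrier ?Q \<and> f1 f \<in> carrier ?Q \<and> g f \<in> carrier (P m) \<and>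
     f = f0 f \<oplus>\<^bsub>P m\<^esub> indexed_var 0 \<otimes>\<^bsub>P m\<^esub> f1 f \<oplus>\<^bsub>P m\<^esub> g f \<otimes>\<^bsub>P m\<^esub> q m" by metis
  have sub: "p \<in> carrier (P m)" if "p \<in> carrier ?Q" for p
    using that mpoly_ring_mono[of ?J "{..<n + m}"] by (auto simp: subset_iff)
  let ?X1 = "indexed_var 1 :: nat multiset \<Rightarrow> 'a"
  \<comment> \<open>\<open>X_1\<close> is included so that \<open>z 1\<close> is nonzero, which
    turns \<open>z_1 f1(z) = 0\<close> into \<open>f1(z) = 0\<close> below.\<close>
  let ?G = "insert ?X1 ((f0 ` \<F> \<union> f1 ` \<F>) - {\<zero>\<^bsub>?Q\<^esub>})"
  have X1: "?X1 \<in> carrier ?Q" using n_pos by simp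
  have "?X1 \<noteq> \<zero>\<^bsub>?Q\<^esub>" using indexed_var_not_index_free[of "1::nat"] indexed_const_index_free[of \<zero> "1::nat"] by auto
  moreover have "f0 f \<in> carrier ?Q" "f1 f \<in> carrier ?Q" if "f \<in> \<F>" for f using dec[OF that] by blast+
  ultimately have G: "p \<in> carrier ?Q \<and> p \<noteq> \<zero>\<^bsub>?Q\<^esub>" if "p \<in> ?G" for p
    using that X1 by (elim insertE DiffE UnE imageE) simp_all
  have "finite ?G" using assms(1) by simp
  then obtain z where z: "z \<in> ?J \<rightarrow> carrier F" "\<And>p. p \<in> ?G \<Longrightarrow> peval ?J z p \<noteq> \<zero>"
    using exists_common_nonzero[OF infinite_carrier _ _ G] by blast
  have "frob_eval m z f \<noteq> \<zero>" if f: "f \<in> \<F>" for f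
  proof
    assume zero: "frob_eval m z f = \<zero>"
    note df = dec[OF f]
    note E = frob_eval_hom[OF z(1)]
    note sp = special_pt_closed[OF z(1)]
    have pe_hom: "peval ?J z \<in> ring_hom ?Q F"
      unfolding peval_def using z(1) by (intro id.mpoly_eval_hom) auto
    \<comment> \<open>On polynomials free of \<open>X_0\<close> the special evaluation is the square
      of the ordinary evaluation at \<open>z\<close>.\<close>
    have fp: "frob_eval m z p = frob (peval ?J z p)" if p: "p \<in> carrier ?Q" for p
    proof (rule mpoly_hom_eqI[OF mpoly_hom_mono[OF E] _ _ _ p])
      show "?J \<subseteq> {..<n + m}" by auto
      show "(\<lambda>p. frob (peval ?J z p)) \<in> ring_hom ?Q F"
        using ring_hom_trans[OF pe_hom frobenius_hom] by (simp add: comp_def)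
      show "frob_eval m z (indexed_const c) = frob (peval ?J z (indexed_const c))" if "c \<in> carrier F" for c
        unfolding peval_def using that sp z(1) by (simp add: fr.mpoly_eval_const id.mpoly_eval_const)
      show "frob_eval m z (indexed_var i) = frob (peval ?J z (indexed_var i))" if "i \<in> ?J" for i
        unfolding peval_def using that sp z(1)
        by (subst fr.mpoly_eval_var, simp, simp, simp, subst id.mpoly_eval_var) (auto simp: special_pt_def)
    qed
    let ?u = "peval ?J z (f0 f)" and ?v = "peval ?J z (f1 f)"
    have uv: "?u \<in> carrier F" "?v \<in> carrier F" using df ring_hom_closed[OF pe_hom] by auto
    have X0: "indexed_var 0 \<in> carrier (P m)" using n_pos by simp
    have T: "tail_sum z \<in> carrier F" by (rule tail_sum_closed[OF z(1)])
    have "frob_eval m z f = frob_eval m z (f0 f) \<oplus> frob_eval m z (indexed_var 0) \<otimes> frob_eval m z (f1 f) \<oplus>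
        frob_eval m z (g f \<otimes>\<^bsub>P m\<^esub> q m)"
      using df X0 sub q_closed[of m] P.m_closed
      by (metis (no_types, lifting) P.a_closed ring_hom_add[OF E] ring_hom_mult[OF E])
    also have "frob_eval m z (g f \<otimes>\<^bsub>P m\<^esub> q m) = \<zero>"
      using df by (intro frob_eval_ideal[OF z(1)]) (auto simp: cgenideal_def)
    also have "frob_eval m z (indexed_var 0) = inv (as ! 0) \<otimes> tail_sum z"
      using sp n_pos by (subst fr.mpoly_eval_var) (auto simp: special_pt_def)
    also have "frob_eval m z (f0 f) = frob ?u" using df fp by blast
    also have "frob_eval m z (f1 f) = frob ?v" using df fp by blast
    finally have "frob ?u \<oplus> inv (as ! 0) \<otimes> tail_sum z \<otimes> frob ?v = \<zero>"
      using zero uv T a0_inv by simp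
    then have "as ! 0 \<otimes> (frob ?u \<oplus> inv (as ! 0) \<otimes> tail_sum z \<otimes> frob ?v) = \<zero>"
      using n_pos by simp
    moreover have "as ! 0 \<otimes> (frob ?u \<oplus> inv (as ! 0) \<otimes> tail_sum z \<otimes> frob ?v) =
       as ! 0 \<otimes> frob ?u \<oplus> (as ! 0 \<otimes> inv (as ! 0)) \<otimes> (frob ?v \<otimes> tail_sum z)"
    proof -
      have "frob ?u \<in> carrier F" "frob ?v \<in> carrier F" "as ! 0 \<in> carrier F" using uv n_pos by auto
      then show ?thesis using T a0_inv(1) by (simp add: r_distr m_ac del: Units_r_inv Units_l_inv)
    qed
    ultimately have eq: "as ! 0 \<otimes> frob ?u \<oplus> frob ?v \<otimes> tail_sum z = \<zero>"
      using a0_inv T uv by simp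
    define y where "y i = (if i = 0 then ?u else z i \<otimes> ?v)" for i :: nat
    have zi: "z i \<in> carrier F" if "i < n" "i \<noteq> 0" for i using that z(1) by (auto simp: Pi_iff)
    have y: "y i \<in> carrier F" if "i < n" for i using that uv zi by (auto simp: y_def)
    have "tail_sum y = (\<Oplus>j\<in>{1..<n}. frob ?v \<otimes> (as ! j \<otimes> z j [^] (2::nat)))"
      unfolding tail_sum_def using zi uv
      by (intro finsum_cong') (auto simp: y_def nat_pow_distrib m_ac)
    also have "\<dots> = frob ?v \<otimes> tail_sum z"
      unfolding tail_sum_def using zi uv by (intro finsum_rdistr[symmetric]) auto
    finally have "qsum F as y = \<zero>" using qsum_split[of y] y eq by (simp add: y_def)
    then have y0: "\<And>i. i < n \<Longrightarrow> y i = \<zero>" using as_indep[of y] y by blast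
    have u0: "?u = \<zero>" using y0[of 0] n_pos by (simp add: y_def)
    have "z 1 \<otimes> ?v = \<zero>" using y0[of 1] n_pos by (simp add: y_def)
    moreover have "z 1 \<noteq> \<zero>"
    proof -
      have "peval ?J z ?X1 = z 1" unfolding peval_def using z(1) n_pos by (intro id.mpoly_eval_var) auto
      then show ?thesis using z(2)[of ?X1] by auto
    qed
    ultimately have v0: "?v = \<zero>" using uv zi[of 1] n_pos by (simp add: integral_iff)
    have "f0 f = \<zero>\<^bsub>?Q\<^esub>" "f1 f = \<zero>\<^bsub>?Q\<^esub>" using z(2) u0 v0 f by blast+
    then have "f = \<zero>\<^bsub>P m\<^esub> \<oplus>\<^bsub>P m\<^esub> indexed_var 0 \<otimes>\<^bsub>P m\<^esub> \<zero>\<^bsub>P m\<^esub> \<oplus>\<^bsub>P m\<^esub> g f \<otimes>\<^bsub>P m\<^esub> q m"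
      using df by (simp only: mpoly_ring_simps(3))
    then have "f = g f \<otimes>\<^bsub>P m\<^esub> q m" using df X0 q_closed[of m] by (simp del: mpoly_ring_simps)
    then have "f \<in> PIdl\<^bsub>P m\<^esub> (q m)" using df by (auto simp: cgenideal_def)
    then show False using assms(2)[OF f] by blast
  qed
  then show ?thesis using that z(1) by blast
qed

text \<open>If neither factor lies in the ideal, one special point avoids the zeros of both, and the
  product of two nonzero values in the field \<open>F\<close> is not zero.\<close>

lemma q_primeideal: "primeideal (PIdl\<^bsub>P m\<^esub> (q m)) (P m)"
proof -
  interpret P: cring "P m" by (rule P_cring)
  show ?thesis
  proof (rule primeidealI[OF P.cgenideal_ideal[OF q_closed] P_cring])
    show "carrier (P m) \<noteq> PIdl\<^bsub>P m\<^esub> (q m)"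
    proof
      assume *: "carrier (P m) = PIdl\<^bsub>P m\<^esub> (q m)"
      have z: "(\<lambda>_. \<zero>) \<in> {1..<n + m} \<rightarrow> carrier F" by auto
      have "\<one>\<^bsub>P m\<^esub> \<in> PIdl\<^bsub>P m\<^esub> (q m)" unfolding *[symmetric] by (rule P.one_closed)
      then show False using frob_eval_ideal[OF z] ring_hom_one[OF frob_eval_hom[OF z]] by simp
    qed
    fix a b assume ab: "a \<in> carrier (P m)" "b \<in> carrier (P m)" "a \<otimes>\<^bsub>P m\<^esub> b \<in> PIdl\<^bsub>P m\<^esub> (q m)"
    show "a \<in> PIdl\<^bsub>P m\<^esub> (q m) \<or> b \<in> PIdl\<^bsub>P m\<^esub> (q m)"
    proof (rule ccontr)
      assume "\<not> ?thesis"
      then obtain z where z: "z \<in> {1..<n + m} \<rightarrow> carrier F" "\<And>f. f \<in> {a, b} \<Longrightarrow> frob_eval m z f \<noteq> \<zero>"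
        using exists_special_pt[of "{a, b}" m] ab by blast
      have "frob_eval m z a \<otimes> frob_eval m z b = \<zero>"
        using frob_eval_ideal[OF z(1) ab(3)] ring_hom_mult[OF frob_eval_hom[OF z(1)] ab(1,2)] by simp
      then show False
        using z(2) ring_hom_closed[OF frob_eval_hom[OF z(1)]] ab(1,2) by (auto simp: integral_iff simp del: mpoly_ring_simps)
    qed
  qed
qed

lemma A_domain: "domain (A m)"
  by (rule primeideal.quotient_is_domain[OF q_primeideal])

lemma A_cring: "cring (A m)"
  using A_domain domain.axioms(1) by blast

lemma cls_hom: "cls m \<in> ring_hom (P m) (A m)"
  by (rule ideal.rcos_ring_hom[OF primeideal.axioms(1)[OF q_primeideal]])

lemma A_repr: "a \<in> carrier (A m) \<Longrightarrow> \<exists>p\<in>carrier (P m). a = cls m p"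
  by (auto simp: FactRing_def A_RCOSETS_def')

lemma cls_eq_zero_iff:
  assumes "p \<in> carrier (P m)"
  shows "cls m p = \<zero>\<^bsub>A m\<^esub> \<longleftrightarrow> p \<in> PIdl\<^bsub>P m\<^esub> (q m)"
proof -
  interpret I: ideal "PIdl\<^bsub>P m\<^esub> (q m)" "P m" by (rule primeideal.axioms(1)[OF q_primeideal])
  show ?thesis
    using assms I.a_rcos_const I.a_rcos_self unfolding FactRing_def by force
qed

lemma A_hom_ext:
  assumes "cring T" "\<iota> \<in> ring_hom F T" "x \<in> {..<n + m} \<rightarrow> carrier T" "qsum T (map \<iota> as) x = \<zero>\<^bsub>T\<^esub>"
  obtains \<chi> where "\<chi> \<in> ring_hom (A m) T"
    "\<And>p. p \<in> carrier (P m) \<Longrightarrow> \<chi> (cls m p) = ring_hom_cring.mpoly_eval F T \<iota> {..<n + m} x p"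
proof -
  interpret h: ring_hom_cring F T \<iota> using assms is_cring by (intro ring_hom_cring_of)
  interpret I: ideal "PIdl\<^bsub>P m\<^esub> (q m)" "P m" by (rule primeideal.axioms(1)[OF q_primeideal])
  have E: "h.mpoly_eval {..<n + m} x \<in> ring_hom (P m) T" using assms(3) by (intro h.mpoly_eval_hom) auto
  have "h.mpoly_eval {..<n + m} x f = \<zero>\<^bsub>T\<^esub>" if f: "f \<in> PIdl\<^bsub>P m\<^esub> (q m)" for f
  proof -
    obtain g where g: "g \<in> carrier (P m)" "f = g \<otimes>\<^bsub>P m\<^esub> q m" using f by (auto simp: cgenideal_def)
    show ?thesis
      unfolding g(2) ring_hom_mult[OF E g(1) q_closed] mpoly_eval_q[OF assms(1-3)] assms(4)
      using ring_hom_closed[OF E g(1)] by simp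
  qed
  then show ?thesis using I.quotient_hom_ext[OF h.S.ring_axioms E] that by blast
qed

end

section \<open>Homomorphisms out of localizations, common denominators\<close>

context mult_subset
begin

lemma loc_hom_ext:
  assumes "cring T" "\<chi> \<in> ring_hom R T" "\<And>s. s \<in> S \<Longrightarrow> \<chi> s \<in> Units T"
  obtains \<chi>' where "\<chi>' \<in> ring_hom (localization R S) T" "\<And>a. a \<in> carrier R \<Longrightarrow> \<chi>' (loc_frac R S a \<one>) = \<chi> a"
  using that loc_ext_hom[OF assms] loc_ext_map[OF assms] by blast

lemma loc_denom_Unit:
  assumes "s \<in> S"
  shows "loc_frac R S s \<one> \<in> Units (localization R S)"
proof -
  interpret L: cring "localization R S" by (rule localization_cring)
  have "loc_frac R S s \<one> \<otimes>\<^bsub>localization R S\<^esub> loc_frac R S \<one> s = \<one>\<^bsub>localization R S\<^esub>"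
    using assms S_one by (simp add: loc_mult loc_one) (subst frac_eq_iff, auto)
  moreover have "loc_frac R S s \<one> \<in> carrier (localization R S)" "loc_frac R S \<one> s \<in> carrier (localization R S)"
    using assms S_one by auto
  ultimately show ?thesis using L.m_comm unfolding Units_def by fastforce
qed

lemma loc_hom_unique:
  assumes T: "cring T" and "\<chi> \<in> ring_hom (localization R S) T" "\<chi>' \<in> ring_hom (localization R S) T"
    and eq: "\<And>a. a \<in> carrier R \<Longrightarrow> \<chi> (loc_frac R S a \<one>) = \<chi>' (loc_frac R S a \<one>)"
    and x: "x \<in> carrier (localization R S)"
  shows "\<chi> x = \<chi>' x"
proof -
  interpret T: cring T by (rule T)
  interpret L: cring "localization R S" by (rule localization_cring)
  obtain a s where as: "a \<in> carrier R" "s \<in> S" "x = loc_frac R S a s" using fracE[OF x] by metis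
  let ?s = "loc_frac R S s \<one>"
  have s: "?s \<in> carrier (localization R S)" using as S_one by auto
  have u: "\<chi> ?s \<in> Units T"
  proof -
    interpret h: ring_hom_cring "localization R S" T \<chi>
      using assms localization_cring by (intro ring_hom_cring_of)
    obtain t where t: "t \<in> carrier (localization R S)" "?s \<otimes>\<^bsub>localization R S\<^esub> t = \<one>\<^bsub>localization R S\<^esub>"
      using loc_denom_Unit[OF as(2)] unfolding Units_def by auto
    have "\<chi> ?s \<otimes>\<^bsub>T\<^esub> \<chi> t = \<one>\<^bsub>T\<^esub>" using t s h.hom_mult h.hom_one by metis
    then show ?thesis using t s h.hom_closed T.m_comm unfolding Units_def by fastforce
  qed
  have "\<chi> x \<otimes>\<^bsub>T\<^esub> \<chi> ?s = \<chi> (loc_frac R S a \<one>)"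
    using frac_mult_denom[OF as(1,2)] as(3) ring_hom_mult[OF assms(2) x s] by simp
  also have "\<dots> = \<chi>' x \<otimes>\<^bsub>T\<^esub> \<chi> ?s"
    using frac_mult_denom[OF as(1,2)] as ring_hom_mult[OF assms(3) x s] eq by simp
  finally show ?thesis
    using u ring_hom_closed[OF assms(2) x] ring_hom_closed[OF assms(3) x] T.m_comm T.Units_closed
    by (metis T.Units_l_cancel)
qed

text \<open>Clearing denominators of a whole family of coordinates by one element is what turns
  equations between fractions into polynomial equations.\<close>

lemma common_denominator:
  fixes x :: "'i \<Rightarrow> _"
  assumes "finite J" "\<And>i. i \<in> J \<Longrightarrow> x i \<in> carrier (localization R S)"
  shows "\<exists>s\<in>S. \<forall>i\<in>J. \<exists>a\<in>carrier R. x i \<otimes>\<^bsub>localization R S\<^esub> loc_frac R S s \<one> = loc_frac R S a \<one>"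
  using assms
proof (induction J rule: finite_induct)
  case empty
  then show ?case using S_one by auto
next
  case (insert j J)
  interpret L: cring "localization R S" by (rule localization_cring)
  note lh = loc_map_hom
  obtain s where s: "s \<in> S" "\<And>i. i \<in> J \<Longrightarrow> \<exists>a\<in>carrier R. x i \<otimes>\<^bsub>localization R S\<^esub> loc_frac R S s \<one> = loc_frac R S a \<one>"
    using insert.IH insert.prems by blast
  obtain b t where bt: "b \<in> carrier R" "t \<in> S" "x j = loc_frac R S b t" using fracE insert.prems by blast
  have sc: "loc_frac R S s \<one> \<in> carrier (localization R S)" and tc: "loc_frac R S t \<one> \<in> carrier (localization R S)"
    using s bt S_one by auto
  have st: "loc_frac R S (s \<otimes> t) \<one> = loc_frac R S s \<one> \<otimes>\<^bsub>localization R S\<^esub> loc_frac R S t \<one>"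
    using ring_hom_mult[OF lh, of s t] s bt by simp
  have mult: "loc_frac R S a \<one> \<otimes>\<^bsub>localization R S\<^esub> loc_frac R S c \<one> = loc_frac R S (a \<otimes> c) \<one>"
    if "a \<in> carrier R" "c \<in> carrier R" for a c using ring_hom_mult[OF lh that] by simp
  have "\<exists>a\<in>carrier R. x i \<otimes>\<^bsub>localization R S\<^esub> loc_frac R S (s \<otimes> t) \<one> = loc_frac R S a \<one>" if i: "i \<in> insert j J" for i
  proof (cases "i = j")
    case True
    have "x i \<otimes>\<^bsub>localization R S\<^esub> loc_frac R S (s \<otimes> t) \<one> =
        (x j \<otimes>\<^bsub>localization R S\<^esub> loc_frac R S t \<one>) \<otimes>\<^bsub>localization R S\<^esub> loc_frac R S s \<one>"
      unfolding st True using sc tc insert.prems[of j] by (simp add: L.m_ac)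
    also have "\<dots> = loc_frac R S (b \<otimes> s) \<one>"
      using bt s frac_mult_denom mult by simp
    finally show ?thesis using bt s by (intro bexI[of _ "b \<otimes> s"]) auto
  next
    case False
    then obtain a where a: "a \<in> carrier R" "x i \<otimes>\<^bsub>localization R S\<^esub> loc_frac R S s \<one> = loc_frac R S a \<one>"
      using s(2) i by blast
    have "x i \<otimes>\<^bsub>localization R S\<^esub> loc_frac R S (s \<otimes> t) \<one> = loc_frac R S a \<one> \<otimes>\<^bsub>localization R S\<^esub> loc_frac R S t \<one>"
      unfolding st a(2)[symmetric] using sc tc insert.prems[OF i] by (simp add: L.m_assoc)
    also have "\<dots> = loc_frac R S (a \<otimes> t) \<one>" using a bt mult by simp
    finally show ?thesis using a bt by (intro bexI[of _ "a \<otimes> t"]) auto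
  qed
  then show ?case using s bt S_mult by blast
qed

end

lemma (in domain) powers_nonzero:
  assumes "f \<in> carrier R" "f \<noteq> \<zero>" "u \<in> powers R f"
  shows "u \<noteq> \<zero>"
proof -
  have "f [^] (k::nat) \<noteq> \<zero>" for k
    by (induction k) (use assms integral_iff in auto)
  then show ?thesis using assms(3) by (auto simp: powers_def)
qed

section \<open>Principal open subsets of the quadric and their points\<close>

context quasilinear_coeffs
begin

abbreviation "Af m f \<equiv> localization (A m) (powers (A m) f)"
abbreviation "lc m f p \<equiv> loc_frac (A m) (powers (A m) f) (cls m p) \<one>\<^bsub>A m\<^esub>"

lemma Af_mult_subset: "f \<in> carrier (A m) \<Longrightarrow> mult_subset (A m) (powers (A m) f)"
  by (rule cring.mult_subset_powers[OF A_cring])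

lemma Af_cring: "f \<in> carrier (A m) \<Longrightarrow> cring (Af m f)"
  by (rule mult_subset.localization_cring[OF Af_mult_subset])

lemma lc_hom: "f \<in> carrier (A m) \<Longrightarrow> lc m f \<in> ring_hom (P m) (Af m f)"
  using ring_hom_trans[OF cls_hom mult_subset.loc_map_hom[OF Af_mult_subset]] by (simp add: comp_def)

lemma cls_closed: "p \<in> carrier (P m) \<Longrightarrow> cls m p \<in> carrier (A m)"
  using ring_hom_closed[OF cls_hom] by blast

lemma powers_repr:
  assumes "f \<in> carrier (A m)" "s \<in> powers (A m) f"
  shows "\<exists>p\<in>carrier (P m). s = cls m p"
proof -
  interpret A: cring "A m" by (rule A_cring)
  show ?thesis using A_repr assms by (auto simp: powers_def simp del: mpoly_ring_simps)
qed

lemma lc_denom_Unit: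
  assumes "f \<in> carrier (A m)" "s \<in> powers (A m) f"
  shows "loc_frac (A m) (powers (A m) f) s \<one>\<^bsub>A m\<^esub> \<in> Units (Af m f)"
  by (rule mult_subset.loc_denom_Unit[OF Af_mult_subset[OF assms(1)] assms(2)])

text \<open>Homomorphisms from \<open>A_f\<close> to \<open>T\<close> over \<open>F\<close> are the
  \<open>T\<close>-points of the quadric at which \<open>f\<close> is invertible. This is the
  existence half of the statement, \<open>Af_hom_unique\<close> the other.\<close>

lemma Af_hom_ext:
  assumes "cring T" "\<iota> \<in> ring_hom F T" "x \<in> {..<n + m} \<rightarrow> carrier T" "qsum T (map \<iota> as) x = \<zero>\<^bsub>T\<^esub>"
    and f: "f \<in> carrier (P m)" and unit: "ring_hom_cring.mpoly_eval F T \<iota> {..<n + m} x f \<in> Units T"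
  obtains \<chi> where "\<chi> \<in> ring_hom (Af m (cls m f)) T"
    "\<And>p. p \<in> carrier (P m) \<Longrightarrow> \<chi> (lc m (cls m f) p) = ring_hom_cring.mpoly_eval F T \<iota> {..<n + m} x p"
proof -
  interpret T: cring T by (rule assms)
  obtain \<chi> where \<chi>: "\<chi> \<in> ring_hom (A m) T"
    "\<And>p. p \<in> carrier (P m) \<Longrightarrow> \<chi> (cls m p) = ring_hom_cring.mpoly_eval F T \<iota> {..<n + m} x p"
    using A_hom_ext[OF assms(1-4)] by blast
  interpret c: ring_hom_cring "A m" T \<chi> using A_cring assms \<chi> by (intro ring_hom_cring_of)
  note fc = cls_closed[OF f]
  have "\<chi> s \<in> Units T" if s: "s \<in> powers (A m) (cls m f)" for s
  proof -
    obtain k :: nat where "s = cls m f [^]\<^bsub>A m\<^esub> k" using s by (auto simp: powers_def)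
    moreover have "\<chi> (cls m f [^]\<^bsub>A m\<^esub> k) = \<chi> (cls m f) [^]\<^bsub>T\<^esub> k"
      using fc by (induction k) (simp_all del: mpoly_ring_simps)
    ultimately have "\<chi> s = \<chi> (cls m f) [^]\<^bsub>T\<^esub> k" by simp
    then show ?thesis using \<chi>(2)[OF f] unit T.Units_pow_closed by simp
  qed
  then obtain \<chi>' where "\<chi>' \<in> ring_hom (Af m (cls m f)) T"
    "\<And>a. a \<in> carrier (A m) \<Longrightarrow> \<chi>' (loc_frac (A m) (powers (A m) (cls m f)) a \<one>\<^bsub>A m\<^esub>) = \<chi> a"
    using mult_subset.loc_hom_ext[OF Af_mult_subset[OF fc] assms(1) \<chi>(1)] by metis
  then show ?thesis using that \<chi>(2) cls_closed by simp
qed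

lemma Af_hom_unique:
  assumes "cring T" and f: "f \<in> carrier (A m)"
    and "\<chi> \<in> ring_hom (Af m f) T" "\<chi>' \<in> ring_hom (Af m f) T"
    and const: "\<And>c. c \<in> carrier F \<Longrightarrow> \<chi> (lc m f (indexed_const c)) = \<chi>' (lc m f (indexed_const c))"
    and var: "\<And>i. i < n + m \<Longrightarrow> \<chi> (lc m f (indexed_var i)) = \<chi>' (lc m f (indexed_var i))"
    and x: "x \<in> carrier (Af m f)"
  shows "\<chi> x = \<chi>' x"
proof (rule mult_subset.loc_hom_unique[OF Af_mult_subset[OF f] assms(1,3,4) _ x])
  fix a assume "a \<in> carrier (A m)"
  then obtain p where p: "p \<in> carrier (P m)" "a = cls m p" using A_repr by blast
  have "(\<lambda>p. \<chi> (lc m f p)) \<in> ring_hom (P m) T" "(\<lambda>p. \<chi>' (lc m f p)) \<in> ring_hom (P m) T"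
    using ring_hom_trans[OF lc_hom[OF f] assms(3)] ring_hom_trans[OF lc_hom[OF f] assms(4)] by (simp_all add: comp_def)
  from mpoly_hom_eqI[OF this const _ p(1)] var
  show "\<chi> (loc_frac (A m) (powers (A m) f) a \<one>\<^bsub>A m\<^esub>) = \<chi>' (loc_frac (A m) (powers (A m) f) a \<one>\<^bsub>A m\<^esub>)"
    unfolding p(2) by auto
qed

text \<open>Inverting a nonzero element of a domain kills nothing, so the kernel is still the ideal
  of the quadric.\<close>

lemma lc_eq_zero_iff:
  assumes f: "f \<in> carrier (A m)" "f \<noteq> \<zero>\<^bsub>A m\<^esub>" and p: "p \<in> carrier (P m)"
  shows "lc m f p = \<zero>\<^bsub>Af m f\<^esub> \<longleftrightarrow> p \<in> PIdl\<^bsub>P m\<^esub> (q m)"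
proof -
  interpret A: domain "A m" by (rule A_domain)
  note ms = Af_mult_subset[OF f(1)]
  have one: "\<one>\<^bsub>A m\<^esub> \<in> powers (A m) f" by (rule mult_subset.S_one[OF ms])
  have "lc m f p = \<zero>\<^bsub>Af m f\<^esub> \<longleftrightarrow> (\<exists>u\<in>powers (A m) f. u \<otimes>\<^bsub>A m\<^esub> (cls m p \<otimes>\<^bsub>A m\<^esub> \<one>\<^bsub>A m\<^esub>) = u \<otimes>\<^bsub>A m\<^esub> (\<zero>\<^bsub>A m\<^esub> \<otimes>\<^bsub>A m\<^esub> \<one>\<^bsub>A m\<^esub>))"
    unfolding mult_subset.loc_zero[OF ms] using one cls_closed[OF p]
    by (intro mult_subset.frac_eq_iff[OF ms]) auto
  also have "\<dots> \<longleftrightarrow> cls m p = \<zero>\<^bsub>A m\<^esub>"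
  proof
    assume "\<exists>u\<in>powers (A m) f. u \<otimes>\<^bsub>A m\<^esub> (cls m p \<otimes>\<^bsub>A m\<^esub> \<one>\<^bsub>A m\<^esub>) = u \<otimes>\<^bsub>A m\<^esub> (\<zero>\<^bsub>A m\<^esub> \<otimes>\<^bsub>A m\<^esub> \<one>\<^bsub>A m\<^esub>)"
    then obtain u where u: "u \<in> powers (A m) f" "u \<otimes>\<^bsub>A m\<^esub> cls m p = \<zero>\<^bsub>A m\<^esub>"
      using cls_closed[OF p] mult_subset.S_subset[OF ms] by (auto simp: subset_iff)
    then have "u \<in> carrier (A m)" "u \<noteq> \<zero>\<^bsub>A m\<^esub>"
      using mult_subset.S_subset[OF ms] A.powers_nonzero[OF f] by auto
    then show "cls m p = \<zero>\<^bsub>A m\<^esub>" using u(2) cls_closed[OF p] A.integral_iff by blast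
  next
    assume "cls m p = \<zero>\<^bsub>A m\<^esub>"
    then show "\<exists>u\<in>powers (A m) f. u \<otimes>\<^bsub>A m\<^esub> (cls m p \<otimes>\<^bsub>A m\<^esub> \<one>\<^bsub>A m\<^esub>) = u \<otimes>\<^bsub>A m\<^esub> (\<zero>\<^bsub>A m\<^esub> \<otimes>\<^bsub>A m\<^esub> \<one>\<^bsub>A m\<^esub>)"
      using one by (intro bexI[of _ "\<one>\<^bsub>A m\<^esub>"]) auto
  qed
  also have "\<dots> \<longleftrightarrow> p \<in> PIdl\<^bsub>P m\<^esub> (q m)" by (rule cls_eq_zero_iff[OF p])
  finally show ?thesis .
qed

lemma qsum_lc_var:
  assumes f: "f \<in> carrier (A m)"
  shows "qsum (Af m f) (map (\<lambda>c. lc m f (indexed_const c)) as) (\<lambda>i. lc m f (indexed_var i)) = \<zero>\<^bsub>Af m f\<^esub>"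
proof -
  interpret P: cring "P m" by (rule P_cring)
  interpret h: ring_hom_cring "P m" "Af m f" "lc m f"
    using P_cring Af_cring[OF f] lc_hom[OF f] by (intro ring_hom_cring_of)
  have "q m \<in> PIdl\<^bsub>P m\<^esub> (q m)" by (rule P.cgenideal_self[OF q_closed])
  then have "cls m (q m) = \<zero>\<^bsub>A m\<^esub>" using cls_eq_zero_iff[OF q_closed] by blast
  then have "lc m f (q m) = \<zero>\<^bsub>Af m f\<^esub>" by (simp add: mult_subset.loc_zero[OF Af_mult_subset[OF f]])
  moreover have "lc m f (qsum (P m) (map indexed_const as) indexed_var) =
      qsum (Af m f) (map (lc m f) (map indexed_const as)) (\<lambda>i. lc m f (indexed_var i))"
    by (rule h.hom_qsum) (use as_closed in auto)
  ultimately show ?thesis by (simp add: comp_def q_eq[symmetric])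
qed

end

section \<open>Similarity of the forms at corresponding points\<close>

text \<open>Reduction of \<open>qsum_trunc3\<close> modulo \<open>t^2\<close>, after padding the
  coordinates by a zero \<open>t^2\<close> component.\<close>

lemma (in char2_cring) qsum_dual:
  assumes "set as \<subseteq> carrier R" "\<And>i. i < length as \<Longrightarrow> x i \<in> carrier (dual_ring R)"
  shows "qsum (dual_ring R) (map (\<lambda>a. (a, \<zero>)) as) x = (qsum R as (\<lambda>i. fst (x i)), \<zero>)"
proof -
  let ?y = "\<lambda>i. (fst (x i), snd (x i), \<zero>)" and ?\<pi> = "\<lambda>(a, b, c). (a, b) :: 'a \<times> 'a"
  interpret h: ring_hom_cring "trunc3_ring R" "dual_ring R" "\<lambda>(a, b, c). (a, b)"
    using trunc3_ring_cring dual_ring_cring trunc3_dual_hom by (intro ring_hom_cring_of)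
  have y: "?y i \<in> carrier (trunc3_ring R)" if "i < length as" for i using assms(2)[OF that] by simp
  have "?\<pi> (qsum (trunc3_ring R) (map (\<lambda>a. (a, \<zero>, \<zero>)) as) ?y) =
      qsum (dual_ring R) (map ?\<pi> (map (\<lambda>a. (a, \<zero>, \<zero>)) as)) (\<lambda>i. ?\<pi> (?y i))"
    by (rule h.hom_qsum) (use assms y in auto)
  then show ?thesis using qsum_trunc3[OF assms(1), of ?y] y by (simp add: comp_def)
qed

context quasilinear_coeffs
begin

text \<open>The equation has no term in \<open>t\<close>, so \<open>Q + w t\<close> satisfies it for
  every \<open>w\<close> as soon as \<open>Q\<close> does: every vector is tangent to the quadric at
  every point. The element \<open>f\<close> stays invertible because its constant term is.\<close>

lemma Af_dual_hom:
  assumes N: "field N" and \<iota>: "\<iota> \<in> ring_hom F N" and f: "f \<in> carrier (P m)"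
    and \<chi>0: "\<chi>0 \<in> ring_hom (Af m (cls m f)) N"
    and const: "\<And>c. c \<in> carrier F \<Longrightarrow> \<chi>0 (lc m (cls m f) (indexed_const c)) = \<iota> c"
    and w: "\<And>i. i < n + m \<Longrightarrow> w i \<in> carrier N"
  obtains \<chi> where "\<chi> \<in> ring_hom (Af m (cls m f)) (dual_ring N)"
    "\<And>c. c \<in> carrier F \<Longrightarrow> \<chi> (lc m (cls m f) (indexed_const c)) = (\<iota> c, \<zero>\<^bsub>N\<^esub>)"
    "\<And>x. x \<in> carrier (Af m (cls m f)) \<Longrightarrow> fst (\<chi> x) = \<chi>0 x"
    "\<And>i. i < n + m \<Longrightarrow> snd (\<chi> (lc m (cls m f) (indexed_var i))) = w i"
proof -
  interpret N: field N by (rule N)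
  have Nc: "cring N" by (rule N.is_cring)
  have N2: "char2_cring N" by (rule char2_cring_image[OF Nc \<iota>])
  note fc = cls_closed[OF f]
  let ?f = "cls m f" and ?D = "dual_ring N" and ?\<iota> = "\<lambda>c. (\<iota> c, \<zero>\<^bsub>N\<^esub>)"
  let ?Q = "\<lambda>i. \<chi>0 (lc m ?f (indexed_var i))"
  let ?x = "\<lambda>i. (?Q i, w i)"
  have D: "cring ?D" by (rule N.dual_ring_cring)
  have \<iota>D: "?\<iota> \<in> ring_hom F ?D" using ring_hom_trans[OF \<iota> N.dual_embed_hom] by (simp add: comp_def)
  note lch = lc_hom[OF fc]
  have clc: "(\<lambda>p. \<chi>0 (lc m ?f p)) \<in> ring_hom (P m) N"
    using ring_hom_trans[OF lch \<chi>0] by (simp add: comp_def)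
  have Q: "?Q i \<in> carrier N" if "i < n + m" for i using ring_hom_closed[OF clc, of "indexed_var i"] that by simp
  have x: "?x \<in> {..<n + m} \<rightarrow> carrier ?D" using Q w by auto
  interpret hD: ring_hom_cring F ?D ?\<iota> using is_cring D \<iota>D by (intro ring_hom_cring_of)
  interpret hN: ring_hom_cring F N \<iota> using is_cring Nc \<iota> by (intro ring_hom_cring_of)
  interpret c: ring_hom_cring "Af m ?f" N \<chi>0 using Af_cring[OF fc] Nc \<chi>0 by (intro ring_hom_cring_of)
  have \<iota>as: "set (map \<iota> as) \<subseteq> carrier N" using as_closed by auto
  have q0: "qsum N (map \<iota> as) ?Q = \<zero>\<^bsub>N\<^esub>"
  proof -
    have lcc: "lc m ?f p \<in> carrier (Af m ?f)" if "p \<in> carrier (P m)" for p using ring_hom_closed[OF lch that] .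
    have "\<chi>0 (qsum (Af m ?f) (map (\<lambda>c. lc m ?f (indexed_const c)) as) (\<lambda>i. lc m ?f (indexed_var i))) =
        qsum N (map \<chi>0 (map (\<lambda>c. lc m ?f (indexed_const c)) as)) ?Q"
      by (rule c.hom_qsum) (use as_closed lcc in auto)
    moreover have "map \<chi>0 (map (\<lambda>c. lc m ?f (indexed_const c)) as) = map \<iota> as"
      using const as_closed by (simp add: subset_iff)
    ultimately show ?thesis by (simp only: qsum_lc_var[OF fc] c.hom_zero)
  qed
  have "map ?\<iota> as = map (\<lambda>a. (a, \<zero>\<^bsub>N\<^esub>)) (map \<iota> as)" by simp
  then have qD: "qsum ?D (map ?\<iota> as) ?x = \<zero>\<^bsub>?D\<^esub>"
    using char2_cring.qsum_dual[OF N2 \<iota>as, of ?x] q0 Q w by (simp add: comp_def)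
  have E: "hD.mpoly_eval {..<n + m} ?x \<in> ring_hom (P m) ?D" using x by (intro hD.mpoly_eval_hom) auto
  have fstE: "fst (hD.mpoly_eval {..<n + m} ?x p) = \<chi>0 (lc m ?f p)" if p: "p \<in> carrier (P m)" for p
  proof (rule mpoly_hom_eqI[OF _ clc _ _ p])
    show "(\<lambda>p. fst (hD.mpoly_eval {..<n + m} ?x p)) \<in> ring_hom (P m) N"
      using ring_hom_trans[OF E N.dual_fst_hom] by (simp add: comp_def)
    show "fst (hD.mpoly_eval {..<n + m} ?x (indexed_const c)) = \<chi>0 (lc m ?f (indexed_const c))"
      if "c \<in> carrier F" for c using const[OF that] hD.mpoly_eval_const[OF that x] by simp
    show "fst (hD.mpoly_eval {..<n + m} ?x (indexed_var i)) = \<chi>0 (lc m ?f (indexed_var i))"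
      if "i \<in> {..<n + m}" for i using hD.mpoly_eval_var[OF _ x that] by simp
  qed
  have "\<chi>0 (lc m ?f f) \<in> Units N"
  proof -
    have "?f \<in> powers (A m) ?f"
    proof -
      interpret A: cring "A m" by (rule A_cring)
      have "?f = ?f [^]\<^bsub>A m\<^esub> (1::nat)" using fc A.nat_pow_eone by simp
      then show ?thesis unfolding powers_def by blast
    qed
    then have "lc m ?f f \<in> Units (Af m ?f)" by (rule lc_denom_Unit[OF fc])
    then obtain t where "t \<in> carrier (Af m ?f)" "lc m ?f f \<in> carrier (Af m ?f)"
        "lc m ?f f \<otimes>\<^bsub>Af m ?f\<^esub> t = \<one>\<^bsub>Af m ?f\<^esub>" unfolding Units_def by auto
    then have "\<chi>0 (lc m ?f f) \<otimes>\<^bsub>N\<^esub> \<chi>0 t = \<one>\<^bsub>N\<^esub>" "\<chi>0 t \<in> carrier N" "\<chi>0 (lc m ?f f) \<in> carrier N"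
      using c.hom_mult c.hom_one c.hom_closed by metis+
    then show ?thesis using N.m_comm unfolding Units_def by fastforce
  qed
  then have "hD.mpoly_eval {..<n + m} ?x f \<in> Units ?D"
    using N.dual_Units[OF ring_hom_closed[OF E f]] fstE[OF f] by simp
  then obtain \<chi> where \<chi>: "\<chi> \<in> ring_hom (Af m ?f) ?D"
    "\<And>p. p \<in> carrier (P m) \<Longrightarrow> \<chi> (lc m ?f p) = hD.mpoly_eval {..<n + m} ?x p"
    using Af_hom_ext[OF D \<iota>D x qD f] by blast
  have fc1: "(\<lambda>a. fst (\<chi> a)) \<in> ring_hom (Af m ?f) N"
    using ring_hom_trans[OF \<chi>(1) N.dual_fst_hom] by (simp add: comp_def)
  show ?thesis
  proof (rule that[OF \<chi>(1)])
    show "\<chi> (lc m ?f (indexed_const c)) = (\<iota> c, \<zero>\<^bsub>N\<^esub>)" if "c \<in> carrier F" for c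
      using \<chi>(2)[of "indexed_const c"] that hD.mpoly_eval_const[OF that x] by simp
    show "fst (\<chi> a) = \<chi>0 a" if a: "a \<in> carrier (Af m ?f)" for a
    proof (rule Af_hom_unique[OF Nc fc fc1 \<chi>0 _ _ a])
      show "fst (\<chi> (lc m ?f (indexed_const c))) = \<chi>0 (lc m ?f (indexed_const c))" if "c \<in> carrier F" for c
        using \<chi>(2)[of "indexed_const c"] fstE[of "indexed_const c"] that by simp
      show "fst (\<chi> (lc m ?f (indexed_var i))) = \<chi>0 (lc m ?f (indexed_var i))" if "i < n + m" for i
        using \<chi>(2)[of "indexed_var i"] fstE[of "indexed_var i"] that by simp
    qed
    show "snd (\<chi> (lc m ?f (indexed_var i))) = w i" if "i < n + m" for i
      using \<chi>(2)[of "indexed_var i"] that hD.mpoly_eval_var[OF _ x] by simp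
  qed
qed

text \<open>Let \<open>x\<^sub>i = p\<^sub>i / d\<close>. Then \<open>\<Sum> c\<^sub>i p\<^sub>i\<^sup>2 = s \<cdot> \<Sum> a\<^sub>j X\<^sub>j\<^sup>2\<close> for a polynomial \<open>s\<close>. At a point
  \<open>Q + t w\<close> over \<open>N[t]/(t\<^sup>3)\<close> whose constant term \<open>Q\<close> lies on the quadric both sides are multiples of
  \<open>t\<^sup>2\<close>, and comparing coefficients gives the claim with \<open>u = s(Q) / d(Q)\<^sup>2\<close>.\<close>

lemma tangent_scaling_aux:
  assumes B: "cring B" and l: "l \<in> ring_hom (P m) B"
    and ker: "\<And>p. p \<in> carrier (P m) \<Longrightarrow> l p = \<zero>\<^bsub>B\<^esub> \<longleftrightarrow> p \<in> PIdl\<^bsub>P m\<^esub> (q m)"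
    and l_point: "qsum B (map (\<lambda>c. l (indexed_const c)) as) (\<lambda>j. l (indexed_var j)) = \<zero>\<^bsub>B\<^esub>"
    and cs_closed: "set cs \<subseteq> carrier F" and x: "\<And>i. i < length cs \<Longrightarrow> x i \<in> carrier B"
    and qx: "qsum B (map (\<lambda>c. l (indexed_const c)) cs) x = \<zero>\<^bsub>B\<^esub>"
    and d: "d \<in> carrier (P m)" and dU: "l d \<in> Units B"
    and p: "\<And>i. i < length cs \<Longrightarrow> p i \<in> carrier (P m) \<and> x i \<otimes>\<^bsub>B\<^esub> l d = l (p i)"
    and N: "field N" and \<iota>: "\<iota> \<in> ring_hom F N" and \<chi>0: "\<chi>0 \<in> ring_hom B N"
    and const: "\<And>c. c \<in> carrier F \<Longrightarrow> \<chi>0 (l (indexed_const c)) = \<iota> c"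
  obtains u where "u \<in> carrier N"
    "\<And>\<chi>. \<lbrakk>\<chi> \<in> ring_hom B (dual_ring N);
       \<And>c. c \<in> carrier F \<Longrightarrow> \<chi> (l (indexed_const c)) = (\<iota> c, \<zero>\<^bsub>N\<^esub>);
       \<And>x. x \<in> carrier B \<Longrightarrow> fst (\<chi> x) = \<chi>0 x\<rbrakk> \<Longrightarrow>
     qsum N (map \<iota> cs) (\<lambda>i. snd (\<chi> (x i))) =
       u \<otimes>\<^bsub>N\<^esub> qsum N (map \<iota> as) (\<lambda>j. snd (\<chi> (l (indexed_var j))))"
proof -
  let ?I = "{..<n + m}"
  interpret N: field N by (rule N)
  have Nc: "cring N" by (rule N.is_cring)
  interpret N2: char2_cring N by (rule char2_cring_image[OF Nc \<iota>])
  interpret P: cring "P m" by (rule P_cring)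
  interpret B: cring B by (rule B)
  interpret l: ring_hom_cring "P m" B l using P_cring B l by (intro ring_hom_cring_of)
  interpret c0: ring_hom_cring B N \<chi>0 using B Nc \<chi>0 by (intro ring_hom_cring_of)
  have \<iota>as: "set (map \<iota> cs) \<subseteq> carrier N" "set (map \<iota> as) \<subseteq> carrier N"
    using as_closed cs_closed ring_hom_closed[OF \<iota>] by auto
  let ?cas = "map (\<lambda>c. l (indexed_const c)) cs"
  have constY: "l (indexed_const c) \<in> carrier B" if "c \<in> carrier F" for c
    using that by (intro l.hom_closed) simp
  have cas: "set ?cas \<subseteq> carrier B" using constY cs_closed by auto
  have dc: "l d \<in> carrier B" using d by (rule l.hom_closed)
  let ?kas = "map indexed_const cs"
  have kas: "set ?kas \<subseteq> carrier (P m)" using cs_closed by auto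
  have "l (qsum (P m) ?kas p) = qsum B (map l ?kas) (\<lambda>i. l (p i))"
    by (rule l.hom_qsum[OF kas]) (use p in auto)
  also have "\<dots> = qsum B ?cas (\<lambda>i. l d \<otimes>\<^bsub>B\<^esub> x i)"
  proof -
    have "map l ?kas = ?cas" by simp
    moreover have "qsum B ?cas (\<lambda>i. l (p i)) = qsum B ?cas (\<lambda>i. l d \<otimes>\<^bsub>B\<^esub> x i)"
      by (rule B.qsum_cong[OF cas]) (use p x dc B.m_comm l.hom_closed in \<open>auto simp del: mpoly_ring_simps\<close>)
    ultimately show ?thesis by (simp only:)
  qed
  also have "\<dots> = l d [^]\<^bsub>B\<^esub> (2::nat) \<otimes>\<^bsub>B\<^esub> qsum B ?cas x"
    by (rule B.qsum_smult[OF cas]) (use x dc in auto)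
  finally have "l (qsum (P m) ?kas p) = \<zero>\<^bsub>B\<^esub>" using qx dc by simp
  moreover have qp: "qsum (P m) ?kas p \<in> carrier (P m)" by (rule P.qsum_closed[OF kas]) (use p in auto)
  ultimately have "qsum (P m) ?kas p \<in> PIdl\<^bsub>P m\<^esub> (q m)" using ker by blast
  \<comment> \<open>Clearing denominators turns the equation for the \<open>x_i\<close> into an
    equation between polynomials modulo the ideal; the cofactor \<open>\<sigma>\<close> makes it an
    honest equation that can be evaluated off the quadric.\<close>
  then obtain \<sigma> where \<sigma>: "\<sigma> \<in> carrier (P m)" "qsum (P m) ?kas p = \<sigma> \<otimes>\<^bsub>P m\<^esub> q m"
    by (auto simp: cgenideal_def)
  let ?\<gamma> = "\<chi>0 (l d)"
  have \<gamma>: "?\<gamma> \<in> carrier N" "?\<gamma> \<noteq> \<zero>\<^bsub>N\<^esub>"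
  proof -
    show "?\<gamma> \<in> carrier N" using dc by simp
    obtain t where "t \<in> carrier B" "l d \<otimes>\<^bsub>B\<^esub> t = \<one>\<^bsub>B\<^esub>" using dU unfolding Units_def by auto
    then have "?\<gamma> \<otimes>\<^bsub>N\<^esub> \<chi>0 t = \<one>\<^bsub>N\<^esub>" "\<chi>0 t \<in> carrier N" using dc c0.hom_mult c0.hom_one c0.hom_closed by metis+
    then show "?\<gamma> \<noteq> \<zero>\<^bsub>N\<^esub>" using N.one_not_zero by (metis N.l_null)
  qed
  have \<sigma>c: "\<chi>0 (l \<sigma>) \<in> carrier N" using \<sigma>(1) l.hom_closed c0.hom_closed by blast
  let ?\<gamma>2 = "?\<gamma> [^]\<^bsub>N\<^esub> (2::nat)"
  have \<gamma>2: "?\<gamma>2 \<in> Units N" using \<gamma> N.field_Units by (simp add: N.sq_eq N.integral_iff)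
  define u where "u = inv\<^bsub>N\<^esub> ?\<gamma>2 \<otimes>\<^bsub>N\<^esub> \<chi>0 (l \<sigma>)"
  have uc: "u \<in> carrier N" using \<gamma>2 \<sigma>c by (simp add: u_def)
  show ?thesis
  proof (rule that[OF uc])
    fix \<chi> assume \<chi>: "\<chi> \<in> ring_hom B (dual_ring N)"
      and \<chi>c: "\<And>c. c \<in> carrier F \<Longrightarrow> \<chi> (l (indexed_const c)) = (\<iota> c, \<zero>\<^bsub>N\<^esub>)"
      and \<chi>f: "\<And>x. x \<in> carrier B \<Longrightarrow> fst (\<chi> x) = \<chi>0 x"
    let ?T = "trunc3_ring N" and ?\<iota> = "\<lambda>c. (\<iota> c, \<zero>\<^bsub>N\<^esub>, \<zero>\<^bsub>N\<^esub>)"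
    let ?Q = "\<lambda>j. \<chi>0 (l (indexed_var j))" and ?w = "\<lambda>j. snd (\<chi> (l (indexed_var j)))"
    \<comment> \<open>The \<open>t^2\<close> components are set to zero; by
      \<open>qsum_trunc3\<close> they do not enter the value of the form.\<close>
    let ?y = "\<lambda>j. (?Q j, ?w j, \<zero>\<^bsub>N\<^esub>)"
    have T: "cring ?T" by (rule N.trunc3_ring_cring)
    interpret c: ring_hom_cring B "dual_ring N" \<chi>
      using B N.dual_ring_cring \<chi> by (intro ring_hom_cring_of)
    have \<iota>T: "?\<iota> \<in> ring_hom F ?T" using ring_hom_trans[OF \<iota> N.trunc3_embed_hom] by (simp add: comp_def)
    interpret hT: ring_hom_cring F ?T ?\<iota> using is_cring T \<iota>T by (intro ring_hom_cring_of)
    have varY: "l (indexed_var j) \<in> carrier B" if "j < n + m" for j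
      using that by (intro l.hom_closed) auto
    have Qw: "?Q j \<in> carrier N" "?w j \<in> carrier N" if "j < n + m" for j
      using c0.hom_closed[OF varY[OF that]] c.hom_closed[OF varY[OF that]] by auto
    have y: "?y \<in> ?I \<rightarrow> carrier ?T" using Qw by auto
    \<comment> \<open>An evaluation of polynomials only: it need not kill \<open>q\<close>, whose
      \<open>t^2\<close> term is the quantity sought, so it is not obtained from a map on
      \<open>B\<close>.\<close>
    define E where "E = hT.mpoly_eval ?I ?y"
    have Eh: "E \<in> ring_hom (P m) ?T" unfolding E_def using y by (intro hT.mpoly_eval_hom) auto
    interpret E: ring_hom_cring "P m" ?T E using P_cring T Eh by (intro ring_hom_cring_of)
    have E2: "(\<lambda>(a, b, c). (a, b)) (E r) = \<chi> (l r)" if r: "r \<in> carrier (P m)" for r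
    proof (rule mpoly_hom_eqI[OF _ _ _ _ r])
      show "(\<lambda>r. (\<lambda>(a, b, c). (a, b)) (E r)) \<in> ring_hom (P m) (dual_ring N)"
        using ring_hom_trans[OF Eh N.trunc3_dual_hom] by (simp add: comp_def)
      show "(\<lambda>r. \<chi> (l r)) \<in> ring_hom (P m) (dual_ring N)"
        using ring_hom_trans[OF l \<chi>] by (simp add: comp_def)
      show "(\<lambda>(a, b, c). (a, b)) (E (indexed_const c)) = \<chi> (l (indexed_const c))" if "c \<in> carrier F" for c
        unfolding E_def using hT.mpoly_eval_const[OF that y] \<chi>c[OF that] by simp
      show "(\<lambda>(a, b, c). (a, b)) (E (indexed_var j)) = \<chi> (l (indexed_var j))" if "j \<in> ?I" for j
        unfolding E_def using hT.mpoly_eval_var[OF _ y that] \<chi>f[OF varY[of j]] that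
        by (cases "\<chi> (l (indexed_var j))") simp
    qed
    have E1: "fst (E r) = \<chi>0 (l r)" "fst (snd (E r)) = snd (\<chi> (l r))" if "r \<in> carrier (P m)" for r
    proof -
      obtain a b c where abc: "E r = (a, b, c)" by (cases "E r")
      then have ab: "\<chi> (l r) = (a, b)" using E2[OF that] by simp
      show "fst (E r) = \<chi>0 (l r)" using \<chi>f[OF l.hom_closed[OF that]] unfolding ab abc by simp
      show "fst (snd (E r)) = snd (\<chi> (l r))" unfolding ab abc by simp
    qed
    have Eq: "E (q m) = (\<zero>\<^bsub>N\<^esub>, \<zero>\<^bsub>N\<^esub>, qsum N (map \<iota> as) ?w)"
    proof -
      have "E (q m) = qsum ?T (map ?\<iota> as) ?y" unfolding E_def by (rule mpoly_eval_q[OF T \<iota>T y])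
      also have "map ?\<iota> as = map (\<lambda>a. (a, \<zero>\<^bsub>N\<^esub>, \<zero>\<^bsub>N\<^esub>)) (map \<iota> as)" by simp
      also have "qsum ?T \<dots> ?y = (qsum N (map \<iota> as) (\<lambda>j. fst (?y j)), \<zero>\<^bsub>N\<^esub>, qsum N (map \<iota> as) (\<lambda>j. fst (snd (?y j))))"
        by (rule N2.qsum_trunc3[OF \<iota>as(2)]) (use Qw in auto)
      also have "qsum N (map \<iota> as) (\<lambda>j. fst (?y j)) = \<zero>\<^bsub>N\<^esub>"
      proof -
        have "\<chi>0 (qsum B (map (\<lambda>c. l (indexed_const c)) as) (\<lambda>j. l (indexed_var j))) =
            qsum N (map \<chi>0 (map (\<lambda>c. l (indexed_const c)) as)) ?Q"
          by (rule c0.hom_qsum) (use as_closed constY varY in auto)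
        moreover have "map \<chi>0 (map (\<lambda>c. l (indexed_const c)) as) = map \<iota> as"
          using const as_closed by (simp add: subset_iff)
        ultimately have "\<zero>\<^bsub>N\<^esub> = qsum N (map \<iota> as) ?Q" by (simp only: l_point c0.hom_zero)
        then show ?thesis by simp
      qed
      finally show ?thesis by simp
    qed
    have "E (qsum (P m) ?kas p) = qsum ?T (map E ?kas) (\<lambda>i. E (p i))"
      by (rule E.hom_qsum[OF kas]) (use p in auto)
    also have "map E ?kas = map (\<lambda>a. (a, \<zero>\<^bsub>N\<^esub>, \<zero>\<^bsub>N\<^esub>)) (map \<iota> cs)"
      unfolding E_def using hT.mpoly_eval_const[OF _ y] cs_closed by (simp add: subset_iff)
    also have "qsum ?T \<dots> (\<lambda>i. E (p i)) = (qsum N (map \<iota> cs) (\<lambda>i. fst (E (p i))), \<zero>\<^bsub>N\<^esub>,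
        qsum N (map \<iota> cs) (\<lambda>i. fst (snd (E (p i)))))"
      by (rule N2.qsum_trunc3[OF \<iota>as(1)]) (use p E.hom_closed in \<open>auto simp del: mpoly_ring_simps N.trunc3_ring_simps\<close>)
    finally have eq1: "snd (snd (E (qsum (P m) ?kas p))) = qsum N (map \<iota> cs) (\<lambda>i. fst (snd (E (p i))))" by simp
    have "E (\<sigma> \<otimes>\<^bsub>P m\<^esub> q m) = E \<sigma> \<otimes>\<^bsub>?T\<^esub> E (q m)" by (rule E.hom_mult[OF \<sigma>(1) q_closed])
    then have "snd (snd (E (\<sigma> \<otimes>\<^bsub>P m\<^esub> q m))) = \<chi>0 (l \<sigma>) \<otimes>\<^bsub>N\<^esub> qsum N (map \<iota> as) ?w"
      unfolding Eq E1(1)[OF \<sigma>(1), symmetric] using E.hom_closed[OF \<sigma>(1)] N.qsum_closed[OF \<iota>as(2), of ?w] Qw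
      by (cases "E \<sigma>") auto
    then have main: "qsum N (map \<iota> cs) (\<lambda>i. fst (snd (E (p i)))) = \<chi>0 (l \<sigma>) \<otimes>\<^bsub>N\<^esub> qsum N (map \<iota> as) ?w"
      using eq1 \<sigma>(2) by simp
    let ?P = "\<lambda>i. \<chi>0 (x i)" and ?v = "\<lambda>i. snd (\<chi> (x i))" and ?\<kappa> = "snd (\<chi> (l d))"
    have \<kappa>: "?\<kappa> \<in> carrier N" using c.hom_closed[OF dc] by simp
    have Pv: "?P i \<in> carrier N" "?v i \<in> carrier N" if "i < length cs" for i
      using c0.hom_closed[OF x[OF that]] c.hom_closed[OF x[OF that]] by auto
    \<comment> \<open>Product rule for \<open>p_i = x_i d\<close>. The part along the point
      \<open>?P\<close> contributes a multiple of the value of the form there, which is zero, so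
      only the tangent part \<open>?v\<close> survives.\<close>
    have "fst (snd (E (p i))) = ?\<kappa> \<otimes>\<^bsub>N\<^esub> ?P i \<oplus>\<^bsub>N\<^esub> ?\<gamma> \<otimes>\<^bsub>N\<^esub> ?v i" if "i < length cs" for i
    proof -
      have "fst (snd (E (p i))) = snd (\<chi> (x i \<otimes>\<^bsub>B\<^esub> l d))" using E1(2) p[OF that] by simp
      also have "\<chi> (x i \<otimes>\<^bsub>B\<^esub> l d) = \<chi> (x i) \<otimes>\<^bsub>dual_ring N\<^esub> \<chi> (l d)"
        by (rule c.hom_mult[OF x[OF that] dc])
      also have "\<chi> (x i) = (?P i, ?v i)" using \<chi>f[OF x[OF that]] by (simp add: prod_eq_iff)
      also have "\<chi> (l d) = (?\<gamma>, ?\<kappa>)" using \<chi>f[OF dc] by (simp add: prod_eq_iff)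
      finally show ?thesis using Pv[OF that] \<gamma>(1) \<kappa> by (simp add: N.m_comm)
    qed
    then have "qsum N (map \<iota> cs) (\<lambda>i. fst (snd (E (p i)))) =
        qsum N (map \<iota> cs) (\<lambda>i. ?\<kappa> \<otimes>\<^bsub>N\<^esub> ?P i \<oplus>\<^bsub>N\<^esub> ?\<gamma> \<otimes>\<^bsub>N\<^esub> ?v i)"
      by (intro N.qsum_cong[OF \<iota>as(1)]) (use Pv \<kappa> \<gamma> in auto)
    also have "\<dots> = qsum N (map \<iota> cs) (\<lambda>i. ?\<kappa> \<otimes>\<^bsub>N\<^esub> ?P i) \<oplus>\<^bsub>N\<^esub> qsum N (map \<iota> cs) (\<lambda>i. ?\<gamma> \<otimes>\<^bsub>N\<^esub> ?v i)"
      by (rule N2.qsum_add[OF \<iota>as(1)]) (use Pv \<kappa> \<gamma> in auto)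
    also have "\<dots> = ?\<kappa> [^]\<^bsub>N\<^esub> (2::nat) \<otimes>\<^bsub>N\<^esub> qsum N (map \<iota> cs) ?P \<oplus>\<^bsub>N\<^esub> ?\<gamma>2 \<otimes>\<^bsub>N\<^esub> qsum N (map \<iota> cs) ?v"
      using Pv \<kappa> \<gamma> \<iota>as(1) N.qsum_smult[of "map \<iota> cs" ?P ?\<kappa>] N.qsum_smult[of "map \<iota> cs" ?v ?\<gamma>] by simp
    also have "qsum N (map \<iota> cs) ?P = \<zero>\<^bsub>N\<^esub>"
    proof -
      have "\<chi>0 (qsum B ?cas x) = qsum N (map \<chi>0 ?cas) ?P" by (rule c0.hom_qsum[OF cas]) (use x in auto)
      moreover have "map \<chi>0 ?cas = map \<iota> cs" using const cs_closed by (simp add: subset_iff)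
      ultimately show ?thesis by (simp only: qx c0.hom_zero)
    qed
    finally have eq: "?\<gamma>2 \<otimes>\<^bsub>N\<^esub> qsum N (map \<iota> cs) ?v = \<chi>0 (l \<sigma>) \<otimes>\<^bsub>N\<^esub> qsum N (map \<iota> as) ?w"
      unfolding main using \<kappa> N.Units_closed[OF \<gamma>2] N.qsum_closed[OF \<iota>as(1), of ?v] Pv by simp
    have vc: "qsum N (map \<iota> cs) ?v \<in> carrier N" and wc: "qsum N (map \<iota> as) ?w \<in> carrier N"
      using N.qsum_closed[OF \<iota>as(1), of ?v] N.qsum_closed[OF \<iota>as(2), of ?w] Pv Qw by auto
    have "qsum N (map \<iota> cs) ?v = inv\<^bsub>N\<^esub> ?\<gamma>2 \<otimes>\<^bsub>N\<^esub> (?\<gamma>2 \<otimes>\<^bsub>N\<^esub> qsum N (map \<iota> cs) ?v)"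
      using \<gamma>2 vc N.m_assoc[of "inv\<^bsub>N\<^esub> ?\<gamma>2" ?\<gamma>2 "qsum N (map \<iota> cs) ?v"] N.Units_closed[OF \<gamma>2] by simp
    also have "\<dots> = u \<otimes>\<^bsub>N\<^esub> qsum N (map \<iota> as) ?w"
      unfolding eq u_def using \<gamma>2 \<sigma>c wc by (simp add: N.m_assoc)
    finally show "qsum N (map \<iota> cs) (\<lambda>i. snd (\<chi> (x i))) = u \<otimes>\<^bsub>N\<^esub> qsum N (map \<iota> as) ?w" .
  qed
qed

end

section \<open>Spans over the field of squares\<close>

definition qvals :: "('a, 'm) ring_scheme \<Rightarrow> 'a list \<Rightarrow> 'a set"
  where "qvals F as = {qsum F as x | x. \<forall>i<length as. x i \<in> carrier F}"

lemma (in ring) Span_mono: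
  assumes "subfield K R" "subfield M R" "K \<subseteq> M" "set Us \<subseteq> carrier R" "set Us \<subseteq> Span M Vs" "set Vs \<subseteq> carrier R"
  shows "Span K Us \<subseteq> Span M Vs"
proof (rule Span_min[OF assms(1,4) Span_is_add_subgroup[OF assms(2,6)]])
  show "K <#> set Us \<subseteq> Span M Vs"
    using assms(3,5) Span_smult_closed[OF assms(2,6)] unfolding set_mult_def by blast
qed

lemma (in ring) short_base:
  assumes K: "subfield K R" and "set Us \<subseteq> carrier R"
  shows "\<exists>Vs. independent K Vs \<and> Span K Vs = Span K Us \<and> length Vs \<le> length Us"
  using assms(2)
proof (induction Us)
  case (Cons u Us)
  then obtain Vs where Vs: "independent K Vs" "Span K Vs = Span K Us" "length Vs \<le> length Us" by auto
  show ?case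
  proof (cases "u \<in> Span K Us")
    case True
    then have "Span K (u # Us) = Span K Us"
      using Span_base_incl[OF K] mono_Span_subset[OF K]
      by (metis Cons.prems insert_subset list.simps(15) subset_antisym)
    then show ?thesis using Vs by (intro exI[of _ Vs]) simp
  next
    case False
    then have "Span K (u # Vs) = Span K (u # Us)" "independent K (u # Vs)"
      using li_Cons[of u K Vs] Cons(2) Vs by auto
    then show ?thesis using Vs(3) by (intro exI[of _ "u # Vs"]) simp
  qed
qed auto

lemma (in ring) dimension_le_of_subset:
  assumes K: "subfield K R" and d: "dimension d K E" and Vs: "set Vs \<subseteq> carrier R" and E: "E \<subseteq> Span K Vs"
  shows "d \<le> length Vs"
proof -
  obtain Us where Us: "set Us \<subseteq> carrier R" "independent K Us" "length Us = d" "Span K Us = E"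
    using exists_base[OF K d] by metis
  obtain Ws where Ws: "independent K Ws" "Span K Ws = Span K Vs" "length Ws \<le> length Vs"
    using short_base[OF K Vs] by auto
  have "set Us \<subseteq> Span K Ws" using Span_base_incl[OF K Us(1)] Us(4) E Ws(2) by blast
  then show ?thesis using independent_length_le[OF K Us(2) Ws(1)] Ws(3) Us(3) by simp
qed

lemma (in cring) combine_smult:
  assumes "set Ks \<subseteq> carrier R" "set Us \<subseteq> carrier R" "u \<in> carrier R"
  shows "combine Ks (map ((\<otimes>) u) Us) = u \<otimes> combine Ks Us"
  using assms by (induction Ks Us rule: combine.induct) (simp_all add: r_distr m_lcomm)

lemma (in cring) Span_smult:
  assumes K: "subfield K R" and "set Us \<subseteq> carrier R" "u \<in> carrier R"
  shows "Span K (map ((\<otimes>) u) Us) = (\<otimes>) u ` Span K Us"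
proof -
  have Kc: "K \<subseteq> carrier R" using subring_props(1)[OF K] .
  have Us': "set (map ((\<otimes>) u) Us) \<subseteq> carrier R" using assms by auto
  have "Span K (map ((\<otimes>) u) Us) = {combine Ks (map ((\<otimes>) u) Us) | Ks. set Ks \<subseteq> K}"
    by (rule Span_eq_combine_set[OF K Us'])
  also have "\<dots> = {u \<otimes> combine Ks Us | Ks. set Ks \<subseteq> K}"
    using combine_smult[OF _ assms(2,3)] Kc by (metis (no_types, opaque_lifting) order_trans)
  also have "\<dots> = (\<otimes>) u ` {combine Ks Us | Ks. set Ks \<subseteq> K}" by auto
  finally show ?thesis unfolding Span_eq_combine_set[OF K assms(2)] .
qed

lemma (in domain) independent_smult:
  assumes K: "subfield K R" and Us: "independent K Us" and u: "u \<in> carrier R" "u \<noteq> \<zero>"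
  shows "independent K (map ((\<otimes>) u) Us)"
proof -
  have Usc: "set Us \<subseteq> carrier R" by (rule independent_in_carrier[OF Us])
  have Us': "set (map ((\<otimes>) u) Us) \<subseteq> carrier R" using Usc u by auto
  show ?thesis
  proof (rule trivial_combine_imp_independent[OF K Us'])
    fix Ks assume Ks: "set Ks \<subseteq> K" "combine Ks (map ((\<otimes>) u) Us) = \<zero>"
    then have Ksc: "set Ks \<subseteq> carrier R" using subring_props(1)[OF K] by auto
    then have "combine Ks Us = \<zero>"
      using Ks(2) combine_smult[OF Ksc Usc u(1)] combine_in_carrier[OF Ksc Usc] u integral_iff by simp
    then show "set (take (length (map ((\<otimes>) u) Us)) Ks) \<subseteq> {\<zero>}"
      using independent_imp_trivial_combine[OF K Us Ks(1)] by simp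
  qed
qed

lemma (in domain) dimension_smult:
  assumes K: "subfield K R" and "dimension e K E" and u: "u \<in> carrier R" "u \<noteq> \<zero>"
  shows "dimension e K ((\<otimes>) u ` E)"
proof -
  obtain Us where Us: "set Us \<subseteq> carrier R" "independent K Us" "length Us = e" "Span K Us = E"
    using exists_base[OF K assms(2)] by metis
  show ?thesis
    using dimension_independent[OF independent_smult[OF K Us(2) u]] Us Span_smult[OF K Us(1) u(1)] by simp
qed

section \<open>Tensor products and quasi-Pfister forms as spans over the squares\<close>

context cring
begin

lemma tensor_coeffs_closed:
  "set cs \<subseteq> carrier R \<Longrightarrow> set vs \<subseteq> carrier R \<Longrightarrow> set (tensor_coeffs R cs vs) \<subseteq> carrier R"
  unfolding tensor_coeffs_def by auto

lemma length_tensor_coeffs: "length (tensor_coeffs R cs vs) = length cs * length vs"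
  unfolding tensor_coeffs_def by (induction cs) auto

text \<open>Each coefficient in the field spanned by \<open>cs\<close> is itself a combination of
  \<open>cs\<close>, so the products \<open>c v\<close> suffice over \<open>K\<close>. Applied to
  the value field of a quasi-Pfister form, this makes the value set of a tensor product a vector
  space over that field.\<close>

lemma Span_tensor_coeffs:
  assumes K: "subfield K R" and M: "subfield (Span K cs) R" and "K \<subseteq> Span K cs"
    and cs: "set cs \<subseteq> carrier R" and vs: "set vs \<subseteq> carrier R"
  shows "Span K (tensor_coeffs R cs vs) = Span (Span K cs) vs"
proof
  let ?T = "tensor_coeffs R cs vs"
  have T: "set ?T \<subseteq> carrier R" by (rule tensor_coeffs_closed[OF cs vs])
  have sT: "set ?T = {c \<otimes> v | c v. c \<in> set cs \<and> v \<in> set vs}" unfolding tensor_coeffs_def by auto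
  show "Span K ?T \<subseteq> Span (Span K cs) vs"
  proof (rule Span_mono[OF K M assms(3) T _ vs])
    show "set ?T \<subseteq> Span (Span K cs) vs"
    proof
      fix t assume "t \<in> set ?T"
      then obtain c v where cv: "t = c \<otimes> v" "c \<in> set cs" "v \<in> set vs" unfolding sT by blast
      have "c \<in> Span K cs" "v \<in> Span (Span K cs) vs"
        using cv Span_base_incl[OF K cs] Span_base_incl[OF M vs] by auto
      then show "t \<in> Span (Span K cs) vs" unfolding cv(1) by (rule Span_smult_closed[OF M vs])
    qed
  qed
  show "Span (Span K cs) vs \<subseteq> Span K ?T"
  proof (rule Span_min[OF M vs Span_is_add_subgroup[OF K T]])
    have "m \<otimes> v \<in> Span K ?T" if m: "m \<in> Span K cs" and v: "v \<in> set vs" for m v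
    proof -
      have vc: "v \<in> carrier R" using v vs by blast
      have "v \<otimes> m \<in> Span K (map ((\<otimes>) v) cs)" using m Span_smult[OF K cs vc] by blast
      moreover have "Span K (map ((\<otimes>) v) cs) \<subseteq> Span K ?T"
      proof (rule Span_mono[OF K K order.refl _ _ T])
        show "set (map ((\<otimes>) v) cs) \<subseteq> carrier R" using vc cs by auto
        show "set (map ((\<otimes>) v) cs) \<subseteq> Span K ?T"
        proof
          fix t assume "t \<in> set (map ((\<otimes>) v) cs)"
          then obtain c where c: "t = v \<otimes> c" "c \<in> set cs" by auto
          then have "t = c \<otimes> v" using m_comm[OF vc] cs by auto
          then have "t \<in> set ?T" unfolding sT using c(2) v by blast
          then show "t \<in> Span K ?T" using Span_base_incl[OF K T] by blast
        qed
      qed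
      moreover have "m \<in> carrier R" using Span_subgroup_props(1)[OF K cs] m by blast
      ultimately show ?thesis using m_comm[OF vc, of m] by (simp del: Span.simps) blast
    qed
    then show "Span K cs <#> set vs \<subseteq> Span K ?T" unfolding set_mult_def by auto
  qed
qed

lemma pfister_coeffs_closed: "set cs \<subseteq> carrier R \<Longrightarrow> set (pfister_coeffs R cs) \<subseteq> carrier R"
  by (induction cs) (auto simp: tensor_coeffs_def)

lemma length_pfister_coeffs: "length (pfister_coeffs R cs) = 2 ^ length cs"
  by (induction cs) (simp_all add: length_tensor_coeffs)

lemma pfister_coeffs_Cons:
  assumes "set cs \<subseteq> carrier R"
  shows "pfister_coeffs R (c # cs) = pfister_coeffs R cs @ map ((\<otimes>) c) (pfister_coeffs R cs)"
proof -
  have "map ((\<otimes>) \<one>) (pfister_coeffs R cs) = pfister_coeffs R cs"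
    using pfister_coeffs_closed[OF assms] by (intro map_idI) auto
  then show ?thesis by (simp add: tensor_coeffs_def)
qed

end

context char2_field
begin

abbreviation "sq \<equiv> squares R"
abbreviation "pf \<equiv> pfister_coeffs R"

lemma squares_subfield: "subfield sq R"
proof -
  interpret fr: ring_hom_ring R R "\<lambda>a. a [^] (2::nat)"
    using frobenius_hom by (intro ring_hom_ringI2) (simp_all add: ring_axioms)
  have "subfield ((\<lambda>a. a [^] (2::nat)) ` carrier R) R"
    using carrier_is_subfield one_not_zero by (intro fr.img_is_subfield(2)) auto
  moreover have "(\<lambda>a. a [^] (2::nat)) ` carrier R = sq" unfolding squares_def by auto
  ultimately show ?thesis by simp
qed

lemma squares_closed: "sq \<subseteq> carrier R" unfolding squares_def by auto

lemma squareI: "a \<in> carrier R \<Longrightarrow> a [^] (2::nat) \<in> sq" unfolding squares_def by auto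

lemma qsum_Cons:
  assumes "a \<in> carrier R" "set as \<subseteq> carrier R" "\<And>i. i < Suc (length as) \<Longrightarrow> x i \<in> carrier R"
  shows "qsum R (a # as) x = x 0 [^] (2::nat) \<otimes> a \<oplus> qsum R as (\<lambda>i. x (Suc i))"
proof -
  have as: "as ! i \<in> carrier R" if "i < length as" for i using assms(2) that by (auto simp: subset_iff)
  have "{..<length (a # as)} = insert 0 (Suc ` {..<length as})"
    by (auto simp: image_iff less_Suc_eq_0_disj)
  then have "qsum R (a # as) x = (\<Oplus>i\<in>insert 0 (Suc ` {..<length as}). (a # as) ! i \<otimes> x i [^] (2::nat))"
    by (simp only: qsum_def)
  also have "\<dots> = a \<otimes> x 0 [^] (2::nat) \<oplus> (\<Oplus>i\<in>Suc ` {..<length as}. (a # as) ! i \<otimes> x i [^] (2::nat))"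
    using assms as by (subst finsum_insert) auto
  also have "(\<Oplus>i\<in>Suc ` {..<length as}. (a # as) ! i \<otimes> x i [^] (2::nat)) = qsum R as (\<lambda>i. x (Suc i))"
    unfolding qsum_def using assms as by (subst finsum_reindex) auto
  finally show ?thesis using assms by (simp add: m_comm)
qed

text \<open>The scalars from the field of squares are exactly the possible \<open>x_i^2\<close>, so
  a value of the form is the same as a linear combination of its coefficients.\<close>

lemma qvals_eq_Span:
  assumes "set as \<subseteq> carrier R"
  shows "qvals R as = Span sq as"
  using assms
proof (induction as)
  case Nil
  then show ?case by (auto simp: qvals_def qsum_def)
next
  case (Cons a as)
  have "qvals R (a # as) = line_extension sq a (qvals R as)"
  proof
    show "qvals R (a # as) \<subseteq> line_extension sq a (qvals R as)"
    proof
      fix y assume "y \<in> qvals R (a # as)"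
      then obtain x where x: "y = qsum R (a # as) x" "\<forall>i<Suc (length as). x i \<in> carrier R"
        by (auto simp: qvals_def)
      then have "y = x 0 [^] (2::nat) \<otimes> a \<oplus> qsum R as (\<lambda>i. x (Suc i))" using Cons by (simp add: qsum_Cons)
      moreover have "qsum R as (\<lambda>i. x (Suc i)) \<in> qvals R as" unfolding qvals_def using x by auto
      ultimately show "y \<in> line_extension sq a (qvals R as)"
        using x squareI[of "x 0"] unfolding line_extension_mem_iff by blast
    qed
    show "line_extension sq a (qvals R as) \<subseteq> qvals R (a # as)"
    proof
      fix y assume "y \<in> line_extension sq a (qvals R as)"
      then obtain k v where kv: "k \<in> sq" "v \<in> qvals R as" "y = k \<otimes> a \<oplus> v"
        unfolding line_extension_mem_iff by blast
      then obtain t x where tx: "t \<in> carrier R" "k = t [^] (2::nat)" "v = qsum R as x" "\<forall>i<length as. x i \<in> carrier R"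
        by (auto simp: squares_def qvals_def)
      let ?x = "case_nat t x"
      have x': "?x i \<in> carrier R" if "i < Suc (length as)" for i using tx that by (cases i) auto
      then have "qsum R (a # as) ?x = y" using qsum_Cons[of a as ?x] Cons tx kv by simp
      then show "y \<in> qvals R (a # as)" unfolding qvals_def using x' by auto
    qed
  qed
  then show ?case using Cons by simp
qed

lemma Span_pf_Cons:
  assumes "c \<in> carrier R" "set cs \<subseteq> carrier R"
  shows "Span sq (pf (c # cs)) = {x \<oplus> c \<otimes> y | x y. x \<in> Span sq (pf cs) \<and> y \<in> Span sq (pf cs)}"
proof -
  note pc = pfister_coeffs_closed[OF assms(2)]
  have m: "set (map ((\<otimes>) c) (pf cs)) \<subseteq> carrier R" using pc assms by auto
  have "Span sq (pf (c # cs)) = Span sq (pf cs) <+>\<^bsub>R\<^esub> (\<otimes>) c ` Span sq (pf cs)"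
    unfolding pfister_coeffs_Cons[OF assms(2)] Span_append_eq_set_add[OF squares_subfield pc m]
      Span_smult[OF squares_subfield pc assms(1)] ..
  then show ?thesis unfolding set_add_def' by auto
qed

text \<open>The span contains the square of each of its elements, so \<open>x\<^sup>-\<^sup>1 = x \<cdot> (x\<^sup>-\<^sup>1)\<^sup>2\<close> reduces
  closure under inverses to closure under products.\<close>

lemma Span_pf_field:
  assumes "set cs \<subseteq> carrier R"
  shows "subfield (Span sq (pf cs)) R" and "sq \<subseteq> Span sq (pf cs)" and "set cs \<subseteq> Span sq (pf cs)"
proof -
  have main: "sq \<subseteq> Span sq (pf cs) \<and> set cs \<subseteq> Span sq (pf cs) \<and>
      (\<forall>x\<in>Span sq (pf cs). \<forall>y\<in>Span sq (pf cs). x \<otimes> y \<in> Span sq (pf cs))"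
    using assms
  proof (induction cs)
    case Nil
    have "Span sq [\<one>] = sq"
      using squares_closed subring_props(2)[OF squares_subfield] by (auto simp: line_extension_mem_iff subset_iff)
    then show ?case using subring_props(6)[OF squares_subfield] by simp
  next
    case (Cons c cs)
    let ?S = "Span sq (pf cs)"
    have c: "c \<in> carrier R" and cs: "set cs \<subseteq> carrier R" using Cons.prems by auto
    note pc = pfister_coeffs_closed[OF cs]
    note Sp = Span_subgroup_props[OF squares_subfield pc]
    note eq = Span_pf_Cons[OF c cs]
    have IH: "sq \<subseteq> ?S" "set cs \<subseteq> ?S" "\<And>x y. x \<in> ?S \<Longrightarrow> y \<in> ?S \<Longrightarrow> x \<otimes> y \<in> ?S"
      using Cons.IH[OF cs] by auto
    have one: "\<one> \<in> ?S" using IH(1) subring_props(3)[OF squares_subfield] by auto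
    have Sc: "\<And>x. x \<in> ?S \<Longrightarrow> x \<in> carrier R" using Sp(1) by auto
    have sub: "?S \<subseteq> Span sq (pf (c # cs))"
    proof
      fix x assume "x \<in> ?S"
      then have "x = x \<oplus> c \<otimes> \<zero>" using c Sc by simp
      then show "x \<in> Span sq (pf (c # cs))" unfolding eq using \<open>x \<in> ?S\<close> Sp(2) by blast
    qed
    have "c = \<zero> \<oplus> c \<otimes> \<one>" using c by simp
    then have "c \<in> Span sq (pf (c # cs))" unfolding eq using Sp(2) one by blast
    moreover have "x \<otimes> y \<in> Span sq (pf (c # cs))"
      if xy: "x \<in> Span sq (pf (c # cs))" "y \<in> Span sq (pf (c # cs))" for x y
    proof -
      obtain a b a' b' where ab: "x = a \<oplus> c \<otimes> b" "y = a' \<oplus> c \<otimes> b'" "a \<in> ?S" "b \<in> ?S" "a' \<in> ?S" "b' \<in> ?S"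
        using xy unfolding eq by blast
      \<comment> \<open>As \<open>c^2\<close> is a square, hence a scalar, the product of two
        elements \<open>a + c b\<close> has this shape again.\<close>
      have "x \<otimes> y = (a \<otimes> a' \<oplus> c [^] (2::nat) \<otimes> (b \<otimes> b')) \<oplus> c \<otimes> (a \<otimes> b' \<oplus> b \<otimes> a')"
        unfolding ab(1,2) using ab(3-6)[THEN Sc] c by (simp add: sq_eq l_distr r_distr m_ac a_ac)
      moreover have "a \<otimes> a' \<oplus> c [^] (2::nat) \<otimes> (b \<otimes> b') \<in> ?S" "a \<otimes> b' \<oplus> b \<otimes> a' \<in> ?S"
        using ab(3-6) Sp(3) IH squareI[OF c] by auto
      ultimately show ?thesis unfolding eq by blast
    qed
    ultimately show ?case using sub IH by auto
  qed
  show 1: "sq \<subseteq> Span sq (pf cs)" and "set cs \<subseteq> Span sq (pf cs)" using main by auto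
  note pc = pfister_coeffs_closed[OF assms]
  note Sp = Span_subgroup_props[OF squares_subfield pc]
  have one: "\<one> \<in> Span sq (pf cs)" using 1 subring_props(3)[OF squares_subfield] by auto
  have sr: "subring (Span sq (pf cs)) R"
    using Sp one main by (intro subringI) auto
  show "subfield (Span sq (pf cs)) R"
  proof (rule subfieldI'[OF sr])
    fix x assume x: "x \<in> Span sq (pf cs) - {\<zero>}"
    then have xc: "x \<in> carrier R" "x \<noteq> \<zero>" "x \<in> Units R" using Sp(1) field_Units by auto
    have "inv x = x \<otimes> (inv x) [^] (2::nat)"
      using xc m_assoc[of x "inv x" "inv x"] by (simp add: sq_eq)
    also have "\<dots> \<in> Span sq (pf cs)"
      using main x 1 squareI[of "inv x"] xc by auto
    finally show "inv x \<in> Span sq (pf cs)" .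
  qed
qed

text \<open>Let \<open>M\<close> be the field spanned by \<open>pf cs\<close>. A nonzero common
  element of \<open>M\<close> and \<open>c M\<close> would put \<open>c\<close> into
  \<open>M\<close> by division, so the sum of \<open>M\<close> and \<open>c M\<close> is
  direct.\<close>

lemma independent_pf_Cons:
  assumes cs: "set cs \<subseteq> carrier R" "independent sq (pf cs)" and c: "c \<in> carrier R" "c \<notin> Span sq (pf cs)"
  shows "independent sq (pf (c # cs))"
proof -
  note pc = pfister_coeffs_closed[OF cs(1)]
  note K = squares_subfield and M = Span_pf_field[OF cs(1)]
  have cnz: "c \<noteq> \<zero>" using c Span_subgroup_props(2)[OF K pc] by auto
  have "Span sq (pf cs) \<inter> (\<otimes>) c ` Span sq (pf cs) = {\<zero>}"
  proof
    show "Span sq (pf cs) \<inter> (\<otimes>) c ` Span sq (pf cs) \<subseteq> {\<zero>}"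
    proof
      fix x assume "x \<in> Span sq (pf cs) \<inter> (\<otimes>) c ` Span sq (pf cs)"
      then obtain y where y: "x \<in> Span sq (pf cs)" "y \<in> Span sq (pf cs)" "x = c \<otimes> y" by auto
      have yc: "y \<in> carrier R" using y(2) Span_subgroup_props(1)[OF K pc] by auto
      have "y = \<zero>"
      proof (rule ccontr)
        assume "y \<noteq> \<zero>"
        then have yU: "y \<in> Units R" "inv y \<in> Span sq (pf cs)"
          using y(2) yc field_Units subfield_m_inv(1)[OF M(1), of y] by auto
        have "c = x \<otimes> inv y" unfolding y(3) using c(1) yc yU by (simp add: m_assoc)
        then have "c \<in> Span sq (pf cs)" using y(1) yU subring_props(6)[OF M(1)] by simp
        then show False using c(2) by blast
      qed
      then show "x \<in> {\<zero>}" using y(3) c(1) by simp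
    qed
    have "\<zero> = c \<otimes> \<zero>" using c(1) by simp
    then show "{\<zero>} \<subseteq> Span sq (pf cs) \<inter> (\<otimes>) c ` Span sq (pf cs)"
      using Span_subgroup_props(2)[OF K pc] by blast
  qed
  then show ?thesis
    unfolding pfister_coeffs_Cons[OF cs(1)]
    using independent_append[OF K cs(2) independent_smult[OF K cs(2) c(1) cnz]] Span_smult[OF K pc c(1)] by simp
qed

text \<open>Independence over the squares is anisotropy: the scalars are squares, and a square
  vanishes only with its root.\<close>

lemma independent_iff_qsum:
  assumes as: "set as \<subseteq> carrier R"
  shows "independent sq as \<longleftrightarrow> (\<forall>x. (\<forall>i<length as. x i \<in> carrier R) \<longrightarrow> qsum R as x = \<zero> \<longrightarrow> (\<forall>i<length as. x i = \<zero>))"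
proof -
  have comb: "combine (map (\<lambda>i. x i [^] (2::nat)) [0..<length as]) as = qsum R as x"
    if "set as \<subseteq> carrier R" "\<And>i. i < length as \<Longrightarrow> x i \<in> carrier R" for x as
    using that
  proof (induction as arbitrary: x)
    case (Cons a as)
    have "map (\<lambda>i. x i [^] (2::nat)) [0..<length (a # as)] =
        x 0 [^] (2::nat) # map (\<lambda>i. x (Suc i) [^] (2::nat)) [0..<length as]"
      by (simp add: upt_conv_Cons map_Suc_upt[symmetric] del: upt_Suc)
    then show ?case using Cons.IH[of "\<lambda>i. x (Suc i)"] Cons.prems qsum_Cons[of a as x] by simp
  qed (simp add: qsum_def)
  have sq0: "t [^] (2::nat) = \<zero> \<longleftrightarrow> t = \<zero>" if "t \<in> carrier R" for t using that by (simp add: sq_eq integral_iff)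
  show ?thesis
  proof (intro iffI allI impI)
    fix x i assume ind: "independent sq as" and x: "\<forall>i<length as. x i \<in> carrier R" "qsum R as x = \<zero>" and i: "i < length as"
    let ?K = "map (\<lambda>i. x i [^] (2::nat)) [0..<length as]"
    have "set (take (length as) ?K) \<subseteq> {\<zero>}"
      using x comb[OF as, of x] squareI by (intro independent_imp_trivial_combine[OF squares_subfield ind]) auto
    then have "x i [^] (2::nat) = \<zero>" using i by (simp add: image_subset_iff)
    then show "x i = \<zero>" using sq0 x i by blast
  next
    assume triv: "\<forall>x. (\<forall>i<length as. x i \<in> carrier R) \<longrightarrow> qsum R as x = \<zero> \<longrightarrow> (\<forall>i<length as. x i = \<zero>)"
    show "independent sq as"
      using as triv
    proof (induction as)
      case (Cons a as)
      have a: "a \<in> carrier R" and as': "set as \<subseteq> carrier R" using Cons.prems by auto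
      have "independent sq as"
      proof (rule Cons.IH[OF as'], intro allI impI)
        fix x i assume x: "\<forall>i<length as. x i \<in> carrier R" "qsum R as x = \<zero>" and i: "i < length as"
        define y where "y = case_nat \<zero> x"
        have y: "y 0 = \<zero>" "\<And>i. y (Suc i) = x i" by (simp_all add: y_def)
        have c: "y i \<in> carrier R" if "i < Suc (length as)" for i using x y that by (cases i) auto
        have "qsum R (a # as) y = \<zero>" using qsum_Cons[OF a as', of y] c x a y by (simp add: sq_eq)
        then have "y (Suc i) = \<zero>" using Cons.prems(2)[rule_format, of y "Suc i"] c i by simp
        then show "x i = \<zero>" using y by simp
      qed
      moreover have "a \<notin> Span sq as"
      proof
        assume "a \<in> Span sq as"
        then obtain x where x: "a = qsum R as x" "\<forall>i<length as. x i \<in> carrier R"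
          unfolding qvals_eq_Span[OF as', symmetric] qvals_def by auto
        define y where "y = case_nat \<one> x"
        have y: "y 0 = \<one>" "\<And>i. y (Suc i) = x i" by (simp_all add: y_def)
        have c: "y i \<in> carrier R" if "i < Suc (length as)" for i using x y that by (cases i) auto
        have "qsum R (a # as) y = \<zero>" using qsum_Cons[OF a as', of y] c x(1)[symmetric] a y by simp
        then have "y 0 = \<zero>" using Cons.prems(2)[rule_format, of y 0] c by simp
        then show False using y by simp
      qed
      ultimately show ?case using a by (intro li_Cons)
    qed simp
  qed
qed

lemma Span_over_extension:
  assumes M: "subfield M R" "sq \<subseteq> M" and as: "set as \<subseteq> carrier R" and bs: "set bs \<subseteq> carrier R"
    and eq: "Span sq as = Span sq bs"
  shows "Span M as = Span M bs"
proof -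
  have *: "Span M as \<subseteq> Span M bs" if "set as \<subseteq> carrier R" "set bs \<subseteq> carrier R" "Span sq as = Span sq bs" for as bs
  proof (rule Span_mono[OF M(1) M(1) order.refl that(1) _ that(2)])
    have "set as \<subseteq> Span sq bs" using Span_base_incl[OF squares_subfield that(1)] that(3) by simp
    also have "\<dots> \<subseteq> Span M bs"
      using that(2) by (intro Span_mono[OF squares_subfield M] Span_base_incl[OF M(1)])
    finally show "set as \<subseteq> Span M bs" .
  qed
  show ?thesis by (rule subset_antisym[OF *[OF as bs eq] *[OF bs as eq[symmetric]]])
qed

text \<open>Similarity of spans over the squares persists over the larger field \<open>M\<close>,
  and multiplication by \<open>u\<close> is an isomorphism of \<open>M\<close>-spaces.\<close>

lemma dimension_Span_similar:
  assumes M: "subfield M R" "sq \<subseteq> M" and as: "set as \<subseteq> carrier R" and bs: "set bs \<subseteq> carrier R"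
    and u: "u \<in> carrier R" "u \<noteq> \<zero>" and eq: "Span sq as = (\<otimes>) u ` Span sq bs"
    and d: "dimension e M (Span M as)"
  shows "dimension e M (Span M bs)"
proof -
  have ubs: "set (map ((\<otimes>) u) bs) \<subseteq> carrier R" using bs u by auto
  have "Span sq as = Span sq (map ((\<otimes>) u) bs)" using eq Span_smult[OF squares_subfield bs u(1)] by simp
  then have "Span M as = (\<otimes>) u ` Span M bs"
    using Span_over_extension[OF M as ubs] Span_smult[OF M(1) bs u(1)] by simp
  then have "(\<otimes>) (inv u) ` Span M as = (\<lambda>x. inv u \<otimes> (u \<otimes> x)) ` Span M bs" by (simp add: image_image)
  also have "\<dots> = id ` Span M bs"
  proof (rule image_cong[OF refl])
    fix x assume "x \<in> Span M bs"
    then have "x \<in> carrier R" using Span_subgroup_props(1)[OF M(1) bs] by blast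
    then show "inv u \<otimes> (u \<otimes> x) = id x"
      using u field_Units m_assoc[of "inv u" u x] by simp
  qed
  finally have "(\<otimes>) (inv u) ` Span M as = Span M bs" by simp
  moreover have "inv u \<in> carrier R" "inv u \<noteq> \<zero>" using u field_Units nonzero_imp_inverse_nonzero by auto
  ultimately show ?thesis using dimension_smult[OF M(1) d] by metis
qed

text \<open>An element that already lies in the field generated so far is dropped, so the number of
  generators can only fall.\<close>

lemma exists_independent_pf:
  assumes "set cs \<subseteq> carrier R"
  shows "\<exists>ds. set ds \<subseteq> carrier R \<and> length ds \<le> length cs \<and> independent sq (pf ds) \<and> Span sq (pf cs) \<subseteq> Span sq (pf ds)"
  using assms
proof (induction cs)
  case Nil
  have "independent sq [\<one>]" by (intro li_Cons li_Nil) auto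
  then show ?case by (intro exI[of _ "[]"]) simp
next
  case (Cons c cs)
  then obtain ds where ds: "set ds \<subseteq> carrier R" "length ds \<le> length cs" "independent sq (pf ds)" "Span sq (pf cs) \<subseteq> Span sq (pf ds)"
    by auto
  have c: "c \<in> carrier R" "set cs \<subseteq> carrier R" using Cons.prems by auto
  note pd = pfister_coeffs_closed[OF ds(1)]
  note M = Span_pf_field[OF ds(1)]
  show ?case
  proof (cases "c \<in> Span sq (pf ds)")
    case True
    have "Span sq (pf (c # cs)) \<subseteq> Span sq (pf ds)"
    proof
      fix x assume "x \<in> Span sq (pf (c # cs))"
      then obtain y z where "x = y \<oplus> c \<otimes> z" "y \<in> Span sq (pf ds)" "z \<in> Span sq (pf ds)"
        unfolding Span_pf_Cons[OF c] using ds(4) by blast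
      then show "x \<in> Span sq (pf ds)" using True subring_props(6,7)[OF M(1)] by simp
    qed
    then show ?thesis using ds by (intro exI[of _ ds]) simp
  next
    case False
    have "Span sq (pf (c # cs)) \<subseteq> Span sq (pf (c # ds))"
      unfolding Span_pf_Cons[OF c] Span_pf_Cons[OF c(1) ds(1)] using ds(4) by blast
    then show ?thesis using ds c independent_pf_Cons[OF ds(1,3) c(1) False] by (intro exI[of _ "c # ds"]) simp
  qed
qed

text \<open>Redundant elements are discarded, then elements outside the generated field are adjoined
  until the length is \<open>r\<close> again. The hypothesis \<open>proper\<close> supplies them:
  fewer than \<open>r\<close> elements never generate the whole field.\<close>

lemma exists_independent_pf_length:
  assumes cs: "set cs \<subseteq> carrier R" "length cs = r"
    and proper: "\<And>ds. set ds \<subseteq> carrier R \<Longrightarrow> length ds < r \<Longrightarrow> Span sq (pf ds) \<noteq> carrier R"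
  shows "\<exists>ds. set ds \<subseteq> carrier R \<and> length ds = r \<and> independent sq (pf ds) \<and> Span sq (pf cs) \<subseteq> Span sq (pf ds)"
proof -
  have "\<exists>ds. set ds \<subseteq> carrier R \<and> length ds = k \<and> independent sq (pf ds) \<and> Span sq (pf es) \<subseteq> Span sq (pf ds)"
    if "length es + j = k" "k \<le> r" "set es \<subseteq> carrier R" "independent sq (pf es)" for es k j
    using that(1,2)
  proof (induction j arbitrary: k)
    case 0
    then show ?case using that(3,4) by (intro exI[of _ es]) simp
  next
    case (Suc j)
    then obtain ds where ds: "set ds \<subseteq> carrier R" "length ds = length es + j" "independent sq (pf ds)" "Span sq (pf es) \<subseteq> Span sq (pf ds)"
      using Suc.IH[OF refl] by auto
    have "Span sq (pf ds) \<noteq> carrier R" using proper[OF ds(1)] ds(2) Suc.prems by simp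
    then obtain c where c: "c \<in> carrier R" "c \<notin> Span sq (pf ds)"
      using Span_subgroup_props(1)[OF squares_subfield pfister_coeffs_closed[OF ds(1)]] by blast
    note pd = pfister_coeffs_closed[OF ds(1)]
    have "Span sq (pf ds) \<subseteq> Span sq (pf (c # ds))"
    proof (rule Span_mono[OF squares_subfield squares_subfield order.refl pd _ pfister_coeffs_closed])
      have "set (pf ds) \<subseteq> set (pf (c # ds))" by (simp add: pfister_coeffs_Cons[OF ds(1)] del: pfister_coeffs.simps)
      then show "set (pf ds) \<subseteq> Span sq (pf (c # ds))"
        using Span_base_incl[OF squares_subfield pfister_coeffs_closed[of "c # ds"]] c ds by auto
      show "set (c # ds) \<subseteq> carrier R" using c ds by auto
    qed
    then have "Span sq (pf es) \<subseteq> Span sq (pf (c # ds))" using ds(4) by (rule order.trans[rotated])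
    then show ?case
      using ds(1,2) c(1) Suc.prems(1) independent_pf_Cons[OF ds(1,3) c]
      by (intro exI[of _ "c # ds"] conjI) simp_all
  qed
  moreover obtain es where es: "set es \<subseteq> carrier R" "length es \<le> r" "independent sq (pf es)" "Span sq (pf cs) \<subseteq> Span sq (pf es)"
    using exists_independent_pf[OF cs(1)] cs(2) by auto
  ultimately obtain ds where "set ds \<subseteq> carrier R" "length ds = r" "independent sq (pf ds)" "Span sq (pf es) \<subseteq> Span sq (pf ds)"
    using le_add_diff_inverse[OF es(2)] by blast
  then show ?thesis using order.trans[OF es(4)] by blast
qed

end

section \<open>Charts of the quadric and isomorphisms between them\<close>

context quasilinear_coeffs
begin

text \<open>Both the rings \<open>A\<^sub>f\<close> and the function field are charts.\<close>

definition chart :: "nat \<Rightarrow> ('r, 'k) ring_scheme \<Rightarrow> ((nat multiset \<Rightarrow> 'a) \<Rightarrow> 'r) \<Rightarrow> bool"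
  where "chart m B l \<longleftrightarrow> cring B \<and> l \<in> ring_hom (P m) B \<and>
    (\<forall>p\<in>carrier (P m). l p = \<zero>\<^bsub>B\<^esub> \<longleftrightarrow> p \<in> PIdl\<^bsub>P m\<^esub> (q m)) \<and>
    (\<forall>N x. (\<forall>i<(N::nat). x i \<in> carrier B) \<longrightarrow>
      (\<exists>d\<in>carrier (P m). l d \<in> Units B \<and> (\<forall>i<N. \<exists>p\<in>carrier (P m). x i \<otimes>\<^bsub>B\<^esub> l d = l p)))"

lemma Af_chart:
  assumes f: "f \<in> carrier (A m)" "f \<noteq> \<zero>\<^bsub>A m\<^esub>"
  shows "chart m (Af m f) (lc m f)"
proof -
  note ms = Af_mult_subset[OF f(1)]
  have "\<exists>d\<in>carrier (P m). lc m f d \<in> Units (Af m f) \<and>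
      (\<forall>i<N. \<exists>p\<in>carrier (P m). x i \<otimes>\<^bsub>Af m f\<^esub> lc m f d = lc m f p)"
    if x: "\<forall>i<N. x i \<in> carrier (Af m f)" for N :: nat and x
  proof -
    obtain s where s: "s \<in> powers (A m) f"
      "\<forall>i\<in>{..<N}. \<exists>a\<in>carrier (A m). x i \<otimes>\<^bsub>Af m f\<^esub> loc_frac (A m) (powers (A m) f) s \<one>\<^bsub>A m\<^esub> =
         loc_frac (A m) (powers (A m) f) a \<one>\<^bsub>A m\<^esub>"
      using mult_subset.common_denominator[OF ms, of "{..<N}" x] x by blast
    obtain d where d: "d \<in> carrier (P m)" "s = cls m d" using powers_repr[OF f(1) s(1)] by blast
    have "\<exists>p\<in>carrier (P m). x i \<otimes>\<^bsub>Af m f\<^esub> lc m f d = lc m f p" if i: "i < N" for i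
    proof -
      obtain a where a: "a \<in> carrier (A m)" "x i \<otimes>\<^bsub>Af m f\<^esub> loc_frac (A m) (powers (A m) f) s \<one>\<^bsub>A m\<^esub> =
         loc_frac (A m) (powers (A m) f) a \<one>\<^bsub>A m\<^esub>" using s(2) i by blast
      obtain p where p: "p \<in> carrier (P m)" "a = cls m p" using A_repr[OF a(1)] by blast
      show ?thesis using a(2) p(1) unfolding d(2) p(2) by (rule bexI)
    qed
    moreover have "lc m f d \<in> Units (Af m f)" using lc_denom_Unit[OF f(1) s(1)] unfolding d(2) .
    ultimately show ?thesis using d(1) by blast
  qed
  then show ?thesis
    unfolding chart_def using Af_cring[OF f(1)] lc_hom[OF f(1)] lc_eq_zero_iff[OF f] by blast
qed

text \<open>\<open>q\<close> lies in its own ideal, hence in the kernel of \<open>l\<close>, and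
  \<open>l\<close> commutes with the sum defining \<open>q\<close>.\<close>

lemma chart_point:
  assumes "chart m B l"
  shows "qsum B (map (\<lambda>c. l (indexed_const c)) as) (\<lambda>i. l (indexed_var i)) = \<zero>\<^bsub>B\<^esub>"
proof -
  have B: "cring B" and l: "l \<in> ring_hom (P m) B"
    and ker: "\<And>p. p \<in> carrier (P m) \<Longrightarrow> l p = \<zero>\<^bsub>B\<^esub> \<longleftrightarrow> p \<in> PIdl\<^bsub>P m\<^esub> (q m)"
    using assms unfolding chart_def by auto
  interpret P: cring "P m" by (rule P_cring)
  interpret h: ring_hom_cring "P m" B l using P_cring B l by (intro ring_hom_cring_of)
  have "l (q m) = \<zero>\<^bsub>B\<^esub>" using ker[OF q_closed] P.cgenideal_self[OF q_closed] by blast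
  moreover have "l (qsum (P m) (map indexed_const as) indexed_var) =
      qsum B (map l (map indexed_const as)) (\<lambda>i. l (indexed_var i))"
    by (rule h.hom_qsum) (use as_closed in auto)
  ultimately show ?thesis by (simp add: comp_def q_eq[symmetric])
qed

text \<open>At every \<open>N\<close>-point of the chart compatible with \<open>\<iota>\<close>,
  every vector of the ambient space is tangent. Isolated as a property of the chart so that
  \<open>similar_charts\<close> can demand it on both sides.\<close>

definition dual_lifts where
  "dual_lifts m B l N \<iota> \<longleftrightarrow> (\<forall>\<chi>0\<in>ring_hom B N. \<forall>w.
    (\<forall>c\<in>carrier F. \<chi>0 (l (indexed_const c)) = \<iota> c) \<longrightarrow> (\<forall>i<n + m. w i \<in> carrier N) \<longrightarrow>
    (\<exists>\<chi>\<in>ring_hom B (dual_ring N). (\<forall>c\<in>carrier F. \<chi> (l (indexed_const c)) = (\<iota> c, \<zero>\<^bsub>N\<^esub>)) \<and>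
      (\<forall>x\<in>carrier B. fst (\<chi> x) = \<chi>0 x) \<and> (\<forall>i<n + m. snd (\<chi> (l (indexed_var i))) = w i)))"

lemma Af_dual_lifts:
  assumes N: "field N" and \<iota>: "\<iota> \<in> ring_hom F N" and f: "f \<in> carrier (P m)"
  shows "dual_lifts m (Af m (cls m f)) (lc m (cls m f)) N \<iota>"
  unfolding dual_lifts_def
proof (intro ballI allI impI)
  fix \<chi>0 w assume *: "\<chi>0 \<in> ring_hom (Af m (cls m f)) N"
    "\<forall>c\<in>carrier F. \<chi>0 (lc m (cls m f) (indexed_const c)) = \<iota> c" "\<forall>i<n + m. w i \<in> carrier N"
  show "\<exists>\<chi>\<in>ring_hom (Af m (cls m f)) (dual_ring N).
      (\<forall>c\<in>carrier F. \<chi> (lc m (cls m f) (indexed_const c)) = (\<iota> c, \<zero>\<^bsub>N\<^esub>)) \<and>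
      (\<forall>x\<in>carrier (Af m (cls m f)). fst (\<chi> x) = \<chi>0 x) \<and>
      (\<forall>i<n + m. snd (\<chi> (lc m (cls m f) (indexed_var i))) = w i)"
    by (rule Af_dual_hom[OF N \<iota> f *(1) *(2)[rule_format] *(3)[rule_format]], assumption, assumption,
        rule bexI[rotated], assumption, intro conjI ballI allI impI, blast+)
qed

end

locale quadric_pair = X: quasilinear_coeffs F as + Y: quasilinear_coeffs F bs
  for F (structure) and as bs
begin

text \<open>\<open>tangent_scaling_aux\<close> on the second quadric, applied to the images under
  \<open>h\<close> of the first coordinates: these satisfy the equation of the first form.\<close>

lemma tangent_scaling:
  assumes X: "X.chart m A lX" and Y: "Y.chart k B lY"
    and h: "h \<in> ring_hom A B"
    and h_const: "\<And>c. c \<in> carrier F \<Longrightarrow> h (lX (X.indexed_const c)) = lY (X.indexed_const c)"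
    and N: "field N" and \<iota>: "\<iota> \<in> ring_hom F N" and \<chi>0: "\<chi>0 \<in> ring_hom B N"
    and const: "\<And>c. c \<in> carrier F \<Longrightarrow> \<chi>0 (lY (X.indexed_const c)) = \<iota> c"
  obtains u where "u \<in> carrier N"
    "\<And>\<chi>. \<lbrakk>\<chi> \<in> ring_hom B (dual_ring N);
       \<And>c. c \<in> carrier F \<Longrightarrow> \<chi> (lY (X.indexed_const c)) = (\<iota> c, \<zero>\<^bsub>N\<^esub>);
       \<And>x. x \<in> carrier B \<Longrightarrow> fst (\<chi> x) = \<chi>0 x\<rbrakk> \<Longrightarrow>
     qsum N (map \<iota> as) (\<lambda>i. snd (\<chi> (h (lX (X.indexed_var i))))) =
       u \<otimes>\<^bsub>N\<^esub> qsum N (map \<iota> bs) (\<lambda>j. snd (\<chi> (lY (X.indexed_var j))))"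
proof -
  have A: "cring A" and lX: "lX \<in> ring_hom (X.P m) A" using X unfolding X.chart_def by auto
  have B: "cring B" and lY: "lY \<in> ring_hom (Y.P k) B"
    and ker: "\<And>p. p \<in> carrier (Y.P k) \<Longrightarrow> lY p = \<zero>\<^bsub>B\<^esub> \<longleftrightarrow> p \<in> PIdl\<^bsub>Y.P k\<^esub> (Y.q k)"
    using Y unfolding Y.chart_def by auto
  interpret h: ring_hom_cring A B h using A B h by (intro ring_hom_cring_of)
  have varX: "lX (X.indexed_var i) \<in> carrier A" if "i < length as" for i
    using ring_hom_closed[OF lX, of "X.indexed_var i"] that by simp
  have constX: "lX (X.indexed_const c) \<in> carrier A" if "c \<in> carrier F" for c
    using ring_hom_closed[OF lX, of "X.indexed_const c"] that by simp
  let ?x = "\<lambda>i. h (lX (X.indexed_var i))"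
  have x: "?x i \<in> carrier B" if "i < length as" for i using varX[OF that] by simp
  have qx: "qsum B (map (\<lambda>c. lY (X.indexed_const c)) as) ?x = \<zero>\<^bsub>B\<^esub>"
  proof -
    have "h (qsum A (map (\<lambda>c. lX (X.indexed_const c)) as) (\<lambda>i. lX (X.indexed_var i))) =
        qsum B (map h (map (\<lambda>c. lX (X.indexed_const c)) as)) ?x"
      by (rule h.hom_qsum) (use X.as_closed constX varX in auto)
    moreover have "map h (map (\<lambda>c. lX (X.indexed_const c)) as) = map (\<lambda>c. lY (X.indexed_const c)) as"
      using h_const X.as_closed by (simp add: subset_iff)
    ultimately show ?thesis by (simp only: X.chart_point[OF X] h.hom_zero)
  qed
  have "\<exists>d\<in>carrier (Y.P k). lY d \<in> Units B \<and> (\<forall>i<length as. \<exists>p\<in>carrier (Y.P k). ?x i \<otimes>\<^bsub>B\<^esub> lY d = lY p)"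
    using Y[unfolded Y.chart_def, THEN conjunct2, THEN conjunct2, THEN conjunct2, THEN spec[of _ "length as"],
        THEN spec[of _ ?x]] x by simp
  then obtain d where d: "d \<in> carrier (Y.P k)" "lY d \<in> Units B"
    "\<And>i. i < length as \<Longrightarrow> \<exists>p. p \<in> carrier (Y.P k) \<and> ?x i \<otimes>\<^bsub>B\<^esub> lY d = lY p" by blast
  define p where "p i = (SOME p. p \<in> carrier (Y.P k) \<and> ?x i \<otimes>\<^bsub>B\<^esub> lY d = lY p)" for i
  have p: "p i \<in> carrier (Y.P k) \<and> ?x i \<otimes>\<^bsub>B\<^esub> lY d = lY (p i)" if "i < length as" for i
    unfolding p_def using d(3)[OF that] by (rule someI_ex)
  show ?thesis
  proof (rule Y.tangent_scaling_aux[OF B lY ker Y.chart_point[OF Y] X.as_closed x qx d(1,2) p N \<iota> \<chi>0 const])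
    fix u assume u: "u \<in> carrier N"
      "\<And>\<chi>. \<lbrakk>\<chi> \<in> ring_hom B (dual_ring N);
         \<And>c. c \<in> carrier F \<Longrightarrow> \<chi> (lY (X.indexed_const c)) = (\<iota> c, \<zero>\<^bsub>N\<^esub>);
         \<And>x. x \<in> carrier B \<Longrightarrow> fst (\<chi> x) = \<chi>0 x\<rbrakk> \<Longrightarrow>
       qsum N (map \<iota> as) (\<lambda>i. snd (\<chi> (?x i))) =
         u \<otimes>\<^bsub>N\<^esub> qsum N (map \<iota> bs) (\<lambda>j. snd (\<chi> (lY (X.indexed_var j))))"
    show thesis by (rule that[OF u(1)]) (rule u(2); blast)
  qed
qed

text \<open>\<open>tangent_scaling\<close> is used for \<open>h\<close> and for its inverse. On
  first order terms the two maps multiply the forms by \<open>u\<close> and \<open>u'\<close>;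
  following a vector around and comparing a nonzero value gives \<open>u' u = 1\<close>. Since every
  vector is tangent on both sides, each value of one form corresponds to a value of the
  other.\<close>

lemma similar_charts:
  assumes X: "X.chart m Af lX" and Y: "Y.chart k Bg lY" and h: "h \<in> ring_iso Af Bg"
    and h_const: "\<And>c. c \<in> carrier F \<Longrightarrow> h (lX (X.indexed_const c)) = lY (X.indexed_const c)"
    and N: "field N" and \<iota>: "\<iota> \<in> ring_hom F N" and \<chi>0: "\<chi>0 \<in> ring_hom Bg N"
    and const: "\<And>c. c \<in> carrier F \<Longrightarrow> \<chi>0 (lY (X.indexed_const c)) = \<iota> c"
    and X_dual: "X.dual_lifts m Af lX N \<iota>" and Y_dual: "Y.dual_lifts k Bg lY N \<iota>"
  shows "\<exists>u\<in>carrier N. u \<noteq> \<zero>\<^bsub>N\<^esub> \<and> qvals N (map \<iota> as) = (\<lambda>y. u \<otimes>\<^bsub>N\<^esub> y) ` qvals N (map \<iota> bs)"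
proof -
  interpret S: quadric_pair F bs as by unfold_locales
  interpret N: field N by (rule N)
  have Nc: "cring N" by (rule N.is_cring)
  have Af: "cring Af" and lX: "lX \<in> ring_hom (X.P m) Af" using X unfolding X.chart_def by auto
  have Bg: "cring Bg" and lY: "lY \<in> ring_hom (Y.P k) Bg" using Y unfolding Y.chart_def by auto
  have hh: "h \<in> ring_hom Af Bg" and bij: "bij_betw h (carrier Af) (carrier Bg)"
    using h unfolding ring_iso_def by auto
  define h' where "h' = inv_into (carrier Af) h"
  have h': "h' \<in> ring_iso Bg Af" unfolding h'_def by (rule ring_iso_set_sym[OF cring.axioms(1)[OF Af] h])
  have hh': "h' \<in> ring_hom Bg Af" using h' unfolding ring_iso_def by auto
  have inv1: "h' (h x) = x" if "x \<in> carrier Af" for x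
    unfolding h'_def using bij that by (rule bij_betw_inv_into_left)
  have inv2: "h (h' y) = y" if "y \<in> carrier Bg" for y
    unfolding h'_def using bij that by (rule bij_betw_inv_into_right)
  have lXc: "lX (X.indexed_const c) \<in> carrier Af" if "c \<in> carrier F" for c
    using that by (intro ring_hom_closed[OF lX]) simp
  have lYv: "lY (X.indexed_var j) \<in> carrier Bg" if "j < length bs" for j
    using that by (intro ring_hom_closed[OF lY]) simp
  have lXv: "lX (X.indexed_var i) \<in> carrier Af" if "i < length as" for i
    using that by (intro ring_hom_closed[OF lX]) simp
  have h'_const: "h' (lY (X.indexed_const c)) = lX (X.indexed_const c)" if "c \<in> carrier F" for c
    using inv1[OF lXc[OF that]] h_const[OF that] by simp
  have \<chi>0h: "(\<lambda>x. \<chi>0 (h x)) \<in> ring_hom Af N" using ring_hom_trans[OF hh \<chi>0] by (simp add: comp_def)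
  have consth: "\<chi>0 (h (lX (X.indexed_const c))) = \<iota> c" if "c \<in> carrier F" for c
    using h_const[OF that] const[OF that] by simp
  obtain u where u: "u \<in> carrier N"
    "\<And>\<chi>. \<lbrakk>\<chi> \<in> ring_hom Bg (dual_ring N); \<And>c. c \<in> carrier F \<Longrightarrow> \<chi> (lY (X.indexed_const c)) = (\<iota> c, \<zero>\<^bsub>N\<^esub>);
       \<And>x. x \<in> carrier Bg \<Longrightarrow> fst (\<chi> x) = \<chi>0 x\<rbrakk> \<Longrightarrow>
     qsum N (map \<iota> as) (\<lambda>i. snd (\<chi> (h (lX (X.indexed_var i))))) =
       u \<otimes>\<^bsub>N\<^esub> qsum N (map \<iota> bs) (\<lambda>j. snd (\<chi> (lY (X.indexed_var j))))"
    using tangent_scaling[OF X Y hh h_const N \<iota> \<chi>0 const] by blast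
  obtain u' where u': "u' \<in> carrier N"
    "\<And>\<chi>. \<lbrakk>\<chi> \<in> ring_hom Af (dual_ring N); \<And>c. c \<in> carrier F \<Longrightarrow> \<chi> (lX (X.indexed_const c)) = (\<iota> c, \<zero>\<^bsub>N\<^esub>);
       \<And>x. x \<in> carrier Af \<Longrightarrow> fst (\<chi> x) = \<chi>0 (h x)\<rbrakk> \<Longrightarrow>
     qsum N (map \<iota> bs) (\<lambda>j. snd (\<chi> (h' (lY (X.indexed_var j))))) =
       u' \<otimes>\<^bsub>N\<^esub> qsum N (map \<iota> as) (\<lambda>i. snd (\<chi> (lX (X.indexed_var i))))"
    using S.tangent_scaling[OF Y X hh' h'_const N \<iota> \<chi>0h consth] by blast
  have \<iota>as: "set (map \<iota> as) \<subseteq> carrier N" "set (map \<iota> bs) \<subseteq> carrier N"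
    using X.as_closed Y.as_closed ring_hom_closed[OF \<iota>] by auto
  have dualc: "snd p \<in> carrier N" if "p \<in> carrier (dual_ring N)" for p using that by simp
  have fwd: "\<exists>v. (\<forall>i<length as. v i \<in> carrier N) \<and> qsum N (map \<iota> as) v = u \<otimes>\<^bsub>N\<^esub> qsum N (map \<iota> bs) w \<and>
      qsum N (map \<iota> bs) w = u' \<otimes>\<^bsub>N\<^esub> qsum N (map \<iota> as) v"
    if w: "\<forall>j<length bs. w j \<in> carrier N" for w
  proof -
    \<comment> \<open>Directions along the extra affine coordinates, of index at least
      \<open>length bs\<close>, are zero; they do not enter the form.\<close>
    let ?w = "\<lambda>j. if j < length bs then w j else \<zero>\<^bsub>N\<^esub>"
    have w': "?w j \<in> carrier N" if "j < length bs + k" for j using w by simp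
    obtain \<chi> where \<chi>: "\<chi> \<in> ring_hom Bg (dual_ring N)"
      "\<And>c. c \<in> carrier F \<Longrightarrow> \<chi> (lY (X.indexed_const c)) = (\<iota> c, \<zero>\<^bsub>N\<^esub>)"
      "\<And>x. x \<in> carrier Bg \<Longrightarrow> fst (\<chi> x) = \<chi>0 x"
      "\<And>j. j < length bs + k \<Longrightarrow> snd (\<chi> (lY (X.indexed_var j))) = ?w j"
      using Y_dual[unfolded Y.dual_lifts_def, THEN bspec[OF _ \<chi>0], THEN spec[of _ ?w]] const w' by blast
    have \<chi>h: "(\<lambda>x. \<chi> (h x)) \<in> ring_hom Af (dual_ring N)" using ring_hom_trans[OF hh \<chi>(1)] by (simp add: comp_def)
    let ?v = "\<lambda>i. snd (\<chi> (h (lX (X.indexed_var i))))"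
    have v: "?v i \<in> carrier N" if "i < length as" for i
      using ring_hom_closed[OF \<chi>h lXv[OF that]] by (rule dualc)
    have ww: "qsum N (map \<iota> bs) (\<lambda>j. snd (\<chi> (lY (X.indexed_var j)))) = qsum N (map \<iota> bs) w"
      by (rule N.qsum_cong[OF \<iota>as(2)]) (use \<chi>(4) w in auto)
    have 1: "qsum N (map \<iota> as) ?v = u \<otimes>\<^bsub>N\<^esub> qsum N (map \<iota> bs) w"
      using u(2)[OF \<chi>(1-3)] unfolding ww .
    have "qsum N (map \<iota> bs) (\<lambda>j. snd (\<chi> (h (h' (lY (X.indexed_var j)))))) = u' \<otimes>\<^bsub>N\<^esub> qsum N (map \<iota> as) ?v"
    proof (rule u'(2)[OF \<chi>h])
      show "\<chi> (h (lX (X.indexed_const c))) = (\<iota> c, \<zero>\<^bsub>N\<^esub>)" if "c \<in> carrier F" for c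
        using h_const[OF that] \<chi>(2)[OF that] by simp
      show "fst (\<chi> (h x)) = \<chi>0 (h x)" if "x \<in> carrier Af" for x
        by (rule \<chi>(3)[OF ring_hom_closed[OF hh that]])
    qed
    moreover have "qsum N (map \<iota> bs) (\<lambda>j. snd (\<chi> (h (h' (lY (X.indexed_var j)))))) = qsum N (map \<iota> bs) w"
      by (rule N.qsum_cong[OF \<iota>as(2)]) (use \<chi>(4) w lYv inv2 in auto)
    ultimately have 2: "qsum N (map \<iota> bs) w = u' \<otimes>\<^bsub>N\<^esub> qsum N (map \<iota> as) ?v" by simp
    show ?thesis using 1 2 v by (intro exI[of _ ?v]) simp
  qed
  have n: "0 < length bs" using Y.n_pos by simp
  interpret i: ring_hom_ring F N \<iota>
    using X.ring_axioms N.ring_axioms \<iota> by (intro ring_hom_ringI2)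
  let ?b = "\<iota> (bs ! 0)"
  have b: "?b \<in> carrier N" "?b \<noteq> \<zero>\<^bsub>N\<^esub>"
    using n Y.as_nonzero[OF n] inj_onD[OF non_trivial_field_hom_is_inj[OF \<iota> X.field_axioms N.field_axioms], of "bs ! 0" \<zero>]
    by auto
  \<comment> \<open>The first unit vector, at which the second form takes the nonzero value
    \<open>?b\<close>; cancelling this value yields \<open>u' u = 1\<close>.\<close>
  define e where "e j = (if j = 0 then \<one>\<^bsub>N\<^esub> else \<zero>\<^bsub>N\<^esub>)" for j :: nat
  have e: "qsum N (map \<iota> bs) e = ?b" "\<And>j. e j \<in> carrier N"
    using N.qsum_single[OF \<iota>as(2), of 0] n by (simp_all add: e_def[abs_def])
  obtain v where v: "qsum N (map \<iota> as) v = u \<otimes>\<^bsub>N\<^esub> ?b" "?b = u' \<otimes>\<^bsub>N\<^esub> qsum N (map \<iota> as) v"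
    using fwd[of e] e(2) unfolding e(1) by blast
  have "(u' \<otimes>\<^bsub>N\<^esub> u) \<otimes>\<^bsub>N\<^esub> ?b = \<one>\<^bsub>N\<^esub> \<otimes>\<^bsub>N\<^esub> ?b"
    using u(1) u'(1) b(1) v by (metis N.m_assoc N.l_one)
  then have u'u: "u' \<otimes>\<^bsub>N\<^esub> u = \<one>\<^bsub>N\<^esub>" using b u(1) u'(1) N.m_rcancel[of ?b "u' \<otimes>\<^bsub>N\<^esub> u" "\<one>\<^bsub>N\<^esub>"] by simp
  have unz: "u \<noteq> \<zero>\<^bsub>N\<^esub>" using u'u u'(1) N.one_not_zero N.r_null by metis
  have bwd: "\<exists>w. (\<forall>j<length bs. w j \<in> carrier N) \<and> qsum N (map \<iota> as) v = u \<otimes>\<^bsub>N\<^esub> qsum N (map \<iota> bs) w"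
    if v: "\<And>i. i < length as \<Longrightarrow> v i \<in> carrier N" for v
  proof -
    let ?v = "\<lambda>i. if i < length as then v i else \<zero>\<^bsub>N\<^esub>"
    have v': "?v i \<in> carrier N" if "i < length as + m" for i using v by simp
    obtain \<chi> where \<chi>: "\<chi> \<in> ring_hom Af (dual_ring N)"
      "\<And>c. c \<in> carrier F \<Longrightarrow> \<chi> (lX (X.indexed_const c)) = (\<iota> c, \<zero>\<^bsub>N\<^esub>)"
      "\<And>x. x \<in> carrier Af \<Longrightarrow> fst (\<chi> x) = \<chi>0 (h x)"
      "\<And>i. i < length as + m \<Longrightarrow> snd (\<chi> (lX (X.indexed_var i))) = ?v i"
      using X_dual[unfolded X.dual_lifts_def, THEN bspec[OF _ \<chi>0h], THEN spec[of _ ?v]] consth v' by blast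
    let ?w = "\<lambda>j. snd (\<chi> (h' (lY (X.indexed_var j))))"
    have w: "?w j \<in> carrier N" if "j < length bs" for j
      using ring_hom_closed[OF \<chi>(1) ring_hom_closed[OF hh' lYv[OF that]]] by (rule dualc)
    have "qsum N (map \<iota> as) (\<lambda>i. snd (\<chi> (lX (X.indexed_var i)))) = qsum N (map \<iota> as) v"
      by (rule N.qsum_cong[OF \<iota>as(1)]) (use \<chi>(4) v in auto)
    then have "qsum N (map \<iota> bs) ?w = u' \<otimes>\<^bsub>N\<^esub> qsum N (map \<iota> as) v" using u'(2)[OF \<chi>(1-3)] by simp
    then have "u \<otimes>\<^bsub>N\<^esub> qsum N (map \<iota> bs) ?w = (u' \<otimes>\<^bsub>N\<^esub> u) \<otimes>\<^bsub>N\<^esub> qsum N (map \<iota> as) v"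
      using u(1) u'(1) N.qsum_closed[OF \<iota>as(1), of v] v by (simp add: N.m_ac)
    also have "\<dots> = qsum N (map \<iota> as) v"
      unfolding u'u using N.qsum_closed[OF \<iota>as(1), of v] v by simp
    finally have "qsum N (map \<iota> as) v = u \<otimes>\<^bsub>N\<^esub> qsum N (map \<iota> bs) ?w" by simp
    then show ?thesis using w by (intro exI[of _ ?w]) simp
  qed
  have "qvals N (map \<iota> as) = (\<lambda>y. u \<otimes>\<^bsub>N\<^esub> y) ` qvals N (map \<iota> bs)"
  proof
    show "qvals N (map \<iota> as) \<subseteq> (\<lambda>y. u \<otimes>\<^bsub>N\<^esub> y) ` qvals N (map \<iota> bs)"
    proof
      fix y assume "y \<in> qvals N (map \<iota> as)"
      then obtain v where v: "y = qsum N (map \<iota> as) v" "\<forall>i<length as. v i \<in> carrier N"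
        unfolding qvals_def by auto
      then obtain w where w: "\<forall>j<length bs. w j \<in> carrier N" "qsum N (map \<iota> as) v = u \<otimes>\<^bsub>N\<^esub> qsum N (map \<iota> bs) w"
        using bwd[of v] by blast
      have "qsum N (map \<iota> bs) w \<in> qvals N (map \<iota> bs)" unfolding qvals_def using w(1) by auto
      then show "y \<in> (\<lambda>y. u \<otimes>\<^bsub>N\<^esub> y) ` qvals N (map \<iota> bs)" unfolding v(1) w(2) by (rule imageI)
    qed
    show "(\<lambda>y. u \<otimes>\<^bsub>N\<^esub> y) ` qvals N (map \<iota> bs) \<subseteq> qvals N (map \<iota> as)"
    proof
      fix z assume "z \<in> (\<lambda>y. u \<otimes>\<^bsub>N\<^esub> y) ` qvals N (map \<iota> bs)"
      then obtain w where w: "z = u \<otimes>\<^bsub>N\<^esub> qsum N (map \<iota> bs) w" "\<forall>j<length bs. w j \<in> carrier N"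
        unfolding qvals_def by auto
      then obtain v where v: "\<forall>i<length as. v i \<in> carrier N" "qsum N (map \<iota> as) v = u \<otimes>\<^bsub>N\<^esub> qsum N (map \<iota> bs) w"
        using fwd[of w] by blast
      show "z \<in> qvals N (map \<iota> as)" unfolding w(1) v(2)[symmetric] qvals_def using v(1) by auto
    qed
  qed
  then show ?thesis using u(1) unz by blast
qed

lemma similar_at_point:
  assumes f: "f \<in> carrier (X.P m)" "f \<notin> PIdl\<^bsub>X.P m\<^esub> (X.q m)"
    and g: "g \<in> carrier (Y.P k)" "g \<notin> PIdl\<^bsub>Y.P k\<^esub> (Y.q k)"
    and h: "h \<in> ring_iso (X.Af m (X.cls m f)) (Y.Af k (Y.cls k g))"
    and h_const: "\<And>c. c \<in> carrier F \<Longrightarrow>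
      h (X.lc m (X.cls m f) (X.indexed_const c)) = Y.lc k (Y.cls k g) (X.indexed_const c)"
    and N: "field N" and \<iota>: "\<iota> \<in> ring_hom F N"
    and \<chi>0: "\<chi>0 \<in> ring_hom (Y.Af k (Y.cls k g)) N"
    and const: "\<And>c. c \<in> carrier F \<Longrightarrow> \<chi>0 (Y.lc k (Y.cls k g) (X.indexed_const c)) = \<iota> c"
  shows "\<exists>u\<in>carrier N. u \<noteq> \<zero>\<^bsub>N\<^esub> \<and> qvals N (map \<iota> as) = (\<lambda>y. u \<otimes>\<^bsub>N\<^esub> y) ` qvals N (map \<iota> bs)"
proof -
  have X: "X.chart m (X.Af m (X.cls m f)) (X.lc m (X.cls m f))"
    using X.cls_eq_zero_iff[OF f(1)] f(2) by (intro X.Af_chart X.cls_closed[OF f(1)]) blast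
  have Y: "Y.chart k (Y.Af k (Y.cls k g)) (Y.lc k (Y.cls k g))"
    using Y.cls_eq_zero_iff[OF g(1)] g(2) by (intro Y.Af_chart Y.cls_closed[OF g(1)]) blast
  show ?thesis
    by (rule similar_charts[OF X Y h h_const N \<iota> \<chi>0 const X.Af_dual_lifts[OF N \<iota> f(1)] Y.Af_dual_lifts[OF N \<iota> g(1)]])
qed

end

section \<open>Forms and their value sets\<close>

text \<open>\<open>quasilinear_form\<close> without finite dimension, which for anisotropic parts is
  proved only afterwards, from generators of the value set.\<close>

locale semilinear_form = vectorspace F \<phi>
  for F :: "('a, 'm) ring_scheme" (structure) and \<phi> :: "('a, 'v) qform" +
  assumes field_char2: "\<one> \<oplus> \<one> = \<zero>"
    and value_closed: "v \<in> carrier \<phi> \<Longrightarrow> qval \<phi> v \<in> carrier F"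
    and value_semilinear: "a \<in> carrier F \<Longrightarrow> v \<in> carrier \<phi> \<Longrightarrow> w \<in> carrier \<phi> \<Longrightarrow>
      qval \<phi> ((a \<odot>\<^bsub>\<phi>\<^esub> v) \<oplus>\<^bsub>\<phi>\<^esub> w) = a [^] (2::nat) \<otimes> qval \<phi> v \<oplus> qval \<phi> w"

sublocale semilinear_form \<subseteq> char2_field F
  by unfold_locales (rule field_char2)

lemma quasilinear_form_iff:
  "quasilinear_form F \<phi> \<longleftrightarrow> semilinear_form F \<phi> \<and> vectorspace.fin_dim F \<phi>"
proof
  assume "quasilinear_form F \<phi>"
  then interpret quasilinear_form F \<phi> .
  have "semilinear_form F \<phi>"
    by unfold_locales (simp_all add: char2 qval_closed qval_semilinear)
  then show "semilinear_form F \<phi> \<and> vectorspace.fin_dim F \<phi>" using finite_dimensional by simp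
next
  assume *: "semilinear_form F \<phi> \<and> vectorspace.fin_dim F \<phi>"
  then interpret semilinear_form F \<phi> by simp
  show "quasilinear_form F \<phi>"
    using * by unfold_locales (simp_all add: field_char2 value_closed value_semilinear)
qed

context semilinear_form
begin

lemma value_add: "v \<in> carrier \<phi> \<Longrightarrow> w \<in> carrier \<phi> \<Longrightarrow> qval \<phi> (v \<oplus>\<^bsub>\<phi>\<^esub> w) = qval \<phi> v \<oplus> qval \<phi> w"
  using value_semilinear[of \<one> v w] value_closed by simp

lemma value_zero: "qval \<phi> \<zero>\<^bsub>\<phi>\<^esub> = \<zero>"
proof -
  have "qval \<phi> \<zero>\<^bsub>\<phi>\<^esub> = qval \<phi> \<zero>\<^bsub>\<phi>\<^esub> \<oplus> qval \<phi> \<zero>\<^bsub>\<phi>\<^esub>" using value_add[of "\<zero>\<^bsub>\<phi>\<^esub>" "\<zero>\<^bsub>\<phi>\<^esub>"] by simp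
  then show ?thesis using value_closed[of "\<zero>\<^bsub>\<phi>\<^esub>"] by simp
qed

lemma value_smult: "a \<in> carrier F \<Longrightarrow> v \<in> carrier \<phi> \<Longrightarrow> qval \<phi> (a \<odot>\<^bsub>\<phi>\<^esub> v) = a [^] (2::nat) \<otimes> qval \<phi> v"
  using value_semilinear[of a v "\<zero>\<^bsub>\<phi>\<^esub>"] value_closed value_zero by simp

lemma value_minus: "v \<in> carrier \<phi> \<Longrightarrow> qval \<phi> (\<ominus>\<^bsub>\<phi>\<^esub> v) = qval \<phi> v"
  using value_add[of v "\<ominus>\<^bsub>\<phi>\<^esub> v"] value_zero value_closed M.r_neg[of v] add_eq_zero_iff[of "qval \<phi> v" "qval \<phi> (\<ominus>\<^bsub>\<phi>\<^esub> v)"]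
  by simp

text \<open>The quadratic map is additive, so injectivity can be tested at zero.\<close>

lemma anisotropic_iff_inj: "anisotropic F \<phi> \<longleftrightarrow> inj_on (qval \<phi>) (carrier \<phi>)"
proof
  assume an: "anisotropic F \<phi>"
  show "inj_on (qval \<phi>) (carrier \<phi>)"
  proof (rule inj_onI)
    fix v w assume vw: "v \<in> carrier \<phi>" "w \<in> carrier \<phi>" "qval \<phi> v = qval \<phi> w"
    then have "qval \<phi> (v \<oplus>\<^bsub>\<phi>\<^esub> \<ominus>\<^bsub>\<phi>\<^esub> w) = \<zero>" by (simp add: value_add value_minus value_closed)
    then have "v \<oplus>\<^bsub>\<phi>\<^esub> \<ominus>\<^bsub>\<phi>\<^esub> w = \<zero>\<^bsub>\<phi>\<^esub>"
      using an vw unfolding anisotropic_def zero_set_def by auto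
    then show "v = w" using vw M.r_neg M.minus_equality M.minus_minus by (metis M.a_inv_closed)
  qed
next
  assume inj: "inj_on (qval \<phi>) (carrier \<phi>)"
  then have "v = \<zero>\<^bsub>\<phi>\<^esub>" if "v \<in> carrier \<phi>" "qval \<phi> v = \<zero>" for v
    using inj_onD[OF inj, of v "\<zero>\<^bsub>\<phi>\<^esub>"] that value_zero M.zero_closed by simp
  then show "anisotropic F \<phi>" unfolding anisotropic_def zero_set_def using value_zero by auto
qed

lemma value_lincomb:
  assumes "finite S" "S \<subseteq> carrier \<phi>" "a \<in> S \<rightarrow> carrier F"
  shows "qval \<phi> (lincomb a S) = (\<Oplus>v\<in>S. qval \<phi> v \<otimes> a v [^] (2::nat))"
  using assms
proof (induction S rule: finite_induct)
  case empty
  then show ?case by (simp add: lincomb_def value_zero)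
next
  case (insert v S)
  have S: "S \<subseteq> carrier \<phi>" "a \<in> S \<rightarrow> carrier F" and v: "v \<in> carrier \<phi>" "a v \<in> carrier F" using insert.prems by auto
  have "lincomb a (insert v S) = a v \<odot>\<^bsub>\<phi>\<^esub> v \<oplus>\<^bsub>\<phi>\<^esub> lincomb a S"
    unfolding lincomb_def using insert(1,2) S v by (subst M.finsum_insert) auto
  moreover have "lincomb a S \<in> carrier \<phi>" unfolding lincomb_def using S by (intro M.finsum_closed) auto
  ultimately have "qval \<phi> (lincomb a (insert v S)) = a v [^] (2::nat) \<otimes> qval \<phi> v \<oplus> qval \<phi> (lincomb a S)"
    using v by (simp add: value_semilinear)
  also have "\<dots> = (\<Oplus>v\<in>insert v S. qval \<phi> v \<otimes> a v [^] (2::nat))"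
    using insert.IH[OF S] insert(1,2) S v value_closed by (subst R.finsum_insert) (auto simp: R.m_comm)
  finally show ?case .
qed

lemma value_lincomb_nth:
  assumes "distinct bs" "set bs \<subseteq> carrier \<phi>" "a \<in> set bs \<rightarrow> carrier F"
  shows "qval \<phi> (lincomb a (set bs)) = qsum F (map (qval \<phi>) bs) (\<lambda>i. a (bs ! i))"
proof -
  let ?f = "\<lambda>v. qval \<phi> v \<otimes> a v [^] (2::nat)"
  have im: "(\<lambda>i. bs ! i) ` {..<length bs} = set bs" by (auto simp: set_conv_nth)
  have inj: "inj_on (\<lambda>i. bs ! i) {..<length bs}" using assms(1) by (simp add: inj_on_nth)
  have f: "?f v \<in> carrier F" if "v \<in> set bs" for v using that assms value_closed by auto
  have "(\<Oplus>v\<in>(\<lambda>i. bs ! i) ` {..<length bs}. ?f v) = (\<Oplus>i\<in>{..<length bs}. ?f (bs ! i))"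
    using f by (intro R.finsum_reindex[OF _ inj]) auto
  then have "(\<Oplus>v\<in>set bs. ?f v) = (\<Oplus>i\<in>{..<length bs}. ?f (bs ! i))" unfolding im .
  also have "\<dots> = qsum F (map (qval \<phi>) bs) (\<lambda>i. a (bs ! i))"
    unfolding qsum_def using f by (intro R.finsum_cong') auto
  finally show ?thesis using value_lincomb[of "set bs" a] assms by simp
qed

text \<open>\<open>lincomb\<close> takes coefficients indexed by vectors, \<open>qsum\<close> by
  positions; distinctness of the list allows the passage.\<close>

lemma coordinate_function:
  assumes "distinct bs" "\<forall>i<length bs. x i \<in> carrier F"
  shows "\<exists>a. a \<in> set bs \<rightarrow> carrier F \<and> (\<forall>i<length bs. a (bs ! i) = x i)"
proof -
  have "inj_on (\<lambda>i. bs ! i) {..<length bs}" using assms(1) by (simp add: inj_on_nth)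
  then have eq: "inv_into {..<length bs} (\<lambda>i. bs ! i) (bs ! i) = i" if "i < length bs" for i
    using that by (simp add: inv_into_f_f)
  show ?thesis
    by (rule exI[of _ "\<lambda>v. x (inv_into {..<length bs} (\<lambda>i. bs ! i) v)"]) (auto simp: in_set_conv_nth eq assms(2))
qed

lemma values_closed: "set bs \<subseteq> carrier \<phi> \<Longrightarrow> set (map (qval \<phi>) bs) \<subseteq> carrier F"
  using value_closed by auto

lemma value_span:
  assumes "distinct bs" "set bs \<subseteq> carrier \<phi>"
  shows "qval \<phi> ` span (set bs) = Span sq (map (qval \<phi>) bs)"
proof -
  have sp: "span (set bs) = {lincomb a (set bs) | a. a \<in> set bs \<rightarrow> carrier F}"
    by (rule finite_span) (use assms in auto)
  have "qval \<phi> ` span (set bs) = qvals F (map (qval \<phi>) bs)"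
  proof
    show "qval \<phi> ` span (set bs) \<subseteq> qvals F (map (qval \<phi>) bs)"
    proof
      fix y assume "y \<in> qval \<phi> ` span (set bs)"
      then obtain a where a: "a \<in> set bs \<rightarrow> carrier F" "y = qval \<phi> (lincomb a (set bs))" unfolding sp by auto
      then have "y = qsum F (map (qval \<phi>) bs) (\<lambda>i. a (bs ! i))" using value_lincomb_nth[OF assms a(1)] by simp
      then show "y \<in> qvals F (map (qval \<phi>) bs)"
        unfolding qvals_def using a(1) by (intro CollectI exI[of _ "\<lambda>i. a (bs ! i)"]) auto
    qed
    show "qvals F (map (qval \<phi>) bs) \<subseteq> qval \<phi> ` span (set bs)"
    proof
      fix y assume "y \<in> qvals F (map (qval \<phi>) bs)"
      then obtain x where x: "y = qsum F (map (qval \<phi>) bs) x" "\<forall>i<length bs. x i \<in> carrier F"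
        unfolding qvals_def by auto
      obtain a where a: "a \<in> set bs \<rightarrow> carrier F" "\<forall>i<length bs. a (bs ! i) = x i"
        using coordinate_function[OF assms(1) x(2)] by (elim exE conjE)
      have "y = qsum F (map (qval \<phi>) bs) (\<lambda>i. a (bs ! i))"
        unfolding x(1) using x(2) a(2) values_closed[OF assms(2)] by (intro qsum_cong) auto
      then have "y = qval \<phi> (lincomb a (set bs))" using value_lincomb_nth[OF assms a(1)] by simp
      then show "y \<in> qval \<phi> ` span (set bs)" unfolding sp using a(1) by blast
    qed
  qed
  then show ?thesis using qvals_eq_Span[OF values_closed[OF assms(2)]] by simp
qed

text \<open>An injective quadratic map identifies the space, semilinearly along squaring, with its
  value set. Preimages of a basis of the value set over the squares therefore span the
  space.\<close>

lemma injective_quasilinear_form: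
  assumes inj: "inj_on (qval \<phi>) (carrier \<phi>)" and ds: "set ds \<subseteq> carrier F" "value_set \<phi> = Span sq ds"
  shows "quasilinear_form F \<phi>"
proof -
  obtain ws where ws: "independent sq ws" "Span sq ws = Span sq ds"
    using short_base[OF squares_subfield ds(1)] by auto
  have wsc: "set ws \<subseteq> carrier F" using independent_in_carrier[OF ws(1)] .
  have "set ws \<subseteq> qval \<phi> ` carrier \<phi>"
    using Span_base_incl[OF squares_subfield wsc] ws(2) ds(2) unfolding value_set_def by simp
  then obtain bs where bs: "set bs \<subseteq> carrier \<phi>" "ws = map (qval \<phi>) bs"
  proof (induction ws arbitrary: thesis)
    case (Cons w ws)
    then obtain bs where "set bs \<subseteq> carrier \<phi>" "ws = map (qval \<phi>) bs" by auto
    moreover obtain b where "b \<in> carrier \<phi>" "w = qval \<phi> b" using Cons.prems(2) by auto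
    ultimately show ?case by (intro Cons.prems(1)[of "b # bs"]) auto
  qed auto
  have "distinct bs" using independent_distinct[OF squares_subfield ws(1)] bs(2) distinct_map by blast
  then have "qval \<phi> ` span (set bs) = qval \<phi> ` carrier \<phi>"
    using value_span[OF _ bs(1)] bs(2) ws(2) ds(2) unfolding value_set_def by simp
  moreover have "span (set bs) \<subseteq> carrier \<phi>" using bs(1) by (rule span_is_subset2)
  ultimately have "span (set bs) = carrier \<phi>" using inj_on_image_eq_iff[OF inj] by blast
  then have "fin_dim" unfolding fin_dim_def using bs(1) by (intro exI[of _ "set bs"]) simp
  then show ?thesis unfolding quasilinear_form_iff using semilinear_form_axioms by simp
qed

end

sublocale quasilinear_form \<subseteq> semilinear_form
  using quasilinear_form_axioms quasilinear_form_iff by blast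

context quasilinear_form
begin

lemma coord_basis: "distinct (coord_basis F \<phi>)" "basis (set (coord_basis F \<phi>))"
proof -
  obtain B where "finite B" "basis B" using finite_basis_exists[OF finite_dimensional] by blast
  then have "\<exists>bs. distinct bs \<and> basis (set bs)" using finite_distinct_list by metis
  then have "distinct (coord_basis F \<phi>) \<and> basis (set (coord_basis F \<phi>))"
    unfolding coord_basis_def by (rule someI_ex)
  then show "distinct (coord_basis F \<phi>)" "basis (set (coord_basis F \<phi>))" by auto
qed

lemma length_diag_coeffs: "length (diag_coeffs F \<phi>) = vectorspace.dim F \<phi>"
  using dim_basis[OF _ coord_basis(2)] distinct_card[OF coord_basis(1)] unfolding diag_coeffs_def by simp

lemma coord_basis_closed: "set (coord_basis F \<phi>) \<subseteq> carrier \<phi>"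
  using coord_basis(2) unfolding basis_def by simp

lemma diag_coeffs_closed: "set (diag_coeffs F \<phi>) \<subseteq> carrier F"
  unfolding diag_coeffs_def by (rule values_closed[OF coord_basis_closed])

lemma value_set_eq_Span: "value_set \<phi> = Span sq (diag_coeffs F \<phi>)"
  using value_span[OF coord_basis(1) coord_basis_closed] coord_basis(2)
  unfolding value_set_def diag_coeffs_def basis_def by simp

lemma independent_diag_coeffs:
  assumes "anisotropic F \<phi>"
  shows "independent sq (diag_coeffs F \<phi>)"
proof -
  have "x i = \<zero>" if x: "\<forall>i<length (diag_coeffs F \<phi>). x i \<in> carrier F"
    and 0: "qsum F (diag_coeffs F \<phi>) x = \<zero>" and i: "i < length (diag_coeffs F \<phi>)" for x i
  proof -
    let ?bs = "coord_basis F \<phi>"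
    have x': "\<forall>i<length ?bs. x i \<in> carrier F" using x by (simp add: diag_coeffs_def)
    obtain a where a: "a \<in> set ?bs \<rightarrow> carrier F" "\<forall>i<length ?bs. a (?bs ! i) = x i"
      using coordinate_function[OF coord_basis(1) x'] by (elim exE conjE)
    have "qsum F (diag_coeffs F \<phi>) x = qsum F (diag_coeffs F \<phi>) (\<lambda>i. a (?bs ! i))"
      using diag_coeffs_closed x a(2) by (intro qsum_cong) (auto simp: diag_coeffs_def)
    then have "qval \<phi> (lincomb a (set ?bs)) = \<zero>"
      using value_lincomb_nth[OF coord_basis(1) coord_basis_closed a(1)] 0 by (simp add: diag_coeffs_def)
    moreover have "lincomb a (set ?bs) \<in> carrier \<phi>"
      unfolding lincomb_def using a(1) coord_basis_closed by (intro M.finsum_closed) auto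
    ultimately have "lincomb a (set ?bs) = \<zero>\<^bsub>\<phi>\<^esub>" using assms unfolding anisotropic_def zero_set_def by auto
    then have "a v = \<zero>" if "v \<in> set ?bs" for v
      using lin_dep_crit[OF _ order.refl a(1) that] coord_basis(2) unfolding basis_def by auto
    then show "x i = \<zero>" using i a(2) by (simp add: diag_coeffs_def)
  qed
  then show ?thesis unfolding independent_iff_qsum[OF diag_coeffs_closed] by blast
qed

lemma dimension_value_set:
  assumes "anisotropic F \<phi>"
  shows "dimension (vectorspace.dim F \<phi>) sq (value_set \<phi>)"
  using dimension_independent[OF independent_diag_coeffs[OF assms]]
  unfolding length_diag_coeffs value_set_eq_Span .

lemma quasilinear_coeffs_diag:
  assumes "anisotropic F \<phi>" "vectorspace.dim F \<phi> \<ge> 2"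
  shows "quasilinear_coeffs F (diag_coeffs F \<phi>)"
proof
  show "set (diag_coeffs F \<phi>) \<subseteq> carrier F" by (rule diag_coeffs_closed)
  show "2 \<le> length (diag_coeffs F \<phi>)" using assms(2) by (simp add: length_diag_coeffs)
  show "x i = \<zero>" if "\<And>i. i < length (diag_coeffs F \<phi>) \<Longrightarrow> x i \<in> carrier F"
    "qsum F (diag_coeffs F \<phi>) x = \<zero>" "i < length (diag_coeffs F \<phi>)" for x i
    using independent_diag_coeffs[OF assms(1)] that unfolding independent_iff_qsum[OF diag_coeffs_closed] by blast
qed

end

section \<open>The anisotropic part\<close>

context semilinear_form
begin

text \<open>By additivity these are the cosets of the zero set. On fibres the independence of
  quotient operations from representatives is visible from the value alone.\<close>

definition fibre :: "'v \<Rightarrow> 'v set"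
  where "fibre v = {w \<in> carrier \<phi>. qval \<phi> w = qval \<phi> v}"

lemma fibre_self: "v \<in> carrier \<phi> \<Longrightarrow> v \<in> fibre v"
  unfolding fibre_def by simp

lemma sub_add_cancel:
  assumes "v \<in> carrier \<phi>" "w \<in> carrier \<phi>"
  shows "w \<oplus>\<^bsub>\<phi>\<^esub> \<ominus>\<^bsub>\<phi>\<^esub> v \<oplus>\<^bsub>\<phi>\<^esub> v = w"
  using assms by (simp add: M.a_assoc M.l_neg)

lemma coset_zero_set:
  assumes "v \<in> carrier \<phi>"
  shows "zero_set F \<phi> +>\<^bsub>\<phi>\<^esub> v = fibre v"
proof
  show "zero_set F \<phi> +>\<^bsub>\<phi>\<^esub> v \<subseteq> fibre v"
    unfolding a_r_coset_def' zero_set_def fibre_def using assms by (auto simp: value_add value_closed)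
  show "fibre v \<subseteq> zero_set F \<phi> +>\<^bsub>\<phi>\<^esub> v"
  proof
    fix w assume w: "w \<in> fibre v"
    then have wc: "w \<in> carrier \<phi>" "qval \<phi> w = qval \<phi> v" unfolding fibre_def by auto
    have "w \<oplus>\<^bsub>\<phi>\<^esub> \<ominus>\<^bsub>\<phi>\<^esub> v \<in> zero_set F \<phi>"
      unfolding zero_set_def using wc assms by (simp add: value_add value_minus value_closed)
    then show "w \<in> zero_set F \<phi> +>\<^bsub>\<phi>\<^esub> v"
      unfolding a_r_coset_def' using sub_add_cancel[OF assms wc(1)] by (auto intro!: bexI[of _ "w \<oplus>\<^bsub>\<phi>\<^esub> \<ominus>\<^bsub>\<phi>\<^esub> v"])
  qed
qed

lemma zero_set_eq_fibre: "zero_set F \<phi> = fibre \<zero>\<^bsub>\<phi>\<^esub>"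
  unfolding zero_set_def fibre_def by (simp add: value_zero)

lemma aniso_part_carrier: "carrier (aniso_part F \<phi>) = fibre ` carrier \<phi>"
proof -
  have "carrier (aniso_part F \<phi>) = (\<Union>v\<in>carrier \<phi>. {zero_set F \<phi> +>\<^bsub>\<phi>\<^esub> v})"
    unfolding aniso_part_def by (simp add: A_RCOSETS_def' )
  also have "\<dots> = fibre ` carrier \<phi>" using coset_zero_set by auto
  finally show ?thesis .
qed

lemma aniso_part_zero: "\<zero>\<^bsub>aniso_part F \<phi>\<^esub> = fibre \<zero>\<^bsub>\<phi>\<^esub>"
  unfolding aniso_part_def by (simp add: zero_set_eq_fibre)

lemma aniso_part_add:
  assumes "v \<in> carrier \<phi>" "w \<in> carrier \<phi>"
  shows "fibre v \<oplus>\<^bsub>aniso_part F \<phi>\<^esub> fibre w = fibre (v \<oplus>\<^bsub>\<phi>\<^esub> w)"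
proof -
  have "fibre v <+>\<^bsub>\<phi>\<^esub> fibre w = fibre (v \<oplus>\<^bsub>\<phi>\<^esub> w)"
  proof
    show "fibre v <+>\<^bsub>\<phi>\<^esub> fibre w \<subseteq> fibre (v \<oplus>\<^bsub>\<phi>\<^esub> w)"
      unfolding set_add_def' fibre_def using assms by (auto simp: value_add)
    show "fibre (v \<oplus>\<^bsub>\<phi>\<^esub> w) \<subseteq> fibre v <+>\<^bsub>\<phi>\<^esub> fibre w"
    proof
      fix x assume "x \<in> fibre (v \<oplus>\<^bsub>\<phi>\<^esub> w)"
      then have x: "x \<in> carrier \<phi>" "qval \<phi> x = qval \<phi> v \<oplus> qval \<phi> w"
        using assms unfolding fibre_def by (auto simp: value_add)
      have "qval \<phi> (x \<oplus>\<^bsub>\<phi>\<^esub> \<ominus>\<^bsub>\<phi>\<^esub> w) = qval \<phi> v"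
        using x assms by (simp add: value_add value_minus value_closed R.a_assoc)
      then have "x \<oplus>\<^bsub>\<phi>\<^esub> \<ominus>\<^bsub>\<phi>\<^esub> w \<in> fibre v" using x assms unfolding fibre_def by simp
      then show "x \<in> fibre v <+>\<^bsub>\<phi>\<^esub> fibre w"
        unfolding set_add_def' using fibre_self[OF assms(2)] sub_add_cancel[OF assms(2) x(1)] by fastforce
    qed
  qed
  then show ?thesis unfolding aniso_part_def by simp
qed

lemma aniso_part_smult:
  assumes "a \<in> carrier F" "v \<in> carrier \<phi>"
  shows "a \<odot>\<^bsub>aniso_part F \<phi>\<^esub> fibre v = fibre (a \<odot>\<^bsub>\<phi>\<^esub> v)"
proof -
  have "zero_set F \<phi> +>\<^bsub>\<phi>\<^esub> (a \<odot>\<^bsub>\<phi>\<^esub> w) = fibre (a \<odot>\<^bsub>\<phi>\<^esub> v)" if "w \<in> fibre v" for w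
    using that assms by (auto simp: fibre_def coset_zero_set value_smult)
  then have "(\<Union>w\<in>fibre v. zero_set F \<phi> +>\<^bsub>\<phi>\<^esub> (a \<odot>\<^bsub>\<phi>\<^esub> w)) = fibre (a \<odot>\<^bsub>\<phi>\<^esub> v)"
    using fibre_self[OF assms(2)] by blast
  then show ?thesis unfolding aniso_part_def by simp
qed

lemma aniso_part_value:
  assumes "v \<in> carrier \<phi>"
  shows "qval (aniso_part F \<phi>) (fibre v) = qval \<phi> v"
proof -
  have "(SOME w. w \<in> fibre v) \<in> fibre v" by (rule someI[of _ v]) (rule fibre_self[OF assms])
  then show ?thesis unfolding aniso_part_def by (simp add: fibre_def)
qed

lemma semilinear_form_aniso_part: "semilinear_form F (aniso_part F \<phi>)"
proof -
  let ?A = "aniso_part F \<phi>"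
  note s = aniso_part_carrier aniso_part_zero aniso_part_add aniso_part_smult aniso_part_value
  have "vectorspace F ?A"
  proof (rule vs_criteria)
    show "field F" by unfold_locales
    show "\<forall>v\<in>carrier ?A. \<exists>w\<in>carrier ?A. v \<oplus>\<^bsub>?A\<^esub> w = \<zero>\<^bsub>?A\<^esub>"
    proof
      fix Z assume "Z \<in> carrier ?A"
      then obtain v where v: "v \<in> carrier \<phi>" "Z = fibre v" unfolding aniso_part_carrier by auto
      then have "Z \<oplus>\<^bsub>?A\<^esub> fibre (\<ominus>\<^bsub>\<phi>\<^esub> v) = \<zero>\<^bsub>?A\<^esub>" by (simp add: s M.r_neg)
      then show "\<exists>w\<in>carrier ?A. Z \<oplus>\<^bsub>?A\<^esub> w = \<zero>\<^bsub>?A\<^esub>"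
        using v by (intro bexI[of _ "fibre (\<ominus>\<^bsub>\<phi>\<^esub> v)"]) (auto simp: aniso_part_carrier)
    qed
  qed (auto simp: s M.a_ac smult_assoc1 smult_l_distr smult_r_distr)
  moreover have "semilinear_form_axioms F ?A"
    by (rule semilinear_form_axioms.intro) (auto simp: s char2 value_closed value_semilinear)
  ultimately show ?thesis by (rule semilinear_form.intro)
qed

lemma value_set_aniso_part: "value_set (aniso_part F \<phi>) = value_set \<phi>"
  unfolding value_set_def aniso_part_carrier using aniso_part_value by (auto simp: image_image image_iff)

lemma aniso_part_inj: "inj_on (qval (aniso_part F \<phi>)) (carrier (aniso_part F \<phi>))"
  unfolding aniso_part_carrier by (rule inj_onI, clarsimp simp: aniso_part_value) (simp add: fibre_def)

lemma aniso_part_anisotropic: "anisotropic F (aniso_part F \<phi>)"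
  using aniso_part_inj semilinear_form.anisotropic_iff_inj[OF semilinear_form_aniso_part] by simp

text \<open>Finite dimension comes from the finitely many generators \<open>ds\<close> of the value
  set, which the quotient by the zero set preserves.\<close>

lemma aniso_part_quasilinear_form:
  assumes "set ds \<subseteq> carrier F" "value_set \<phi> = Span sq ds"
  shows "quasilinear_form F (aniso_part F \<phi>)"
  using semilinear_form.injective_quasilinear_form[OF semilinear_form_aniso_part aniso_part_inj assms(1)]
    assms(2) value_set_aniso_part by simp

end

section \<open>Diagonal forms and the sets \<open>P_r\<close> in terms of value sets\<close>

context char2_field
begin

lemma diag_form_simps:
  "carrier (diag_form R as) = {..<length as} \<rightarrow>\<^sub>E carrier R"
  "\<zero>\<^bsub>diag_form R as\<^esub> = restrict (\<lambda>i. \<zero>) {..<length as}"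
  "v \<oplus>\<^bsub>diag_form R as\<^esub> w = restrict (\<lambda>i. v i \<oplus> w i) {..<length as}"
  "a \<odot>\<^bsub>diag_form R as\<^esub> v = restrict (\<lambda>i. a \<otimes> v i) {..<length as}"
  "qval (diag_form R as) = qsum R as"
  unfolding diag_form_def module.extend_def qform.fields_def func_space_def
  by (simp_all add: qsum_def fun_eq_iff)

lemma semilinear_form_diag_form:
  assumes as: "set as \<subseteq> carrier R"
  shows "semilinear_form R (diag_form R as)"
proof -
  let ?D = "diag_form R as"
  have "vectorspace R ?D"
  proof (rule vs_criteria)
    show "field R" by (rule field_axioms)
    show "\<forall>v\<in>carrier ?D. \<exists>w\<in>carrier ?D. v \<oplus>\<^bsub>?D\<^esub> w = \<zero>\<^bsub>?D\<^esub>"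
    proof
      fix v assume v: "v \<in> carrier ?D"
      then have "v \<oplus>\<^bsub>?D\<^esub> v = \<zero>\<^bsub>?D\<^esub>"
        unfolding diag_form_simps by (auto simp: fun_eq_iff restrict_def PiE_iff)
      then show "\<exists>w\<in>carrier ?D. v \<oplus>\<^bsub>?D\<^esub> w = \<zero>\<^bsub>?D\<^esub>" using v by blast
    qed
  qed (auto simp: diag_form_simps fun_eq_iff restrict_def PiE_iff extensional_def a_ac m_assoc l_distr r_distr)
  moreover have "semilinear_form_axioms R ?D"
  proof (rule semilinear_form_axioms.intro)
    show "\<one> \<oplus> \<one> = \<zero>" by (rule char2)
    show "qval ?D v \<in> carrier R" if "v \<in> carrier ?D" for v
      using that as unfolding diag_form_simps by (intro qsum_closed) auto
    show "qval ?D ((a \<odot>\<^bsub>?D\<^esub> v) \<oplus>\<^bsub>?D\<^esub> w) = a [^] (2::nat) \<otimes> qval ?D v \<oplus> qval ?D w"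
      if avw: "a \<in> carrier R" "v \<in> carrier ?D" "w \<in> carrier ?D" for a v w
    proof -
      have v: "\<And>i. i < length as \<Longrightarrow> v i \<in> carrier R" and w: "\<And>i. i < length as \<Longrightarrow> w i \<in> carrier R"
        using avw unfolding diag_form_simps by auto
      have "qval ?D ((a \<odot>\<^bsub>?D\<^esub> v) \<oplus>\<^bsub>?D\<^esub> w) = qsum R as (\<lambda>i. a \<otimes> v i \<oplus> w i)"
        unfolding diag_form_simps using as v w avw(1) by (intro qsum_cong) auto
      also have "\<dots> = qsum R as (\<lambda>i. a \<otimes> v i) \<oplus> qsum R as w"
        using as v w avw(1) by (intro qsum_add) auto
      finally show ?thesis using qsum_smult[OF as v avw(1)] unfolding diag_form_simps by simp
    qed
  qed
  ultimately show ?thesis by (rule semilinear_form.intro)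
qed

lemma value_set_diag_form:
  assumes as: "set as \<subseteq> carrier R"
  shows "value_set (diag_form R as) = Span sq as"
proof -
  have "value_set (diag_form R as) = qvals R as"
    unfolding value_set_def qvals_def diag_form_simps
  proof
    show "qsum R as ` ({..<length as} \<rightarrow>\<^sub>E carrier R) \<subseteq> {qsum R as x |x. \<forall>i<length as. x i \<in> carrier R}" by auto
    show "{qsum R as x |x. \<forall>i<length as. x i \<in> carrier R} \<subseteq> qsum R as ` ({..<length as} \<rightarrow>\<^sub>E carrier R)"
    proof
      fix y assume "y \<in> {qsum R as x |x. \<forall>i<length as. x i \<in> carrier R}"
      then obtain x where x: "y = qsum R as x" "\<forall>i<length as. x i \<in> carrier R" by auto
      then have "y = qsum R as (restrict x {..<length as})" using as by (auto intro!: qsum_cong)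
      moreover have "restrict x {..<length as} \<in> {..<length as} \<rightarrow>\<^sub>E carrier R" using x(2) by auto
      ultimately show "y \<in> qsum R as ` ({..<length as} \<rightarrow>\<^sub>E carrier R)" by blast
    qed
  qed
  then show ?thesis using qvals_eq_Span[OF as] by simp
qed

lemma anisotropic_diag_form:
  assumes as: "set as \<subseteq> carrier R"
  shows "anisotropic R (diag_form R as) \<longleftrightarrow> independent sq as"
proof
  assume ind: "independent sq as"
  interpret D: semilinear_form R "diag_form R as" by (rule semilinear_form_diag_form[OF as])
  have "v = \<zero>\<^bsub>diag_form R as\<^esub>" if v: "v \<in> carrier (diag_form R as)" "qval (diag_form R as) v = \<zero>" for v
  proof -
    have "\<forall>i<length as. v i = \<zero>"
      using ind v unfolding independent_iff_qsum[OF as] diag_form_simps by blast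
    then show ?thesis using v(1) unfolding diag_form_simps by (auto simp: fun_eq_iff PiE_iff extensional_def)
  qed
  then show "anisotropic R (diag_form R as)"
    unfolding anisotropic_def zero_set_def using D.value_zero D.M.zero_closed by auto
next
  assume an: "anisotropic R (diag_form R as)"
  have "x i = \<zero>" if x: "\<forall>i<length as. x i \<in> carrier R" "qsum R as x = \<zero>" and i: "i < length as" for x i
  proof -
    have "qsum R as (restrict x {..<length as}) = qsum R as x" using x(1) as by (auto intro!: qsum_cong)
    then have "restrict x {..<length as} \<in> zero_set R (diag_form R as)"
      unfolding zero_set_def diag_form_simps using x by auto
    then have "restrict x {..<length as} = restrict (\<lambda>i. \<zero>) {..<length as}"
      using an unfolding anisotropic_def by (simp add: diag_form_simps)
    then show ?thesis using i by (metis lessThan_iff restrict_apply')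
  qed
  then show "independent sq as" unfolding independent_iff_qsum[OF as] by blast
qed

lemma isometric_value_set:
  assumes "isometric R \<phi> \<psi>"
  shows "value_set \<phi> = value_set \<psi>"
proof -
  obtain h where h: "bij_betw h (carrier \<phi>) (carrier \<psi>)" "\<And>v. v \<in> carrier \<phi> \<Longrightarrow> qval \<psi> (h v) = qval \<phi> v"
    using assms unfolding isometric_def by auto
  have "value_set \<psi> = qval \<psi> ` (h ` carrier \<phi>)"
    unfolding value_set_def using bij_betw_imp_surj_on[OF h(1)] by simp
  then show ?thesis unfolding value_set_def using h(2) by (simp add: image_image)
qed

lemma isometric_inj:
  assumes "isometric R \<phi> \<psi>" "inj_on (qval \<phi>) (carrier \<phi>)"
  shows "inj_on (qval \<psi>) (carrier \<psi>)"
proof -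
  obtain h where h: "bij_betw h (carrier \<phi>) (carrier \<psi>)" "\<And>v. v \<in> carrier \<phi> \<Longrightarrow> qval \<psi> (h v) = qval \<phi> v"
    using assms(1) unfolding isometric_def by auto
  have "inj_on (qval \<psi>) (h ` carrier \<phi>)"
  proof (rule inj_onI)
    fix x y assume xy: "x \<in> h ` carrier \<phi>" "y \<in> h ` carrier \<phi>" "qval \<psi> x = qval \<psi> y"
    then obtain v w where vw: "v \<in> carrier \<phi>" "w \<in> carrier \<phi>" "x = h v" "y = h w" by auto
    then have "v = w" using xy(3) h(2) inj_onD[OF assms(2), of v w] by simp
    then show "x = y" using vw by simp
  qed
  then show ?thesis using bij_betw_imp_surj_on[OF h(1)] by simp
qed

lemma isometric_refl: "isometric R \<phi> \<phi>"
  unfolding isometric_def by (rule bexI[of _ "\<lambda>x. x"]) (auto simp: module_hom_def bij_betw_def)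

text \<open>Let \<open>M\<close> be the field of values of \<open>\<pi>\<close>. The values of the
  tensor product are the \<open>M\<close>-span of those of \<open>\<chi>\<close>. Passing to the
  anisotropic part keeps the values, and the dimension of an anisotropic form is that of its value
  set over the squares, so the tower law gives the product.\<close>

lemma dimension_aniso_tensor:
  assumes pi: "quasilinear_form R \<pi>" and chi: "quasilinear_form R \<chi>"
    and cs: "set cs \<subseteq> carrier R" "independent sq (pf cs)" and v: "value_set \<pi> = Span sq (pf cs)"
    and ds: "set ds \<subseteq> carrier R" "value_set \<chi> = Span sq ds"
    and e: "dimension e (Span sq (pf cs)) (Span (Span sq (pf cs)) ds)"
  shows "vectorspace.dim R (aniso_part R (tensor_form R \<pi> \<chi>)) = 2 ^ length cs * e"
proof -
  let ?M = "Span sq (pf cs)"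
  let ?T = "tensor_coeffs R (diag_coeffs R \<pi>) (diag_coeffs R \<chi>)"
  interpret pi: quasilinear_form R \<pi> by (rule pi)
  interpret chi: quasilinear_form R \<chi> by (rule chi)
  have M: "subfield ?M R" "sq \<subseteq> ?M" using Span_pf_field[OF cs(1)] by auto
  have pic: "Span sq (diag_coeffs R \<pi>) = ?M" using v pi.value_set_eq_Span by simp
  have T: "set ?T \<subseteq> carrier R" by (rule tensor_coeffs_closed[OF pi.diag_coeffs_closed chi.diag_coeffs_closed])
  have "Span sq ?T = Span ?M (diag_coeffs R \<chi>)"
    using Span_tensor_coeffs[OF squares_subfield _ _ pi.diag_coeffs_closed chi.diag_coeffs_closed] M pic by simp
  also have "\<dots> = Span ?M ds"
    using ds(2) chi.value_set_eq_Span by (intro Span_over_extension[OF M chi.diag_coeffs_closed ds(1)]) simp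
  finally have ST: "Span sq ?T = Span ?M ds" .
  interpret T: semilinear_form R "tensor_form R \<pi> \<chi>"
    unfolding tensor_form_def by (rule semilinear_form_diag_form[OF T])
  have VT: "value_set (tensor_form R \<pi> \<chi>) = Span sq ?T"
    unfolding tensor_form_def by (rule value_set_diag_form[OF T])
  interpret A: quasilinear_form R "aniso_part R (tensor_form R \<pi> \<chi>)"
    by (rule T.aniso_part_quasilinear_form[OF T VT])
  have "dimension (vectorspace.dim R (aniso_part R (tensor_form R \<pi> \<chi>))) sq (Span ?M ds)"
    using A.dimension_value_set[OF T.aniso_part_anisotropic] VT ST T.value_set_aniso_part by simp
  moreover have "dimension (2 ^ length cs * e) sq (Span ?M ds)"
    using telescopic_base[OF squares_subfield M(1) _ e] dimension_independent[OF cs(2)]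
    by (simp add: length_pfister_coeffs)
  ultimately show ?thesis by (rule dimension_is_inj[OF squares_subfield])
qed

text \<open>An anisotropic \<open>r\<close>-fold quasi-Pfister form amounts to \<open>r\<close>
  elements whose \<open>2^r\<close> products are independent over the squares, and
  \<open>dimension_aniso_tensor\<close> computes the dimension in question as \<open>2^r e\<close>.
  Apart from its dimension, \<open>\<chi>\<close> now enters only through generators of its value
  set.\<close>

lemma P_set_nonempty_iff:
  assumes chi: "quasilinear_form R \<chi>" and ds: "set ds \<subseteq> carrier R" "value_set \<chi> = Span sq ds"
  shows "P_set R r \<chi> \<noteq> {} \<longleftrightarrow> (\<exists>cs e. set cs \<subseteq> carrier R \<and> length cs = r \<and> independent sq (pf cs) \<and>
    dimension e (Span sq (pf cs)) (Span (Span sq (pf cs)) ds) \<and> 2 ^ r * e < vectorspace.dim R \<chi> + 2 ^ r)"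
proof
  assume "P_set R r \<chi> \<noteq> {}"
  then obtain \<pi> :: "('a, nat \<Rightarrow> 'a) qform" and cs where pi: "quasilinear_form R \<pi>" "anisotropic R \<pi>"
    and cs: "length cs = r" "set cs \<subseteq> carrier R" "isometric R \<pi> (diag_form R (pf cs))"
    and d: "vectorspace.dim R (aniso_part R (tensor_form R \<pi> \<chi>)) < vectorspace.dim R \<chi> + 2 ^ r"
    unfolding P_set_def quasi_pfister_def by blast
  note pc = pfister_coeffs_closed[OF cs(2)]
  interpret pi: quasilinear_form R \<pi> by (rule pi(1))
  interpret D: semilinear_form R "diag_form R (pf cs)" by (rule semilinear_form_diag_form[OF pc])
  have "anisotropic R (diag_form R (pf cs))"
    using isometric_inj[OF cs(3)] pi(2) unfolding D.anisotropic_iff_inj pi.anisotropic_iff_inj by simp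
  then have ind: "independent sq (pf cs)" unfolding anisotropic_diag_form[OF pc] .
  have v: "value_set \<pi> = Span sq (pf cs)"
    using isometric_value_set[OF cs(3)] value_set_diag_form[OF pc] by simp
  obtain us where us: "independent (Span sq (pf cs)) us" "Span (Span sq (pf cs)) us = Span (Span sq (pf cs)) ds"
    using short_base[OF Span_pf_field(1)[OF cs(2)] ds(1)] by auto
  have e: "dimension (length us) (Span sq (pf cs)) (Span (Span sq (pf cs)) ds)"
    using dimension_independent[OF us(1)] us(2) by simp
  then show "\<exists>cs e. set cs \<subseteq> carrier R \<and> length cs = r \<and> independent sq (pf cs) \<and>
    dimension e (Span sq (pf cs)) (Span (Span sq (pf cs)) ds) \<and> 2 ^ r * e < vectorspace.dim R \<chi> + 2 ^ r"
    using dimension_aniso_tensor[OF pi(1) chi cs(2) ind v ds e] d cs(1,2) ind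
    by (intro exI[of _ cs] exI[of _ "length us"]) simp
next
  assume "\<exists>cs e. set cs \<subseteq> carrier R \<and> length cs = r \<and> independent sq (pf cs) \<and>
    dimension e (Span sq (pf cs)) (Span (Span sq (pf cs)) ds) \<and> 2 ^ r * e < vectorspace.dim R \<chi> + 2 ^ r"
  then obtain cs e where cs: "set cs \<subseteq> carrier R" "length cs = r" "independent sq (pf cs)"
    and e: "dimension e (Span sq (pf cs)) (Span (Span sq (pf cs)) ds)" "2 ^ r * e < vectorspace.dim R \<chi> + 2 ^ r"
    by auto
  let ?\<pi> = "diag_form R (pf cs)"
  note pc = pfister_coeffs_closed[OF cs(1)]
  interpret D: semilinear_form R ?\<pi> by (rule semilinear_form_diag_form[OF pc])
  have an: "anisotropic R ?\<pi>" using cs(3) anisotropic_diag_form[OF pc] by simp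
  have v: "value_set ?\<pi> = Span sq (pf cs)" by (rule value_set_diag_form[OF pc])
  have q: "quasilinear_form R ?\<pi>"
    using D.injective_quasilinear_form[OF _ pc v] an D.anisotropic_iff_inj by simp
  have "quasi_pfister R r ?\<pi>" unfolding quasi_pfister_def using cs isometric_refl by blast
  moreover have "vectorspace.dim R (aniso_part R (tensor_form R ?\<pi> \<chi>)) < vectorspace.dim R \<chi> + 2 ^ r"
    using dimension_aniso_tensor[OF q chi cs(1,3) v ds e(1)] e(2) cs(2) by simp
  ultimately have "iso_class R ?\<pi> \<in> P_set R r \<chi>" unfolding P_set_def using q an by blast
  then show "P_set R r \<chi> \<noteq> {}" by blast
qed

end

section \<open>The function field of a quadric\<close>

lemma (in ring) base_in_powers: "x \<in> carrier R \<Longrightarrow> x \<in> powers R x"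
  unfolding powers_def by (rule CollectI, rule exI[of _ "1::nat"]) simp

lemma (in cring) Units_r_cancel:
  assumes "u \<in> Units R" "x \<in> carrier R" "y \<in> carrier R"
  shows "x \<otimes> u = y \<otimes> u \<longleftrightarrow> x = y"
  using assms Units_l_cancel[of u x y] m_comm[of x u] m_comm[of y u] Units_closed[of u] by auto

context quasilinear_coeffs
begin

text \<open>The function field in terms of the coefficient list;
  \<open>first_form_properties\<close> identifies it with \<open>function_field\<close>.\<close>

definition "FF = localization (A 0) (carrier (A 0) - {\<zero>\<^bsub>A 0\<^esub>})"

definition "ff p = loc_frac (A 0) (carrier (A 0) - {\<zero>\<^bsub>A 0\<^esub>}) (cls 0 p) \<one>\<^bsub>A 0\<^esub>"

lemma chart_repr:
  assumes "chart m B l" "b \<in> carrier B"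
  shows "\<exists>d\<in>carrier (P m). l d \<in> Units B \<and> (\<exists>p\<in>carrier (P m). b \<otimes>\<^bsub>B\<^esub> l d = l p)"
proof -
  have "\<exists>d\<in>carrier (P m). l d \<in> Units B \<and> (\<forall>i<1::nat. \<exists>p\<in>carrier (P m). b \<otimes>\<^bsub>B\<^esub> l d = l p)"
    using assms unfolding chart_def by (elim conjE allE[of _ "1::nat"] allE[of _ "\<lambda>_. b"]) simp
  then show ?thesis by simp
qed

lemma FF_field: "field FF"
  unfolding FF_def by (rule domain.fraction_field[OF A_domain])

lemma FF_chart: "chart 0 FF ff"
proof -
  let ?S = "carrier (A 0) - {\<zero>\<^bsub>A 0\<^esub>}"
  interpret A: domain "A 0" by (rule A_domain)
  note ms = A.mult_subset_nonzero
  have cr: "cring FF" unfolding FF_def by (rule mult_subset.localization_cring[OF ms])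
  have hom: "ff \<in> ring_hom (P 0) FF"
  proof -
    have "(\<lambda>a. loc_frac (A 0) ?S a \<one>\<^bsub>A 0\<^esub>) \<circ> cls 0 \<in> ring_hom (P 0) FF"
      unfolding FF_def by (rule ring_hom_trans[OF cls_hom mult_subset.loc_map_hom[OF ms]])
    then show ?thesis unfolding ff_def comp_def .
  qed
  have ker: "ff p = \<zero>\<^bsub>FF\<^esub> \<longleftrightarrow> p \<in> PIdl\<^bsub>P 0\<^esub> (q 0)" if p: "p \<in> carrier (P 0)" for p
  proof -
    have "ff p = \<zero>\<^bsub>FF\<^esub> \<longleftrightarrow> cls 0 p = \<zero>\<^bsub>A 0\<^esub>"
      unfolding ff_def FF_def mult_subset.loc_zero[OF ms] by (rule A.fraction_map_inj[OF cls_closed[OF p] A.zero_closed])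
    then show ?thesis using cls_eq_zero_iff[OF p] by simp
  qed
  have "\<exists>d\<in>carrier (P 0). ff d \<in> Units FF \<and> (\<forall>i<N. \<exists>p\<in>carrier (P 0). x i \<otimes>\<^bsub>FF\<^esub> ff d = ff p)"
    if x: "\<forall>i<N. x i \<in> carrier FF" for N :: nat and x
  proof -
    have x': "x i \<in> carrier (localization (A 0) ?S)" if "i \<in> {..<N}" for i using x that by (simp add: FF_def)
    obtain s where s: "s \<in> ?S"
      "\<forall>i\<in>{..<N}. \<exists>a\<in>carrier (A 0). x i \<otimes>\<^bsub>localization (A 0) ?S\<^esub> loc_frac (A 0) ?S s \<one>\<^bsub>A 0\<^esub> = loc_frac (A 0) ?S a \<one>\<^bsub>A 0\<^esub>"
      using mult_subset.common_denominator[OF ms, of "{..<N}" x] x' by blast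
    have sA: "s \<in> carrier (A 0)" using s(1) by simp
    obtain d where d: "d \<in> carrier (P 0)" "s = cls 0 d" using A_repr[OF sA] by (elim bexE)
    have "\<exists>p\<in>carrier (P 0). x i \<otimes>\<^bsub>FF\<^esub> ff d = ff p" if i: "i < N" for i
    proof -
      obtain a where a: "a \<in> carrier (A 0)"
        "x i \<otimes>\<^bsub>localization (A 0) ?S\<^esub> loc_frac (A 0) ?S s \<one>\<^bsub>A 0\<^esub> = loc_frac (A 0) ?S a \<one>\<^bsub>A 0\<^esub>"
        using s(2) i by blast
      obtain p where p: "p \<in> carrier (P 0)" "a = cls 0 p" using A_repr[OF a(1)] by (elim bexE)
      show ?thesis using a(2) p(1) unfolding d(2) p(2) FF_def ff_def by (rule bexI)
    qed
    moreover have "ff d \<in> Units FF"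
      using mult_subset.loc_denom_Unit[OF ms s(1)] unfolding d(2) FF_def ff_def .
    ultimately show ?thesis using d(1) by blast
  qed
  then show ?thesis unfolding chart_def using cr hom ker by blast
qed

lemma FF_cring: "cring FF" and ff_hom: "ff \<in> ring_hom (P 0) FF"
  and ff_eq_zero_iff: "p \<in> carrier (P 0) \<Longrightarrow> ff p = \<zero>\<^bsub>FF\<^esub> \<longleftrightarrow> p \<in> PIdl\<^bsub>P 0\<^esub> (q 0)"
  using FF_chart unfolding chart_def by blast+

lemma ff_closed: "p \<in> carrier (P 0) \<Longrightarrow> ff p \<in> carrier FF"
  by (rule ring_hom_closed[OF ff_hom])

lemma const_P: "c \<in> carrier F \<Longrightarrow> indexed_const c \<in> carrier (P m)" by simp

lemma ff_const_hom: "(\<lambda>c. ff (indexed_const c)) \<in> ring_hom F FF"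
  using ring_hom_trans[OF const_hom ff_hom] unfolding comp_def .

lemma FF_char2_field: "char2_field FF"
  using char2_cring_image[OF FF_cring ff_const_hom] FF_field unfolding char2_field_def by simp

lemma FF_Units: "p \<in> carrier (P 0) \<Longrightarrow> p \<notin> PIdl\<^bsub>P 0\<^esub> (q 0) \<Longrightarrow> ff p \<in> Units FF"
  using field.field_Units[OF FF_field] ff_closed ff_eq_zero_iff by simp

text \<open>A special point where \<open>s\<close> does not vanish is extended by zeros in the
  \<open>m\<close> extra coordinates, which \<open>s\<close> does not involve.\<close>

lemma ideal_transfer:
  assumes s: "s \<in> carrier (P 0)" "s \<notin> PIdl\<^bsub>P 0\<^esub> (q 0)"
  shows "s \<in> carrier (P m)" "s \<notin> PIdl\<^bsub>P m\<^esub> (q m)"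
proof -
  interpret fr: ring_hom_cring F F frob by (rule frobenius_hom_cring)
  show sm: "s \<in> carrier (P m)" using s(1) mpoly_ring_mono[of "{..<n + 0}" "{..<n + m}"] by auto
  obtain z where z: "z \<in> {1..<n + 0} \<rightarrow> carrier F" "frob_eval 0 z s \<noteq> \<zero>"
    using exists_special_pt[of "{s}" 0] s by (metis finite.emptyI finite.insertI singletonI singletonD)
  define z' where "z' i = (if i < n then z i else \<zero>)" for i
  have zc: "z i \<in> carrier F" if "1 \<le> i" "i < n" for i using pt_coord[OF z(1), of i] that by simp
  have z': "z' \<in> {1..<n + m} \<rightarrow> carrier F" using z(1) by (auto simp: z'_def)
  have z'0: "z' \<in> {1..<n + 0} \<rightarrow> carrier F" using z(1) by (auto simp: z'_def)
  have pts: "special_pt z' i = special_pt z i" if "i < n" for i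
  proof -
    have "tail_sum z' = tail_sum z"
      unfolding tail_sum_def using z(1) by (intro finsum_cong') (auto simp: z'_def zc)
    then show ?thesis using that by (simp add: special_pt_def z'_def)
  qed
  have "frob_eval m z' s = frob_eval 0 z' s"
    by (rule fr.mpoly_eval_restrict[OF _ _ special_pt_closed[OF z'] s(1)]) auto
  also have "\<dots> = frob_eval 0 z s"
    using special_pt_closed[OF z(1)] special_pt_closed[OF z'0] pts
    by (intro mpoly_hom_eqI[OF frob_eval_hom[OF z'0] frob_eval_hom[OF z(1)] _ _ s(1)])
       (auto simp: fr.mpoly_eval_const fr.mpoly_eval_var)
  finally show "s \<notin> PIdl\<^bsub>P m\<^esub> (q m)" using frob_eval_ideal[OF z'] z(2) by auto
qed

text \<open>The point over the function field whose quadric part is the generic point and whose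
  affine part is constant. The constants \<open>z_i\<close> come from a special point where
  \<open>f\<close> and \<open>r\<close> do not vanish, which keeps both nonzero here.\<close>

lemma generic_hom:
  assumes f: "f \<in> carrier (P m)" "f \<notin> PIdl\<^bsub>P m\<^esub> (q m)" and r: "r \<in> carrier (P m)" "r \<notin> PIdl\<^bsub>P m\<^esub> (q m)"
  shows "\<exists>\<chi>\<in>ring_hom (Af m (cls m f)) FF.
    (\<forall>c\<in>carrier F. \<chi> (lc m (cls m f) (indexed_const c)) = ff (indexed_const c)) \<and>
    \<chi> (lc m (cls m f) r) \<noteq> \<zero>\<^bsub>FF\<^esub>"
proof -
  interpret fr: ring_hom_cring F F frob by (rule frobenius_hom_cring)
  interpret cst: ring_hom_cring F "P 0" indexed_const by (rule ring_hom_cring_of[OF is_cring P_cring const_hom])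
  interpret j: ring_hom_cring F FF "\<lambda>c. ff (indexed_const c)"
    by (rule ring_hom_cring_of[OF is_cring FF_cring ff_const_hom])
  obtain z where z: "z \<in> {1..<n + m} \<rightarrow> carrier F" "frob_eval m z f \<noteq> \<zero>" "frob_eval m z r \<noteq> \<zero>"
    using exists_special_pt[of "{f, r}" m] f r
    by (metis finite.emptyI finite.insertI insertI1 insertI2 singletonI singletonD insertE)
  have z0: "z \<in> {1..<n + 0} \<rightarrow> carrier F" using z(1) by auto
  define y :: "nat \<Rightarrow> nat multiset \<Rightarrow> 'a" where "y i = (if i < n then indexed_var i else indexed_const (z i))" for i
  have zc: "z i \<in> carrier F" if "\<not> i < n" "i < n + m" for i
    using pt_coord[OF z(1), of i] that n_pos(1) by (cases i) auto
  have y: "y \<in> {..<n + m} \<rightarrow> carrier (P 0)" by (auto simp: y_def zc)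
  define \<rho> where "\<rho> = cst.mpoly_eval {..<n + m} y"
  have \<rho>: "\<rho> \<in> ring_hom (P m) (P 0)" unfolding \<rho>_def by (rule cst.mpoly_eval_hom[OF _ y]) simp
  have \<rho>_const: "\<rho> (indexed_const c) = indexed_const c" if "c \<in> carrier F" for c
    unfolding \<rho>_def using that y by (rule cst.mpoly_eval_const)
  have \<rho>_var: "\<rho> (indexed_var i) = y i" if "i < n + m" for i
    unfolding \<rho>_def using that by (intro cst.mpoly_eval_var[OF _ y]) auto
  have sp: "special_pt z \<in> {..<n + m} \<rightarrow> carrier F" "special_pt z \<in> {..<n + 0} \<rightarrow> carrier F"
    using special_pt_closed[OF z(1)] special_pt_closed[OF z0] by auto
  \<comment> \<open>Evaluation at \<open>z\<close> factors through the substitution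
    \<open>\<rho>\<close>, so \<open>\<rho> f\<close> and \<open>\<rho> r\<close> inherit
    nonvanishing from \<open>f\<close> and \<open>r\<close>.\<close>
  have \<rho>_eval: "frob_eval 0 z (\<rho> p) = frob_eval m z p" if p: "p \<in> carrier (P m)" for p
  proof -
    have "(frob_eval 0 z \<circ> \<rho>) p = frob_eval m z p"
    proof (rule mpoly_hom_eqI[OF ring_hom_trans[OF \<rho> frob_eval_hom[OF z0]] frob_eval_hom[OF z(1)] _ _ p])
      show "(frob_eval 0 z \<circ> \<rho>) (indexed_const c) = frob_eval m z (indexed_const c)" if "c \<in> carrier F" for c
        using that sp by (simp add: \<rho>_const fr.mpoly_eval_const)
      fix i assume i: "i \<in> {..<n + m}"
      have zi: "z i \<in> carrier F" if "\<not> i < n" using z(1) i n_pos that by auto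
      have vm: "frob_eval m z (indexed_var i) = special_pt z i"
        using i sp by (intro fr.mpoly_eval_var) auto
      show "(frob_eval 0 z \<circ> \<rho>) (indexed_var i) = frob_eval m z (indexed_var i)"
      proof (cases "i < n")
        case True
        then have "frob_eval 0 z (indexed_var i) = special_pt z i" using sp by (intro fr.mpoly_eval_var) auto
        then show ?thesis using True i vm \<rho>_var by (simp add: y_def)
      next
        case False
        then have "frob_eval 0 z (indexed_const (z i)) = z i [^] (2::nat)" by (intro fr.mpoly_eval_const zi sp)
        then show ?thesis using False i n_pos vm \<rho>_var by (simp add: y_def special_pt_def)
      qed
    qed
    then show ?thesis by simp
  qed
  have \<rho>_closed: "\<rho> p \<in> carrier (P 0)" if "p \<in> carrier (P m)" for p using \<rho> that by (rule ring_hom_closed)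
  have nz: "\<rho> f \<notin> PIdl\<^bsub>P 0\<^esub> (q 0)" "\<rho> r \<notin> PIdl\<^bsub>P 0\<^esub> (q 0)"
    using frob_eval_ideal[OF z0] \<rho>_eval[OF f(1)] \<rho>_eval[OF r(1)] z(2,3) by auto
  define x where "x i = ff (y i)" for i
  have x: "x \<in> {..<n + m} \<rightarrow> carrier FF" using y ff_closed unfolding x_def by (auto simp del: mpoly_ring_simps)
  have eval: "j.mpoly_eval {..<n + m} x p = ff (\<rho> p)" if p: "p \<in> carrier (P m)" for p
  proof -
    have "j.mpoly_eval {..<n + m} x p = (ff \<circ> \<rho>) p"
    proof (rule mpoly_hom_eqI[OF j.mpoly_eval_hom[OF finite_lessThan x] ring_hom_trans[OF \<rho> ff_hom] _ _ p])
      show "j.mpoly_eval {..<n + m} x (indexed_const c) = (ff \<circ> \<rho>) (indexed_const c)" if "c \<in> carrier F" for c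
        using j.mpoly_eval_const[OF that x] \<rho>_const[OF that] by simp
      show "j.mpoly_eval {..<n + m} x (indexed_var i) = (ff \<circ> \<rho>) (indexed_var i)" if "i \<in> {..<n + m}" for i
        using j.mpoly_eval_var[OF finite_lessThan x that] \<rho>_var[of i] that by (simp add: x_def)
    qed
    then show ?thesis by simp
  qed
  have pt: "qsum FF (map (\<lambda>c. ff (indexed_const c)) as) x = \<zero>\<^bsub>FF\<^esub>"
  proof -
    have "ff (indexed_var i) \<in> carrier FF" if "i < n" for i using that by (intro ff_closed) simp
    then have "qsum FF (map (\<lambda>c. ff (indexed_const c)) as) x = qsum FF (map (\<lambda>c. ff (indexed_const c)) as) (\<lambda>i. ff (indexed_var i))"
      using as_closed x by (intro cring.qsum_cong[OF FF_cring]) (auto simp: x_def y_def)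
    then show ?thesis using chart_point[OF FF_chart] by simp
  qed
  have unit: "j.mpoly_eval {..<n + m} x f \<in> Units FF"
    unfolding eval[OF f(1)] using \<rho>_closed[OF f(1)] nz(1) by (rule FF_Units)
  obtain \<chi> where \<chi>: "\<chi> \<in> ring_hom (Af m (cls m f)) FF"
    "\<And>p. p \<in> carrier (P m) \<Longrightarrow> \<chi> (lc m (cls m f) p) = j.mpoly_eval {..<n + m} x p"
    using Af_hom_ext[OF FF_cring ff_const_hom x pt f(1) unit] by blast
  have "\<chi> (lc m (cls m f) (indexed_const c)) = ff (indexed_const c)" if "c \<in> carrier F" for c
    unfolding \<chi>(2)[OF const_P[OF that]] by (rule j.mpoly_eval_const[OF that x])
  moreover have "\<chi> (lc m (cls m f) r) \<noteq> \<zero>\<^bsub>FF\<^esub>"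
    unfolding \<chi>(2)[OF r(1)] eval[OF r(1)] using ff_eq_zero_iff[OF \<rho>_closed[OF r(1)]] nz(2) by simp
  ultimately show ?thesis using \<chi>(1) by blast
qed

text \<open>Finitely many fractions have a common denominator \<open>s\<close>, so they come from
  the single localization at \<open>s\<close>. Injectivity of \<open>\<mu>\<close> lets identities
  between them be pulled back.\<close>

lemma finite_lift:
  assumes "set xs \<subseteq> carrier FF"
  shows "\<exists>s\<in>carrier (P 0). s \<notin> PIdl\<^bsub>P 0\<^esub> (q 0) \<and> (\<exists>\<mu>\<in>ring_hom (Af 0 (cls 0 s)) FF.
    inj_on \<mu> (carrier (Af 0 (cls 0 s))) \<and> set xs \<subseteq> \<mu> ` carrier (Af 0 (cls 0 s)) \<and>
    (\<forall>c\<in>carrier F. \<mu> (lc 0 (cls 0 s) (indexed_const c)) = ff (indexed_const c)))"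
proof -
  interpret FF: field FF by (rule FF_field)
  interpret j: ring_hom_cring F FF "\<lambda>c. ff (indexed_const c)"
    by (rule ring_hom_cring_of[OF is_cring FF_cring ff_const_hom])
  have xs: "\<forall>i<length xs. xs ! i \<in> carrier FF" using assms by (auto simp: subset_iff)
  obtain s where s: "s \<in> carrier (P 0)" "ff s \<in> Units FF" "\<forall>i<length xs. \<exists>p\<in>carrier (P 0). xs ! i \<otimes>\<^bsub>FF\<^esub> ff s = ff p"
    using FF_chart xs unfolding chart_def by blast
  have sI: "s \<notin> PIdl\<^bsub>P 0\<^esub> (q 0)"
    using s(2) ff_eq_zero_iff[OF s(1)] FF.field_Units by auto
  have sA: "cls 0 s \<in> carrier (A 0)" "cls 0 s \<noteq> \<zero>\<^bsub>A 0\<^esub>"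
    using cls_closed[OF s(1)] cls_eq_zero_iff[OF s(1)] sI by auto
  define B where "B = Af 0 (cls 0 s)"
  define l where "l = lc 0 (cls 0 s)"
  have B: "chart 0 B l" unfolding B_def l_def by (rule Af_chart[OF sA])
  define x where "x i = ff (indexed_var i)" for i
  have x: "x \<in> {..<n + 0} \<rightarrow> carrier FF" unfolding x_def by (auto intro!: ff_closed)
  have eval: "j.mpoly_eval {..<n + 0} x p = ff p" if p: "p \<in> carrier (P 0)" for p
  proof (rule mpoly_hom_eqI[OF j.mpoly_eval_hom[OF finite_lessThan x] ff_hom j.mpoly_eval_const[OF _ x] _ p])
    show "j.mpoly_eval {..<n + 0} x (indexed_var i) = ff (indexed_var i)" if "i \<in> {..<n + 0}" for i
      using j.mpoly_eval_var[OF finite_lessThan x that] unfolding x_def .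
  qed
  have pt: "qsum FF (map (\<lambda>c. ff (indexed_const c)) as) x = \<zero>\<^bsub>FF\<^esub>"
    unfolding x_def by (rule chart_point[OF FF_chart])
  have unit: "j.mpoly_eval {..<n + 0} x s \<in> Units FF" unfolding eval[OF s(1)] by (rule s(2))
  obtain \<mu> where \<mu>: "\<mu> \<in> ring_hom B FF" "\<And>p. p \<in> carrier (P 0) \<Longrightarrow> \<mu> (l p) = j.mpoly_eval {..<n + 0} x p"
    unfolding B_def l_def using Af_hom_ext[OF FF_cring ff_const_hom x pt s(1) unit] by blast
  have \<mu>l: "\<mu> (l p) = ff p" if "p \<in> carrier (P 0)" for p using \<mu>(2)[OF that] eval[OF that] by simp
  have Bc: "cring B" and lh: "l \<in> ring_hom (P 0) B" using B unfolding chart_def by auto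
  interpret m: ring_hom_cring B FF \<mu> by (rule ring_hom_cring_of[OF Bc FF_cring \<mu>(1)])
  have lc: "l p \<in> carrier B" if "p \<in> carrier (P 0)" for p using lh that by (rule ring_hom_closed)
  have ker: "b = \<zero>\<^bsub>B\<^esub>" if b: "b \<in> carrier B" "\<mu> b = \<zero>\<^bsub>FF\<^esub>" for b
  proof -
    obtain d p where d: "d \<in> carrier (P 0)" "l d \<in> Units B" "p \<in> carrier (P 0)" "b \<otimes>\<^bsub>B\<^esub> l d = l p"
      using chart_repr[OF B b(1)] by blast
    have "ff p = \<mu> b \<otimes>\<^bsub>FF\<^esub> \<mu> (l d)" using \<mu>l[OF d(3)] d(4)[symmetric] b(1) lc[OF d(1)] by simp
    also have "\<dots> = \<zero>\<^bsub>FF\<^esub>" using b lc[OF d(1)] by simp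
    finally have "l p = \<zero>\<^bsub>B\<^esub>" using ff_eq_zero_iff[OF d(3)] B d(3) unfolding chart_def by blast
    then have "b \<otimes>\<^bsub>B\<^esub> l d = \<zero>\<^bsub>B\<^esub> \<otimes>\<^bsub>B\<^esub> l d" using d(4) lc[OF d(1)] by simp
    then show ?thesis using m.R.Units_r_cancel[OF d(2) b(1) m.R.zero_closed] by simp
  qed
  have inj: "inj_on \<mu> (carrier B)"
  proof (rule inj_onI)
    fix a b assume ab: "a \<in> carrier B" "b \<in> carrier B" "\<mu> a = \<mu> b"
    then have "a \<ominus>\<^bsub>B\<^esub> b = \<zero>\<^bsub>B\<^esub>" by (intro ker) (simp_all add: a_minus_def FF.r_neg)
    then show "a = b" using ab by (simp add: m.R.r_right_minus_eq)
  qed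
  have sU: "l s \<in> Units B"
    unfolding l_def B_def
    by (rule lc_denom_Unit[OF sA(1) ring.base_in_powers[OF cring.axioms(1)[OF A_cring] sA(1)]])
  have "set xs \<subseteq> \<mu> ` carrier B"
  proof
    fix y assume y: "y \<in> set xs"
    then obtain p where p: "p \<in> carrier (P 0)" "y \<otimes>\<^bsub>FF\<^esub> ff s = ff p" using s(3) by (metis in_set_conv_nth)
    let ?w = "l p \<otimes>\<^bsub>B\<^esub> inv\<^bsub>B\<^esub> (l s)"
    have w: "?w \<in> carrier B" using lc[OF p(1)] sU by simp
    have "?w \<otimes>\<^bsub>B\<^esub> l s = l p" using lc[OF p(1)] sU lc[OF s(1)] by (simp add: m.R.m_assoc)
    then have "\<mu> ?w \<otimes>\<^bsub>FF\<^esub> ff s = ff p" using m.hom_mult[OF w lc[OF s(1)]] \<mu>l[OF p(1)] \<mu>l[OF s(1)] by simp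
    then have "\<mu> ?w = y"
      using p(2) FF.Units_r_cancel[OF s(2), of "\<mu> ?w" y] m.hom_closed[OF w] assms y by auto
    then show "y \<in> \<mu> ` carrier B" using w by blast
  qed
  moreover have "\<forall>c\<in>carrier F. \<mu> (l (indexed_const c)) = ff (indexed_const c)" using \<mu>l const_P by blast
  ultimately show ?thesis using s(1) sI \<mu>(1) inj unfolding B_def l_def by blast
qed

end

lemma (in ring_hom_cring) map_tensor_coeffs:
  assumes "set cs \<subseteq> carrier R" "set ds \<subseteq> carrier R"
  shows "map h (tensor_coeffs R cs ds) = tensor_coeffs S (map h cs) (map h ds)"
  using assms(1)
proof (induction cs)
  case (Cons c cs)
  then show ?case using assms(2) by (auto simp: tensor_coeffs_def subset_iff)
qed (simp add: tensor_coeffs_def)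

lemma (in ring_hom_cring) map_pfister_coeffs:
  assumes "set cs \<subseteq> carrier R"
  shows "map h (pfister_coeffs R cs) = pfister_coeffs S (map h cs)"
  using assms
  by (induction cs) (simp_all add: map_tensor_coeffs R.pfister_coeffs_closed)

section \<open>Specialization from one function field to the other\<close>

context quadric_pair
begin

text \<open>\<open>h\<close> followed by a point of the second chart over \<open>Y.FF\<close> is a
  point of the first quadric. The point has to keep \<open>s\<close> invertible;
  \<open>generic_hom\<close> provides one, because the numerator \<open>r\<close> of the image of
  \<open>s\<close> under \<open>h\<close> is not in the ideal.\<close>

lemma specialize:
  assumes f: "f \<in> carrier (X.P m)" "f \<notin> PIdl\<^bsub>X.P m\<^esub> (X.q m)"
    and g: "g \<in> carrier (Y.P k)" "g \<notin> PIdl\<^bsub>Y.P k\<^esub> (Y.q k)"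
    and h: "h \<in> ring_iso (X.Af m (X.cls m f)) (Y.Af k (Y.cls k g))"
    and h_const: "\<And>c. c \<in> carrier F \<Longrightarrow>
      h (X.lc m (X.cls m f) (X.indexed_const c)) = Y.lc k (Y.cls k g) (X.indexed_const c)"
    and s: "s \<in> carrier (X.P 0)" "s \<notin> PIdl\<^bsub>X.P 0\<^esub> (X.q 0)"
  shows "\<exists>\<chi>\<in>ring_hom (X.Af 0 (X.cls 0 s)) Y.FF.
    \<forall>c\<in>carrier F. \<chi> (X.lc 0 (X.cls 0 s) (X.indexed_const c)) = Y.ff (X.indexed_const c)"
proof -
  define A where "A = X.Af m (X.cls m f)"
  define B where "B = Y.Af k (Y.cls k g)"
  define lX where "lX = X.lc m (X.cls m f)"
  define lY where "lY = Y.lc k (Y.cls k g)"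
  have fA: "X.cls m f \<in> carrier (X.A m)" "X.cls m f \<noteq> \<zero>\<^bsub>X.A m\<^esub>"
    using X.cls_closed[OF f(1)] X.cls_eq_zero_iff[OF f(1)] f(2) by auto
  have gA: "Y.cls k g \<in> carrier (Y.A k)" "Y.cls k g \<noteq> \<zero>\<^bsub>Y.A k\<^esub>"
    using Y.cls_closed[OF g(1)] Y.cls_eq_zero_iff[OF g(1)] g(2) by auto
  have cX: "X.chart m A lX" unfolding A_def lX_def by (rule X.Af_chart[OF fA])
  have cY: "Y.chart k B lY" unfolding B_def lY_def by (rule Y.Af_chart[OF gA])
  have AB: "cring A" "cring B" and lXh: "lX \<in> ring_hom (X.P m) A" and lYh: "lY \<in> ring_hom (Y.P k) B"
    using cX cY unfolding X.chart_def Y.chart_def by auto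
  have hA: "h \<in> ring_iso A B" using h unfolding A_def B_def .
  have hh: "h \<in> ring_hom A B" and hb: "inj_on h (carrier A)"
    using hA unfolding ring_iso_def bij_betw_def by auto
  have hc: "h (lX (X.indexed_const c)) = lY (X.indexed_const c)" if "c \<in> carrier F" for c
    unfolding lX_def lY_def by (rule h_const[OF that])
  interpret h: ring_hom_cring A B h by (rule ring_hom_cring_of[OF AB hh])
  note sm = X.ideal_transfer[OF s, of m]
  have ls: "lX s \<in> carrier A" by (rule ring_hom_closed[OF lXh sm(1)])
  have "lX s \<noteq> \<zero>\<^bsub>A\<^esub>" using cX sm unfolding X.chart_def by blast
  then have hs: "h (lX s) \<in> carrier B" "h (lX s) \<noteq> \<zero>\<^bsub>B\<^esub>"
    using ls inj_onD[OF hb, of "lX s" "\<zero>\<^bsub>A\<^esub>"] h.hom_zero by auto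
  obtain d r where d: "d \<in> carrier (Y.P k)" "lY d \<in> Units B" and r: "r \<in> carrier (Y.P k)" "h (lX s) \<otimes>\<^bsub>B\<^esub> lY d = lY r"
    using Y.chart_repr[OF cY hs(1)] by blast
  have ld: "lY d \<in> carrier B" by (rule ring_hom_closed[OF lYh d(1)])
  have rI: "r \<notin> PIdl\<^bsub>Y.P k\<^esub> (Y.q k)"
  proof
    assume "r \<in> PIdl\<^bsub>Y.P k\<^esub> (Y.q k)"
    then have "lY r = \<zero>\<^bsub>B\<^esub>" using cY r(1) unfolding Y.chart_def by blast
    then have "h (lX s) \<otimes>\<^bsub>B\<^esub> lY d = \<zero>\<^bsub>B\<^esub> \<otimes>\<^bsub>B\<^esub> lY d" using r(2) ld by simp
    then show False using h.S.Units_r_cancel[OF d(2) hs(1) h.S.zero_closed] hs(2) by simp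
  qed
  have "\<exists>\<chi>\<in>ring_hom B Y.FF. (\<forall>c\<in>carrier F. \<chi> (lY (X.indexed_const c)) = Y.ff (X.indexed_const c)) \<and>
      \<chi> (lY r) \<noteq> \<zero>\<^bsub>Y.FF\<^esub>"
    unfolding B_def lY_def by (rule Y.generic_hom[OF g r(1) rI])
  then obtain \<tau> where \<tau>: "\<tau> \<in> ring_hom B Y.FF" "\<forall>c\<in>carrier F. \<tau> (lY (X.indexed_const c)) = Y.ff (X.indexed_const c)"
    "\<tau> (lY r) \<noteq> \<zero>\<^bsub>Y.FF\<^esub>" by blast
  interpret FF: field Y.FF by (rule Y.FF_field)
  interpret t: ring_hom_cring B Y.FF \<tau> by (rule ring_hom_cring_of[OF AB(2) Y.FF_cring \<tau>(1)])
  have \<tau>s: "\<tau> (h (lX s)) \<noteq> \<zero>\<^bsub>Y.FF\<^esub>"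
  proof
    assume "\<tau> (h (lX s)) = \<zero>\<^bsub>Y.FF\<^esub>"
    then have "\<tau> (lY r) = \<zero>\<^bsub>Y.FF\<^esub>" using r(2)[symmetric] hs(1) ld by simp
    then show False using \<tau>(3) by simp
  qed
  define \<sigma> where "\<sigma> p = \<tau> (h (lX p))" for p
  have th: "\<tau> \<circ> h \<in> ring_hom A Y.FF" by (rule ring_hom_trans[OF hh \<tau>(1)])
  have "(\<tau> \<circ> h) \<circ> lX \<in> ring_hom (X.P m) Y.FF" by (rule ring_hom_trans[OF lXh th])
  then have \<sigma>m: "\<sigma> \<in> ring_hom (X.P m) Y.FF" unfolding \<sigma>_def comp_def .
  \<comment> \<open>Forgetting the extra affine coordinates turns a point of the product into a
    point of the quadric itself.\<close>
  have \<sigma>0: "\<sigma> \<in> ring_hom (X.P 0) Y.FF" by (rule X.mpoly_hom_mono[OF \<sigma>m]) auto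
  have \<sigma>c: "\<sigma> (X.indexed_const c) = Y.ff (X.indexed_const c)" if "c \<in> carrier F" for c
    unfolding \<sigma>_def using hc[OF that] \<tau>(2) that by simp
  define x where "x i = \<sigma> (X.indexed_var i)" for i
  have x: "x \<in> {..<X.n + 0} \<rightarrow> carrier Y.FF"
    unfolding x_def using ring_hom_closed[OF \<sigma>0] by auto
  interpret j: ring_hom_cring F Y.FF "\<lambda>c. Y.ff (X.indexed_const c)"
    by (rule ring_hom_cring_of[OF X.is_cring Y.FF_cring Y.ff_const_hom])
  have pt: "qsum Y.FF (map (\<lambda>c. Y.ff (X.indexed_const c)) as) x = \<zero>\<^bsub>Y.FF\<^esub>"
  proof -
    interpret th: ring_hom_cring A Y.FF "\<tau> \<circ> h" by (rule ring_hom_cring_of[OF AB(1) Y.FF_cring th])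
    have cl: "set (map (\<lambda>c. lX (X.indexed_const c)) as) \<subseteq> carrier A"
      using X.as_closed ring_hom_closed[OF lXh] by auto
    have vl: "lX (X.indexed_var i) \<in> carrier A" if "i < length (map (\<lambda>c. lX (X.indexed_const c)) as)" for i
      using that by (intro ring_hom_closed[OF lXh]) auto
    have "(\<tau> \<circ> h) (qsum A (map (\<lambda>c. lX (X.indexed_const c)) as) (\<lambda>i. lX (X.indexed_var i))) = \<zero>\<^bsub>Y.FF\<^esub>"
      using X.chart_point[OF cX] th.hom_zero by simp
    then have q0: "qsum Y.FF (map (\<tau> \<circ> h) (map (\<lambda>c. lX (X.indexed_const c)) as)) (\<lambda>i. (\<tau> \<circ> h) (lX (X.indexed_var i))) = \<zero>\<^bsub>Y.FF\<^esub>"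
      using th.hom_qsum[OF cl vl] by simp
    have eq: "map (\<tau> \<circ> h) (map (\<lambda>c. lX (X.indexed_const c)) as) = map (\<lambda>c. Y.ff (X.indexed_const c)) as"
      using \<sigma>c X.as_closed unfolding \<sigma>_def by (auto simp: subset_iff)
    show ?thesis using q0[unfolded eq] unfolding x_def \<sigma>_def comp_def .
  qed
  have eval: "j.mpoly_eval {..<X.n + 0} x p = \<sigma> p" if p: "p \<in> carrier (X.P 0)" for p
  proof (rule X.mpoly_hom_eqI[OF j.mpoly_eval_hom[OF finite_lessThan x] \<sigma>0 _ _ p])
    show "j.mpoly_eval {..<X.n + 0} x (X.indexed_const c) = \<sigma> (X.indexed_const c)" if "c \<in> carrier F" for c
      using j.mpoly_eval_const[OF that x] \<sigma>c[OF that] by simp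
    show "j.mpoly_eval {..<X.n + 0} x (X.indexed_var i) = \<sigma> (X.indexed_var i)" if "i \<in> {..<X.n + 0}" for i
      using j.mpoly_eval_var[OF finite_lessThan x that] unfolding x_def .
  qed
  have "\<sigma> s \<in> carrier Y.FF" by (rule ring_hom_closed[OF \<sigma>0 s(1)])
  then have unit: "j.mpoly_eval {..<X.n + 0} x s \<in> Units Y.FF"
    unfolding eval[OF s(1)] using \<tau>s FF.field_Units unfolding \<sigma>_def by simp
  obtain \<chi> where \<chi>: "\<chi> \<in> ring_hom (X.Af 0 (X.cls 0 s)) Y.FF"
    "\<And>p. p \<in> carrier (X.P 0) \<Longrightarrow> \<chi> (X.lc 0 (X.cls 0 s) p) = j.mpoly_eval {..<X.n + 0} x p"
    using X.Af_hom_ext[OF Y.FF_cring Y.ff_const_hom x pt s(1) unit] by blast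
  have "\<chi> (X.lc 0 (X.cls 0 s) (X.indexed_const c)) = Y.ff (X.indexed_const c)" if "c \<in> carrier F" for c
    unfolding \<chi>(2)[OF X.const_P[OF that]] by (rule j.mpoly_eval_const[OF that x])
  then show ?thesis using \<chi>(1) by blast
qed

text \<open>That each \<open>e\<close> lies in the span is witnessed by finitely many elements of
  \<open>X.FF\<close>. Witnesses and equations lift to a suitable localization, and specialization
  preserves the equations. The \<open>e\<close> themselves come from \<open>F\<close>, so they
  remain the same constants on the other side.\<close>

lemma spread:
  assumes iso: "f \<in> carrier (X.P m)" "f \<notin> PIdl\<^bsub>X.P m\<^esub> (X.q m)"
    "g \<in> carrier (Y.P k)" "g \<notin> PIdl\<^bsub>Y.P k\<^esub> (Y.q k)"
    "h \<in> ring_iso (X.Af m (X.cls m f)) (Y.Af k (Y.cls k g))"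
    and h_const: "\<And>c. c \<in> carrier F \<Longrightarrow>
      h (X.lc m (X.cls m f) (X.indexed_const c)) = Y.lc k (Y.cls k g) (X.indexed_const c)"
    and cs: "set cs \<subseteq> carrier X.FF" and vs: "set vs \<subseteq> carrier X.FF" and es: "set es \<subseteq> carrier F"
    and sub: "(\<lambda>c. X.ff (X.indexed_const c)) ` set es \<subseteq>
      qvals X.FF (tensor_coeffs X.FF (pfister_coeffs X.FF cs) vs)"
  shows "\<exists>cs' vs'. set cs' \<subseteq> carrier Y.FF \<and> set vs' \<subseteq> carrier Y.FF \<and> length cs' = length cs \<and> length vs' = length vs \<and>
    (\<lambda>c. Y.ff (X.indexed_const c)) ` set es \<subseteq> qvals Y.FF (tensor_coeffs Y.FF (pfister_coeffs Y.FF cs') vs')"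
proof -
  let ?W = "tensor_coeffs X.FF (pfister_coeffs X.FF cs) vs"
  have "\<forall>e\<in>set es. \<exists>x. (\<forall>i<length ?W. x i \<in> carrier X.FF) \<and> X.ff (X.indexed_const e) = qsum X.FF ?W x"
    using sub unfolding qvals_def by blast
  then obtain x where x: "\<forall>e\<in>set es. (\<forall>i<length ?W. x e i \<in> carrier X.FF) \<and> X.ff (X.indexed_const e) = qsum X.FF ?W (x e)"
    using bchoice[of "set es" "\<lambda>e x. (\<forall>i<length ?W. x i \<in> carrier X.FF) \<and> X.ff (X.indexed_const e) = qsum X.FF ?W x"] by blast
  \<comment> \<open>Everything that occurs in the equations: generators, vectors, and the
    coordinates witnessing each \<open>e\<close>.\<close>
  define xs where "xs = cs @ vs @ concat (map (\<lambda>e. map (x e) [0..<length ?W]) es)"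
  have "set xs \<subseteq> carrier X.FF" using cs vs x unfolding xs_def by auto
  then obtain s \<mu> where s: "s \<in> carrier (X.P 0)" "s \<notin> PIdl\<^bsub>X.P 0\<^esub> (X.q 0)"
    and \<mu>: "\<mu> \<in> ring_hom (X.Af 0 (X.cls 0 s)) X.FF" "inj_on \<mu> (carrier (X.Af 0 (X.cls 0 s)))"
      "set xs \<subseteq> \<mu> ` carrier (X.Af 0 (X.cls 0 s))"
      "\<forall>c\<in>carrier F. \<mu> (X.lc 0 (X.cls 0 s) (X.indexed_const c)) = X.ff (X.indexed_const c)"
    using X.finite_lift[of xs] by blast
  obtain \<chi> where \<chi>: "\<chi> \<in> ring_hom (X.Af 0 (X.cls 0 s)) Y.FF"
    "\<forall>c\<in>carrier F. \<chi> (X.lc 0 (X.cls 0 s) (X.indexed_const c)) = Y.ff (X.indexed_const c)"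
    using specialize[OF iso h_const s] by blast
  define B where "B = X.Af 0 (X.cls 0 s)"
  define l where "l c = X.lc 0 (X.cls 0 s) (X.indexed_const c)" for c
  have sA: "X.cls 0 s \<in> carrier (X.A 0)" by (rule X.cls_closed[OF s(1)])
  have B: "cring B" unfolding B_def by (rule X.Af_cring[OF sA])
  have lB: "l c \<in> carrier B" if "c \<in> carrier F" for c
    unfolding l_def B_def by (rule ring_hom_closed[OF X.lc_hom[OF sA] X.const_P[OF that]])
  note \<mu> = \<mu>[folded B_def l_def] and \<chi> = \<chi>[folded B_def l_def]
  interpret m: ring_hom_cring B X.FF \<mu> by (rule ring_hom_cring_of[OF B X.FF_cring \<mu>(1)])
  interpret c: ring_hom_cring B Y.FF \<chi> by (rule ring_hom_cring_of[OF B Y.FF_cring \<chi>(1)])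
  define \<nu> where "\<nu> = inv_into (carrier B) \<mu>"
  have \<nu>: "\<nu> y \<in> carrier B" "\<mu> (\<nu> y) = y" if "y \<in> set xs" for y
    using that \<mu>(3) unfolding \<nu>_def by (auto intro!: inv_into_into f_inv_into_f)
  define cs0 where "cs0 = map \<nu> cs"
  define vs0 where "vs0 = map \<nu> vs"
  have cs0: "set cs0 \<subseteq> carrier B" "map \<mu> cs0 = cs" and vs0: "set vs0 \<subseteq> carrier B" "map \<mu> vs0 = vs"
    unfolding cs0_def vs0_def using \<nu> unfolding xs_def by (auto intro!: map_idI simp: comp_def)
  define W0 where "W0 = tensor_coeffs B (pfister_coeffs B cs0) vs0"
  note pc = m.R.pfister_coeffs_closed[OF cs0(1)]
  have W0: "set W0 \<subseteq> carrier B" unfolding W0_def by (rule m.R.tensor_coeffs_closed[OF pc vs0(1)])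
  have \<mu>W: "map \<mu> W0 = ?W"
    unfolding W0_def m.map_tensor_coeffs[OF pc vs0(1)] m.map_pfister_coeffs[OF cs0(1)] cs0(2) vs0(2) ..
  have \<chi>W: "map \<chi> W0 = tensor_coeffs Y.FF (pfister_coeffs Y.FF (map \<chi> cs0)) (map \<chi> vs0)"
    unfolding W0_def c.map_tensor_coeffs[OF pc vs0(1)] c.map_pfister_coeffs[OF cs0(1)] ..
  have len: "length W0 = length ?W" using \<mu>W by (metis length_map)
  have "Y.ff (X.indexed_const e) \<in> qvals Y.FF (map \<chi> W0)" if e: "e \<in> set es" for e
  proof -
    have ec: "e \<in> carrier F" using es e by blast
    define y where "y i = \<nu> (x e i)" for i
    have xm: "x e i \<in> set xs" if "i < length W0" for i
      using that e len unfolding xs_def by (auto intro!: bexI[of _ e])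
    have y: "y i \<in> carrier B" "\<mu> (y i) = x e i" if "i < length W0" for i
      using \<nu>[OF xm[OF that]] by (simp_all add: y_def)
    have "\<mu> (qsum B W0 y) = qsum X.FF (map \<mu> W0) (\<lambda>i. \<mu> (y i))" by (rule m.hom_qsum[OF W0 y(1)])
    also have "\<dots> = qsum X.FF (map \<mu> W0) (x e)"
      using W0 y x e len by (intro m.S.qsum_cong) auto
    also have "\<dots> = \<mu> (l e)" unfolding \<mu>W using x e \<mu>(4) ec by simp
    finally have "\<mu> (qsum B W0 y) = \<mu> (l e)" .
    then have "qsum B W0 y = l e" by (rule inj_onD[OF \<mu>(2) _ m.R.qsum_closed[OF W0 y(1)] lB[OF ec]])
    moreover have "\<chi> (qsum B W0 y) = qsum Y.FF (map \<chi> W0) (\<lambda>i. \<chi> (y i))"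
      by (rule c.hom_qsum[OF W0 y(1)])
    ultimately have "\<chi> (l e) = qsum Y.FF (map \<chi> W0) (\<lambda>i. \<chi> (y i))" by simp
    then have "Y.ff (X.indexed_const e) = qsum Y.FF (map \<chi> W0) (\<lambda>i. \<chi> (y i))" using \<chi>(2) ec by simp
    moreover have "\<forall>i<length (map \<chi> W0). \<chi> (y i) \<in> carrier Y.FF" using y(1) by simp
    ultimately show ?thesis unfolding qvals_def by blast
  qed
  then have "(\<lambda>c. Y.ff (X.indexed_const c)) ` set es \<subseteq>
      qvals Y.FF (tensor_coeffs Y.FF (pfister_coeffs Y.FF (map \<chi> cs0)) (map \<chi> vs0))"
    unfolding \<chi>W by blast
  moreover have "set (map \<chi> cs0) \<subseteq> carrier Y.FF" "set (map \<chi> vs0) \<subseteq> carrier Y.FF"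
    using cs0(1) vs0(1) by auto
  moreover have "length (map \<chi> cs0) = length cs" "length (map \<chi> vs0) = length vs"
    by (simp_all add: cs0_def vs0_def)
  ultimately show ?thesis by blast
qed

end

section \<open>Derivations of the function field\<close>

context cring
begin

definition derivation :: "('a \<Rightarrow> 'a) \<Rightarrow> bool"
  where "derivation D \<longleftrightarrow> (\<forall>x\<in>carrier R. D x \<in> carrier R) \<and>
    (\<forall>x\<in>carrier R. \<forall>y\<in>carrier R. D (x \<oplus> y) = D x \<oplus> D y \<and> D (x \<otimes> y) = x \<otimes> D y \<oplus> D x \<otimes> y)"

lemma derivationD:
  assumes "derivation D" "x \<in> carrier R" "y \<in> carrier R"
  shows "D x \<in> carrier R" "D (x \<oplus> y) = D x \<oplus> D y" "D (x \<otimes> y) = x \<otimes> D y \<oplus> D x \<otimes> y"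
  using assms unfolding derivation_def by auto

lemma derivation_combination:
  assumes D: "derivation D" and E: "derivation E" and c: "c \<in> carrier R"
  shows "derivation (\<lambda>x. D x \<oplus> c \<otimes> E x)"
proof -
  have "D (x \<otimes> y) \<oplus> c \<otimes> E (x \<otimes> y) = x \<otimes> (D y \<oplus> c \<otimes> E y) \<oplus> (D x \<oplus> c \<otimes> E x) \<otimes> y"
    if xy: "x \<in> carrier R" "y \<in> carrier R" for x y
  proof -
    note cl = xy c derivationD(1)[OF D xy(1) xy(1)] derivationD(1)[OF D xy(2) xy(2)]
      derivationD(1)[OF E xy(1) xy(1)] derivationD(1)[OF E xy(2) xy(2)]
    show ?thesis
      unfolding derivationD(3)[OF D xy] derivationD(3)[OF E xy] using cl by (simp add: r_distr l_distr m_ac a_ac)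
  qed
  moreover have "D (x \<oplus> y) \<oplus> c \<otimes> E (x \<oplus> y) = (D x \<oplus> c \<otimes> E x) \<oplus> (D y \<oplus> c \<otimes> E y)"
    if xy: "x \<in> carrier R" "y \<in> carrier R" for x y
  proof -
    note cl = xy c derivationD(1)[OF D xy(1) xy(1)] derivationD(1)[OF D xy(2) xy(2)]
      derivationD(1)[OF E xy(1) xy(1)] derivationD(1)[OF E xy(2) xy(2)]
    show ?thesis
      unfolding derivationD(2)[OF D xy] derivationD(2)[OF E xy] using cl by (simp add: r_distr a_ac)
  qed
  moreover have "D x \<oplus> c \<otimes> E x \<in> carrier R" if "x \<in> carrier R" for x
    using that c derivationD(1)[OF D that that] derivationD(1)[OF E that that] by simp
  ultimately show ?thesis unfolding derivation_def by blast
qed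

end

text \<open>In characteristic 2 a derivation kills squares, so it is linear over them; by the
  product rule it vanishes on the field generated by elements that it kills.\<close>

lemma (in char2_field) derivation_vanishes:
  assumes D: "derivation D" and ds: "set ds \<subseteq> carrier R" "\<forall>d\<in>set ds. D d = \<zero>" and x: "x \<in> Span sq (pf ds)"
  shows "D x = \<zero>"
  using ds x
proof (induction ds arbitrary: x)
  case Nil
  then have "x \<in> sq"
    using squares_closed subring_props(2)[OF squares_subfield] by (auto simp: line_extension_mem_iff subset_iff)
  then obtain a where a: "a \<in> carrier R" "x = a \<otimes> a" unfolding squares_def by (auto simp: sq_eq)
  then show ?case using derivationD(1,3)[OF D a(1) a(1)] by (simp add: m_comm)
next
  case (Cons d ds)
  have d: "d \<in> carrier R" "D d = \<zero>" and ds: "set ds \<subseteq> carrier R" "\<forall>d\<in>set ds. D d = \<zero>" using Cons.prems by auto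
  obtain y z where yz: "x = y \<oplus> d \<otimes> z" "y \<in> Span sq (pf ds)" "z \<in> Span sq (pf ds)"
    using Cons.prems(3) unfolding Span_pf_Cons[OF d(1) ds(1)] by blast
  have c: "y \<in> carrier R" "z \<in> carrier R"
    using yz(2,3) Span_subgroup_props(1)[OF squares_subfield pfister_coeffs_closed[OF ds(1)]] by auto
  have "D y = \<zero>" "D z = \<zero>" using Cons.IH[OF ds] yz(2,3) by auto
  then show ?case using derivationD(2)[OF D c(1), of "d \<otimes> z"] derivationD(3)[OF D d(1) c(2)] c d yz(1) by simp
qed

text \<open>Gaussian elimination, phrased for functionals: each element of \<open>ds\<close> costs one member of a
  dual system.\<close>

lemma (in char2_field) exists_vanishing_combination:
  assumes "finite I" "length ds < card I" "set ds \<subseteq> carrier R"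
    and "\<forall>D\<in>\<D>. \<forall>x\<in>carrier R. D x \<in> carrier R"
    and "\<forall>D\<in>\<D>. \<forall>E\<in>\<D>. \<forall>c\<in>carrier R. (\<lambda>x. D x \<oplus> c \<otimes> E x) \<in> \<D>"
    and "\<forall>j\<in>I. E j \<in> \<D>" "\<forall>i\<in>I. \<xi> i \<in> carrier R"
    and "\<forall>i\<in>I. \<forall>j\<in>I. E j (\<xi> i) = (if i = j then \<one> else \<zero>)"
  shows "\<exists>D\<in>\<D>. (\<exists>i\<in>I. D (\<xi> i) \<noteq> \<zero>) \<and> (\<forall>d\<in>set ds. D d = \<zero>)"
  using assms
proof (induction ds arbitrary: I E \<D>)
  case Nil
  then obtain j where "j \<in> I" by fastforce
  then show ?case using Nil.prems by (intro bexI[of _ "E j"]) auto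
next
  case (Cons d ds)
  note fin = Cons.prems(1) and len = Cons.prems(2) and closed = Cons.prems(4) and comb = Cons.prems(5)
    and E = Cons.prems(6) and xi = Cons.prems(7) and dual = Cons.prems(8)
  have d: "d \<in> carrier R" and ds: "set ds \<subseteq> carrier R" using Cons.prems(3) by auto
  define \<D>' where "\<D>' = {D \<in> \<D>. D d = \<zero>}"
  have closed': "\<forall>D\<in>\<D>'. \<forall>x\<in>carrier R. D x \<in> carrier R" using closed unfolding \<D>'_def by blast
  have comb': "\<forall>D\<in>\<D>'. \<forall>E\<in>\<D>'. \<forall>c\<in>carrier R. (\<lambda>x. D x \<oplus> c \<otimes> E x) \<in> \<D>'"
    using comb d unfolding \<D>'_def by auto
  have result: "\<exists>D\<in>\<D>. (\<exists>i\<in>I. D (\<xi> i) \<noteq> \<zero>) \<and> (\<forall>d\<in>set (d # ds). D d = \<zero>)"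
    if J: "J \<subseteq> I" "length ds < card J" "\<forall>j\<in>J. E' j \<in> \<D>'"
      "\<forall>i\<in>J. \<forall>j\<in>J. E' j (\<xi> i) = (if i = j then \<one> else \<zero>)" for J and E' :: "_ \<Rightarrow> 'a \<Rightarrow> 'a"
  proof -
    have fJ: "finite J" using fin J(1) by (rule finite_subset[rotated])
    have xJ: "\<forall>i\<in>J. \<xi> i \<in> carrier R" using xi J(1) by blast
    obtain D i where "D \<in> \<D>'" "i \<in> J" "D (\<xi> i) \<noteq> \<zero>" "\<forall>d\<in>set ds. D d = \<zero>"
      using Cons.IH[OF fJ J(2) ds closed' comb' J(3) xJ J(4)] by (elim bexE conjE)
    then show ?thesis using J(1) unfolding \<D>'_def by (intro bexI[of _ D]) auto
  qed
  show ?case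
  proof (cases "\<forall>j\<in>I. E j d = \<zero>")
    case True
    show ?thesis
      by (rule result[of I E]) (use len True E dual in \<open>auto simp: \<D>'_def\<close>)
  next
    case False
    then obtain p where p: "p \<in> I" "E p d \<noteq> \<zero>" by blast
    have Ed: "E j d \<in> carrier R" if "j \<in> I" for j using closed E d that by blast
    define c where "c j = E j d \<otimes> inv (E p d)" for j
    have inv: "inv (E p d) \<in> carrier R" "inv (E p d) \<otimes> E p d = \<one>" using Ed[OF p(1)] p(2) field_Units by auto
    have c: "c j \<in> carrier R" "c j \<otimes> E p d = E j d" if "j \<in> I" for j
      using that Ed p(1) inv by (simp_all add: c_def m_assoc)
    \<comment> \<open>Adding a multiple of the pivot \<open>E p\<close> kills \<open>d\<close>,
      signs being immaterial in characteristic 2. The system stays dual on \<open>I - {p}\<close>,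
      because \<open>E p\<close> vanishes at the remaining \<open>\<xi> i\<close>.\<close>
    define E' where "E' j x = E j x \<oplus> c j \<otimes> E p x" for j x
    show ?thesis
    proof (rule result[of "I - {p}" E'])
      show "length ds < card (I - {p})" using len p(1) fin by simp
      show "\<forall>j\<in>I - {p}. E' j \<in> \<D>'"
      proof
        fix j assume j: "j \<in> I - {p}"
        then have "E' j \<in> \<D>" using comb E p(1) c(1)[of j] unfolding E'_def by blast
        moreover have "E' j d = \<zero>" using j c(2)[of j] Ed[of j] by (simp add: E'_def)
        ultimately show "E' j \<in> \<D>'" unfolding \<D>'_def by simp
      qed
      show "\<forall>i\<in>I - {p}. \<forall>j\<in>I - {p}. E' j (\<xi> i) = (if i = j then \<one> else \<zero>)"
        using dual p(1) c(1) by (auto simp: E'_def)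
    qed simp
  qed
qed

context quasilinear_coeffs
begin

text \<open>In characteristic 2 the partial derivative of \<open>q\<close> in \<open>X_k\<close> is
  zero, so this derivation of the polynomial ring descends to the quadric and its function field. It
  is read off as the \<open>t\<close> coefficient of the homomorphism that sends \<open>X_k\<close>
  to \<open>X_k + t\<close> and fixes the other variables.\<close>

lemma coordinate_derivation:
  assumes k: "k < n"
  shows "\<exists>D. cring.derivation FF D \<and> (\<forall>i<n. D (ff (indexed_var i)) = (if i = k then \<one>\<^bsub>FF\<^esub> else \<zero>\<^bsub>FF\<^esub>))"
proof -
  interpret L: char2_field FF by (rule FF_char2_field)
  interpret T: cring "dual_ring FF" by (rule L.dual_ring_cring)
  define \<iota> where "\<iota> c = (ff (indexed_const c), \<zero>\<^bsub>FF\<^esub>)" for c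
  have \<iota>: "\<iota> \<in> ring_hom F (dual_ring FF)"
    using ring_hom_trans[OF ff_const_hom L.dual_embed_hom] unfolding \<iota>_def comp_def .
  define x where "x i = (ff (indexed_var i), if i = k then \<one>\<^bsub>FF\<^esub> else \<zero>\<^bsub>FF\<^esub>)" for i
  have vc: "ff (indexed_var i) \<in> carrier FF" if "i < n" for i using that by (intro ff_closed) simp
  have x: "x \<in> {..<n + 0} \<rightarrow> carrier (dual_ring FF)" using vc by (auto simp: x_def)
  define es where "es = map (\<lambda>c. ff (indexed_const c)) as"
  have es: "set es \<subseteq> carrier FF" "length es = n" unfolding es_def using as_closed ring_hom_closed[OF ff_const_hom] by auto
  have pt: "qsum (dual_ring FF) (map \<iota> as) x = \<zero>\<^bsub>dual_ring FF\<^esub>"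
  proof -
    have "map \<iota> as = map (\<lambda>a. (a, \<zero>\<^bsub>FF\<^esub>)) es" unfolding es_def \<iota>_def by simp
    then have "qsum (dual_ring FF) (map \<iota> as) x = (qsum FF es (\<lambda>i. fst (x i)), \<zero>\<^bsub>FF\<^esub>)"
      using L.qsum_dual[OF es(1), of x] x es(2) by (simp add: Pi_iff)
    then show ?thesis using chart_point[OF FF_chart] by (simp add: x_def es_def)
  qed
  obtain \<chi> where \<chi>: "\<chi> \<in> ring_hom (A 0) (dual_ring FF)"
    "\<And>p. p \<in> carrier (P 0) \<Longrightarrow> \<chi> (cls 0 p) = ring_hom_cring.mpoly_eval F (dual_ring FF) \<iota> {..<n + 0} x p"
    using A_hom_ext[OF L.dual_ring_cring \<iota> x pt] by blast
  interpret j: ring_hom_cring F "dual_ring FF" \<iota>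
    by (rule ring_hom_cring_of[OF is_cring L.dual_ring_cring \<iota>])
  have eh: "j.mpoly_eval {..<n + 0} x \<in> ring_hom (P 0) (dual_ring FF)" by (rule j.mpoly_eval_hom[OF _ x]) simp
  have ev: "j.mpoly_eval {..<n + 0} x (indexed_var i) = x i" if "i < n" for i
    using that by (intro j.mpoly_eval_var[OF _ x]) auto
  have fst_eval: "fst (j.mpoly_eval {..<n + 0} x p) = ff p" if p: "p \<in> carrier (P 0)" for p
  proof -
    have "(fst \<circ> j.mpoly_eval {..<n + 0} x) p = ff p"
    proof (rule mpoly_hom_eqI[OF ring_hom_trans[OF eh L.dual_fst_hom] ff_hom _ _ p])
      show "(fst \<circ> j.mpoly_eval {..<n + 0} x) (indexed_const c) = ff (indexed_const c)" if "c \<in> carrier F" for c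
        using j.mpoly_eval_const[OF that x] by (simp add: \<iota>_def)
      show "(fst \<circ> j.mpoly_eval {..<n + 0} x) (indexed_var i) = ff (indexed_var i)" if "i \<in> {..<n + 0}" for i
        using ev[of i] that by (simp add: x_def)
    qed
    then show ?thesis by simp
  qed
  interpret A: domain "A 0" by (rule A_domain)
  note ms = A.mult_subset_nonzero
  \<comment> \<open>The constant term of \<open>\<chi> s\<close> is \<open>s\<close> viewed in the
    function field, hence a unit.\<close>
  have unit: "\<chi> s \<in> Units (dual_ring FF)" if s: "s \<in> carrier (A 0) - {\<zero>\<^bsub>A 0\<^esub>}" for s
  proof -
    have sA: "s \<in> carrier (A 0)" using s by simp
    obtain p where p: "p \<in> carrier (P 0)" "s = cls 0 p" using A_repr[OF sA] by (elim bexE)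
    have pI: "p \<notin> PIdl\<^bsub>P 0\<^esub> (q 0)" using s cls_eq_zero_iff[OF p(1)] p(2) by auto
    have "fst (\<chi> s) \<in> Units FF" unfolding p(2) \<chi>(2)[OF p(1)] fst_eval[OF p(1)] by (rule FF_Units[OF p(1) pI])
    then show ?thesis using L.dual_Units ring_hom_closed[OF \<chi>(1) sA] by blast
  qed
  obtain \<eta> where \<eta>: "\<eta> \<in> ring_hom FF (dual_ring FF)"
    "\<And>a. a \<in> carrier (A 0) \<Longrightarrow> \<eta> (loc_frac (A 0) (carrier (A 0) - {\<zero>\<^bsub>A 0\<^esub>}) a \<one>\<^bsub>A 0\<^esub>) = \<chi> a"
    unfolding FF_def using mult_subset.loc_hom_ext[OF ms _ \<chi>(1) unit] L.dual_ring_cring unfolding FF_def by blast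
  have \<eta>ff: "\<eta> (ff p) = j.mpoly_eval {..<n + 0} x p" if "p \<in> carrier (P 0)" for p
    unfolding ff_def \<eta>(2)[OF cls_closed[OF that]] by (rule \<chi>(2)[OF that])
  have fst\<eta>: "fst (\<eta> z) = z" if z: "z \<in> carrier FF" for z
  proof -
    have fh: "(\<lambda>z. fst (\<eta> z)) \<in> ring_hom FF FF" using ring_hom_trans[OF \<eta>(1) L.dual_fst_hom] unfolding comp_def .
    have ih: "(\<lambda>z. z) \<in> ring_hom FF FF" by (rule ring_hom_memI) simp_all
    show ?thesis
    proof (rule mult_subset.loc_hom_unique[OF ms L.is_cring, folded FF_def])
      show "(\<lambda>z. fst (\<eta> z)) \<in> ring_hom FF FF" by (rule fh)
      show "(\<lambda>z. z) \<in> ring_hom FF FF" by (rule ih)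
      show "z \<in> carrier FF" by (rule z)
      fix a assume a: "a \<in> carrier (A 0)"
      obtain p where p: "p \<in> carrier (P 0)" "a = cls 0 p" using A_repr[OF a] by (elim bexE)
      show "fst (\<eta> (loc_frac (A 0) (carrier (A 0) - {\<zero>\<^bsub>A 0\<^esub>}) a \<one>\<^bsub>A 0\<^esub>)) =
          loc_frac (A 0) (carrier (A 0) - {\<zero>\<^bsub>A 0\<^esub>}) a \<one>\<^bsub>A 0\<^esub>"
        using \<eta>ff[OF p(1)] fst_eval[OF p(1)] unfolding p(2) ff_def by simp
    qed
  qed
  have split: "\<eta> z = (z, snd (\<eta> z))" if "z \<in> carrier FF" for z using fst\<eta>[OF that] by (simp add: prod_eq_iff)
  have sc: "snd (\<eta> z) \<in> carrier FF" if "z \<in> carrier FF" for z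
    using ring_hom_closed[OF \<eta>(1) that] by simp
  have "L.derivation (\<lambda>z. snd (\<eta> z))"
    unfolding L.derivation_def
  proof (intro conjI ballI)
    fix y z assume yz: "y \<in> carrier FF" "z \<in> carrier FF"
    have "\<eta> (y \<oplus>\<^bsub>FF\<^esub> z) = (y, snd (\<eta> y)) \<oplus>\<^bsub>dual_ring FF\<^esub> (z, snd (\<eta> z))"
      using ring_hom_add[OF \<eta>(1) yz] split[OF yz(1)] split[OF yz(2)] by simp
    then show "snd (\<eta> (y \<oplus>\<^bsub>FF\<^esub> z)) = snd (\<eta> y) \<oplus>\<^bsub>FF\<^esub> snd (\<eta> z)" by simp
    have "\<eta> (y \<otimes>\<^bsub>FF\<^esub> z) = (y, snd (\<eta> y)) \<otimes>\<^bsub>dual_ring FF\<^esub> (z, snd (\<eta> z))"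
      using ring_hom_mult[OF \<eta>(1) yz] split[OF yz(1)] split[OF yz(2)] by simp
    then show "snd (\<eta> (y \<otimes>\<^bsub>FF\<^esub> z)) = y \<otimes>\<^bsub>FF\<^esub> snd (\<eta> z) \<oplus>\<^bsub>FF\<^esub> snd (\<eta> y) \<otimes>\<^bsub>FF\<^esub> z" by simp
  qed (rule sc)
  moreover have "snd (\<eta> (ff (indexed_var i))) = (if i = k then \<one>\<^bsub>FF\<^esub> else \<zero>\<^bsub>FF\<^esub>)" if i: "i < n" for i
  proof -
    have "indexed_var i \<in> carrier (P 0)" using i by simp
    then show ?thesis using \<eta>ff ev[OF i] by (simp add: x_def)
  qed
  ultimately show ?thesis by blast
qed

text \<open>If \<open>ds\<close> generated the function field over its squares, a derivation killing
  \<open>ds\<close> would be zero. But a combination of the \<open>n\<close> coordinate derivations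
  can kill fewer than \<open>n\<close> elements without killing all coordinates.\<close>

lemma FF_not_short_pfister:
  assumes ds: "set ds \<subseteq> carrier FF" "length ds < n"
  shows "Embedded_Algebras.ring.Span FF (squares FF) (pfister_coeffs FF ds) \<noteq> carrier FF"
proof
  interpret L: char2_field FF by (rule FF_char2_field)
  assume eq: "L.Span (squares FF) (pfister_coeffs FF ds) = carrier FF"
  have "\<forall>k\<in>{..<n}. \<exists>D. L.derivation D \<and> (\<forall>i<n. D (ff (indexed_var i)) = (if i = k then \<one>\<^bsub>FF\<^esub> else \<zero>\<^bsub>FF\<^esub>))"
    using coordinate_derivation by blast
  then obtain E where E: "\<forall>k\<in>{..<n}. L.derivation (E k) \<and>
      (\<forall>i<n. E k (ff (indexed_var i)) = (if i = k then \<one>\<^bsub>FF\<^esub> else \<zero>\<^bsub>FF\<^esub>))"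
    by (rule bchoice[THEN exE])
  have vc: "\<forall>i\<in>{..<n}. ff (indexed_var i) \<in> carrier FF" by (intro ballI ff_closed) simp
  have len: "length ds < card {..<n}" using ds(2) by simp
  have "\<exists>D\<in>Collect L.derivation. (\<exists>i\<in>{..<n}. D (ff (indexed_var i)) \<noteq> \<zero>\<^bsub>FF\<^esub>) \<and> (\<forall>d\<in>set ds. D d = \<zero>\<^bsub>FF\<^esub>)"
  proof (rule L.exists_vanishing_combination[OF finite_lessThan len ds(1) _ _ _ vc])
    show "\<forall>D\<in>Collect L.derivation. \<forall>x\<in>carrier FF. D x \<in> carrier FF" using L.derivationD(1) by blast
    show "\<forall>D\<in>Collect L.derivation. \<forall>E\<in>Collect L.derivation. \<forall>c\<in>carrier FF.
        (\<lambda>x. D x \<oplus>\<^bsub>FF\<^esub> c \<otimes>\<^bsub>FF\<^esub> E x) \<in> Collect L.derivation"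
      using L.derivation_combination by simp
    show "\<forall>j\<in>{..<n}. E j \<in> Collect L.derivation" using E by simp
    show "\<forall>i\<in>{..<n}. \<forall>j\<in>{..<n}. E j (ff (indexed_var i)) = (if i = j then \<one>\<^bsub>FF\<^esub> else \<zero>\<^bsub>FF\<^esub>)"
      using E by simp
  qed
  then obtain D i where D: "L.derivation D" "i < n" "D (ff (indexed_var i)) \<noteq> \<zero>\<^bsub>FF\<^esub>" "\<forall>d\<in>set ds. D d = \<zero>\<^bsub>FF\<^esub>"
    by auto
  then show False using L.derivation_vanishes[OF D(1) ds(1) D(4)] vc unfolding eq by blast
qed

end

section \<open>The norm field\<close>

lemma (in abelian_monoid) finsum_in_submonoid:
  assumes "finite A" "H \<subseteq> carrier G" "\<zero> \<in> H" "\<And>x y. x \<in> H \<Longrightarrow> y \<in> H \<Longrightarrow> x \<oplus> y \<in> H" "\<And>a. a \<in> A \<Longrightarrow> f a \<in> H"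
  shows "finsum G f A \<in> H"
  using assms(1,5)
proof (induction A rule: finite_induct)
  case (insert a A)
  then have "f \<in> A \<rightarrow> carrier G" "f a \<in> carrier G" using assms(2) by auto
  then show ?case using insert assms(4) by simp
qed (simp add: assms(3))

lemma (in cring) smult_Span_subset:
  assumes K: "subfield K R" and M: "subfield M R" "K \<subseteq> M" and as: "set as \<subseteq> carrier R"
    and u: "u \<in> carrier R" "\<forall>a\<in>set as. u \<otimes> a \<in> M" and y: "y \<in> Span K as"
  shows "u \<otimes> y \<in> M"
proof -
  have sub: "set (map ((\<otimes>) u) as) \<subseteq> carrier R" using as u by auto
  have sg: "subgroup M (add_monoid R)" using subring.axioms(1)[OF subfieldE(1)[OF M(1)]] .
  have "Span K (map ((\<otimes>) u) as) \<subseteq> M"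
  proof (rule Span_min[OF K sub sg])
    show "K <#> set (map ((\<otimes>) u) as) \<subseteq> M"
      using M(2) u(2) subring_props(6)[OF M(1)] unfolding set_mult_def by auto
  qed
  then show ?thesis using y unfolding Span_smult[OF K as u(1)] by blast
qed

lemma (in char2_field) sq_inj:
  assumes "x \<in> carrier R" "y \<in> carrier R" "x [^] (2::nat) = y [^] (2::nat)"
  shows "x = y"
proof -
  have "(x \<oplus> y) [^] (2::nat) = \<zero>" using assms by (simp add: sq_add)
  then have "x \<oplus> y = \<zero>" using assms integral_iff[of "x \<oplus> y" "x \<oplus> y"] by (simp add: sq_eq)
  then show ?thesis using assms add_eq_zero_iff by simp
qed

context quasilinear_coeffs
begin

definition "nf = generate_field F {a \<otimes> b | a b. a \<in> Span sq as \<and> b \<in> Span sq as}"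

lemma Span_as_closed: "x \<in> Span sq as \<Longrightarrow> x \<in> carrier F"
  using Span_subgroup_props(1)[OF squares_subfield as_closed] by blast

lemma nf_generators: "{a \<otimes> b | a b. a \<in> Span sq as \<and> b \<in> Span sq as} \<subseteq> carrier F"
  using Span_as_closed by auto

lemma nf_subfield: "subfield nf F"
  unfolding nf_def by (rule generate_field_is_subfield[OF nf_generators])

lemma nf_prod: "a \<in> Span sq as \<Longrightarrow> b \<in> Span sq as \<Longrightarrow> a \<otimes> b \<in> nf"
  unfolding nf_def by (rule subsetD[OF generate_fieldE(2)[OF nf_generators refl]]) blast

lemma as_in_Span: "a \<in> set as \<Longrightarrow> a \<in> Span sq as"
  using Span_base_incl[OF squares_subfield as_closed] by blast

text \<open>For a nonzero value \<open>a\<close> one has \<open>s = (s a) a / a^2\<close>, and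
  \<open>s a\<close> is again a value.\<close>

lemma squares_subset_nf: "sq \<subseteq> nf"
proof
  fix s assume s: "s \<in> sq"
  let ?a = "as ! 0"
  have a: "?a \<in> Span sq as" "?a \<in> carrier F" "?a \<noteq> \<zero>"
    using as_in_Span[of ?a] n_pos as_nonzero[of 0] by auto
  have "s \<otimes> ?a \<in> Span sq as" by (rule Span_smult_closed[OF squares_subfield as_closed s a(1)])
  then have 1: "s \<otimes> ?a \<otimes> ?a \<in> nf" "?a \<otimes> ?a \<in> nf" using nf_prod a(1) by auto
  have nz: "?a \<otimes> ?a \<noteq> \<zero>" "?a \<otimes> ?a \<in> carrier F" using a integral_iff by auto
  then have inv: "inv (?a \<otimes> ?a) \<in> nf" using subfield_m_inv(1)[OF nf_subfield] 1(2) by simp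
  have sc: "s \<in> carrier F" using s squares_closed by blast
  have U: "?a \<otimes> ?a \<in> Units F" using nz field_Units by simp
  have "s \<otimes> ?a \<otimes> ?a \<otimes> inv (?a \<otimes> ?a) = s \<otimes> ((?a \<otimes> ?a) \<otimes> inv (?a \<otimes> ?a))"
    using sc a(2) nz(2) U by (simp add: m_assoc del: Units_r_inv)
  then have "s \<otimes> ?a \<otimes> ?a \<otimes> inv (?a \<otimes> ?a) = s" using U sc by simp
  then show "s \<in> nf" using subring_props(6)[OF nf_subfield 1(1) inv] by simp
qed

text \<open>Products are bilinear over the squares, so membership in \<open>M\<close> extends from
  products of coefficients to products of arbitrary values.\<close>

lemma nf_subset:
  assumes M: "subfield M F" "sq \<subseteq> M" and prods: "\<forall>a\<in>set as. \<forall>b\<in>set as. a \<otimes> b \<in> M"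
  shows "nf \<subseteq> M"
proof -
  have 1: "a \<otimes> y \<in> M" if "a \<in> set as" "y \<in> Span sq as" for a y
    by (rule smult_Span_subset[OF squares_subfield M as_closed _ _ that(2)]) (use that(1) as_closed prods in auto)
  have 2: "x \<otimes> y \<in> M" if x: "x \<in> Span sq as" and y: "y \<in> Span sq as" for x y
    by (rule smult_Span_subset[OF squares_subfield M as_closed Span_as_closed[OF x] _ y])
       (use 1[OF _ x] Span_as_closed[OF x] as_closed m_comm[OF Span_as_closed[OF x]] in auto)
  show ?thesis
    unfolding nf_def by (rule generate_field_min_subfield1[OF nf_generators M(1)]) (use 2 in auto)
qed

text \<open>The norm field lies in the field generated by the \<open>n\<close> coefficients over the
  squares, which has degree at most \<open>2^n\<close>.\<close>

lemma less_log_dim_nf: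
  assumes "real r < log 2 (real (ring.dim F sq nf))"
  shows "r \<le> n"
proof -
  let ?S = "Span sq (pf as)" and ?d = "ring.dim F sq nf"
  note S = Span_pf_field[OF as_closed] and pc = pfister_coeffs_closed[OF as_closed]
  have sub: "nf \<subseteq> ?S"
    by (rule nf_subset[OF S(1,2)]) (use S(3) subring_props(6)[OF S(1)] in blast)
  have sg: "subgroup nf (add_monoid F)" using subring.axioms(1)[OF subfieldE(1)[OF nf_subfield]] .
  have "subalgebra sq nf F"
    by (rule subalgebra.intro[OF sg subalgebra_axioms.intro])
       (use squares_subset_nf subring_props(6)[OF nf_subfield] in blast)
  then have "finite_dimension sq nf"
    using subalbegra_incl_imp_finite_dimension[OF squares_subfield Span_finite_dimension[OF squares_subfield pc] _ sub] by simp
  then have d: "dimension ?d sq nf" using finite_dimensionE[OF squares_subfield] unfolding over_def by simp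
  \<comment> \<open>The logarithm is monotone only on positive numbers.\<close>
  have "?d \<noteq> 0"
  proof
    assume "?d = 0"
    then have "nf = {\<zero>}" using d by (auto elim: dimension.cases)
    then show False using subring_props(3)[OF nf_subfield] one_not_zero by simp
  qed
  moreover from d have "?d \<le> 2 ^ n" using dimension_le_of_subset[OF squares_subfield _ pc sub] by (simp add: length_pfister_coeffs)
  then have "real ?d \<le> 2 ^ n" by (metis of_nat_le_iff of_nat_numeral of_nat_power)
  ultimately have "log 2 (real ?d) \<le> log 2 (2 ^ n)" by (subst log_le_cancel_iff) auto
  then have "log 2 (real ?d) \<le> real n" by simp
  then show ?thesis using assms by linarith
qed

lemma tail_sum_in_Span:
  assumes "z \<in> {1..<n + m} \<rightarrow> carrier F"
  shows "tail_sum z \<in> Span sq as"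
proof -
  \<comment> \<open>The hypothesis does not constrain \<open>z 0\<close>, so it is reset to zero;
    \<open>tail_sum\<close> starts at index 1 and does not notice.\<close>
  define z' where "z' = z(0 := \<zero>)"
  have zc: "z i \<in> carrier F" if "0 < i" "i < n" for i using pt_coord[OF assms, of i] that by simp
  have z': "z' i \<in> carrier F" if "i < n" for i using zc that by (auto simp: z'_def)
  have "tail_sum z' = tail_sum z"
    unfolding tail_sum_def using zc by (intro finsum_cong') (auto simp: z'_def)
  moreover have "tail_sum z' \<in> carrier F" using calculation tail_sum_closed[OF assms] by simp
  ultimately have eq: "qsum F as z' = tail_sum z" using qsum_split[of z', OF z'] n_pos by (simp add: z'_def sq_eq)
  have "tail_sum z \<in> qvals F as"
    unfolding qvals_def by (rule CollectI, rule exI[of _ z']) (use eq z' in auto)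
  then show ?thesis using qvals_eq_Span[OF as_closed] by simp
qed

text \<open>The critical coordinate is \<open>a_0^-1 T = a_0^-2 (a_0 T)\<close> with
  \<open>T = tail_sum z\<close> a value of the form, hence a square times a product of two values.
  All other coordinates are squares.\<close>

lemma special_pt_in_nf:
  assumes z: "z \<in> {1..<n + m} \<rightarrow> carrier F"
  shows "special_pt z \<in> {..<n + m} \<rightarrow> nf"
proof
  fix i assume i: "i \<in> {..<n + m}"
  show "special_pt z i \<in> nf"
  proof (cases "i = 0")
    case True
    let ?a = "as ! 0"
    note T = tail_sum_in_Span[OF z]
    have "?a \<otimes> tail_sum z \<in> nf" using nf_prod[OF as_in_Span T, of ?a] n_pos by simp
    moreover have "inv ?a [^] (2::nat) \<in> nf" using squareI[OF a0_inv(1)] squares_subset_nf by blast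
    ultimately have "inv ?a [^] (2::nat) \<otimes> (?a \<otimes> tail_sum z) \<in> nf" by (rule subring_props(6)[OF nf_subfield, rotated])
    moreover have "inv ?a [^] (2::nat) \<otimes> (?a \<otimes> tail_sum z) = inv ?a \<otimes> (?a \<otimes> inv ?a) \<otimes> tail_sum z"
      using a0_inv(1) n_pos Span_as_closed[OF T] by (simp add: sq_eq m_ac del: Units_r_inv Units_l_inv)
    moreover have "inv ?a \<otimes> (?a \<otimes> inv ?a) \<otimes> tail_sum z = inv ?a \<otimes> tail_sum z"
      unfolding a0_inv(2) using a0_inv(1) by simp
    ultimately show ?thesis using True by (simp add: special_pt_def)
  next
    case False
    then have "z i \<in> carrier F" using pt_coord[OF z, of i] i by simp
    then show ?thesis using False squareI squares_subset_nf by (auto simp: special_pt_def)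
  qed
qed

end

context quadric_pair
begin

text \<open>The special points have coordinates in the norm field when \<open>F\<close> acts on it through squaring,
  so the similarity theorem applies over the norm field of the second form.\<close>

lemma nf_subset_of_birational:
  assumes f: "f \<in> carrier (X.P m)" "f \<notin> PIdl\<^bsub>X.P m\<^esub> (X.q m)"
    and g: "g \<in> carrier (Y.P k)" "g \<notin> PIdl\<^bsub>Y.P k\<^esub> (Y.q k)"
    and h: "h \<in> ring_iso (X.Af m (X.cls m f)) (Y.Af k (Y.cls k g))"
    and h_const: "\<And>c. c \<in> carrier F \<Longrightarrow>
      h (X.lc m (X.cls m f) (X.indexed_const c)) = Y.lc k (Y.cls k g) (X.indexed_const c)"
  shows "X.nf \<subseteq> Y.nf"
proof -
  define M where "M = Y.nf"
  \<comment> \<open>The norm field as a field of its own. The structure map from \<open>F\<close> is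
    squaring, which lands in it because it contains the squares.\<close>
  define N where "N = F\<lparr>carrier := M\<rparr>"
  have M: "subfield M F" "X.sq \<subseteq> M" unfolding M_def by (rule Y.nf_subfield Y.squares_subset_nf)+
  have Mc: "x \<in> M \<Longrightarrow> x \<in> carrier F" for x using subfieldE(3)[OF M(1)] by blast
  have N: "field N" unfolding N_def by (rule X.subfield_iff(2)[OF M(1)])
  have Nc: "cring N" using N unfolding field_def domain_def by simp
  have N_simps: "carrier N = M" "\<And>x y. x \<otimes>\<^bsub>N\<^esub> y = x \<otimes> y" "\<And>x y. x \<oplus>\<^bsub>N\<^esub> y = x \<oplus> y"
    "\<one>\<^bsub>N\<^esub> = \<one>" "\<zero>\<^bsub>N\<^esub> = \<zero>"
    unfolding N_def by simp_all
  have inc: "(\<lambda>x. x) \<in> ring_hom N F"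
    by (rule ring_hom_memI) (simp_all add: N_simps Mc)
  have \<iota>: "X.frob \<in> ring_hom F N"
    using X.squareI M(2) ring_hom_memE[OF X.frobenius_hom]
    by (intro ring_hom_memI) (auto simp: N_simps)
  interpret N: field N by (rule N)
  interpret inc: ring_hom_cring N F "\<lambda>x. x" by (rule ring_hom_cring_of[OF Nc X.is_cring inc])
  interpret fN: ring_hom_cring F N "X.frob" by (rule ring_hom_cring_of[OF X.is_cring Nc \<iota>])
  interpret fr: ring_hom_cring F F "X.frob" by (rule X.frobenius_hom_cring)
  obtain z where z: "z \<in> {1..<Y.n + k} \<rightarrow> carrier F" "Y.frob_eval k z g \<noteq> \<zero>"
    using Y.exists_special_pt[of "{g}" k] g by (metis finite.emptyI finite.insertI singletonI singletonD)
  define x where "x = Y.special_pt z"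
  have x: "x \<in> {..<Y.n + k} \<rightarrow> carrier N" unfolding x_def N_simps M_def by (rule Y.special_pt_in_nf[OF z(1)])
  have xF: "x \<in> {..<Y.n + k} \<rightarrow> carrier F" unfolding x_def by (rule Y.special_pt_closed[OF z(1)])
  have qN: "qsum N cs y = qsum F cs y" if "set cs \<subseteq> M" "\<And>i. i < length cs \<Longrightarrow> y i \<in> M" for cs y
    using inc.hom_qsum[of cs y] that by (simp add: N_simps)
  have fbs: "set (map X.frob bs) \<subseteq> M" and fas: "set (map X.frob as) \<subseteq> M"
    using X.squareI M(2) X.as_closed Y.as_closed by auto
  have pt: "qsum N (map X.frob bs) x = \<zero>\<^bsub>N\<^esub>"
    using qN[OF fbs, of x] x Y.special_pt_zero[OF z(1)] by (simp add: N_simps x_def Pi_iff)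
  have eval: "fN.mpoly_eval {..<Y.n + k} x p = Y.frob_eval k z p" if p: "p \<in> carrier (Y.P k)" for p
  proof -
    have eh: "fN.mpoly_eval {..<Y.n + k} x \<in> ring_hom (Y.P k) F"
      using ring_hom_trans[OF fN.mpoly_eval_hom[OF finite_lessThan x] inc] by (simp add: comp_def)
    show ?thesis
    proof (rule X.mpoly_hom_eqI[OF eh Y.frob_eval_hom[OF z(1)] _ _ p])
      show "fN.mpoly_eval {..<Y.n + k} x (X.indexed_const c) = Y.frob_eval k z (X.indexed_const c)" if "c \<in> carrier F" for c
        using fN.mpoly_eval_const[OF that x] fr.mpoly_eval_const[OF that xF] by (simp add: x_def)
      show "fN.mpoly_eval {..<Y.n + k} x (X.indexed_var i) = Y.frob_eval k z (X.indexed_var i)" if "i \<in> {..<Y.n + k}" for i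
        using fN.mpoly_eval_var[OF finite_lessThan x that] fr.mpoly_eval_var[OF finite_lessThan xF that] by (simp add: x_def)
    qed
  qed
  have "fN.mpoly_eval {..<Y.n + k} x g \<in> carrier N"
    by (rule ring_hom_closed[OF fN.mpoly_eval_hom[OF finite_lessThan x] g(1)])
  then have unit: "fN.mpoly_eval {..<Y.n + k} x g \<in> Units N"
    unfolding N.field_Units using eval[OF g(1)] z(2) by (simp add: N_simps)
  obtain \<chi> where \<chi>: "\<chi> \<in> ring_hom (Y.Af k (Y.cls k g)) N"
    "\<And>p. p \<in> carrier (Y.P k) \<Longrightarrow> \<chi> (Y.lc k (Y.cls k g) p) = fN.mpoly_eval {..<Y.n + k} x p"
    using Y.Af_hom_ext[OF Nc \<iota> x pt g(1) unit] by blast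
  have \<chi>c: "\<chi> (Y.lc k (Y.cls k g) (X.indexed_const c)) = X.frob c" if "c \<in> carrier F" for c
    unfolding \<chi>(2)[OF Y.const_P[OF that]] by (rule fN.mpoly_eval_const[OF that x])
  obtain u where u: "u \<in> M" "qvals N (map X.frob as) = (\<lambda>y. u \<otimes> y) ` qvals N (map X.frob bs)"
    using similar_at_point[OF f g h h_const N \<iota> \<chi>(1) \<chi>c] unfolding N_simps by blast
  have bprod: "a \<otimes> b \<in> M" if "a \<in> set bs" "b \<in> set bs" for a b
    unfolding M_def by (rule Y.nf_prod[OF Y.as_in_Span Y.as_in_Span]) (use that in auto)
  have SM: "y \<in> carrier F" if "y \<in> X.Span M bs" for y
    using X.Span_subgroup_props(1)[OF M(1) Y.as_closed] that by blast
  \<comment> \<open>A unit vector shows that \<open>a^2\<close> is a value of the first twisted form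
    over \<open>M\<close>, hence \<open>u\<close> times a value of the second one. That value is the
    square of the linear combination \<open>y\<close> of \<open>bs\<close> with coefficients
    \<open>w\<close> in \<open>M\<close>.\<close>
  have root: "\<exists>y\<in>X.Span M bs. a [^] (2::nat) = u \<otimes> y [^] (2::nat)" if a: "a \<in> set as" for a
  proof -
    obtain i where i: "i < X.n" "a = as ! i" using a by (metis in_set_conv_nth)
    have fasN: "set (map X.frob as) \<subseteq> carrier N" using fas by (simp add: N_simps)
    have il: "i < length (map X.frob as)" using i by simp
    have "qsum N (map X.frob as) (\<lambda>l. if l = i then \<one>\<^bsub>N\<^esub> else \<zero>\<^bsub>N\<^esub>) = X.frob a"
      using N.qsum_single[OF fasN il] i by simp
    then have "X.frob a \<in> qvals N (map X.frob as)"
      unfolding qvals_def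
      by (intro CollectI exI[of _ "\<lambda>l. if l = i then \<one>\<^bsub>N\<^esub> else \<zero>\<^bsub>N\<^esub>"])
         (insert N.one_closed N.zero_closed, simp)
    then obtain w where w: "X.frob a = u \<otimes> qsum N (map X.frob bs) w" "\<forall>l<length bs. w l \<in> M"
      unfolding u(2) unfolding qvals_def N_simps by auto
    define t where "t l = bs ! l \<otimes> w l" for l
    have wF: "\<And>l. l < length bs \<Longrightarrow> w l \<in> carrier F" using w(2) Mc by blast
    have t: "t l \<in> carrier F" if "l < length bs" for l using wF that by (simp add: t_def)
    define y where "y = (\<Oplus>l\<in>{..<length bs}. t l)"
    have yS: "y \<in> X.Span M bs"
      unfolding y_def
    proof (rule X.finsum_in_submonoid[OF finite_lessThan X.Span_subgroup_props(1,2)[OF M(1) Y.as_closed] X.Span_subgroup_props(3)[OF M(1) Y.as_closed]])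
      fix l assume "l \<in> {..<length bs}"
      then have l: "l < length bs" by simp
      have "w l \<otimes> bs ! l \<in> X.Span M bs"
        using w(2) l X.Span_base_incl[OF M(1) Y.as_closed] nth_mem[OF l]
        by (intro X.Span_smult_closed[OF M(1) Y.as_closed]) auto
      then show "t l \<in> X.Span M bs" unfolding t_def using X.m_comm[OF wF[OF l] Y.as_nth[OF l]] by simp
    qed
    have y2: "y [^] (2::nat) = qsum F (map X.frob bs) w"
    proof -
      have "y [^] (2::nat) = (\<Oplus>l\<in>{..<length bs}. t l [^] (2::nat))"
        unfolding y_def using t by (subst fr.hom_finsum) (auto simp: comp_def)
      also have "\<dots> = qsum F (map X.frob bs) w"
        unfolding qsum_def using wF t
        by (intro X.finsum_cong') (auto simp: t_def X.nat_pow_distrib)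
      finally show ?thesis .
    qed
    have "qsum N (map X.frob bs) w = qsum F (map X.frob bs) w"
      using w(2) by (intro qN[OF fbs]) simp
    then have "a [^] (2::nat) = u \<otimes> y [^] (2::nat)" using w(1) y2 by simp
    then show ?thesis using yS by (rule bexI)
  qed
  \<comment> \<open>Both roots involve the same \<open>u\<close>, so
    \<open>(a b)^2 = u^2 (y y')^2\<close> and \<open>a b = u y y'\<close>. The product of two
    elements of the \<open>M\<close>-span of \<open>bs\<close> lies in \<open>M\<close>, since
    products of the generators do.\<close>
  have "a \<otimes> b \<in> M" if ab: "a \<in> set as" "b \<in> set as" for a b
  proof -
    obtain y y' where y: "y \<in> X.Span M bs" "a [^] (2::nat) = u \<otimes> y [^] (2::nat)"
      and y': "y' \<in> X.Span M bs" "b [^] (2::nat) = u \<otimes> y' [^] (2::nat)"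
      using root[OF ab(1)] root[OF ab(2)] by blast
    note c = SM[OF y(1)] SM[OF y'(1)] Mc[OF u(1)]
    have abc: "a \<in> carrier F" "b \<in> carrier F" using ab X.as_closed by auto
    have 1: "b' \<otimes> y \<in> M" if "b' \<in> set bs" for b'
      by (rule X.smult_Span_subset[OF M(1) M(1) order.refl Y.as_closed _ _ y(1)])
         (use that bprod Y.as_closed in auto)
    have "y \<otimes> y' \<in> M"
      by (rule X.smult_Span_subset[OF M(1) M(1) order.refl Y.as_closed c(1) _ y'(1)])
         (use 1 X.m_comm[OF c(1)] Y.as_closed in auto)
    then have yy: "u \<otimes> (y \<otimes> y') \<in> M" by (rule X.subring_props(6)[OF M(1) u(1)])
    have "(a \<otimes> b) [^] (2::nat) = (u \<otimes> y [^] (2::nat)) \<otimes> (u \<otimes> y' [^] (2::nat))"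
      using X.nat_pow_distrib[OF abc] y(2) y'(2) by simp
    also have "\<dots> = (u \<otimes> (y \<otimes> y')) [^] (2::nat)" using c by (simp add: X.sq_eq X.m_ac)
    finally have "a \<otimes> b = u \<otimes> (y \<otimes> y')" using X.sq_inj abc c by simp
    then show ?thesis using yy by simp
  qed
  then show ?thesis unfolding M_def[symmetric] by (intro X.nf_subset[OF M]) blast
qed

end

section \<open>Transfer between the two function fields\<close>

lemma (in field) image_mult_inverse:
  assumes "u \<in> carrier R" "u \<noteq> \<zero>" "S \<subseteq> carrier R" "T = (\<otimes>) u ` S"
  shows "S = (\<otimes>) (inv u) ` T"
proof -
  have u: "inv u \<in> carrier R" "inv u \<otimes> u = \<one>" using assms(1,2) field_Units by auto
  have "inv u \<otimes> (u \<otimes> s) = s" if "s \<in> S" for s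
    using that assms(1,3) u by (simp add: m_assoc[symmetric] subset_iff)
  then show ?thesis unfolding assms(4) by (simp add: image_image)
qed

lemma (in char2_field) Span_pf_Nil: "Span sq (pf []) = sq"
proof
  show "sq \<subseteq> Span sq (pf [])" by (rule Span_pf_field(2)) simp
  have "\<one> \<in> sq" by (rule subring_props(3)[OF squares_subfield])
  moreover have "subgroup sq (add_monoid R)" using subring.axioms(1)[OF subfieldE(1)[OF squares_subfield]] .
  ultimately show "Span sq (pf []) \<subseteq> sq"
    using squares_closed by (intro Span_min[OF squares_subfield]) (auto simp: set_mult_def subset_iff)
qed

context quadric_pair
begin

text \<open>Stable birationality with polynomial representatives of the inverted elements; being
  nonzero in the coordinate ring becomes avoidance of the ideal.\<close>

definition equivalent :: bool
  where "equivalent \<longleftrightarrow> (\<exists>m k f g h. f \<in> carrier (X.P m) \<and> f \<notin> PIdl\<^bsub>X.P m\<^esub> (X.q m) \<and>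
    g \<in> carrier (Y.P k) \<and> g \<notin> PIdl\<^bsub>Y.P k\<^esub> (Y.q k) \<and>
    h \<in> ring_iso (X.Af m (X.cls m f)) (Y.Af k (Y.cls k g)) \<and>
    (\<forall>c\<in>carrier F. h (X.lc m (X.cls m f) (X.indexed_const c)) = Y.lc k (Y.cls k g) (X.indexed_const c)))"

lemma equivalent_swap:
  assumes equivalent
  shows "quadric_pair.equivalent F bs as"
proof -
  interpret S: quadric_pair F bs as ..
  obtain m k f g h where e: "f \<in> carrier (X.P m)" "f \<notin> PIdl\<^bsub>X.P m\<^esub> (X.q m)"
    "g \<in> carrier (Y.P k)" "g \<notin> PIdl\<^bsub>Y.P k\<^esub> (Y.q k)"
    and h: "h \<in> ring_iso (X.Af m (X.cls m f)) (Y.Af k (Y.cls k g))"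
    and hc: "\<forall>c\<in>carrier F. h (X.lc m (X.cls m f) (X.indexed_const c)) = Y.lc k (Y.cls k g) (X.indexed_const c)"
    using assms unfolding equivalent_def by (elim exE conjE)
  have fA: "X.cls m f \<in> carrier (X.A m)" by (rule X.cls_closed[OF e(1)])
  have ring: "ring (X.Af m (X.cls m f))" using X.Af_cring[OF fA] by (rule cring.axioms(1))
  define h' where "h' = inv_into (carrier (X.Af m (X.cls m f))) h"
  have h': "h' \<in> ring_iso (Y.Af k (Y.cls k g)) (X.Af m (X.cls m f))"
    unfolding h'_def by (rule ring_iso_set_sym[OF ring h])
  have inj: "inj_on h (carrier (X.Af m (X.cls m f)))" using h unfolding ring_iso_def bij_betw_def by blast
  have "h' (Y.lc k (Y.cls k g) (X.indexed_const c)) = X.lc m (X.cls m f) (X.indexed_const c)" if c: "c \<in> carrier F" for c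
    unfolding bspec[OF hc c, symmetric] h'_def
    by (rule inv_into_f_f[OF inj ring_hom_closed[OF X.lc_hom[OF fA] X.const_P[OF c]]])
  then show ?thesis unfolding S.equivalent_def using e h' by blast
qed

abbreviation "jX \<equiv> \<lambda>c. X.ff (X.indexed_const c)"
abbreviation "jY \<equiv> \<lambda>c. Y.ff (X.indexed_const c)"

text \<open>The tangent comparison is made at the point of the second chart that
  \<open>generic_hom\<close> supplies over \<open>Y.FF\<close>; only \<open>g\<close> has to stay
  invertible there, so it is passed in both roles.\<close>

lemma similar_over_function_field:
  assumes equivalent
  shows "\<exists>u\<in>carrier Y.FF. u \<noteq> \<zero>\<^bsub>Y.FF\<^esub> \<and>
    qvals Y.FF (map jY as) = (\<lambda>y. u \<otimes>\<^bsub>Y.FF\<^esub> y) ` qvals Y.FF (map jY bs)"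
proof -
  obtain m k f g h where e: "f \<in> carrier (X.P m)" "f \<notin> PIdl\<^bsub>X.P m\<^esub> (X.q m)"
    "g \<in> carrier (Y.P k)" "g \<notin> PIdl\<^bsub>Y.P k\<^esub> (Y.q k)"
    "h \<in> ring_iso (X.Af m (X.cls m f)) (Y.Af k (Y.cls k g))"
    and hc: "\<forall>c\<in>carrier F. h (X.lc m (X.cls m f) (X.indexed_const c)) = Y.lc k (Y.cls k g) (X.indexed_const c)"
    using assms unfolding equivalent_def by (elim exE conjE)
  obtain \<chi> where \<chi>: "\<chi> \<in> ring_hom (Y.Af k (Y.cls k g)) Y.FF"
    "\<forall>c\<in>carrier F. \<chi> (Y.lc k (Y.cls k g) (X.indexed_const c)) = jY c"
    using Y.generic_hom[OF e(3,4) e(3,4)] by (elim bexE conjE)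
  show ?thesis
    by (rule similar_at_point[OF e bspec[OF hc] Y.FF_field Y.ff_const_hom \<chi>(1)]) (use \<chi>(2) in auto)
qed

lemma nf_subset_of_equivalent:
  assumes equivalent
  shows "X.nf \<subseteq> Y.nf"
proof -
  obtain m k f g h where e: "f \<in> carrier (X.P m)" "f \<notin> PIdl\<^bsub>X.P m\<^esub> (X.q m)"
    "g \<in> carrier (Y.P k)" "g \<notin> PIdl\<^bsub>Y.P k\<^esub> (Y.q k)"
    "h \<in> ring_iso (X.Af m (X.cls m f)) (Y.Af k (Y.cls k g))"
    and hc: "\<forall>c\<in>carrier F. h (X.lc m (X.cls m f) (X.indexed_const c)) = Y.lc k (Y.cls k g) (X.indexed_const c)"
    using assms unfolding equivalent_def by (elim exE conjE)
  show ?thesis by (rule nf_subset_of_birational[OF e bspec[OF hc]])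
qed

lemma jX_closed: "set es \<subseteq> carrier F \<Longrightarrow> set (map jX es) \<subseteq> carrier X.FF"
  and jY_closed: "set es \<subseteq> carrier F \<Longrightarrow> set (map jY es) \<subseteq> carrier Y.FF"
  using ring_hom_closed[OF X.ff_const_hom] ring_hom_closed[OF Y.ff_const_hom] by auto

text \<open>Over \<open>X.FF\<close> the two value sets are similar, so the \<open>M\<close>-span of
  the \<open>b_j\<close> also has dimension \<open>e\<close>. Since the \<open>b_j\<close> come from
  \<open>F\<close>, their membership in the span of \<open>e\<close> vectors is a statement that
  \<open>spread\<close> carries over to \<open>Y.FF\<close>.\<close>

lemma spread_dimension:
  assumes eq: equivalent
    and sim: "\<exists>u\<in>carrier X.FF. u \<noteq> \<zero>\<^bsub>X.FF\<^esub> \<and>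
      qvals X.FF (map jX bs) = (\<lambda>y. u \<otimes>\<^bsub>X.FF\<^esub> y) ` qvals X.FF (map jX as)"
    and cs: "set cs \<subseteq> carrier X.FF"
    and M: "M = ring.Span X.FF (squares X.FF) (pfister_coeffs X.FF cs)"
    and e: "ring.dimension X.FF e M (ring.Span X.FF M (map jX as))"
  shows "\<exists>cs' vs'. set cs' \<subseteq> carrier Y.FF \<and> set vs' \<subseteq> carrier Y.FF \<and> length cs' = length cs \<and> length vs' = e \<and>
    set (map jY bs) \<subseteq> ring.Span Y.FF (ring.Span Y.FF (squares Y.FF) (pfister_coeffs Y.FF cs')) vs'"
proof -
  interpret L: char2_field X.FF by (rule X.FF_char2_field)
  interpret L': char2_field Y.FF by (rule Y.FF_char2_field)
  have Mf: "subfield M X.FF" "L.sq \<subseteq> M" unfolding M using L.Span_pf_field[OF cs] by auto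
  define AS where "AS = map jX as"
  define BS where "BS = map jX bs"
  have c: "set AS \<subseteq> carrier X.FF" "set BS \<subseteq> carrier X.FF"
    unfolding AS_def BS_def using jX_closed X.as_closed Y.as_closed by auto
  obtain u where u: "u \<in> carrier X.FF" "u \<noteq> \<zero>\<^bsub>X.FF\<^esub>" "L.Span L.sq BS = (\<otimes>\<^bsub>X.FF\<^esub>) u ` L.Span L.sq AS"
    using sim unfolding AS_def[symmetric] BS_def[symmetric] L.qvals_eq_Span[OF c(1)] L.qvals_eq_Span[OF c(2)] by blast
  have iu: "inv\<^bsub>X.FF\<^esub> u \<in> carrier X.FF" "inv\<^bsub>X.FF\<^esub> u \<noteq> \<zero>\<^bsub>X.FF\<^esub>"
    using u(1,2) L.field_Units L.Units_inv_Units[of u] by auto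
  have "L.Span L.sq AS = (\<otimes>\<^bsub>X.FF\<^esub>) (inv\<^bsub>X.FF\<^esub> u) ` L.Span L.sq BS"
    by (rule L.image_mult_inverse[OF u(1,2) L.Span_subgroup_props(1)[OF L.squares_subfield c(1)] u(3)])
  then have "L.dimension e M (L.Span M BS)"
    by (rule L.dimension_Span_similar[OF Mf c iu]) (use e in \<open>simp add: AS_def\<close>)
  then obtain vs where vs: "set vs \<subseteq> carrier X.FF" "L.independent M vs" "length vs = e" "L.Span M vs = L.Span M BS"
    using L.exists_base[OF Mf(1)] by metis
  note pc = L.pfister_coeffs_closed[OF cs]
  have T: "L.Span L.sq (tensor_coeffs X.FF (L.pf cs) vs) = L.Span M vs"
    using L.Span_tensor_coeffs[OF L.squares_subfield _ _ pc vs(1)] Mf unfolding M by simp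
  have "set BS \<subseteq> L.Span M vs" unfolding vs(4) by (rule L.Span_base_incl[OF Mf(1) c(2)])
  then have sub: "jX ` set bs \<subseteq> qvals X.FF (tensor_coeffs X.FF (L.pf cs) vs)"
    unfolding L.qvals_eq_Span[OF L.tensor_coeffs_closed[OF pc vs(1)]] T BS_def by simp
  obtain m k f g h where iso: "f \<in> carrier (X.P m)" "f \<notin> PIdl\<^bsub>X.P m\<^esub> (X.q m)"
    "g \<in> carrier (Y.P k)" "g \<notin> PIdl\<^bsub>Y.P k\<^esub> (Y.q k)"
    "h \<in> ring_iso (X.Af m (X.cls m f)) (Y.Af k (Y.cls k g))"
    and hc: "\<forall>c\<in>carrier F. h (X.lc m (X.cls m f) (X.indexed_const c)) = Y.lc k (Y.cls k g) (X.indexed_const c)"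
    using eq unfolding equivalent_def by (elim exE conjE)
  have "\<exists>cs' vs'. set cs' \<subseteq> carrier Y.FF \<and> set vs' \<subseteq> carrier Y.FF \<and> length cs' = length cs \<and> length vs' = length vs \<and>
    jY ` set bs \<subseteq> qvals Y.FF (tensor_coeffs Y.FF (pfister_coeffs Y.FF cs') vs')"
    by (rule spread[OF iso _ cs vs(1) Y.as_closed sub]) (rule bspec[OF hc])
  then obtain cs' vs' where r: "set cs' \<subseteq> carrier Y.FF" "set vs' \<subseteq> carrier Y.FF" "length cs' = length cs" "length vs' = length vs"
    "jY ` set bs \<subseteq> qvals Y.FF (tensor_coeffs Y.FF (L'.pf cs') vs')"
    by (elim exE conjE)
  note pc' = L'.pfister_coeffs_closed[OF r(1)]
  have "qvals Y.FF (tensor_coeffs Y.FF (L'.pf cs') vs') = L'.Span (L'.Span L'.sq (L'.pf cs')) vs'"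
    unfolding L'.qvals_eq_Span[OF L'.tensor_coeffs_closed[OF pc' r(2)]]
    by (rule L'.Span_tensor_coeffs[OF L'.squares_subfield L'.Span_pf_field(1,2)[OF r(1)] pc' r(2)])
  then have "set (map jY bs) \<subseteq> L'.Span (L'.Span L'.sq (L'.pf cs')) vs'" using r(5) by simp
  then show ?thesis using r(1-4) vs(3) by blast
qed

text \<open>The case \<open>cs = []\<close> of \<open>spread_dimension\<close>: the scalars are the
  squares, and the dimensions are those of the two first forms. \<open>Delta_subset\<close> uses it
  in both directions.\<close>

lemma dimension_first_form_le:
  assumes eq: equivalent
    and sim: "\<exists>u\<in>carrier X.FF. u \<noteq> \<zero>\<^bsub>X.FF\<^esub> \<and>
      qvals X.FF (map jX bs) = (\<lambda>y. u \<otimes>\<^bsub>X.FF\<^esub> y) ` qvals X.FF (map jX as)"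
    and d: "ring.dimension X.FF d (squares X.FF) (ring.Span X.FF (squares X.FF) (map jX as))"
    and d': "ring.dimension Y.FF d' (squares Y.FF) (ring.Span Y.FF (squares Y.FF) (map jY bs))"
  shows "d' \<le> d"
proof -
  interpret L: char2_field X.FF by (rule X.FF_char2_field)
  interpret L': char2_field Y.FF by (rule Y.FF_char2_field)
  obtain cs' vs' where r: "set vs' \<subseteq> carrier Y.FF" "length cs' = length ([] :: _ list)" "length vs' = d"
    "set (map jY bs) \<subseteq> L'.Span (L'.Span L'.sq (L'.pf cs')) vs'"
    using spread_dimension[OF eq sim, of "[]", OF _ L.Span_pf_Nil[symmetric] d] by auto
  have sub: "set (map jY bs) \<subseteq> L'.Span L'.sq vs'"
    using r(2,4) L'.Span_pf_Nil by simp
  have "L'.Span L'.sq (map jY bs) \<subseteq> L'.Span L'.sq vs'"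
    by (rule L'.Span_mono[OF L'.squares_subfield L'.squares_subfield order.refl jY_closed[OF Y.as_closed] sub r(1)])
  then show ?thesis using L'.dimension_le_of_subset[OF L'.squares_subfield d' r(1)] r(3) by simp
qed

text \<open>Completing \<open>cs'\<close> to an independent family enlarges the field of scalars.
  The \<open>e\<close> vectors \<open>vs'\<close> still span enough over it, so the dimension stays
  at most \<open>e\<close>. The bound by \<open>Y.n\<close> is what
  \<open>FF_not_short_pfister\<close> asks for.\<close>

lemma transfer_pfister:
  assumes eq: equivalent
    and sim: "\<exists>u\<in>carrier X.FF. u \<noteq> \<zero>\<^bsub>X.FF\<^esub> \<and>
      qvals X.FF (map jX bs) = (\<lambda>y. u \<otimes>\<^bsub>X.FF\<^esub> y) ` qvals X.FF (map jX as)"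
    and cs: "set cs \<subseteq> carrier X.FF" "length cs \<le> Y.n"
    and M: "M = ring.Span X.FF (squares X.FF) (pfister_coeffs X.FF cs)"
    and e: "ring.dimension X.FF e M (ring.Span X.FF M (map jX as))"
  shows "\<exists>ds e'. set ds \<subseteq> carrier Y.FF \<and> length ds = length cs \<and>
    ring.independent Y.FF (squares Y.FF) (pfister_coeffs Y.FF ds) \<and> e' \<le> e \<and>
    ring.dimension Y.FF e' (ring.Span Y.FF (squares Y.FF) (pfister_coeffs Y.FF ds))
      (ring.Span Y.FF (ring.Span Y.FF (squares Y.FF) (pfister_coeffs Y.FF ds)) (map jY bs))"
proof -
  interpret L': char2_field Y.FF by (rule Y.FF_char2_field)
  obtain cs' vs' where r: "set cs' \<subseteq> carrier Y.FF" "set vs' \<subseteq> carrier Y.FF" "length cs' = length cs" "length vs' = e"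
    "set (map jY bs) \<subseteq> L'.Span (L'.Span L'.sq (L'.pf cs')) vs'"
    using spread_dimension[OF eq sim cs(1) M e] by (elim exE conjE)
  have "L'.Span L'.sq (L'.pf ds) \<noteq> carrier Y.FF" if "set ds \<subseteq> carrier Y.FF" "length ds < length cs" for ds
    by (rule Y.FF_not_short_pfister) (use that cs(2) in auto)
  then obtain ds where ds: "set ds \<subseteq> carrier Y.FF" "length ds = length cs" "L'.independent L'.sq (L'.pf ds)"
    "L'.Span L'.sq (L'.pf cs') \<subseteq> L'.Span L'.sq (L'.pf ds)"
    using L'.exists_independent_pf_length[OF r(1,3)] by blast
  define M' where "M' = L'.Span L'.sq (L'.pf ds)"
  have M': "subfield M' Y.FF" unfolding M'_def by (rule L'.Span_pf_field(1)[OF ds(1)])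
  note bc = jY_closed[OF Y.as_closed]
  have "L'.Span (L'.Span L'.sq (L'.pf cs')) vs' \<subseteq> L'.Span M' vs'"
    by (rule L'.Span_mono[OF L'.Span_pf_field(1)[OF r(1)] M' ds(4)[folded M'_def] r(2) L'.Span_base_incl[OF M' r(2)] r(2)])
  then have sub: "L'.Span M' (map jY bs) \<subseteq> L'.Span M' vs'"
    by (intro L'.Span_mono[OF M' M' order.refl bc _ r(2)] order.trans[OF r(5)])
  obtain us where us: "L'.independent M' us" "L'.Span M' us = L'.Span M' (map jY bs)"
    using L'.short_base[OF M' bc] by auto
  have d: "L'.dimension (length us) M' (L'.Span M' (map jY bs))"
    using L'.dimension_independent[OF us(1)] us(2) by simp
  moreover have "length us \<le> e" using L'.dimension_le_of_subset[OF M' d r(2) sub] r(4) by simp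
  ultimately show ?thesis using ds(1-3) unfolding M'_def by blast
qed

end

section \<open>The invariant\<close>

text \<open>The bridge from the definitions in terms of forms to the theory of coefficient lists:
  fields and constants are matched by unfolding, and the first form is described by its value
  set.\<close>

lemma (in quasilinear_form) first_form_properties:
  assumes an: "anisotropic F \<phi>" and dim: "vectorspace.dim F \<phi> \<ge> 2"
  defines "L \<equiv> function_field F \<phi>" and "es \<equiv> map (function_field_const F \<phi>) (diag_coeffs F \<phi>)"
  shows "function_field F \<phi> = quasilinear_coeffs.FF F (diag_coeffs F \<phi>)"
    and "function_field_const F \<phi> = (\<lambda>c. quasilinear_coeffs.ff F (diag_coeffs F \<phi>) (ring.indexed_const F c))"
    and "norm_field F \<phi> = quasilinear_coeffs.nf F (diag_coeffs F \<phi>)"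
    and "set es \<subseteq> carrier L"
    and "quasilinear_form L (first_form F \<phi>)"
    and "value_set (first_form F \<phi>) = ring.Span L (squares L) es"
    and "ring.dimension L (vectorspace.dim L (first_form F \<phi>)) (squares L) (ring.Span L (squares L) es)"
proof -
  interpret Q: quasilinear_coeffs F "diag_coeffs F \<phi>" by (rule quasilinear_coeffs_diag[OF an dim])
  show FF: "function_field F \<phi> = Q.FF"
    unfolding function_field_def Q.FF_def quadric_ring_def quadric_ideal_def ..
  show ff: "function_field_const F \<phi> = (\<lambda>c. Q.ff (ring.indexed_const F c))"
    unfolding function_field_const_def Q.ff_def quadric_ring_def quadric_ideal_def quadric_const_def ..
  show "norm_field F \<phi> = Q.nf"
    unfolding norm_field_def Q.nf_def value_set_eq_Span ..
  have L: "char2_field L" unfolding L_def FF by (rule Q.FF_char2_field)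
  interpret L: char2_field L by (rule L)
  show es: "set es \<subseteq> carrier L"
    unfolding es_def ff L_def FF using Q.as_closed ring_hom_closed[OF Q.ff_const_hom] by auto
  have first: "first_form F \<phi> = aniso_part L (diag_form L es)"
    unfolding first_form_def scalar_extension_def L_def es_def ..
  interpret D: semilinear_form L "diag_form L es" by (rule L.semilinear_form_diag_form[OF es])
  have V: "value_set (diag_form L es) = L.Span L.sq es" by (rule L.value_set_diag_form[OF es])
  show qf: "quasilinear_form L (first_form F \<phi>)"
    unfolding first by (rule D.aniso_part_quasilinear_form[OF es V])
  show vs: "value_set (first_form F \<phi>) = L.Span L.sq es"
    unfolding first D.value_set_aniso_part by (rule V)
  show "L.dimension (vectorspace.dim L (first_form F \<phi>)) L.sq (L.Span L.sq es)"
    using quasilinear_form.dimension_value_set[OF qf] D.aniso_part_anisotropic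
    unfolding vs[symmetric] first by blast
qed

text \<open>The norm fields agree, so \<open>r < lndeg\<close> carries over; it also gives
  \<open>r \<le> C.Y.n\<close>, which \<open>transfer_pfister\<close> requires. As
  \<open>e' \<le> e\<close> and the two first forms have equal dimension, the inequality defining
  \<open>P_r\<close> is preserved.\<close>

lemma Delta_subset:
  fixes F :: "('a, 'm) ring_scheme"
    and \<phi> :: "('a, 'v) qform" and \<psi> :: "('a, 'w) qform"
  assumes phi: "quasilinear_form F \<phi>" "anisotropic F \<phi>" "vectorspace.dim F \<phi> \<ge> 2"
    and psi: "quasilinear_form F \<psi>" "anisotropic F \<psi>" "vectorspace.dim F \<psi> \<ge> 2"
    and eq: "quadric_pair.equivalent F (diag_coeffs F \<phi>) (diag_coeffs F \<psi>)"
  shows "Delta F \<phi> \<subseteq> Delta F \<psi>"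
proof -
  interpret phi: quasilinear_form F \<phi> by (rule phi)
  interpret psi: quasilinear_form F \<psi> by (rule psi)
  let ?as = "diag_coeffs F \<phi>" and ?bs = "diag_coeffs F \<psi>"
  interpret C: quadric_pair F ?as ?bs
    by (rule quadric_pair.intro[OF phi.quasilinear_coeffs_diag[OF phi(2,3)] psi.quasilinear_coeffs_diag[OF psi(2,3)]])
  interpret S: quadric_pair F ?bs ?as ..
  note eq' = C.equivalent_swap[OF eq]
  note ph = phi.first_form_properties[OF phi(2,3)]
  note ps = psi.first_form_properties[OF psi(2,3)]
  note ph' = ph(4-7)[unfolded ph(1,2)] and ps' = ps(4-7)[unfolded ps(1,2)]
  note simX = S.similar_over_function_field[OF eq'] and simY = C.similar_over_function_field[OF eq]
  interpret LX: char2_field C.X.FF by (rule C.X.FF_char2_field)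
  interpret LY: char2_field C.Y.FF by (rule C.Y.FF_char2_field)
  have nf: "norm_field F \<phi> = norm_field F \<psi>"
  proof
    show "norm_field F \<phi> \<subseteq> norm_field F \<psi>"
      unfolding ph(3) ps(3) by (rule C.nf_subset_of_equivalent[OF eq])
    show "norm_field F \<psi> \<subseteq> norm_field F \<phi>"
      unfolding ph(3) ps(3) by (rule S.nf_subset_of_equivalent[OF eq'])
  qed
  have dims: "vectorspace.dim C.X.FF (first_form F \<phi>) = vectorspace.dim C.Y.FF (first_form F \<psi>)"
    by (rule antisym[OF S.dimension_first_form_le[OF eq' simY ps'(4) ph'(4)] C.dimension_first_form_le[OF eq simX ph'(4) ps'(4)]])
  show ?thesis
  proof
    fix r assume "r \<in> Delta F \<phi>"
    then have r: "real r < lndeg F \<phi>" "P_set C.X.FF r (first_form F \<phi>) \<noteq> {}"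
      unfolding Delta_def ph(1) by auto
    have r': "real r < lndeg F \<psi>" using r(1) nf unfolding lndeg_def by simp
    then have le: "r \<le> C.Y.n" unfolding lndeg_def ps(3) by (rule C.Y.less_log_dim_nf)
    obtain cs e where cs: "set cs \<subseteq> carrier C.X.FF" "length cs = r"
      and e: "LX.dimension e (LX.Span LX.sq (LX.pf cs)) (LX.Span (LX.Span LX.sq (LX.pf cs)) (map C.jX ?as))"
        "2 ^ r * e < vectorspace.dim C.X.FF (first_form F \<phi>) + 2 ^ r"
      using r(2) unfolding LX.P_set_nonempty_iff[OF ph'(2,1,3)] by (elim exE conjE)
    have len: "length cs \<le> C.Y.n" using le cs(2) by simp
    obtain ds e' where ds: "set ds \<subseteq> carrier C.Y.FF" "length ds = length cs" "LY.independent LY.sq (LY.pf ds)"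
      and e': "e' \<le> e" "LY.dimension e' (LY.Span LY.sq (LY.pf ds)) (LY.Span (LY.Span LY.sq (LY.pf ds)) (map C.jY ?bs))"
      using C.transfer_pfister[OF eq simX cs(1) len refl e(1)] by (elim exE conjE)
    have "2 ^ r * e' \<le> 2 ^ r * e" using e'(1) by simp
    then have "2 ^ r * e' < vectorspace.dim C.Y.FF (first_form F \<psi>) + 2 ^ r" using e(2) dims by linarith
    then have "P_set C.Y.FF r (first_form F \<psi>) \<noteq> {}"
      unfolding LY.P_set_nonempty_iff[OF ps'(2,1,3)] using ds cs(2) e'(2) by blast
    then show "r \<in> Delta F \<psi>" unfolding Delta_def ps(1) using r' by simp
  qed
qed

lemma equivalent_of_stably_birational:
  fixes F :: "('a, 'm) ring_scheme"
    and \<phi> :: "('a, 'v) qform" and \<psi> :: "('a, 'w) qform"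
  assumes phi: "quasilinear_form F \<phi>" "anisotropic F \<phi>" "vectorspace.dim F \<phi> \<ge> 2"
    and psi: "quasilinear_form F \<psi>" "anisotropic F \<psi>" "vectorspace.dim F \<psi> \<ge> 2"
    and sb: "stably_birational F \<phi> \<psi>"
  shows "quadric_pair F (diag_coeffs F \<phi>) (diag_coeffs F \<psi>)"
    and "quadric_pair.equivalent F (diag_coeffs F \<phi>) (diag_coeffs F \<psi>)"
proof -
  show pair: "quadric_pair F (diag_coeffs F \<phi>) (diag_coeffs F \<psi>)"
    by (rule quadric_pair.intro[OF quasilinear_form.quasilinear_coeffs_diag[OF phi] quasilinear_form.quasilinear_coeffs_diag[OF psi]])
  interpret C: quadric_pair F "diag_coeffs F \<phi>" "diag_coeffs F \<psi>" by (rule pair)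
  obtain m k f g h where f: "f \<in> carrier (C.X.A m) - {\<zero>\<^bsub>C.X.A m\<^esub>}" and g: "g \<in> carrier (C.Y.A k) - {\<zero>\<^bsub>C.Y.A k\<^esub>}"
    and h: "h \<in> ring_iso (C.X.Af m f) (C.Y.Af k g)"
    and hc: "\<forall>c\<in>carrier F. h (C.X.lc m f (C.X.indexed_const c)) = C.Y.lc k g (C.X.indexed_const c)"
    using sb unfolding stably_birational_def birational_def quadric_ring_def quadric_ideal_def quadric_const_def
    by (elim exE bexE)
  have fA: "f \<in> carrier (C.X.A m)" and gA: "g \<in> carrier (C.Y.A k)" using f g by auto
  obtain f' where f': "f' \<in> carrier (C.X.P m)" "f = C.X.cls m f'" using C.X.A_repr[OF fA] by (elim bexE)
  obtain g' where g': "g' \<in> carrier (C.Y.P k)" "g = C.Y.cls k g'" using C.Y.A_repr[OF gA] by (elim bexE)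
  have "f' \<notin> PIdl\<^bsub>C.X.P m\<^esub> (C.X.q m)" "g' \<notin> PIdl\<^bsub>C.Y.P k\<^esub> (C.Y.q k)"
    using f g C.X.cls_eq_zero_iff[OF f'(1)] C.Y.cls_eq_zero_iff[OF g'(1)] f'(2) g'(2) by auto
  then show "C.equivalent"
    unfolding C.equivalent_def using f'(1) g'(1) h hc unfolding f'(2) g'(2) by blast
qed

theorem proposition3p27:
  fixes F :: "('a, 'm) ring_scheme"
    and \<phi> :: "('a, 'v) qform" and \<psi> :: "('a, 'w) qform"
  assumes "field F" and "\<one>\<^bsub>F\<^esub> \<oplus>\<^bsub>F\<^esub> \<one>\<^bsub>F\<^esub> = \<zero>\<^bsub>F\<^esub>"
    and "quasilinear_form F \<phi>" and "anisotropic F \<phi>" and "vectorspace.dim F \<phi> \<ge> 2"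
    and "quasilinear_form F \<psi>" and "anisotropic F \<psi>" and "vectorspace.dim F \<psi> \<ge> 2"
    and "stably_birational F \<phi> \<psi>"
  shows "Delta F \<phi> = Delta F \<psi>"
proof -
  note eq = equivalent_of_stably_birational[OF assms(3-9)]
  show ?thesis
    by (rule antisym[OF Delta_subset[OF assms(3-8) eq(2)]
      Delta_subset[OF assms(6-8,3-5) quadric_pair.equivalent_swap[OF eq]]])
qed

end
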